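(* Let $s\in(0,1)$, and let $L$ be any operator of the form $$Lw(t,x)=\int_{\mathbb{R}^n}\bigl(w(t,x+y)+w(t,x-y)-2w(t,x)\bigr)\frac{a(y/|y|)}{|y|^{n+2s}}\,dy ,$$ where $a\in L^1(S^{n-1})$ is nonnegative and even and satisfies, for constants $0<\lambda\le\Lambda<\infty$, $$\lambda\le\inf_{\nu\in S^{n-1}}\int_{S^{n-1}}|\nu\cdot\theta|^{2s}a(\theta)\,d\theta,\qquad\int_{S^{n-1}}a(\theta)\,d\theta\le\Lambda .$$ Assume that $a\in C^\alpha(S^{n-1})$ for some $\alpha\in(0,1)$ such that $\alpha<2s$. Let $u$ be any bounded weak solution to $$\partial_tu-Lu=f\quad\text{in }(-1,0)\times B_1,$$ and let $$C_0=\|u\|_{C^{\frac{\alpha}{2s}}_t((-1,0)\times\mathbb{R}^n)}+\|f\|_{C^{\frac{\alpha}{2s},\alpha}_{t,x}((-1,0)\times B_1)} .$$ Then, if $2s+\alpha$ is not an integer, $$\|u\|_{C^{1+\frac{\alpha}{2s}}_t\left(\left(-\frac12,0\right)\times B_{1/2}\right)}+\|u\|_{C^{2s+\alpha}_x\left(\left(-\frac12,0\right)\times B_{1/2}\right)}\le C\,C_0,$$ for some constant $C$ depending only on $\alpha,n,s,\|a\|_{C^\alpha(S^{n-1})},\lambda$ and $\Lambda$.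
   Context: $B_r\subset\mathbb{R}^n$ is the ball of radius $r$ centred at the origin. Weak solution: $\partial_tu-Lu=f$ in $I\times D$ means $\int_{I\times\mathbb{R}^n}u(-\partial_t\eta-L\eta)\,dx\,dt=\int_{I\times D}f\eta\,dx\,dt$ for all $\eta\in C_c^\infty(I\times D)$. Regularity of $u$ is understood after modification on a null set. Norms: for $\alpha,\beta\in(0,1)$, $\|u\|_{C^{\beta,\alpha}_{t,x}(I\times D)}=\|u\|_{L^\infty(I\times D)}+\sup\frac{|u(t,x)-u(t',x')|}{|t-t'|^\beta+|x-x'|^\alpha}$, the supremum over distinct points of $I\times D$. For $\gamma>0$, $\|u\|_{C^\gamma_x(I\times D)}=\sup_{t\in I}\|u(t,\cdot)\|_{C^\gamma(D)}$ and $\|u\|_{C^\gamma_t(I\times D)}=\sup_{x\in D}\|u(\cdot,x)\|_{C^\gamma(I)}$, with $C^\gamma=C^{\lfloor\gamma\rfloor,\gamma-\lfloor\gamma\rfloor}$ the usual Hölder space for non-integer $\gamma$. *)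

theory Defs
  imports "HOL-Analysis.Analysis" "HOL-Probability.Essential_Supremum"
begin

section \<open>Iterated partial derivatives and smoothness\<close>

text \<open>
  The list \<^term>\<open>es\<close> of coordinate directions plays the role of a multi-index; its head is the
  direction differentiated last. Only meaningful where the derivatives involved exist, which
  \<open>Ck_on\<close> below guarantees.
\<close>

primrec iter_deriv :: "'a list \<Rightarrow> ('a::euclidean_space \<Rightarrow> real) \<Rightarrow> 'a \<Rightarrow> real" where
  "iter_deriv [] w = w"
| "iter_deriv (e # es) w = (\<lambda>x. frechet_derivative (iter_deriv es w) (at x) e)"

text \<open>
  Used for open \<^term>\<open>D\<close> if \<open>k > 0\<close>. For \<open>k = 0\<close> it is just continuity on \<^term>\<open>D\<close>, and then
  \<^term>\<open>D\<close> may be any set, e.g. a sphere.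
\<close>

definition Ck_on :: "nat \<Rightarrow> ('a::euclidean_space \<Rightarrow> real) \<Rightarrow> 'a set \<Rightarrow> bool" where
  "Ck_on k w D \<longleftrightarrow>
     (\<forall>es. set es \<subseteq> Basis \<and> length es < k \<longrightarrow> (\<forall>x\<in>D. iter_deriv es w differentiable (at x))) \<and>
     (\<forall>es. set es \<subseteq> Basis \<and> length es \<le> k \<longrightarrow> continuous_on D (iter_deriv es w))"

definition test_functions :: "'a::euclidean_space set \<Rightarrow> ('a \<Rightarrow> real) set" where
  "test_functions S =
     {\<eta>. (\<forall>k. Ck_on k \<eta> UNIV) \<and> compact (closure {p. \<eta> p \<noteq> 0}) \<and> closure {p. \<eta> p \<noteq> 0} \<subseteq> S}"

section \<open>Norms\<close>

text \<open>All norms take values in \<open>[0, \<infinity>]\<close>; membership in the space is finiteness of the norm.\<close>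

definition Linf_norm :: "('a::euclidean_space \<Rightarrow> real) \<Rightarrow> 'a set \<Rightarrow> ennreal" where
  "Linf_norm w S =
     (if w \<in> borel_measurable (lebesgue_on S)
      then esssup (lebesgue_on S) (\<lambda>p. ennreal \<bar>w p\<bar>) else \<infinity>)"

definition holder_seminorm :: "real \<Rightarrow> ('a::euclidean_space \<Rightarrow> real) \<Rightarrow> 'a set \<Rightarrow> ennreal" where
  "holder_seminorm \<kappa> w D =
     (SUP x\<in>D. SUP y\<in>D - {x}. ennreal (\<bar>w x - w y\<bar> / norm (x - y) powr \<kappa>))"

text \<open>
  The norm of \<open>C\<^sup>k\<^sup>,\<^sup>\<kappa>(D)\<close> with \<open>k = \<lfloor>\<gamma>\<rfloor>\<close> and \<open>\<kappa> = \<gamma> - \<lfloor>\<gamma>\<rfloor>\<close>, for \<open>\<gamma> > 0\<close> not an integer. For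
  \<open>0 < \<gamma> < 1\<close> no derivative occurs and \<^term>\<open>D\<close> may be any set. On the sphere, distances are
  those of the ambient space.
\<close>

definition holder_norm :: "real \<Rightarrow> ('a::euclidean_space \<Rightarrow> real) \<Rightarrow> 'a set \<Rightarrow> ennreal" where
  "holder_norm \<gamma> w D =
     (let k = nat \<lfloor>\<gamma>\<rfloor>; \<kappa> = frac \<gamma> in
      if Ck_on k w D then
        (\<Sum>es | set es \<subseteq> Basis \<and> length es \<le> k. SUP x\<in>D. ennreal \<bar>iter_deriv es w x\<bar>) +
        (\<Sum>es | set es \<subseteq> Basis \<and> length es = k. holder_seminorm \<kappa> (iter_deriv es w) D)
      else \<infinity>)"

definition holder_norm_t ::
  "real \<Rightarrow> (real \<times> 'a::euclidean_space \<Rightarrow> real) \<Rightarrow> real set \<Rightarrow> 'a set \<Rightarrow> ennreal" where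
  "holder_norm_t \<gamma> u I D = (SUP x\<in>D. holder_norm \<gamma> (\<lambda>t. u (t, x)) I)"

definition holder_norm_x ::
  "real \<Rightarrow> (real \<times> 'a::euclidean_space \<Rightarrow> real) \<Rightarrow> real set \<Rightarrow> 'a set \<Rightarrow> ennreal" where
  "holder_norm_x \<gamma> u I D = (SUP t\<in>I. holder_norm \<gamma> (\<lambda>x. u (t, x)) D)"

definition holder_norm_tx ::
  "real \<Rightarrow> real \<Rightarrow> (real \<times> 'a::euclidean_space \<Rightarrow> real) \<Rightarrow> real set \<Rightarrow> 'a set \<Rightarrow> ennreal" where
  "holder_norm_tx \<beta> \<alpha> u I D =
     Linf_norm u (I \<times> D) +
     (SUP p\<in>I \<times> D. SUP q\<in>I \<times> D - {p}.
        ennreal (\<bar>u p - u q\<bar> / (\<bar>fst p - fst q\<bar> powr \<beta> + norm (snd p - snd q) powr \<alpha>)))"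

section \<open>The operator and weak solutions\<close>

text \<open>
  Surface measure on the unit sphere of an \<open>n\<close>-dimensional space: \<open>\<sigma>(A)\<close> is \<open>n\<close> times the
  Lebesgue measure of the cone \<open>{r \<theta> | 0 < r < 1, \<theta> \<in> A}\<close>. This is the normalisation for which
  \<open>dy = r\<^sup>n\<^sup>-\<^sup>1 dr d\<sigma>(\<theta>)\<close> in polar coordinates; for \<open>n = 1\<close> it is counting measure on \<open>{-1, 1}\<close>.
\<close>

definition sphere_measure :: "'a::euclidean_space measure" where
  "sphere_measure =
     scale_measure (of_nat DIM('a))
       (distr (restrict_space lborel (ball 0 1 - {0})) (restrict_space borel (sphere 0 1))
          (\<lambda>x. x /\<^sub>R norm x))"

lemma space_sphere_measure: "space (sphere_measure :: 'a::euclidean_space measure) = sphere 0 1"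
  by (simp add: sphere_measure_def space_scale_measure space_restrict_space)

lemma emeasure_sphere_measure:
  fixes A :: "'a::euclidean_space set"
  assumes "A \<in> sets borel" "A \<subseteq> sphere 0 1"
  shows "emeasure sphere_measure A =
    of_nat DIM('a) * emeasure lborel {x \<in> ball 0 1 - {0}. x /\<^sub>R norm x \<in> A}"
proof -
  have m: "(\<lambda>x::'a. x /\<^sub>R norm x)
      \<in> restrict_space lborel (ball 0 1 - {0}) \<rightarrow>\<^sub>M restrict_space borel (sphere 0 1)"
    by (rule measurable_restrict_space2) (auto simp: space_restrict_space measurable_restrict_space1)
  have "A \<in> sets (restrict_space borel (sphere 0 1))"
    using assms by (auto simp: sets_restrict_space_iff)
  then have "emeasure sphere_measure A = of_nat DIM('a) *
      emeasure (restrict_space lborel (ball 0 1 - {0}))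
        ((\<lambda>x. x /\<^sub>R norm x) -` A \<inter> (ball 0 1 - {0}))"
    using m by (simp add: sphere_measure_def emeasure_distr space_restrict_space)
  also have "emeasure (restrict_space lborel (ball 0 1 - {0}))
        ((\<lambda>x::'a. x /\<^sub>R norm x) -` A \<inter> (ball 0 1 - {0})) =
      emeasure lborel ((\<lambda>x. x /\<^sub>R norm x) -` A \<inter> (ball 0 1 - {0}))"
    by (rule emeasure_restrict_space) auto
  also have "(\<lambda>x::'a. x /\<^sub>R norm x) -` A \<inter> (ball 0 1 - {0}) =
      {x \<in> ball 0 1 - {0}. x /\<^sub>R norm x \<in> A}"
    by auto
  finally show ?thesis .
qed

definition stable_op ::
  "real \<Rightarrow> ('a::euclidean_space \<Rightarrow> real) \<Rightarrow> (real \<times> 'a \<Rightarrow> real) \<Rightarrow> real \<times> 'a \<Rightarrow> real" where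
  "stable_op s a w = (\<lambda>(t, x).
     LINT y|lebesgue. (w (t, x + y) + w (t, x - y) - 2 * w (t, x)) *
       (a (y /\<^sub>R norm y) / norm y powr (real DIM('a) + 2 * s)))"

definition time_deriv :: "(real \<times> 'a::euclidean_space \<Rightarrow> real) \<Rightarrow> real \<times> 'a \<Rightarrow> real" where
  "time_deriv w = (\<lambda>(t, x). deriv (\<lambda>\<tau>. w (\<tau>, x)) t)"

definition weak_solution ::
  "real \<Rightarrow> ('a::euclidean_space \<Rightarrow> real) \<Rightarrow> (real \<times> 'a \<Rightarrow> real) \<Rightarrow> (real \<times> 'a \<Rightarrow> real)
     \<Rightarrow> real set \<Rightarrow> 'a set \<Rightarrow> bool" where
  "weak_solution s a u f I D \<longleftrightarrow>
     (\<forall>\<eta>\<in>test_functions (I \<times> D).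
        (LINT p:(I \<times> UNIV)|lebesgue. u p * (- time_deriv \<eta> p - stable_op s a \<eta> p)) =
        (LINT p:(I \<times> D)|lebesgue. f p * \<eta> p))"

text \<open>
  Here \<open>a\<close> is the density of the spectral measure; only its values on the unit sphere matter.
\<close>

definition elliptic_density ::
  "real \<Rightarrow> real \<Rightarrow> real \<Rightarrow> ('a::euclidean_space \<Rightarrow> real) \<Rightarrow> bool" where
  "elliptic_density s lam Lam a \<longleftrightarrow>
     integrable sphere_measure a \<and>
     (\<forall>\<theta>\<in>sphere 0 1. 0 \<le> a \<theta> \<and> a (- \<theta>) = a \<theta>) \<and>
     lam \<le> (INF \<nu>\<in>sphere 0 1. LINT \<theta>|sphere_measure. \<bar>\<nu> \<bullet> \<theta>\<bar> powr (2 * s) * a \<theta>) \<and>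
     (LINT \<theta>|sphere_measure. a \<theta>) \<le> Lam"

end

theory Submission
  imports Defs
begin

text \<open>
  The proof uses finite differences and a maximum principle instead of the heat kernel. Let \<open>u\<close> be a
  smooth solution and \<open>\<gamma> = 2 s + \<alpha>\<close>. A difference \<open>\<Delta>\<^sub>h\<^sup>m u\<close> of order \<open>m > \<gamma>\<close> solves the same equation up to
  an error of size \<open>r\<^sup>\<alpha>\<close>, \<open>r = |h|\<close>. Since \<open>a\<close> is bounded below on some cap, the maximum principle
  bounds \<open>\<Delta>\<^sub>h\<^sup>m u\<close> at a maximum by its averages over balls of radius \<open>l \<sim> N r\<close>. Averaging over \<open>N\<^sup>m\<close>
  translates turns this into \<open>N\<^sup>-\<^sup>m \<Delta>\<^sub>N\<^sub>h\<^sup>m u\<close>, and as \<open>(N r)\<^sup>\<gamma> N\<^sup>-\<^sup>m\<close> is much smaller than \<open>r\<^sup>\<gamma>\<close> the a priori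
  finite quantity \<open>sup r\<^sup>-\<^sup>\<gamma> |\<Delta>\<^sub>h\<^sup>m u|\<close>, weighted by the distance to the parabolic boundary, is absorbed.
  Every \<open>\<gamma> \<le> 2 s + \<alpha>\<close>, \<open>\<gamma> < m\<close>, is allowed, which for \<open>m = 1, 2, 3\<close> gives the spatial estimate.

  For the time derivative, \<open>Lu\<close> is \<open>\<alpha>\<close>-Hoelder in \<open>x\<close> by the spatial estimate, hence so is \<open>\<partial>\<^sub>t u\<close>. Applied to
  \<open>u(t) - u(t')\<close>, with the integral defining \<open>L\<close> split at \<open>|y| = |t - t'|\<^sup>1\<^sup>/\<^sup>(\<^sup>2\<^sup>s\<^sup>)\<close>, these bounds and the global Hoelder
  continuity of \<open>u\<close> in time show that \<open>\<partial>\<^sub>t u\<close> is \<open>\<alpha>/(2 s)\<close>-Hoelder in \<open>t\<close>. Mollification reduces bounded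
  weak solutions to smooth ones, with constants independent of the mollifier.
\<close>

subsection \<open>Iterated differences\<close>

text \<open>The kernel is bounded below only on one cone, so at a maximum the difference is compared
  with averages over balls in that cone and not with neighbouring values. The comparison holds for
  all centres shifted by \<open>\<sigma>\<close>; this freedom is what allows summation to larger
  steps. The exponent is a matter of scales: at distance l ~ r the operator has strength r^(-2s), so
  an error r^\<alpha> in the equation costs r^(2s+\<alpha>). The error has two sources, f and the
  far part of the operator. Far away u is only bounded, and one increment is moved from u onto the
  kernel, whose \<alpha>-Hoelder continuity supplies r^\<alpha>. Absorption requires a supremum
  known to be finite, which is why smooth solutions come first; their smoothness never enters a
  constant. Absorption at order m works for exponents below m, hence the truncated exponents
  \<open>\<gamma>'\<close>, q and p at low orders. u is given for t < 0 only, so the mollified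
  equation holds up to t = -2 \<epsilon>, and the limit is taken separately at each t < 0.\<close>

primrec fdiff :: "'a::real_vector list \<Rightarrow> ('a \<Rightarrow> real) \<Rightarrow> 'a \<Rightarrow> real" where
  "fdiff [] g x = g x"
| "fdiff (h # hs) g x = fdiff hs g (x + h) - fdiff hs g x"

lemma fdiff_translate: "fdiff hs (\<lambda>x. g (x + c)) x = fdiff hs g (x + c)"
  by (induction hs arbitrary: x) (auto simp: add_ac)

lemma fdiff_diff: "fdiff hs (\<lambda>x. f x - g x) x = fdiff hs f x - fdiff hs g x"
  by (induction hs arbitrary: x) auto

lemma fdiff_add: "fdiff hs (\<lambda>x. f x + g x) x = fdiff hs f x + fdiff hs g x"
  by (induction hs arbitrary: x) auto

lemma fdiff_cmult: "fdiff hs (\<lambda>x. c * f x) x = c * fdiff hs f x"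
  by (induction hs arbitrary: x) (auto simp: algebra_simps)

text \<open>The operators commute, so the head step may act first on g instead of last. One
  increment can thereby be spent on the data, for instance on f in \<open>fdiff_step\<close>, and
  the other steps be estimated trivially.\<close>

lemma fdiff_Cons_inner: "fdiff (h # hs) g x = fdiff hs (\<lambda>x. g (x + h) - g x) x"
  by (simp add: fdiff_diff fdiff_translate)

lemma fdiff_uminus_arg:
  fixes g :: "'a::real_vector \<Rightarrow> real"
  shows "fdiff (map uminus hs) g x = fdiff hs (\<lambda>x. g (- x)) (- x)"
  by (induction hs arbitrary: x) auto

lemma fdiff_local_bound:
  fixes g :: "'a::real_normed_vector \<Rightarrow> real"
  assumes "\<And>y. norm (y - x) \<le> sum_list (map norm hs) \<Longrightarrow> \<bar>g y\<bar> \<le> U"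
  shows "\<bar>fdiff hs g x\<bar> \<le> 2 ^ length hs * U"
  using assms
proof (induction hs arbitrary: x)
  case (Cons h hs)
  have "\<bar>fdiff hs g (x + h)\<bar> \<le> 2 ^ length hs * U"
  proof (rule Cons.IH)
    fix y assume "norm (y - (x + h)) \<le> sum_list (map norm hs)"
    moreover have "norm (y - x) \<le> norm (y - (x + h)) + norm h"
      using norm_triangle_ineq[of "y - (x + h)" h] by (simp add: algebra_simps)
    ultimately show "\<bar>g y\<bar> \<le> U" by (intro Cons.prems) auto
  qed
  moreover have "\<bar>fdiff hs g x\<bar> \<le> 2 ^ length hs * U"
    by (rule Cons.IH) (use Cons.prems in \<open>force simp: add_increasing\<close>)
  ultimately show ?case by simp
qed auto

lemma fdiff_bound:
  fixes g :: "'a::real_normed_vector \<Rightarrow> real"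
  assumes "\<And>y. \<bar>g y\<bar> \<le> U"
  shows "\<bar>fdiff hs g x\<bar> \<le> 2 ^ length hs * U"
  by (rule fdiff_local_bound) (rule assms)

lemma fdiff_cong_local:
  fixes g :: "'a::real_normed_vector \<Rightarrow> real"
  assumes "\<And>y. norm (y - x) \<le> sum_list (map norm hs) \<Longrightarrow> f y = g y"
  shows "fdiff hs f x = fdiff hs g x"
proof -
  have "\<bar>fdiff hs (\<lambda>x. f x - g x) x\<bar> \<le> 2 ^ length hs * 0"
    by (rule fdiff_local_bound) (use assms in auto)
  then show ?thesis by (simp add: fdiff_diff)
qed

lemma fdiff_has_real_derivative:
  fixes u :: "real \<Rightarrow> 'a::real_normed_vector \<Rightarrow> real"
  assumes "\<And>y. norm (y - x) \<le> sum_list (map norm hs)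
      \<Longrightarrow> ((\<lambda>t. u t y) has_real_derivative u' y) (at t)"
  shows "((\<lambda>t. fdiff hs (u t) x) has_real_derivative fdiff hs u' x) (at t)"
  using assms
proof (induction hs arbitrary: x)
  case (Cons h hs)
  have "((\<lambda>t. fdiff hs (u t) (x + h)) has_real_derivative fdiff hs u' (x + h)) (at t)"
  proof (rule Cons.IH)
    fix y assume "norm (y - (x + h)) \<le> sum_list (map norm hs)"
    moreover have "norm (y - x) \<le> norm (y - (x + h)) + norm h"
      using norm_triangle_ineq[of "y - (x + h)" h] by (simp add: algebra_simps)
    ultimately show "((\<lambda>t. u t y) has_real_derivative u' y) (at t)" by (intro Cons.prems) auto
  qed
  moreover have "((\<lambda>t. fdiff hs (u t) x) has_real_derivative fdiff hs u' x) (at t)"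
    by (rule Cons.IH) (use Cons.prems in \<open>force simp: add_increasing\<close>)
  ultimately show ?case by (auto intro: DERIV_diff)
qed auto

lemma continuous_on_fdiff:
  fixes u :: "real \<Rightarrow> 'a::real_normed_vector \<Rightarrow> real"
  assumes "continuous_on (I \<times> UNIV) (\<lambda>p. u (fst p) (snd p))"
  shows "continuous_on (I \<times> UNIV) (\<lambda>p. fdiff hs (u (fst p)) (snd p))"
proof (induction hs)
  case (Cons h hs)
  have "continuous_on (I \<times> UNIV) ((\<lambda>p. fdiff hs (u (fst p)) (snd p)) \<circ> (\<lambda>p. (fst p, snd p + h)))"
    by (intro continuous_on_compose continuous_intros continuous_on_subset[OF Cons.IH]) auto
  then show ?case using Cons.IH by (auto simp: o_def intro!: continuous_intros)
qed (use assms in auto)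

lemma borel_measurable_fdiff[measurable]:
  fixes g :: "'a::euclidean_space \<Rightarrow> real"
  assumes [measurable]: "g \<in> borel_measurable borel"
  shows "fdiff hs g \<in> borel_measurable borel"
proof (induction hs)
  case (Cons h hs)
  note [measurable] = Cons.IH
  show ?case by (subst fdiff.simps(2)[abs_def]) measurable
qed (use assms in \<open>simp add: fdiff.simps(1)[abs_def]\<close>)

lemma fdiff_integral:
  assumes "\<And>x. integrable M (\<lambda>b. F b x)"
  shows "fdiff hs (\<lambda>x. LINT b|M. F b x) x = (LINT b|M. fdiff hs (F b) x)"
    and "integrable M (\<lambda>b. fdiff hs (F b) x)"
proof -
  have "fdiff hs (\<lambda>x. LINT b|M. F b x) x = (LINT b|M. fdiff hs (F b) x)
      \<and> integrable M (\<lambda>b. fdiff hs (F b) x)"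
    by (induction hs arbitrary: x) (use assms in auto)
  then show "fdiff hs (\<lambda>x. LINT b|M. F b x) x = (LINT b|M. fdiff hs (F b) x)"
    "integrable M (\<lambda>b. fdiff hs (F b) x)" by auto
qed

text \<open>Summing a difference with step \<open>h\<close> over \<open>N\<close> consecutive translates telescopes to the
  difference with step \<open>N h\<close>; so smallness at the large scale is inherited with a factor \<open>N\<^sup>-\<^sup>m\<close>.\<close>

lemma fdiff_telescope:
  fixes G :: "'a::real_normed_vector \<Rightarrow> real"
  assumes "\<And>\<sigma>. norm \<sigma> \<le> real N * sum_list (map norm hs) \<Longrightarrow> c \<le> fdiff hs G (x + \<sigma>)"
  shows "real N ^ length hs * c \<le> fdiff (map ((*\<^sub>R) (real N)) hs) G x"
  using assms
proof (induction hs arbitrary: G x)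
  case Nil
  then show ?case using Nil[of 0] by simp
next
  case (Cons h hs)
  let ?G = "\<lambda>x. G (x + h) - G x"
  let ?H = "fdiff (map ((*\<^sub>R) (real N)) hs) G"
  have "real N ^ length hs * c \<le> ?H (x + real (Suc j) *\<^sub>R h) - ?H (x + real j *\<^sub>R h)" if "j < N" for j
  proof -
    have "real N ^ length hs * c \<le> fdiff (map ((*\<^sub>R) (real N)) hs) ?G (x + real j *\<^sub>R h)"
    \<comment> \<open>The induction hypothesis is used for \<open>?G\<close>, which has absorbed the
      step h, at the j-th translate along h. The shift j h together with \<sigma> still satisfies
      the size condition for \<open>h # hs\<close>.\<close>
    proof (rule Cons.IH)
      fix \<sigma> :: 'a assume \<sigma>: "norm \<sigma> \<le> real N * sum_list (map norm hs)"
      have "norm (real j *\<^sub>R h + \<sigma>) \<le> real j * norm h + norm \<sigma>"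
        using norm_triangle_ineq[of "real j *\<^sub>R h" \<sigma>] by simp
      also have "\<dots> \<le> real N * norm h + real N * sum_list (map norm hs)"
        using \<sigma> that by (intro add_mono mult_right_mono) auto
      finally have "c \<le> fdiff (h # hs) G (x + (real j *\<^sub>R h + \<sigma>))"
        by (intro Cons.prems) (simp add: algebra_simps)
      then show "c \<le> fdiff hs ?G (x + real j *\<^sub>R h + \<sigma>)"
        by (simp only: fdiff_Cons_inner add.assoc)
    qed
    also have "\<dots> = ?H (x + real j *\<^sub>R h + h) - ?H (x + real j *\<^sub>R h)"
      by (simp add: fdiff_diff fdiff_translate)
    also have "x + real j *\<^sub>R h + h = x + real (Suc j) *\<^sub>R h"
      by (simp add: algebra_simps)
    finally show ?thesis .
  qed
  then have "(\<Sum>j<N. real N ^ length hs * c) \<le> (\<Sum>j<N. ?H (x + real (Suc j) *\<^sub>R h) - ?H (x + real j *\<^sub>R h))"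
    by (intro sum_mono) auto
  also have "\<dots> = ?H (x + real N *\<^sub>R h) - ?H (x + real 0 *\<^sub>R h)"
    by (rule sum_lessThan_telescope)
  finally show ?case by simp
qed

subsection \<open>Integrals of powers of the norm\<close>

lemma emeasure_lborel_ball_scale:
  fixes r :: real
  assumes "0 \<le> r"
  shows "emeasure lborel (ball (0::'a::euclidean_space) r)
    = ennreal (r ^ DIM('a) * measure lborel (ball (0::'a) 1))"
proof -
  have "measure lborel (ball (0::'a) r) = r ^ DIM('a) * measure lborel (ball (0::'a) 1)"
    using content_ball_conv_unit_ball[of r "0::'a"] assms
    by (simp add: mult.commute)
  then show ?thesis
    using emeasure_eq_ennreal_measure[of lborel "ball (0::'a) r"] emeasure_lborel_ball_finite[of "0::'a" r]
    by (metis less_irrefl infinity_ennreal_def)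
qed

text \<open>On a dyadic shell a power is comparable to its value at the outer radius. The absolute
  value in the constant treats both signs of the exponent at once.\<close>

lemma powr_le_dyadic:
  fixes x \<rho> e :: real
  assumes "\<rho> / 2 \<le> x" "x < \<rho>" "0 < \<rho>"
  shows "x powr e \<le> 2 powr \<bar>e\<bar> * \<rho> powr e"
proof (cases "e \<ge> 0")
  case True
  have "x powr e \<le> \<rho> powr e" using assms True by (intro powr_mono2) auto
  also have "\<dots> \<le> 2 powr \<bar>e\<bar> * \<rho> powr e"
    using ge_one_powr_ge_zero[of 2 "\<bar>e\<bar>"] by (simp add: mult_le_cancel_right1)
  finally show ?thesis .
next
  case False
  have "x powr e \<le> (\<rho> / 2) powr e" using assms False by (intro powr_mono2') auto
  also have "\<dots> = 2 powr \<bar>e\<bar> * \<rho> powr e"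
    using False assms by (simp add: powr_divide powr_minus_divide)
  finally show ?thesis .
qed

text \<open>Shells with outer radii \<open>\<rho> k\<close> cover A; each is replaced by the full
  ball of radius \<open>\<rho> k\<close>, whose contribution is a constant times
  \<open>\<rho> k powr (e + DIM)\<close>. The hypothesis \<open>sum\<close> says that these form a
  geometric sequence. Leaving the radii free treats a ball (shrinking radii) and its complement
  (growing radii) together.\<close>

lemma norm_powr_dyadic_integral:
  fixes e \<omega> :: real and \<rho> :: "nat \<Rightarrow> real" and A :: "'a::euclidean_space set"
  assumes e: "0 < \<omega>" "\<omega> < 1" and \<rho>: "\<And>k. 0 < \<rho> k" and A: "A \<in> sets borel"
    and cover: "\<And>y. y \<in> A \<Longrightarrow> y \<noteq> 0 \<Longrightarrow> \<exists>k::nat. \<rho> k / 2 \<le> norm y \<and> norm y < \<rho> k"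
    and sum: "\<And>k. \<rho> k powr (e + real DIM('a)) = B * \<omega> ^ k"
  shows "integrable lborel (\<lambda>y. indicator A y * norm y powr e)"
    and "(LINT y|lborel. indicator A y * norm y powr e)
      \<le> 2 powr \<bar>e\<bar> * measure lborel (ball (0::'a) 1) * B / (1 - \<omega>)"
proof -
  let ?V = "measure lborel (ball (0::'a) 1)"
  let ?c = "\<lambda>k. 2 powr \<bar>e\<bar> * \<rho> k powr e"
  note [measurable] = A
  have "\<rho> 0 powr (e + real DIM('a)) = B" using sum[of 0] by (simp only: power_0 mult_1_right)
  then have B: "0 \<le> B" using powr_ge_zero[of "\<rho> 0"] by metis
  have geo: "(\<Sum>k. 2 powr \<bar>e\<bar> * ?V * B * \<omega> ^ k) = 2 powr \<bar>e\<bar> * ?V * B / (1 - \<omega>)"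
    using e by (subst suminf_mult) (auto simp: suminf_geometric)
  have pt: "ennreal (indicator A y * norm y powr e)
      \<le> (\<Sum>k. ennreal (?c k) * indicator (ball 0 (\<rho> k)) y)" for y
  proof (cases "y \<in> A \<and> y \<noteq> 0")
    case True
    then obtain k where k: "\<rho> k / 2 \<le> norm y" "norm y < \<rho> k" using cover by auto
    have "ennreal (indicator A y * norm y powr e) \<le> ennreal (?c k) * indicator (ball 0 (\<rho> k)) y"
      using powr_le_dyadic[OF k \<rho>] k True by (auto intro!: ennreal_leI)
    also have "\<dots> = (\<Sum>k\<in>{k}. ennreal (?c k) * indicator (ball 0 (\<rho> k)) y)"
      by (simp del: sum_mult_indicator)
    also have "\<dots> \<le> (\<Sum>k. ennreal (?c k) * indicator (ball 0 (\<rho> k)) y)"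
      by (rule sum_le_suminf) auto
    finally show ?thesis .
  next
    case False
    then have "indicator A y * norm y powr e = 0" by (auto simp: indicator_def)
    then show ?thesis by (simp only: ennreal_0 zero_le)
  qed
  have "(\<integral>\<^sup>+y. ennreal (indicator A y * norm y powr e) \<partial>lborel)
      \<le> (\<integral>\<^sup>+y. (\<Sum>k. ennreal (?c k) * indicator (ball (0::'a) (\<rho> k)) y) \<partial>lborel)"
    by (rule nn_integral_mono) (rule pt)
  also have "\<dots> = (\<Sum>k. ennreal (?c k) * emeasure lborel (ball (0::'a) (\<rho> k)))"
  proof -
    have m: "(\<lambda>y. ennreal (?c k) * indicator (ball (0::'a) (\<rho> k)) y) \<in> borel_measurable lborel" for k
      by (intro borel_measurable_times_ennreal borel_measurable_const borel_measurable_indicator) simp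
    have c: "(\<integral>\<^sup>+y. ennreal (?c k) * indicator (ball (0::'a) (\<rho> k)) y \<partial>lborel)
        = ennreal (?c k) * emeasure lborel (ball (0::'a) (\<rho> k))" for k
      by (rule nn_integral_cmult_indicator) simp
    show ?thesis
      by (simp only: nn_integral_suminf[OF m] c)
  qed
  also have "\<dots> = (\<Sum>k. ennreal (2 powr \<bar>e\<bar> * ?V * B * \<omega> ^ k))"
  proof (intro suminf_cong)
    fix k
    have "\<rho> k powr e * \<rho> k ^ DIM('a) = B * \<omega> ^ k"
      using sum[of k] \<rho>[of k] by (simp add: powr_add powr_realpow)
    moreover have "?c k * (\<rho> k ^ DIM('a) * ?V) = 2 powr \<bar>e\<bar> * ?V * (\<rho> k powr e * \<rho> k ^ DIM('a))"
      by (simp only: mult_ac)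
    ultimately have *: "?c k * (\<rho> k ^ DIM('a) * ?V) = 2 powr \<bar>e\<bar> * ?V * B * \<omega> ^ k"
      by (simp only: mult.assoc)
    have "ennreal (?c k) * emeasure lborel (ball (0::'a) (\<rho> k)) = ennreal (?c k) * ennreal (\<rho> k ^ DIM('a) * ?V)"
      using \<rho>[of k] by (simp only: emeasure_lborel_ball_scale less_imp_le)
    also have "\<dots> = ennreal (?c k * (\<rho> k ^ DIM('a) * ?V))"
      using \<rho>[of k] by (intro ennreal_mult[symmetric]) auto
    finally show "ennreal (?c k) * emeasure lborel (ball (0::'a) (\<rho> k)) = ennreal (2 powr \<bar>e\<bar> * ?V * B * \<omega> ^ k)"
      by (simp only: *)
  qed
  also have "\<dots> = ennreal (\<Sum>k. 2 powr \<bar>e\<bar> * ?V * B * \<omega> ^ k)"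
  proof (rule suminf_ennreal2)
    show "0 \<le> 2 powr \<bar>e\<bar> * ?V * B * \<omega> ^ k" for k
      using B e(1) by (simp add: mult_nonneg_nonneg)
    show "summable (\<lambda>k. 2 powr \<bar>e\<bar> * ?V * B * \<omega> ^ k)"
      using e by (intro summable_mult summable_geometric) simp
  qed
  also have "\<dots> = ennreal (2 powr \<bar>e\<bar> * ?V * B / (1 - \<omega>))"
    by (simp only: geo)
  finally have le: "(\<integral>\<^sup>+y. ennreal (indicator A y * norm y powr e) \<partial>lborel)
      \<le> ennreal (2 powr \<bar>e\<bar> * ?V * B / (1 - \<omega>))" .
  show "integrable lborel (\<lambda>y. indicator A y * norm y powr e)"
  proof (rule integrableI_bounded)
    have "(\<integral>\<^sup>+y. ennreal (norm (indicator A y * norm y powr e)) \<partial>lborel)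
        \<le> ennreal (2 powr \<bar>e\<bar> * ?V * B / (1 - \<omega>))"
      using le by simp
    then show "(\<integral>\<^sup>+y. ennreal (norm (indicator A y * norm y powr e)) \<partial>lborel) < \<infinity>"
      by (rule le_less_trans) simp
  next
    show "(\<lambda>y. indicator A y * norm y powr e) \<in> borel_measurable lborel" by measurable
  qed
  then show "(LINT y|lborel. indicator A y * norm y powr e) \<le> 2 powr \<bar>e\<bar> * ?V * B / (1 - \<omega>)"
    using le B e by (subst integral_eq_nn_integral) (auto intro!: enn2real_leI)
qed

lemma norm_powr_integral_ball:
  fixes p :: real
  assumes "0 < p"
  obtains C where "0 < C"
    "\<And>r. 0 < r \<Longrightarrow> integrable lborel (\<lambda>y::'a::euclidean_space. indicator (ball 0 r) y * norm y powr (p - DIM('a)))"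
    "\<And>r. 0 < r \<Longrightarrow> (LINT y|lborel. indicator (ball (0::'a) r) y * norm y powr (p - DIM('a))) \<le> C * r powr p"
proof -
  define \<omega> :: real where "\<omega> = 2 powr (-p)"
  have \<omega>: "0 < \<omega>" "\<omega> < 1" using assms powr_less_cancel_iff[of 2 "-p" 0] by (auto simp: \<omega>_def)
  let ?C = "2 powr \<bar>p - DIM('a)\<bar> * measure lborel (ball (0::'a) 1) / (1 - \<omega>)"
  have cover: "\<exists>k::nat. (r / 2 ^ k) / 2 \<le> norm y \<and> norm y < r / 2 ^ k"
    if "y \<in> ball 0 r" "y \<noteq> 0" for r and y :: 'a
  proof -
    \<comment> \<open>The least index whose shell begins below |y|: its minimality gives the upper
      inequality \<open>norm y < r / 2 ^ k\<close>.\<close>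
    let ?P = "\<lambda>k. r / 2 ^ Suc k \<le> norm y"
    have "\<exists>k. ?P k"
    proof -
      obtain k where "r / norm y < 2 ^ k" using real_arch_pow[of 2] by auto
      then have "r < norm y * 2 ^ k" using that by (simp add: field_simps)
      also have "\<dots> \<le> norm y * 2 ^ Suc k" by simp
      finally show ?thesis by (intro exI[of _ k]) (simp add: field_simps)
    qed
    then have P: "?P (LEAST k. ?P k)" by (rule LeastI_ex)
    define k where "k = (LEAST k. ?P k)"
    have "norm y < r / 2 ^ k"
    proof (cases k)
      case 0 then show ?thesis using that by simp
    next
      case (Suc j)
      then have "\<not> ?P j" using not_less_Least[of j ?P] unfolding k_def by linarith
      then show ?thesis using Suc by simp
    qed
    moreover have "?P k" using P unfolding k_def .
    ultimately show ?thesis by (intro exI[of _ k]) (auto simp: field_simps)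
  qed
  have sum: "(r / 2 ^ k) powr (p - DIM('a) + real DIM('a)) = r powr p * \<omega> ^ k" if "0 < r" for r k
    using that by (simp add: powr_divide \<omega>_def powr_power powr_powr powr_minus_divide mult.commute
        flip: powr_realpow)
  note * = norm_powr_dyadic_integral[OF \<omega>, where e = "p - DIM('a)" and A = "ball (0::'a) r"
      and \<rho> = "\<lambda>k. r / 2 ^ k" and B = "r powr p" for r]
  show ?thesis
  proof (rule that[of ?C])
    show "0 < ?C" using \<omega> by (simp add: content_ball_pos)
  next
    fix r :: real assume r: "0 < r"
    show "integrable lborel (\<lambda>y::'a. indicator (ball 0 r) y * norm y powr (p - DIM('a)))"
      by (rule *(1)) (use r cover sum in auto)
    show "(LINT y|lborel. indicator (ball (0::'a) r) y * norm y powr (p - DIM('a))) \<le> ?C * r powr p"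
      using *(2)[of r] r cover sum by (simp add: mult_ac)
  qed
qed

lemma norm_powr_integral_compl_ball:
  fixes p :: real
  assumes "0 < p"
  obtains C where "0 < C"
    "\<And>r. 0 < r \<Longrightarrow> integrable lborel (\<lambda>y::'a::euclidean_space. indicator (- ball 0 r) y * norm y powr (- p - DIM('a)))"
    "\<And>r. 0 < r \<Longrightarrow> (LINT y|lborel. indicator (- ball (0::'a) r) y * norm y powr (- p - DIM('a))) \<le> C * r powr (- p)"
proof -
  define \<omega> :: real where "\<omega> = 2 powr (-p)"
  have \<omega>: "0 < \<omega>" "\<omega> < 1" using assms powr_less_cancel_iff[of 2 "-p" 0] by (auto simp: \<omega>_def)
  \<comment> \<open>The first shell of the complement has outer radius 2 r, so the geometric
    sequence starts at \<open>r powr (- p) * \<omega>\<close>; hence the last factor.\<close>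
  let ?C = "2 powr \<bar>- p - DIM('a)\<bar> * measure lborel (ball (0::'a) 1) / (1 - \<omega>) * \<omega>"
  have cover: "\<exists>k::nat. (r * 2 ^ Suc k) / 2 \<le> norm y \<and> norm y < r * 2 ^ Suc k"
    if "y \<in> - ball 0 r" "0 < r" for r and y :: 'a
  proof -
    let ?P = "\<lambda>k. norm y < r * 2 ^ Suc k"
    have "\<exists>k. ?P k"
    proof -
      obtain k where "norm y / r < 2 ^ k" using real_arch_pow[of 2] by auto
      then have "norm y < r * 2 ^ k" using that by (simp add: field_simps)
      also have "\<dots> \<le> r * 2 ^ Suc k" using that by simp
      finally show ?thesis by (intro exI[of _ k])
    qed
    then have P: "?P (LEAST k. ?P k)" by (rule LeastI_ex)
    define k where "k = (LEAST k. ?P k)"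
    have "r * 2 ^ k \<le> norm y"
    proof (cases k)
      case 0 then show ?thesis using that by simp
    next
      case (Suc j)
      then have "\<not> ?P j" using not_less_Least[of j ?P] unfolding k_def by linarith
      then show ?thesis using Suc by simp
    qed
    moreover have "?P k" using P unfolding k_def .
    ultimately show ?thesis by (intro exI[of _ k]) (auto simp: field_simps)
  qed
  have sum: "(r * 2 ^ Suc k) powr (- p - DIM('a) + real DIM('a)) = (r powr (- p) * \<omega>) * \<omega> ^ k" if "0 < r" for r k
  proof -
    have "(2::real) ^ Suc k = 2 powr real (Suc k)" by (rule powr_realpow[symmetric]) simp
    moreover have "\<omega> * \<omega> ^ k = 2 powr (- p * real (Suc k))"
      using powr_realpow[of \<omega> "Suc k"] \<omega> by (simp add: \<omega>_def powr_powr)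
    ultimately show ?thesis
      using that by (simp only: powr_mult) (simp add: powr_powr mult_ac)
  qed
  note * = norm_powr_dyadic_integral[OF \<omega>, where e = "- p - DIM('a)" and A = "- ball (0::'a) r"
      and \<rho> = "\<lambda>k. r * 2 ^ Suc k" and B = "r powr (- p) * \<omega>" for r]
  show ?thesis
  proof (rule that[of ?C])
    show "0 < ?C" using \<omega> by (simp add: content_ball_pos)
  next
    fix r :: real assume r: "0 < r"
    show "integrable lborel (\<lambda>y::'a. indicator (- ball 0 r) y * norm y powr (- p - DIM('a)))"
      by (rule *(1)[of r]) (use r cover sum in \<open>auto simp del: power_Suc\<close>)
    have "(LINT y|lborel. indicator (- ball (0::'a) r) y * norm y powr (- p - DIM('a)))
       \<le> 2 powr \<bar>- p - DIM('a)\<bar> * measure lborel (ball (0::'a) 1) * (r powr (- p) * \<omega>) / (1 - \<omega>)"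
      by (rule *(2)[of r]) (use r cover sum in \<open>auto simp del: power_Suc\<close>)
    then show "(LINT y|lborel. indicator (- ball (0::'a) r) y * norm y powr (- p - DIM('a))) \<le> ?C * r powr (- p)"
      by (simp add: mult_ac)
  qed
qed

subsection \<open>Kernels\<close>

lemma integral_dominated_le:
  fixes f g :: "'b \<Rightarrow> real"
  assumes "integrable N g" "f \<in> borel_measurable N" "\<And>y. \<bar>f y\<bar> \<le> g y"
  shows "integrable N f" "\<bar>integral\<^sup>L N f\<bar> \<le> integral\<^sup>L N g"
proof -
  show f: "integrable N f"
  proof (rule Bochner_Integration.integrable_bound[OF assms(1,2)], rule AE_I2)
    show "norm (f y) \<le> norm (g y)" for y using assms(3)[of y] by simp
  qed
  have "\<bar>integral\<^sup>L N f\<bar> \<le> (\<integral>y. \<bar>f y\<bar> \<partial>N)" by (rule integral_abs_bound)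
  also have "\<dots> \<le> integral\<^sup>L N g"
    using f assms by (intro integral_mono) auto
  finally show "\<bar>integral\<^sup>L N f\<bar> \<le> integral\<^sup>L N g" .
qed

lemma lborel_integrable_translate:
  fixes f :: "'a::euclidean_space \<Rightarrow> real"
  assumes "integrable lborel f"
  shows "integrable lborel (\<lambda>x. f (a + x))"
proof -
  have "integrable (distr lborel borel ((+) a)) f" using assms by (simp add: lborel_distr_plus)
  then show ?thesis by (intro integrable_distr[of "(+) a" lborel borel f]) auto
qed

lemma lborel_integral_translate:
  fixes f :: "'a::euclidean_space \<Rightarrow> real"
  assumes "f \<in> borel_measurable borel"
  shows "(LINT x|lborel. f (a + x)) = (LINT x|lborel. f x)"
proof -
  have "(LINT x|distr lborel borel ((+) a). f x) = (LINT x|lborel. f (a + x))"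
    by (rule integral_distr) (use assms in auto)
  then show ?thesis by (simp add: lborel_distr_plus)
qed

text \<open>A Lipschitz cutoff rather than an indicator, so that the tail kernel
  \<open>(1 - cutoff \<rho> y) * k y\<close> keeps an \<alpha>-Hoelder modulus of
  continuity.\<close>

definition cutoff :: "real \<Rightarrow> 'a::euclidean_space \<Rightarrow> real" where
  "cutoff \<rho> y = max 0 (min 1 (2 - 2 * norm y / \<rho>))"

lemma cutoff_measurable[measurable]: "cutoff \<rho> \<in> borel_measurable borel"
  unfolding cutoff_def[abs_def] by measurable

lemma cutoff_range: "0 \<le> cutoff \<rho> y" "cutoff \<rho> y \<le> 1"
  by (auto simp: cutoff_def)

lemma cutoff_eq_1: "0 < \<rho> \<Longrightarrow> norm y \<le> \<rho> / 2 \<Longrightarrow> cutoff \<rho> y = 1"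
  by (auto simp: cutoff_def field_simps)

lemma cutoff_eq_0: "0 < \<rho> \<Longrightarrow> \<rho> \<le> norm y \<Longrightarrow> cutoff \<rho> y = 0"
  by (auto simp: cutoff_def field_simps)

lemma cutoff_lipschitz:
  assumes "0 < \<rho>" shows "\<bar>cutoff \<rho> (y + h) - cutoff \<rho> y\<bar> \<le> 2 * norm h / \<rho>"
proof -
  have "\<bar>norm (y + h) - norm y\<bar> \<le> norm h"
    using norm_triangle_ineq3[of "y + h" y] by simp
  then have "\<bar>2 * norm (y + h) / \<rho> - 2 * norm y / \<rho>\<bar> \<le> 2 * norm h / \<rho>"
    using assms by (simp add: abs_le_iff field_simps)
  then show ?thesis unfolding cutoff_def by linarith
qed

definition sdiff :: "('a::real_vector \<Rightarrow> real) \<Rightarrow> 'a \<Rightarrow> 'a \<Rightarrow> real" where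
  "sdiff w x y = w (x + y) + w (x - y) - 2 * w x"

text \<open>The integrand of L is itself a second difference, based at x - y. First differences of
  Lu therefore lead to mixed third differences of u, which are the quantities that the spatial
  estimate controls.\<close>

lemma sdiff_conv_fdiff: "sdiff w x y = fdiff [y, y] w (x - y)"
  by (simp add: sdiff_def)

lemma sdiff_measurable[measurable]:
  fixes w :: "'a::euclidean_space \<Rightarrow> real"
  assumes [measurable]: "w \<in> borel_measurable borel"
  shows "sdiff w x \<in> borel_measurable borel"
  unfolding sdiff_def[abs_def] by measurable

text \<open>Only numbers are fixed; kernels stay quantified inside each lemma. A constant obtained
  here is thus uniform over all kernels with the same M, c and \<kappa>.\<close>

locale stable_parameters =
  fixes s \<alpha> M c \<kappa> :: real
  assumes s: "0 < s" "s < 1" and \<alpha>: "0 < \<alpha>" "\<alpha> < 1" "\<alpha> < 2 * s"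
    and M: "0 < M" and c: "0 < c" and \<kappa>: "0 < \<kappa>" "\<kappa> \<le> 1 / 2"
begin

text \<open>The scale-invariant properties of a(y/|y|) / |y|^(n+2s) that the estimates use.
  Increments of at most |y|/2 keep y + h away from the singularity, and in the last clause a single
  direction \<theta> serves all scales l.\<close>

definition kernel :: "('a::euclidean_space \<Rightarrow> real) \<Rightarrow> bool" where
  "kernel k \<longleftrightarrow> k \<in> borel_measurable borel
    \<and> (\<forall>y. 0 \<le> k y \<and> k y \<le> M * norm y powr (- 2 * s - real DIM('a)))
    \<and> (\<forall>y h. norm h \<le> norm y / 2 \<longrightarrow>
        \<bar>k (y + h) - k y\<bar> \<le> M * norm h powr \<alpha> * norm y powr (- 2 * s - \<alpha> - real DIM('a)))
    \<and> (\<exists>\<theta>. norm \<theta> = 1 \<and> (\<forall>l>0. \<forall>y\<in>ball (l *\<^sub>R \<theta>) (\<kappa> * l). c * l powr (- 2 * s - real DIM('a)) \<le> k y))"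

lemma kernel_measurable[measurable_dest]: "kernel k \<Longrightarrow> k \<in> borel_measurable borel"
  by (simp add: kernel_def)

lemma kernel_nonneg: "kernel k \<Longrightarrow> 0 \<le> k y"
  by (simp add: kernel_def)

lemma kernel_le: "kernel (k::'a::euclidean_space \<Rightarrow> real) \<Longrightarrow> k y \<le> M * norm y powr (- 2 * s - real DIM('a))"
  by (simp add: kernel_def)

text \<open>The kernel has size at most |y|^(-n-2s), so a weight of order above 2s makes it
  integrable at the origin. C is obtained before k and r and hence does not depend on them.\<close>

lemma kernel_near:
  fixes q :: real
  assumes q: "2 * s < q"
  obtains C where "0 < C"
    "\<And>(k::'a::euclidean_space \<Rightarrow> real) r. kernel k \<Longrightarrow> 0 < r \<Longrightarrow>
      integrable lborel (\<lambda>y. indicator (ball 0 r) y * (norm y powr q * k y))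
      \<and> (LINT y|lborel. indicator (ball 0 r) y * (norm y powr q * k y)) \<le> C * r powr (q - 2 * s)"
proof -
  obtain C where C: "0 < C"
    "\<And>r. 0 < r \<Longrightarrow> integrable lborel (\<lambda>y::'a. indicator (ball 0 r) y * norm y powr ((q - 2 * s) - DIM('a)))"
    "\<And>r. 0 < r \<Longrightarrow> (LINT y|lborel. indicator (ball (0::'a) r) y * norm y powr ((q - 2 * s) - DIM('a))) \<le> C * r powr (q - 2 * s)"
    using norm_powr_integral_ball[of "q - 2 * s", where 'a='a] q by auto
  show thesis
  proof (rule that[of "M * C"])
    show "0 < M * C" using M C by simp
  next
    fix k :: "'a \<Rightarrow> real" and r :: real
    assume k: "kernel k" and r: "0 < r"
    note [measurable] = kernel_measurable[OF k]
    have b: "\<bar>indicator (ball 0 r) y * (norm y powr q * k y)\<bar>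
        \<le> M * (indicator (ball 0 r) y * norm y powr ((q - 2 * s) - DIM('a)))" for y
    proof -
      have "norm y powr q * k y \<le> norm y powr q * (M * norm y powr (- 2 * s - real DIM('a)))"
        by (intro mult_left_mono kernel_le[OF k]) auto
      also have "\<dots> = M * norm y powr ((q - 2 * s) - DIM('a))"
        by (simp add: powr_add[symmetric] algebra_simps)
      finally show ?thesis
        using kernel_nonneg[OF k, of y] by (auto simp: indicator_def)
    qed
    have i: "integrable lborel (\<lambda>y::'a. M * (indicator (ball 0 r) y * norm y powr ((q - 2 * s) - DIM('a))))"
      using C(2)[OF r] by simp
    have m: "(\<lambda>y. indicator (ball 0 r) y * (norm y powr q * k y)) \<in> borel_measurable lborel"
      using kernel_measurable[OF k] by (intro borel_measurable_times borel_measurable_indicator) auto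
    have *: "integrable lborel (\<lambda>y. indicator (ball 0 r) y * (norm y powr q * k y))"
      "\<bar>LINT y|lborel. indicator (ball 0 r) y * (norm y powr q * k y)\<bar>
        \<le> (LINT y|lborel. M * (indicator (ball (0::'a) r) y * norm y powr ((q - 2 * s) - DIM('a))))"
      by (rule integral_dominated_le[OF i m b])+
    have "M * (LINT y|lborel. indicator (ball (0::'a) r) y * norm y powr ((q - 2 * s) - DIM('a)))
        \<le> M * (C * r powr (q - 2 * s))"
      using C(3)[OF r] M by (intro mult_left_mono) auto
    with * show "integrable lborel (\<lambda>y. indicator (ball 0 r) y * (norm y powr q * k y))
      \<and> (LINT y|lborel. indicator (ball 0 r) y * (norm y powr q * k y)) \<le> M * C * r powr (q - 2 * s)"
      by (simp add: mult.assoc)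
  qed
qed

lemma kernel_far:
  fixes p :: real
  assumes p: "p < 2 * s"
  obtains C where "0 < C"
    "\<And>(k::'a::euclidean_space \<Rightarrow> real) r. kernel k \<Longrightarrow> 0 < r \<Longrightarrow>
      integrable lborel (\<lambda>y. indicator (- ball 0 r) y * (norm y powr p * k y))
      \<and> (LINT y|lborel. indicator (- ball 0 r) y * (norm y powr p * k y)) \<le> C * r powr (p - 2 * s)"
proof -
  obtain C where C: "0 < C"
    "\<And>r. 0 < r \<Longrightarrow> integrable lborel (\<lambda>y::'a. indicator (- ball 0 r) y * norm y powr (- (2 * s - p) - DIM('a)))"
    "\<And>r. 0 < r \<Longrightarrow> (LINT y|lborel. indicator (- ball (0::'a) r) y * norm y powr (- (2 * s - p) - DIM('a))) \<le> C * r powr (- (2 * s - p))"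
    using norm_powr_integral_compl_ball[of "2 * s - p", where 'a='a] p by auto
  show thesis
  proof (rule that[of "M * C"])
    show "0 < M * C" using M C by simp
  next
    fix k :: "'a \<Rightarrow> real" and r :: real
    assume k: "kernel k" and r: "0 < r"
    note [measurable] = kernel_measurable[OF k]
    have b: "\<bar>indicator (- ball 0 r) y * (norm y powr p * k y)\<bar>
        \<le> M * (indicator (- ball 0 r) y * norm y powr (- (2 * s - p) - DIM('a)))" for y
    proof -
      have "norm y powr p * k y \<le> norm y powr p * (M * norm y powr (- 2 * s - real DIM('a)))"
        by (intro mult_left_mono kernel_le[OF k]) auto
      also have "\<dots> = M * norm y powr (- (2 * s - p) - DIM('a))"
        by (simp add: powr_add[symmetric] algebra_simps)
      finally show ?thesis
        using kernel_nonneg[OF k, of y] by (auto simp: indicator_def)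
    qed
    have i: "integrable lborel (\<lambda>y::'a. M * (indicator (- ball 0 r) y * norm y powr (- (2 * s - p) - DIM('a))))"
      using C(2)[OF r] by simp
    have m: "(\<lambda>y. indicator (- ball 0 r) y * (norm y powr p * k y)) \<in> borel_measurable lborel"
      using kernel_measurable[OF k] by (intro borel_measurable_times borel_measurable_indicator) auto
    have *: "integrable lborel (\<lambda>y. indicator (- ball 0 r) y * (norm y powr p * k y))"
      "\<bar>LINT y|lborel. indicator (- ball 0 r) y * (norm y powr p * k y)\<bar>
        \<le> (LINT y|lborel. M * (indicator (- ball (0::'a) r) y * norm y powr (- (2 * s - p) - DIM('a))))"
      by (rule integral_dominated_le[OF i m b])+
    have "M * (LINT y|lborel. indicator (- ball (0::'a) r) y * norm y powr (- (2 * s - p) - DIM('a)))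
        \<le> M * (C * r powr (- (2 * s - p)))"
      using C(3)[OF r] M by (intro mult_left_mono) auto
    with * show "integrable lborel (\<lambda>y. indicator (- ball 0 r) y * (norm y powr p * k y))
      \<and> (LINT y|lborel. indicator (- ball 0 r) y * (norm y powr p * k y)) \<le> M * C * r powr (p - 2 * s)"
      by (simp add: mult.assoc)
  qed
qed

text \<open>The last estimate is the substitute for regularity of u far away: an L1 modulus of
  continuity of the tail kernel. For increments up to \<rho>/8 both cutoffs are 1 on |y| < \<rho>/4
  and nothing is left there; beyond this radius the Hoelder bound of k and the Lipschitz bound of
  the cutoff apply.\<close>

lemma kernel_tail:
  obtains C where "0 < C"
    "\<And>(k::'a::euclidean_space \<Rightarrow> real) \<rho>. kernel k \<Longrightarrow> 0 < \<rho> \<Longrightarrow>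
      integrable lborel (\<lambda>y. (1 - cutoff \<rho> y) * k y)
      \<and> (LINT y|lborel. (1 - cutoff \<rho> y) * k y) \<le> C * \<rho> powr (- 2 * s)"
    "\<And>(k::'a::euclidean_space \<Rightarrow> real) \<rho> h. kernel k \<Longrightarrow> 0 < \<rho> \<Longrightarrow> norm h \<le> \<rho> / 8 \<Longrightarrow>
      (LINT y|lborel. \<bar>(1 - cutoff \<rho> (y + h)) * k (y + h) - (1 - cutoff \<rho> y) * k y\<bar>)
        \<le> C * norm h powr \<alpha> * \<rho> powr (- 2 * s - \<alpha>)"
proof -
  obtain C0 where C0: "0 < C0"
    "\<And>(k::'a \<Rightarrow> real) r. kernel k \<Longrightarrow> 0 < r \<Longrightarrow>
      integrable lborel (\<lambda>y. indicator (- ball 0 r) y * (norm y powr 0 * k y))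
      \<and> (LINT y|lborel. indicator (- ball 0 r) y * (norm y powr 0 * k y)) \<le> C0 * r powr (0 - 2 * s)"
    using kernel_far[of 0, where 'a='a] s by auto
  obtain C1 where C1: "0 < C1"
    "\<And>r. 0 < r \<Longrightarrow> integrable lborel (\<lambda>y::'a. indicator (- ball 0 r) y * norm y powr (- (2 * s + \<alpha>) - DIM('a)))"
    "\<And>r. 0 < r \<Longrightarrow> (LINT y|lborel. indicator (- ball (0::'a) r) y * norm y powr (- (2 * s + \<alpha>) - DIM('a))) \<le> C1 * r powr (- (2 * s + \<alpha>))"
    using norm_powr_integral_compl_ball[of "2 * s + \<alpha>", where 'a='a] s \<alpha> by auto
  define C where "C = C0 * 2 powr (2 * s) + M * C1 * 4 powr (2 * s + \<alpha>) + 2 * C0 * 4 powr (2 * s)"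
  have Cpos: "0 < C" using C0 C1 M by (simp add: C_def add_pos_pos)
  show thesis
  proof (rule that[OF Cpos])
    fix k :: "'a \<Rightarrow> real" and \<rho> :: real
    assume k: "kernel k" and \<rho>: "0 < \<rho>"
    note [measurable] = kernel_measurable[OF k]
    have b: "\<bar>(1 - cutoff \<rho> y) * k y\<bar> \<le> indicator (- ball 0 (\<rho> / 2)) y * (norm y powr 0 * k y)" for y
    proof (cases "norm y < \<rho> / 2")
      case True
      then show ?thesis using \<rho> by (simp add: cutoff_eq_1)
    next
      case False
      then have "y \<noteq> 0" using \<rho> by auto
      then show ?thesis
        using False cutoff_range[of \<rho> y] kernel_nonneg[OF k, of y]
        by (simp add: abs_mult mult_left_le_one_le)
    qed
    have i: "integrable lborel (\<lambda>y. indicator (- ball 0 (\<rho> / 2)) y * (norm y powr 0 * k y))"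
      and le: "(LINT y|lborel. indicator (- ball 0 (\<rho> / 2)) y * (norm y powr 0 * k y)) \<le> C0 * (\<rho> / 2) powr (0 - 2 * s)"
      using C0(2)[OF k, of "\<rho> / 2"] \<rho> by auto
    have m: "(\<lambda>y. (1 - cutoff \<rho> y) * k y) \<in> borel_measurable lborel"
      by measurable
    have *: "integrable lborel (\<lambda>y. (1 - cutoff \<rho> y) * k y)"
      "\<bar>LINT y|lborel. (1 - cutoff \<rho> y) * k y\<bar> \<le> (LINT y|lborel. indicator (- ball 0 (\<rho> / 2)) y * (norm y powr 0 * k y))"
      by (rule integral_dominated_le[OF i m b])+
    have "C0 * (\<rho> / 2) powr (0 - 2 * s) = C0 * 2 powr (2 * s) * \<rho> powr (- 2 * s)"
      using \<rho> by (simp add: powr_divide powr_minus_divide)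
    also have "\<dots> \<le> C * \<rho> powr (- 2 * s)"
      using C0 C1 M by (intro mult_right_mono) (auto simp: C_def)
    finally show "integrable lborel (\<lambda>y. (1 - cutoff \<rho> y) * k y)
      \<and> (LINT y|lborel. (1 - cutoff \<rho> y) * k y) \<le> C * \<rho> powr (- 2 * s)"
      using * le by linarith
  next
    fix k :: "'a \<Rightarrow> real" and \<rho> :: real and h :: 'a
    assume k: "kernel k" and \<rho>: "0 < \<rho>" and h: "norm h \<le> \<rho> / 8"
    note [measurable] = kernel_measurable[OF k]
    let ?I = "indicator (- ball (0::'a) (\<rho> / 4)) :: 'a \<Rightarrow> real"
    let ?F = "\<lambda>y. M * norm h powr \<alpha> * (?I y * norm y powr (- (2 * s + \<alpha>) - DIM('a)))
          + 2 * (norm h / \<rho>) powr \<alpha> * (?I y * (norm y powr 0 * k y))"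
    have b: "\<bar>\<bar>(1 - cutoff \<rho> (y + h)) * k (y + h) - (1 - cutoff \<rho> y) * k y\<bar>\<bar> \<le> ?F y" for y
    proof (cases "norm y < \<rho> / 4")
      case True
      then have "norm (y + h) \<le> \<rho> / 2" using norm_triangle_ineq[of y h] h \<rho> by linarith
      then show ?thesis using True \<rho> by (simp add: cutoff_eq_1)
    next
      case False
      then have y0: "y \<noteq> 0" using \<rho> by auto
      have "norm h \<le> norm y / 2" using False h by linarith
      then have d: "\<bar>k (y + h) - k y\<bar> \<le> M * norm h powr \<alpha> * norm y powr (- 2 * s - \<alpha> - real DIM('a))"
        using k by (simp add: kernel_def)
      have hr: "0 \<le> norm h / \<rho>" "norm h / \<rho> \<le> 1" using h \<rho> by (auto simp: field_simps)
      \<comment> \<open>The Lipschitz bound |h|/\<rho> of the cutoff is weakened to the power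
        \<alpha>, possible since |h|/\<rho> <= 1; both terms of the product rule then scale
        alike.\<close>
      have "(norm h / \<rho>) powr 1 \<le> (norm h / \<rho>) powr \<alpha>"
        using hr \<alpha> by (intro powr_mono') auto
      then have e: "2 * norm h / \<rho> \<le> 2 * (norm h / \<rho>) powr \<alpha>" using hr \<rho> by simp
      have "(1 - cutoff \<rho> (y + h)) * k (y + h) - (1 - cutoff \<rho> y) * k y
          = (1 - cutoff \<rho> (y + h)) * (k (y + h) - k y) + (cutoff \<rho> y - cutoff \<rho> (y + h)) * k y"
        by (simp add: algebra_simps)
      then have "\<bar>(1 - cutoff \<rho> (y + h)) * k (y + h) - (1 - cutoff \<rho> y) * k y\<bar>
          \<le> \<bar>1 - cutoff \<rho> (y + h)\<bar> * \<bar>k (y + h) - k y\<bar> + \<bar>cutoff \<rho> y - cutoff \<rho> (y + h)\<bar> * k y"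
        using kernel_nonneg[OF k, of y] by (metis abs_mult abs_of_nonneg abs_triangle_ineq)
      also have "\<dots> \<le> 1 * \<bar>k (y + h) - k y\<bar> + (2 * (norm h / \<rho>) powr \<alpha>) * k y"
      proof (intro add_mono mult_right_mono)
        show "\<bar>cutoff \<rho> y - cutoff \<rho> (y + h)\<bar> \<le> 2 * (norm h / \<rho>) powr \<alpha>"
          using cutoff_lipschitz[OF \<rho>, of y h] e by (simp add: abs_minus_commute)
        show "\<bar>1 - cutoff \<rho> (y + h)\<bar> \<le> 1" using cutoff_range[of \<rho> "y + h"] by simp
      qed (use kernel_nonneg[OF k, of y] in auto)
      also have "\<dots> \<le> ?F y"
      proof -
        have "- 2 * s - \<alpha> - real DIM('a) = - (2 * s + \<alpha>) - real DIM('a)" by simp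
        with d have "\<bar>k (y + h) - k y\<bar> \<le> M * norm h powr \<alpha> * norm y powr (- (2 * s + \<alpha>) - real DIM('a))"
          by (simp only:)
        then show ?thesis using False y0 by simp
      qed
      finally show ?thesis by simp
    qed
    have r: "0 < \<rho> / 4" using \<rho> by simp
    note i2 = C0(2)[OF k r]
    have i: "integrable lborel ?F"
      using i2 C1(2)[OF r] by (intro Bochner_Integration.integrable_add integrable_mult_right) auto
    have "\<bar>LINT y|lborel. \<bar>(1 - cutoff \<rho> (y + h)) * k (y + h) - (1 - cutoff \<rho> y) * k y\<bar>\<bar> \<le> (LINT y|lborel. ?F y)"
      by (rule integral_dominated_le(2)[OF i _ b]) measurable
    also have "(LINT y|lborel. ?F y) = M * norm h powr \<alpha> * (LINT y|lborel. ?I y * norm y powr (- (2 * s + \<alpha>) - DIM('a)))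
          + 2 * (norm h / \<rho>) powr \<alpha> * (LINT y|lborel. ?I y * (norm y powr 0 * k y))"
      using i2 C1(2)[OF r]
      by (subst Bochner_Integration.integral_add) auto
    also have "\<dots> \<le> M * norm h powr \<alpha> * (C1 * (\<rho> / 4) powr (- (2 * s + \<alpha>)))
          + 2 * (norm h / \<rho>) powr \<alpha> * (C0 * (\<rho> / 4) powr (0 - 2 * s))"
      using i2 C1(3)[OF r] M by (intro add_mono mult_left_mono) auto
    also have "\<dots> = (M * C1 * 4 powr (2 * s + \<alpha>) + 2 * C0 * 4 powr (2 * s)) * norm h powr \<alpha> * \<rho> powr (- 2 * s - \<alpha>)"
    proof -
      have 1: "(\<rho> / 4) powr (- (2 * s + \<alpha>)) = 4 powr (2 * s + \<alpha>) * \<rho> powr (- 2 * s - \<alpha>)"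
        using \<rho> by (simp add: powr_divide powr_minus_divide powr_diff powr_add)
      have 2: "(norm h / \<rho>) powr \<alpha> * (\<rho> / 4) powr (0 - 2 * s) = 4 powr (2 * s) * norm h powr \<alpha> * \<rho> powr (- 2 * s - \<alpha>)"
        using \<rho> by (simp add: powr_divide powr_minus_divide powr_diff powr_add mult_ac)
      show ?thesis unfolding 1 using 2 by (simp add: algebra_simps)
    qed
    also have "\<dots> \<le> C * norm h powr \<alpha> * \<rho> powr (- 2 * s - \<alpha>)"
      using C0 C1 M by (intro mult_right_mono) (auto simp: C_def)
    finally show "(LINT y|lborel. \<bar>(1 - cutoff \<rho> (y + h)) * k (y + h) - (1 - cutoff \<rho> y) * k y\<bar>)
        \<le> C * norm h powr \<alpha> * \<rho> powr (- 2 * s - \<alpha>)" by linarith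
  qed
qed

text \<open>At a maximum point of \<open>w\<close> minus a paraboloid, discarding every jump except those landing in one
  ball where the kernel is bounded below bounds the maximum by the average of \<open>w\<close> over that ball.\<close>

lemma maximum_principle_step:
  obtains C where "0 < C"
    "\<And>(k::'a::euclidean_space \<Rightarrow> real) w w' x\<^sub>0 t\<^sub>0 \<tau> \<rho> W g\<^sub>0 l.
      \<lbrakk>kernel k; 0 < \<tau>; 0 < \<rho>; 0 < l; l \<le> \<rho> / 4; 0 \<le> W; 0 \<le> g\<^sub>0;
       continuous_on ({t\<^sub>0 - \<tau>..t\<^sub>0} \<times> UNIV) (\<lambda>p. w (fst p) (snd p));
       \<And>t x. t \<in> {t\<^sub>0 - \<tau>..t\<^sub>0} \<Longrightarrow> x \<in> ball x\<^sub>0 (2 * \<rho>) \<Longrightarrow> \<bar>w t x\<bar> \<le> W;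
       \<And>t x. t \<in> {t\<^sub>0 - \<tau>..t\<^sub>0} \<Longrightarrow> x \<in> ball x\<^sub>0 \<rho> \<Longrightarrow> ((\<lambda>t. w t x) has_real_derivative w' t x) (at t);
       \<And>t x. t \<in> {t\<^sub>0 - \<tau>..t\<^sub>0} \<Longrightarrow> x \<in> ball x\<^sub>0 \<rho> \<Longrightarrow>
          integrable lborel (\<lambda>y. cutoff \<rho> y * k y * sdiff (w t) x y);
       \<And>t x. t \<in> {t\<^sub>0 - \<tau>..t\<^sub>0} \<Longrightarrow> x \<in> ball x\<^sub>0 \<rho> \<Longrightarrow>
          w' t x - (LINT y|lborel. cutoff \<rho> y * k y * sdiff (w t) x y) \<le> g\<^sub>0;
       0 < w t\<^sub>0 x\<^sub>0\<rbrakk>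
      \<Longrightarrow> \<exists>t\<^sub>1\<in>{t\<^sub>0 - \<tau>..t\<^sub>0}. \<exists>x\<^sub>1\<in>ball x\<^sub>0 \<rho>. \<exists>\<theta>. norm \<theta> = 1 \<and>
        (\<forall>\<sigma>. norm \<sigma> \<le> \<kappa> * l / 2 \<longrightarrow>
          w t\<^sub>0 x\<^sub>0 \<le> (LINT b|lborel. indicator (ball 0 (\<kappa> * l / 2)) b * w t\<^sub>1 (x\<^sub>1 + l *\<^sub>R \<theta> + \<sigma> + b))
              / measure lborel (ball (0::'a) (\<kappa> * l / 2))
            + C * l powr (2 * s) * (g\<^sub>0 + W / \<tau> + W * \<rho> powr (- 2 * s)))"
proof -
  obtain C1 where C1: "0 < C1"
    "\<And>(k::'a \<Rightarrow> real) r. kernel k \<Longrightarrow> 0 < r \<Longrightarrow>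
      integrable lborel (\<lambda>y. indicator (ball 0 r) y * (norm y powr 2 * k y))
      \<and> (LINT y|lborel. indicator (ball 0 r) y * (norm y powr 2 * k y)) \<le> C1 * r powr (2 - 2 * s)"
    using kernel_near[of 2, where 'a='a] s by auto
  let ?V = "measure lborel (ball (0::'a) 1)"
  have V: "0 < ?V" by (simp add: content_ball_pos)
  \<comment> \<open>The lower bound of k at scale l times the volume of a ball of radius \<kappa> l
    / 2 equals \<open>c' * l powr (- 2 * s)\<close>; see \<open>ev\<close>.\<close>
  define c' where "c' = c * ?V * (\<kappa> / 2) ^ DIM('a)"
  have c': "0 < c'" using c V \<kappa> by (simp add: c'_def)
  define C where "C = (1 + 2 * C1) / c'"
  have C: "0 < C" using c' C1 by (simp add: C_def add_pos_pos)
  show thesis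
  proof (rule that[OF C], goal_cases)
    case prems: (1 k w w' x\<^sub>0 t\<^sub>0 \<tau> \<rho> W g\<^sub>0 l)
    note k = prems(1) and pos = prems(2-7) and cont = prems(8) and bnd = prems(9)
      and der = prems(10) and int = prems(11) and eqn = prems(12) and w0 = prems(13)
    note [measurable] = kernel_measurable[OF k]
    \<comment> \<open>P is at least W for |x - x0| >= \<rho> and at the initial time, and it
      vanishes at the starting point. As |w| <= W, the positive maximum of m is attained inside the
      ball and after the initial time.\<close>
    define P where "P t x = W * ((norm (x - x\<^sub>0))\<^sup>2 / \<rho>\<^sup>2 + (t\<^sub>0 - t) / \<tau>)" for t x
    define m where "m t x = w t x - P t x" for t x
    have P0: "0 \<le> P t x" if "t \<le> t\<^sub>0" for t x
      using that pos by (simp add: P_def)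
    let ?K = "{t\<^sub>0 - \<tau>..t\<^sub>0} \<times> cball x\<^sub>0 \<rho>"
    have "continuous_on ?K (\<lambda>p. m (fst p) (snd p))"
      unfolding m_def P_def using pos
      by (intro continuous_intros continuous_on_subset[OF cont]) auto
    moreover have "compact ?K" by (intro compact_Times) auto
    moreover have "?K \<noteq> {}" using pos by auto
    ultimately obtain p where p: "p \<in> ?K" "\<And>q. q \<in> ?K \<Longrightarrow> m (fst q) (snd q) \<le> m (fst p) (snd p)"
      using continuous_attains_sup[of ?K "\<lambda>p. m (fst p) (snd p)"] by blast
    obtain t\<^sub>1 x\<^sub>1 where p_eq: "p = (t\<^sub>1, x\<^sub>1)" by (cases p)
    have tx: "t\<^sub>1 \<in> {t\<^sub>0 - \<tau>..t\<^sub>0}" "x\<^sub>1 \<in> cball x\<^sub>0 \<rho>" using p(1) p_eq by auto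
    have max: "m t x \<le> m t\<^sub>1 x\<^sub>1" if "t \<in> {t\<^sub>0 - \<tau>..t\<^sub>0}" "x \<in> cball x\<^sub>0 \<rho>" for t x
      using p(2)[of "(t, x)"] that p_eq by simp
    have "m t\<^sub>0 x\<^sub>0 = w t\<^sub>0 x\<^sub>0" by (simp add: m_def P_def)
    then have m1: "w t\<^sub>0 x\<^sub>0 \<le> m t\<^sub>1 x\<^sub>1" using max[of t\<^sub>0 x\<^sub>0] pos by simp
    have outer: "m t x \<le> 0" if "t \<in> {t\<^sub>0 - \<tau>..t\<^sub>0}" "x \<in> ball x\<^sub>0 (2 * \<rho>)" "\<rho> \<le> norm (x - x\<^sub>0)" for t x
    proof -
      have "\<rho>\<^sup>2 \<le> (norm (x - x\<^sub>0))\<^sup>2" using that pos by (intro power_mono) auto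
      then have "1 \<le> (norm (x - x\<^sub>0))\<^sup>2 / \<rho>\<^sup>2" using pos by simp
      then have "W * 1 \<le> P t x" unfolding P_def using that pos
        by (intro mult_left_mono) (auto intro: add_increasing2)
      then show ?thesis using bnd[OF that(1,2)] by (simp add: m_def)
    qed
    have x1: "x\<^sub>1 \<in> ball x\<^sub>0 \<rho>"
    proof (rule ccontr)
      assume "x\<^sub>1 \<notin> ball x\<^sub>0 \<rho>"
      then have "m t\<^sub>1 x\<^sub>1 \<le> 0" using tx pos by (intro outer) (auto simp: dist_norm norm_minus_commute)
      then show False using m1 w0 by simp
    qed
    have t1: "t\<^sub>0 - \<tau> < t\<^sub>1"
    proof (rule ccontr)
      assume "\<not> ?thesis"
      then have "t\<^sub>1 = t\<^sub>0 - \<tau>" using tx by auto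
      then have "W * 1 \<le> P t\<^sub>1 x\<^sub>1" unfolding P_def using pos by (intro mult_left_mono) auto
      moreover have "\<bar>w t\<^sub>1 x\<^sub>1\<bar> \<le> W" using tx x1 pos by (intro bnd) auto
      ultimately show False using m1 w0 by (simp add: m_def)
    qed
    \<comment> \<open>Inside the closed ball this is maximality; between \<rho> and 2 \<rho> it
      holds because m <= 0 there. So no jump with |y| < \<rho>, the range seen by the cutoff, leads
      to a larger value.\<close>
    have nb: "m t\<^sub>1 (x\<^sub>1 + y) \<le> m t\<^sub>1 x\<^sub>1" if "norm y < \<rho>" for y
    proof (cases "x\<^sub>1 + y \<in> cball x\<^sub>0 \<rho>")
      case False
      have "norm (x\<^sub>1 + y - x\<^sub>0) \<le> norm (x\<^sub>1 - x\<^sub>0) + norm y"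
        using norm_triangle_ineq[of "x\<^sub>1 - x\<^sub>0" y] by (simp add: algebra_simps)
      then have "m t\<^sub>1 (x\<^sub>1 + y) \<le> 0"
        using False that x1 tx by (intro outer) (auto simp: dist_norm norm_minus_commute)
      then show ?thesis using m1 w0 by simp
    qed (use tx max in auto)
    have dm: "((\<lambda>t. m t x\<^sub>1) has_real_derivative w' t\<^sub>1 x\<^sub>1 + W / \<tau>) (at t\<^sub>1)"
      unfolding m_def P_def using pos tx x1
      by (auto intro!: derivative_eq_intros der simp: field_simps)
    \<comment> \<open>The maximum may sit at the final time, so it is compared with earlier times
      only, which gives one sign. W / \<tau> is minus the time derivative of P.\<close>
    have dpos: "0 \<le> w' t\<^sub>1 x\<^sub>1 + W / \<tau>"
    proof (rule ccontr)
      assume "\<not> ?thesis"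
      then obtain d where d: "0 < d" "\<And>h. 0 < h \<Longrightarrow> h < d \<Longrightarrow> m t\<^sub>1 x\<^sub>1 < m (t\<^sub>1 - h) x\<^sub>1"
        using DERIV_neg_dec_left[OF dm] by auto
      define h where "h = min (d / 2) (t\<^sub>1 - (t\<^sub>0 - \<tau>))"
      have h: "0 < h" "h < d" "h \<le> t\<^sub>1 - (t\<^sub>0 - \<tau>)" using d t1 by (auto simp: h_def)
      then have "m (t\<^sub>1 - h) x\<^sub>1 \<le> m t\<^sub>1 x\<^sub>1" using tx by (intro max) auto
      then show False using d(2)[OF h(1,2)] by simp
    qed
    define J where "J = (\<lambda>y. cutoff \<rho> y * k y)"
    have J: "0 \<le> J y" "norm y \<ge> \<rho> \<Longrightarrow> J y = 0" "J y \<le> indicator (ball 0 \<rho>) y * k y" for y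
      using cutoff_range[of \<rho> y] kernel_nonneg[OF k, of y] cutoff_eq_0[of \<rho> y] pos
      by (auto simp: J_def indicator_def intro: mult_left_le_one_le)
    have [measurable]: "J \<in> borel_measurable borel" unfolding J_def by measurable
    have iw: "integrable lborel (\<lambda>y. J y * sdiff (w t\<^sub>1) x\<^sub>1 y)"
      using int[OF tx(1) x1] by (simp add: J_def)
    \<comment> \<open>By the parallelogram identity the second difference of the paraboloid does not
      depend on the centre; its time part cancels.\<close>
    have sd: "sdiff (w t\<^sub>1) x\<^sub>1 y = sdiff (m t\<^sub>1) x\<^sub>1 y + 2 * W * (norm y)\<^sup>2 / \<rho>\<^sup>2" for y
    proof -
      let ?A = "\<lambda>z. (norm (z - x\<^sub>0))\<^sup>2"
      have "?A (x\<^sub>1 + y) + ?A (x\<^sub>1 - y) = 2 * ?A x\<^sub>1 + 2 * (norm y)\<^sup>2"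
        by (simp add: power2_norm_eq_inner inner_simps algebra_simps)
      then have A: "?A (x\<^sub>1 + y) + ?A (x\<^sub>1 - y) - 2 * ?A x\<^sub>1 = 2 * (norm y)\<^sup>2" by linarith
      have gen: "W * (a / r + q) + W * (b / r + q) - 2 * (W * (d / r + q)) = W * (a + b - 2 * d) / r"
        for a b d r q :: real
        by (simp add: algebra_simps add_divide_distrib diff_divide_distrib)
      have "sdiff (P t\<^sub>1) x\<^sub>1 y = W * (2 * (norm y)\<^sup>2) / \<rho>\<^sup>2"
        unfolding sdiff_def P_def gen A ..
      then show ?thesis by (simp add: sdiff_def m_def algebra_simps)
    qed
    have i2: "integrable lborel (\<lambda>y. J y * (2 * W * (norm y)\<^sup>2 / \<rho>\<^sup>2))"
      and I2: "(LINT y|lborel. J y * (2 * W * (norm y)\<^sup>2 / \<rho>\<^sup>2)) \<le> 2 * C1 * W * \<rho> powr (- 2 * s)"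
    proof -
      let ?g = "\<lambda>y. (2 * W / \<rho>\<^sup>2) * (indicator (ball 0 \<rho>) y * (norm y powr 2 * k y))"
      have g: "integrable lborel ?g" using C1(2)[OF k pos(2)] by simp
      have b: "\<bar>J y * (2 * W * (norm y)\<^sup>2 / \<rho>\<^sup>2)\<bar> \<le> ?g y" for y
      proof -
        have "\<bar>J y * (2 * W * (norm y)\<^sup>2 / \<rho>\<^sup>2)\<bar> = J y * (2 * W * (norm y)\<^sup>2 / \<rho>\<^sup>2)"
          using J(1)[of y] pos by simp
        also have "\<dots> \<le> (indicator (ball 0 \<rho>) y * k y) * (2 * W * (norm y)\<^sup>2 / \<rho>\<^sup>2)"
          using J(3)[of y] pos by (intro mult_right_mono) auto
        also have "\<dots> = ?g y" by (simp add: mult_ac)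
        finally show ?thesis .
      qed
      have m': "(\<lambda>y. J y * (2 * W * (norm y)\<^sup>2 / \<rho>\<^sup>2)) \<in> borel_measurable lborel" by measurable
      show "integrable lborel (\<lambda>y. J y * (2 * W * (norm y)\<^sup>2 / \<rho>\<^sup>2))"
        by (rule integral_dominated_le(1)[OF g m' b])
      have "(LINT y|lborel. J y * (2 * W * (norm y)\<^sup>2 / \<rho>\<^sup>2)) \<le> (LINT y|lborel. ?g y)"
        using integral_dominated_le(2)[OF g m' b] by linarith
      also have "\<dots> \<le> (2 * W / \<rho>\<^sup>2) * (C1 * \<rho> powr (2 - 2 * s))"
        using C1(2)[OF k pos(2)] pos by (simp del: powr_numeral) (intro mult_left_mono divide_right_mono, auto)
      also have "\<dots> = 2 * C1 * W * \<rho> powr (- 2 * s)"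
        using pos by (simp add: powr_diff powr_minus_divide)
      finally show "(LINT y|lborel. J y * (2 * W * (norm y)\<^sup>2 / \<rho>\<^sup>2)) \<le> 2 * C1 * W * \<rho> powr (- 2 * s)" .
    qed
    have im: "integrable lborel (\<lambda>y. J y * sdiff (m t\<^sub>1) x\<^sub>1 y)"
    proof -
      have "integrable lborel (\<lambda>y. J y * sdiff (w t\<^sub>1) x\<^sub>1 y - J y * (2 * W * (norm y)\<^sup>2 / \<rho>\<^sup>2))"
        using iw i2 by (rule Bochner_Integration.integrable_diff)
      then show ?thesis by (simp add: sd algebra_simps)
    qed
    have Iw: "(LINT y|lborel. J y * sdiff (w t\<^sub>1) x\<^sub>1 y)
        = (LINT y|lborel. J y * sdiff (m t\<^sub>1) x\<^sub>1 y) + (LINT y|lborel. J y * (2 * W * (norm y)\<^sup>2 / \<rho>\<^sup>2))"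
      unfolding Bochner_Integration.integral_add[OF im i2, symmetric] by (simp add: sd algebra_simps)
    obtain \<theta> :: 'a where \<theta>: "norm \<theta> = 1"
      "\<And>l y. 0 < l \<Longrightarrow> y \<in> ball (l *\<^sub>R \<theta>) (\<kappa> * l) \<Longrightarrow> c * l powr (- 2 * s - real DIM('a)) \<le> k y"
      using k unfolding kernel_def by blast
    have "w t\<^sub>0 x\<^sub>0 \<le> (LINT b|lborel. indicator (ball 0 (\<kappa> * l / 2)) b * w t\<^sub>1 (x\<^sub>1 + l *\<^sub>R \<theta> + \<sigma> + b))
              / measure lborel (ball (0::'a) (\<kappa> * l / 2))
            + C * l powr (2 * s) * (g\<^sub>0 + W / \<tau> + W * \<rho> powr (- 2 * s))"
      if \<sigma>: "norm \<sigma> \<le> \<kappa> * l / 2" for \<sigma> :: 'a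
    proof -
      let ?r = "\<kappa> * l / 2"
      \<comment> \<open>For every admissible \<sigma> this ball lies in
        \<open>ball (l *\<^sub>R \<theta>) (\<kappa> * l)\<close>, where k is bounded below. The
        halved radius is what leaves room for the shifts.\<close>
      let ?B = "ball (l *\<^sub>R \<theta> + \<sigma>) ?r"
      let ?v = "measure lborel (ball (0::'a) ?r)"
      let ?e = "c * l powr (- 2 * s - real DIM('a))"
      have r: "0 < ?r" using \<kappa> pos by simp
      have v: "?v = ?r ^ DIM('a) * ?V"
        using content_ball_conv_unit_ball[of ?r "0::'a"] r by simp
      have vB: "measure lborel ?B = ?v"
        using content_ball_conv_unit_ball[of ?r "l *\<^sub>R \<theta> + \<sigma>"] r v by simp
      have vpos: "0 < ?v" using r by (simp add: content_ball_pos)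
      have B: "norm y \<le> \<rho> / 2" "?e \<le> k y" if "y \<in> ?B" for y
      proof -
        have "norm (y - l *\<^sub>R \<theta>) \<le> norm (y - (l *\<^sub>R \<theta> + \<sigma>)) + norm \<sigma>"
          using norm_triangle_ineq[of "y - (l *\<^sub>R \<theta> + \<sigma>)" \<sigma>] by (simp add: algebra_simps)
        then have 1: "norm (y - l *\<^sub>R \<theta>) < \<kappa> * l"
          using that \<sigma> by (auto simp: dist_norm norm_minus_commute)
        then show "?e \<le> k y" using pos by (intro \<theta>) (auto simp: dist_norm norm_minus_commute)
        have "norm y \<le> norm (y - l *\<^sub>R \<theta>) + norm (l *\<^sub>R \<theta>)"
          using norm_triangle_ineq[of "y - l *\<^sub>R \<theta>" "l *\<^sub>R \<theta>"] by simp
        also have "\<dots> \<le> \<kappa> * l + l" using 1 \<theta>(1) pos by simp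
        also have "\<dots> \<le> 1 / 2 * l + l" using \<kappa> pos by (intro add_mono mult_right_mono) auto
        also have "\<dots> \<le> \<rho> / 2" using pos by simp
        finally show "norm y \<le> \<rho> / 2" .
      qed
      have cw: "continuous_on UNIV (w t\<^sub>1)"
      proof -
        have "continuous_on UNIV ((\<lambda>p. w (fst p) (snd p)) \<circ> (\<lambda>x. (t\<^sub>1, x)))"
          by (intro continuous_on_compose continuous_intros continuous_on_subset[OF cont]) (use tx in auto)
        then show ?thesis by (simp add: o_def)
      qed
      then have wm: "w t\<^sub>1 \<in> borel_measurable borel" by (rule borel_measurable_continuous_onI)
      have "(\<lambda>y. w t\<^sub>1 (x\<^sub>1 + y)) \<in> borel_measurable borel"
        by (rule measurable_compose[OF _ wm]) simp
      then have bm: "(\<lambda>y. indicator ?B y * w t\<^sub>1 (x\<^sub>1 + y)) \<in> borel_measurable borel"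
        by (intro borel_measurable_times borel_measurable_indicator) auto
      let ?h = "\<lambda>y. indicator ?B y * (?e * (w t\<^sub>1 (x\<^sub>1 + y) - m t\<^sub>1 x\<^sub>1))"
      \<comment> \<open>All jump contributions are nonpositive. Off \<open>?B\<close> they are
        dropped. On \<open>?B\<close> the jump to x1 - y is dropped, k is lowered to
        \<open>?e\<close>, which raises a nonpositive product, and m is replaced by w since P >=
        0.\<close>
      have pt: "J y * sdiff (m t\<^sub>1) x\<^sub>1 y \<le> ?h y" for y
      proof (cases "y \<in> ?B")
        case True
        have ny: "norm y < \<rho>" using B(1)[OF True] pos by linarith
        have J1: "J y = k y" using B(1)[OF True] pos by (simp add: J_def cutoff_eq_1)
        have "sdiff (m t\<^sub>1) x\<^sub>1 y \<le> m t\<^sub>1 (x\<^sub>1 + y) - m t\<^sub>1 x\<^sub>1"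
          using nb[of "- y"] ny by (simp add: sdiff_def)
        then have "J y * sdiff (m t\<^sub>1) x\<^sub>1 y \<le> k y * (m t\<^sub>1 (x\<^sub>1 + y) - m t\<^sub>1 x\<^sub>1)"
          unfolding J1 using kernel_nonneg[OF k] by (intro mult_left_mono) auto
        also have "\<dots> \<le> ?e * (m t\<^sub>1 (x\<^sub>1 + y) - m t\<^sub>1 x\<^sub>1)"
          using B(2)[OF True] nb[OF ny] by (intro mult_right_mono_neg) auto
        also have "\<dots> \<le> ?e * (w t\<^sub>1 (x\<^sub>1 + y) - m t\<^sub>1 x\<^sub>1)"
          using P0[of t\<^sub>1 "x\<^sub>1 + y"] tx c unfolding m_def by (intro mult_left_mono) auto
        finally show ?thesis using True by simp
      next
        case False
        have "J y * sdiff (m t\<^sub>1) x\<^sub>1 y \<le> 0"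
        proof (cases "norm y < \<rho>")
          case True
          then have "sdiff (m t\<^sub>1) x\<^sub>1 y \<le> 0"
            using nb[of y] nb[of "- y"] by (simp add: sdiff_def)
          then show ?thesis using J(1)[of y] by (simp add: mult_nonneg_nonpos)
        qed (simp add: J(2))
        then show ?thesis using False by simp
      qed
      have ib: "integrable lborel (\<lambda>y. indicator ?B y * w t\<^sub>1 (x\<^sub>1 + y))"
      proof (rule integral_dominated_le(1))
        show "integrable lborel (\<lambda>y. W * indicator ?B y)"
          using emeasure_lborel_ball_finite[of "l *\<^sub>R \<theta> + \<sigma>" ?r] by simp
        show "\<bar>indicator ?B y * w t\<^sub>1 (x\<^sub>1 + y)\<bar> \<le> W * indicator ?B y" for y
        proof (cases "y \<in> ?B")
          case True
          have "norm (x\<^sub>1 + y - x\<^sub>0) \<le> norm (x\<^sub>1 - x\<^sub>0) + norm y"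
            using norm_triangle_ineq[of "x\<^sub>1 - x\<^sub>0" y] by (simp add: algebra_simps)
          then have "\<bar>w t\<^sub>1 (x\<^sub>1 + y)\<bar> \<le> W"
            using B(1)[OF True] x1 tx pos by (intro bnd) (auto simp: dist_norm norm_minus_commute)
          then show ?thesis using True by simp
        qed simp
      qed (use bm in simp)
      have i1: "integrable lborel (\<lambda>y. indicator ?B y :: real)"
        using emeasure_lborel_ball_finite[of "l *\<^sub>R \<theta> + \<sigma>" ?r] by simp
      have heq: "?h = (\<lambda>y. ?e * (indicator ?B y * w t\<^sub>1 (x\<^sub>1 + y)) - ?e * m t\<^sub>1 x\<^sub>1 * indicator ?B y)"
        by (auto simp: algebra_simps)
      have ih: "integrable lborel ?h"
        unfolding heq using ib i1 by (intro Bochner_Integration.integrable_diff integrable_mult_right) auto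
      have "(LINT y|lborel. J y * sdiff (m t\<^sub>1) x\<^sub>1 y) \<le> (LINT y|lborel. ?h y)"
        by (rule integral_mono[OF im ih pt])
      also have "(LINT y|lborel. ?h y) = ?e * (LINT y|lborel. indicator ?B y * w t\<^sub>1 (x\<^sub>1 + y)) - ?e * m t\<^sub>1 x\<^sub>1 * ?v"
        unfolding heq using ib i1 by (subst Bochner_Integration.integral_diff) (auto simp: vB)
      also have "(LINT y|lborel. indicator ?B y * w t\<^sub>1 (x\<^sub>1 + y))
          = (LINT b|lborel. indicator ?B (l *\<^sub>R \<theta> + \<sigma> + b) * w t\<^sub>1 (x\<^sub>1 + (l *\<^sub>R \<theta> + \<sigma> + b)))"
        by (rule lborel_integral_translate[OF bm, symmetric])
      also have "\<dots> = (LINT b|lborel. indicator (ball 0 ?r) b * w t\<^sub>1 (x\<^sub>1 + l *\<^sub>R \<theta> + \<sigma> + b))"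
        by (intro Bochner_Integration.integral_cong) (auto simp: indicator_def dist_norm add_ac)
      finally have Im: "(LINT y|lborel. J y * sdiff (m t\<^sub>1) x\<^sub>1 y)
          \<le> ?e * ((LINT b|lborel. indicator (ball 0 ?r) b * w t\<^sub>1 (x\<^sub>1 + l *\<^sub>R \<theta> + \<sigma> + b)) - m t\<^sub>1 x\<^sub>1 * ?v)"
        by (simp add: algebra_simps)
      let ?A = "(LINT b|lborel. indicator (ball 0 ?r) b * w t\<^sub>1 (x\<^sub>1 + l *\<^sub>R \<theta> + \<sigma> + b)) / ?v"
      have ev: "?e * ?v = c' * l powr (- 2 * s)"
      proof -
        have "?r ^ DIM('a) = (\<kappa> / 2) ^ DIM('a) * l powr real DIM('a)"
          using pos by (simp add: powr_realpow power_mult_distrib field_simps)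
        then have "?e * ?v = c' * (l powr (- 2 * s - real DIM('a)) * l powr real DIM('a))"
          unfolding v c'_def by (simp add: mult_ac)
        then show ?thesis by (simp add: powr_add[symmetric])
      qed
      have "?e * ((LINT b|lborel. indicator (ball 0 ?r) b * w t\<^sub>1 (x\<^sub>1 + l *\<^sub>R \<theta> + \<sigma> + b)) - m t\<^sub>1 x\<^sub>1 * ?v)
          = (?e * ?v) * (?A - m t\<^sub>1 x\<^sub>1)"
        using vpos by (simp add: field_simps)
      also have "\<dots> \<le> (?e * ?v) * (?A - w t\<^sub>0 x\<^sub>0)"
        using m1 vpos c by (intro mult_left_mono) auto
      finally have Im': "(LINT y|lborel. J y * sdiff (m t\<^sub>1) x\<^sub>1 y) \<le> c' * l powr (- 2 * s) * (?A - w t\<^sub>0 x\<^sub>0)"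
        using Im ev by simp
      have "w' t\<^sub>1 x\<^sub>1 - (LINT y|lborel. J y * sdiff (w t\<^sub>1) x\<^sub>1 y) \<le> g\<^sub>0"
        using eqn[OF tx(1) x1] by (simp add: J_def)
      then have "c' * l powr (- 2 * s) * (w t\<^sub>0 x\<^sub>0 - ?A) \<le> g\<^sub>0 + W / \<tau> + 2 * C1 * (W * \<rho> powr (- 2 * s))"
        using Iw I2 Im' dpos by (simp add: algebra_simps)
      also have "\<dots> \<le> (1 + 2 * C1) * (g\<^sub>0 + W / \<tau> + W * \<rho> powr (- 2 * s))"
      proof -
        have "0 \<le> W / \<tau>" "0 \<le> C1 * g\<^sub>0" "0 \<le> C1 * (W / \<tau>)" "0 \<le> W * \<rho> powr (- 2 * s)"
          using pos C1(1) by auto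
        moreover have "g + q + 2 * C1 * X \<le> (1 + 2 * C1) * (g + q + X)"
          if "0 \<le> q" "0 \<le> C1 * g" "0 \<le> C1 * q" "0 \<le> X" for g q X
          using that by (simp add: algebra_simps)
        ultimately show ?thesis by blast
      qed
      finally have "c' * l powr (- 2 * s) * (w t\<^sub>0 x\<^sub>0 - ?A) \<le> (1 + 2 * C1) * (g\<^sub>0 + W / \<tau> + W * \<rho> powr (- 2 * s))" .
      then have "l powr (2 * s) / c' * (c' * l powr (- 2 * s) * (w t\<^sub>0 x\<^sub>0 - ?A))
          \<le> l powr (2 * s) / c' * ((1 + 2 * C1) * (g\<^sub>0 + W / \<tau> + W * \<rho> powr (- 2 * s)))"
        using c' by (intro mult_left_mono) auto
      also have "l powr (2 * s) / c' * (c' * l powr (- 2 * s) * (w t\<^sub>0 x\<^sub>0 - ?A)) = w t\<^sub>0 x\<^sub>0 - ?A"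
        using c' pos by (simp add: powr_minus_divide)
      finally show ?thesis by (simp add: C_def mult_ac)
    qed
    then show ?case using tx(1) x1 \<theta>(1) by blast
  qed
qed

end

section \<open>Tails of the operator on differences, and the interior estimate in space\<close>

lemma borel_measurable_translate:
  fixes f :: "'a::euclidean_space \<Rightarrow> real"
  assumes "f \<in> borel_measurable borel"
  shows "(\<lambda>y. f (a + y)) \<in> borel_measurable borel" "(\<lambda>y. f (a - y)) \<in> borel_measurable borel"
  by (rule measurable_compose[OF _ assms], simp)+

lemma integrable_mult_bounded:
  fixes f g :: "'a::euclidean_space \<Rightarrow> real"
  assumes "integrable lborel f" "g \<in> borel_measurable borel" "\<And>y. \<bar>g y\<bar> \<le> U"
  shows "integrable lborel (\<lambda>y. f y * g y)"
proof (rule integral_dominated_le(1))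
  show "integrable lborel (\<lambda>y. \<bar>f y\<bar> * U)" using assms(1) by auto
  show "\<bar>f y * g y\<bar> \<le> \<bar>f y\<bar> * U" for y
    unfolding abs_mult by (rule mult_left_mono) (use assms(3) in auto)
  show "(\<lambda>y. f y * g y) \<in> borel_measurable lborel"
    using borel_measurable_integrable[OF assms(1)] assms(2) by simp
qed

context stable_parameters
begin

text \<open>g comes without a modulus of continuity, so the factor r^\<alpha> has to come from the
  kernel: a change of variables moves the head increment from g onto the tail kernel, and the
  remaining differences are bounded by 2^(m-1) U.\<close>

lemma tail_fdiff:
  obtains C where "0 < C"
    "\<And>(k::'a::euclidean_space \<Rightarrow> real) \<rho> r g hs x U.
      \<lbrakk>kernel k; 0 < \<rho>; r \<le> \<rho> / 8; hs \<noteq> []; \<And>h. h \<in> set hs \<Longrightarrow> norm h \<le> r;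
       g \<in> borel_measurable borel; \<And>y. \<bar>g y\<bar> \<le> U\<rbrakk>
      \<Longrightarrow> \<bar>LINT y|lborel. (1 - cutoff \<rho> y) * k y * fdiff hs g (x + y)\<bar>
          \<le> C * (2 ^ length hs * U * r powr \<alpha> * \<rho> powr (- 2 * s - \<alpha>))"
proof -
  obtain C where C: "0 < C"
    "\<And>(k::'a \<Rightarrow> real) \<rho>. kernel k \<Longrightarrow> 0 < \<rho> \<Longrightarrow>
      integrable lborel (\<lambda>y. (1 - cutoff \<rho> y) * k y)
      \<and> (LINT y|lborel. (1 - cutoff \<rho> y) * k y) \<le> C * \<rho> powr (- 2 * s)"
    "\<And>(k::'a \<Rightarrow> real) \<rho> h. kernel k \<Longrightarrow> 0 < \<rho> \<Longrightarrow> norm h \<le> \<rho> / 8 \<Longrightarrow>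
      (LINT y|lborel. \<bar>(1 - cutoff \<rho> (y + h)) * k (y + h) - (1 - cutoff \<rho> y) * k y\<bar>)
        \<le> C * norm h powr \<alpha> * \<rho> powr (- 2 * s - \<alpha>)"
    using kernel_tail[where 'a='a] by blast
  show thesis
  proof (rule that[OF C(1)], goal_cases)
    case prems: (1 k \<rho> r g hs x U)
    obtain h hs' where hs: "hs = h # hs'" using prems(4) by (cases hs) auto
    have hr: "norm h \<le> r" using prems(5) hs by auto
    have U: "0 \<le> U" using prems(7)[of 0] by linarith
    define kf where "kf = (\<lambda>y. (1 - cutoff \<rho> y) * k y)"
    define g' where "g' = fdiff hs' g"
    have g'm: "g' \<in> borel_measurable borel"
      unfolding g'_def by (rule borel_measurable_fdiff[OF prems(6)])
    have g'b: "\<bar>g' y\<bar> \<le> 2 ^ length hs' * U" for y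
      unfolding g'_def by (rule fdiff_bound) (rule prems(7))
    have kfi: "integrable lborel kf" unfolding kf_def using C(2)[OF prems(1,2)] by simp
    have kfm: "kf \<in> borel_measurable borel" using borel_measurable_integrable[OF kfi] by simp
    have kfi': "integrable lborel (\<lambda>y. kf (- h + y))" by (rule lborel_integrable_translate[OF kfi])
    have gm: "(\<lambda>y. g' (x + y)) \<in> borel_measurable borel" by (rule borel_measurable_translate[OF g'm])
    have i1: "integrable lborel (\<lambda>y. kf y * g' (x + y))"
      by (rule integrable_mult_bounded[OF kfi gm g'b])
    have gm2: "(\<lambda>y. g' (x + h + y)) \<in> borel_measurable borel" by (rule borel_measurable_translate[OF g'm])
    have i2: "integrable lborel (\<lambda>y. kf y * g' (x + h + y))"
      by (rule integrable_mult_bounded[OF kfi gm2 g'b])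
    have i3: "integrable lborel (\<lambda>y. kf (- h + y) * g' (x + y))"
      by (rule integrable_mult_bounded[OF kfi' gm g'b])
    have "(LINT y|lborel. kf y * g' (x + h + y)) = (LINT y|lborel. kf (- h + y) * g' (x + h + (- h + y)))"
      by (rule lborel_integral_translate[symmetric, where f = "\<lambda>y. kf y * g' (x + h + y)"])
         (intro borel_measurable_times kfm gm2)
    then have t: "(LINT y|lborel. kf y * g' (x + h + y)) = (LINT y|lborel. kf (- h + y) * g' (x + y))"
      by (simp add: add.assoc)
    have "(LINT y|lborel. (1 - cutoff \<rho> y) * k y * fdiff hs g (x + y))
        = (LINT y|lborel. kf y * g' (x + h + y) - kf y * g' (x + y))"
      by (intro Bochner_Integration.integral_cong refl) (simp add: hs kf_def g'_def algebra_simps)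
    also have "\<dots> = (LINT y|lborel. kf (- h + y) * g' (x + y)) - (LINT y|lborel. kf y * g' (x + y))"
      by (simp add: Bochner_Integration.integral_diff[OF i2 i1] t)
    also have "\<dots> = (LINT y|lborel. kf (- h + y) * g' (x + y) - kf y * g' (x + y))"
      by (rule Bochner_Integration.integral_diff[OF i3 i1, symmetric])
    also have "\<bar>\<dots>\<bar> \<le> (LINT y|lborel. \<bar>kf (- h + y) - kf y\<bar> * (2 ^ length hs' * U))"
    proof (rule integral_dominated_le(2))
      show "integrable lborel (\<lambda>y. \<bar>kf (- h + y) - kf y\<bar> * (2 ^ length hs' * U))"
        using kfi kfi' by (intro integrable_mult_left integrable_abs Bochner_Integration.integrable_diff)
      show "(\<lambda>y. kf (- h + y) * g' (x + y) - kf y * g' (x + y)) \<in> borel_measurable lborel"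
        using borel_measurable_integrable[OF i3] borel_measurable_integrable[OF i1] by simp
      show "\<bar>kf (- h + y) * g' (x + y) - kf y * g' (x + y)\<bar> \<le> \<bar>kf (- h + y) - kf y\<bar> * (2 ^ length hs' * U)" for y
        unfolding left_diff_distrib[symmetric] abs_mult by (rule mult_left_mono[OF g'b]) simp
    qed
    also have "\<dots> = (LINT y|lborel. \<bar>kf (- h + y) - kf y\<bar>) * (2 ^ length hs' * U)"
      by simp
    also have "\<dots> \<le> (C * norm h powr \<alpha> * \<rho> powr (- 2 * s - \<alpha>)) * (2 ^ length hs' * U)"
      using C(3)[OF prems(1,2), of "- h"] hr prems(3) U
      by (intro mult_right_mono) (auto simp: kf_def add.commute)
    also have "\<dots> \<le> (C * r powr \<alpha> * \<rho> powr (- 2 * s - \<alpha>)) * (2 ^ length hs * U)"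
      using hr U C(1) \<alpha> by (intro mult_mono mult_right_mono mult_left_mono powr_mono2) (auto simp: hs)
    finally show ?case by (simp add: mult_ac)
  qed
qed

text \<open>Translation invariance of L: together with \<open>fdiff_integral\<close> it identifies
  the difference of Lu with L applied to the difference of u.\<close>

lemma fdiff_sdiff:
  fixes v :: "'a::euclidean_space \<Rightarrow> real"
  shows "fdiff hs (\<lambda>x. K * sdiff v x y) x = K * sdiff (fdiff hs v) x y"
proof -
  have "fdiff hs (\<lambda>x. v (x - y)) x = fdiff hs v (x - y)"
    using fdiff_translate[of hs v "- y" x] by simp
  then show ?thesis
    by (simp add: sdiff_def fdiff_cmult fdiff_diff fdiff_add fdiff_translate)
qed

text \<open>Turns the translates x - y in \<open>sdiff\<close> into translates by +y of the
  reflected function, so that \<open>tail_fdiff\<close> serves both halves.\<close>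

lemma fdiff_reflect:
  fixes g :: "'a::euclidean_space \<Rightarrow> real"
  shows "fdiff hs g (x - y) = fdiff (map uminus hs) (\<lambda>z. g (- z)) (- x + y)"
  using fdiff_uminus_arg[of hs "\<lambda>z. g (- z)" "- x + y"] by simp

text \<open>At its maximum, \<open>fdiff hs u\<close> is at most its average over each slightly shifted ball; summing over
  \<open>N\<^sup>m\<close> shifts produces the difference with steps \<open>N h\<close>, bounded by \<open>W'\<close>.\<close>

lemma fdiff_step:
  obtains C where "0 < C"
    "\<And>(k::'a::euclidean_space \<Rightarrow> real) u u' f x\<^sub>0 t\<^sub>0 \<tau> \<rho> W W' U hs r l N.
      \<lbrakk>kernel k; 0 < \<tau>; 0 < \<rho>; 0 < l; l \<le> \<rho> / 4; 0 \<le> W;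
       hs \<noteq> []; \<And>h. h \<in> set hs \<Longrightarrow> norm h \<le> r; 0 < r; r \<le> \<rho> / 8; 0 < N;
       real (length hs) * N * r \<le> \<kappa> * l / 2;
       continuous_on ({t\<^sub>0 - \<tau>..t\<^sub>0} \<times> UNIV) (\<lambda>p. u (fst p) (snd p));
       \<And>t x. t \<in> {t\<^sub>0 - \<tau>..t\<^sub>0} \<Longrightarrow> \<bar>u t x\<bar> \<le> U;
       \<And>t x. t \<in> {t\<^sub>0 - \<tau>..t\<^sub>0} \<Longrightarrow> x \<in> ball x\<^sub>0 (2 * \<rho>) \<Longrightarrow> \<bar>fdiff hs (u t) x\<bar> \<le> W;
       \<And>t x. t \<in> {t\<^sub>0 - \<tau>..t\<^sub>0} \<Longrightarrow> x \<in> ball x\<^sub>0 (2 * \<rho>) \<Longrightarrow>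
         \<bar>fdiff (map ((*\<^sub>R) (real N)) hs) (u t) x\<bar> \<le> W';
       \<And>t x. t \<in> {t\<^sub>0 - \<tau>..t\<^sub>0} \<Longrightarrow> x \<in> ball x\<^sub>0 (2 * \<rho>) \<Longrightarrow> ((\<lambda>t. u t x) has_real_derivative u' t x) (at t);
       \<And>t x. t \<in> {t\<^sub>0 - \<tau>..t\<^sub>0} \<Longrightarrow> integrable lborel (\<lambda>y. k y * sdiff (u t) x y);
       \<And>t x. t \<in> {t\<^sub>0 - \<tau>..t\<^sub>0} \<Longrightarrow> x \<in> ball x\<^sub>0 (2 * \<rho>) \<Longrightarrow>
          u' t x - (LINT y|lborel. k y * sdiff (u t) x y) = f t x;
       \<And>t x x'. t \<in> {t\<^sub>0 - \<tau>..t\<^sub>0} \<Longrightarrow> x \<in> ball x\<^sub>0 (2 * \<rho>) \<Longrightarrow> x' \<in> ball x\<^sub>0 (2 * \<rho>) \<Longrightarrow>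
          \<bar>f t x - f t x'\<bar> \<le> U * norm (x - x') powr \<alpha>\<rbrakk>
      \<Longrightarrow> \<bar>fdiff hs (u t\<^sub>0) x\<^sub>0\<bar> \<le> W' / real N ^ length hs
          + C * 2 ^ length hs * l powr (2 * s)
            * (U * r powr \<alpha> * (1 + \<rho> powr (- 2 * s - \<alpha>)) + W / \<tau> + W * \<rho> powr (- 2 * s))"
proof -
  show thesis
  proof (rule maximum_principle_step[where 'a='a], goal_cases)
  case C0: (1 C0)
  show thesis
  proof (rule tail_fdiff[where 'a='a], goal_cases)
  case C1: (1 C1)
  show thesis
  proof (rule kernel_tail[where 'a='a], goal_cases)
  case C2: (1 C2)
  \<comment> \<open>C0 comes from the maximum principle, 2 C1 from the tails of the two translates,
    2 C2 from the tail mass multiplying the central value.\<close>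
  define C where "C = C0 * (1 + 2 * C1 + 2 * C2)"
  have C: "0 < C" using C0 C1 C2 by (simp add: C_def add_pos_pos)
  show thesis
  proof (rule that[OF C], goal_cases)
    case prems: (1 k u u' f x\<^sub>0 t\<^sub>0 \<tau> \<rho> W W' U hs r l N)
    note k = prems(1) and pos = prems(2-6) and hs = prems(7,8) and r = prems(9,10) and N = prems(11,12)
      and cont = prems(13) and ub = prems(14) and wb = prems(15) and wb' = prems(16)
      and der = prems(17) and int = prems(18) and eqn = prems(19) and fh = prems(20)
    let ?m = "length hs" and ?I = "{t\<^sub>0 - \<tau>..t\<^sub>0}"
    have t0I: "t\<^sub>0 \<in> ?I" using pos by auto
    have U: "0 \<le> U" using ub[OF t0I, of 0] by linarith
    have hsum: "sum_list (map norm hs) \<le> real ?m * r"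
      using sum_list_mono[of hs norm "\<lambda>_. r"] hs(2) by (simp add: sum_list_triv)
    have N1: "1 \<le> real N" using N by simp
    \<comment> \<open>The steps sum to at most \<rho>/16, so every translate occurring in
      \<open>fdiff hs\<close> at a point of the \<rho>-ball stays in the 2 \<rho>-ball, where the
      equation holds.\<close>
    have mr: "real ?m * r \<le> \<rho> / 16"
    proof -
      have "real ?m * r * 1 \<le> real ?m * r * N" using N1 r by (intro mult_left_mono) auto
      also have "\<dots> = real ?m * N * r" by simp
      also have "\<dots> \<le> \<kappa> * l / 2" by (rule N(2))
      also have "\<dots> \<le> (1 / 2) * (\<rho> / 4) / 2" using \<kappa> pos by (intro divide_right_mono mult_mono) auto
      finally show ?thesis by simp
    qed
    have near: "y \<in> ball x\<^sub>0 (2 * \<rho>)" if "x \<in> ball x\<^sub>0 \<rho>" "norm (y - x) \<le> \<rho> / 2" for x y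
    proof -
      have "dist x\<^sub>0 y \<le> dist x\<^sub>0 x + dist x y" by (rule dist_triangle)
      then show ?thesis using that pos by (simp add: dist_norm norm_minus_commute)
    qed
    have um: "u t \<in> borel_measurable borel" if "t \<in> ?I" for t
    proof -
      have "continuous_on UNIV ((\<lambda>p. u (fst p) (snd p)) \<circ> (\<lambda>x. (t, x)))"
        by (intro continuous_on_compose continuous_intros continuous_on_subset[OF cont]) (use that in auto)
      then show ?thesis by (intro borel_measurable_continuous_onI) (simp add: o_def)
    qed
    have wm: "fdiff hs (u t) \<in> borel_measurable borel" if "t \<in> ?I" for t
      by (rule borel_measurable_fdiff[OF um[OF that]])
    have fd: "\<bar>fdiff hs (f t) x\<bar> \<le> 2 ^ ?m * U * r powr \<alpha>" if t: "t \<in> ?I" and x: "x \<in> ball x\<^sub>0 \<rho>" for t x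
    proof -
      obtain h hs' where hs': "hs = h # hs'" using hs(1) by (cases hs) auto
      have hr: "norm h \<le> r" using hs(2) hs' by auto
      have "\<bar>fdiff hs' (\<lambda>x. f t (x + h) - f t x) x\<bar> \<le> 2 ^ length hs' * (U * r powr \<alpha>)"
      proof (rule fdiff_local_bound)
        fix y assume y: "norm (y - x) \<le> sum_list (map norm hs')"
        have hsum': "norm h + sum_list (map norm hs') \<le> \<rho> / 16"
          using hsum mr hs' by simp
        have "norm (y + h - x) \<le> norm (y - x) + norm h"
          using norm_triangle_ineq[of "y - x" h] by (simp add: algebra_simps)
        then have 1: "norm (y + h - x) \<le> \<rho> / 16" "norm (y - x) \<le> \<rho> / 16"
          using y hsum' norm_ge_zero[of h] by linarith+
        have "\<bar>f t (y + h) - f t y\<bar> \<le> U * norm (y + h - y) powr \<alpha>"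
          by (rule fh[OF t near[OF x] near[OF x]]) (use 1 pos in auto)
        also have "\<dots> \<le> U * r powr \<alpha>"
          using hr U \<alpha> by (intro mult_left_mono powr_mono2) auto
        finally show "\<bar>f t (y + h) - f t y\<bar> \<le> U * r powr \<alpha>" .
      qed
      also have "\<dots> \<le> 2 ^ ?m * (U * r powr \<alpha>)"
        using U by (intro mult_right_mono) (auto simp: hs')
      finally show ?thesis unfolding hs' fdiff_Cons_inner by (simp add: mult.assoc)
    qed
    define g\<^sub>0 where "g\<^sub>0 = 2 ^ ?m * U * r powr \<alpha> * (1 + 2 * C1 * \<rho> powr (- 2 * s - \<alpha>)) + 2 * C2 * W * \<rho> powr (- 2 * s)"
    have g0: "0 \<le> g\<^sub>0" unfolding g\<^sub>0_def using U C1(1) C2(1) pos by (intro add_nonneg_nonneg mult_nonneg_nonneg) auto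
    define E where "E = C0 * l powr (2 * s) * (g\<^sub>0 + W / \<tau> + W * \<rho> powr (- 2 * s))"
    have E0: "0 \<le> E" unfolding E_def using g0 C0 pos by (intro mult_nonneg_nonneg add_nonneg_nonneg) auto
    have W'0: "0 \<le> W'" using wb'[OF t0I, of x\<^sub>0] pos by auto
    \<comment> \<open>The maximum principle is one-sided; it is applied to the difference with
      either sign, in the case where the value is positive.\<close>
    have key: "\<epsilon> * fdiff hs (u t\<^sub>0) x\<^sub>0 \<le> W' / N ^ ?m + E" if \<epsilon>: "\<bar>\<epsilon>\<bar> = 1" for \<epsilon> :: real
    proof (cases "0 < \<epsilon> * fdiff hs (u t\<^sub>0) x\<^sub>0")
      case False
      moreover have "0 \<le> W' / N ^ ?m" using W'0 by simp
      ultimately show ?thesis using E0 by linarith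
    next
      case True
      define w where "w t x = \<epsilon> * fdiff hs (u t) x" for t x
      define w' where "w' t x = \<epsilon> * fdiff hs (u' t) x" for t x
      have c1: "continuous_on (?I \<times> UNIV) (\<lambda>p. w (fst p) (snd p))"
        unfolding w_def by (intro continuous_intros continuous_on_fdiff[OF cont])
      have b1: "\<bar>w t x\<bar> \<le> W" if "t \<in> ?I" "x \<in> ball x\<^sub>0 (2 * \<rho>)" for t x
        using wb[OF that] \<epsilon> by (simp add: w_def abs_mult)
      have d1: "((\<lambda>t. w t x) has_real_derivative w' t x) (at t)" if "t \<in> ?I" "x \<in> ball x\<^sub>0 \<rho>" for t x
        unfolding w_def w'_def
      proof (rule DERIV_cmult, rule fdiff_has_real_derivative)
        fix y assume "norm (y - x) \<le> sum_list (map norm hs)"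
        then have "norm (y - x) \<le> \<rho> / 2" using hsum mr pos by linarith
        then show "((\<lambda>t. u t y) has_real_derivative u' t y) (at t)"
          by (intro der[OF that(1)] near[OF that(2)])
      qed
      have sw: "sdiff (w t) x y = \<epsilon> * sdiff (fdiff hs (u t)) x y" for t x y
        by (simp add: sdiff_def w_def algebra_simps)
      have swm: "sdiff (w t) x \<in> borel_measurable borel" if "t \<in> ?I" for t x
      proof -
        have "w t \<in> borel_measurable borel"
          unfolding w_def using wm[OF that] by simp
        then show ?thesis by (rule sdiff_measurable)
      qed
      have kw: "integrable lborel (\<lambda>y. k y * sdiff (w t) x y)"
        "(LINT y|lborel. k y * sdiff (w t) x y) = \<epsilon> * fdiff hs (\<lambda>x. LINT y|lborel. k y * sdiff (u t) x y) x"
        if "t \<in> ?I" for t x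
      proof -
        note * = fdiff_integral[of lborel "\<lambda>y x. k y * sdiff (u t) x y" hs x, OF int[OF that], unfolded fdiff_sdiff]
        have "integrable lborel (\<lambda>y. \<epsilon> * (k y * sdiff (fdiff hs (u t)) x y))"
          using *(2) by (rule integrable_mult_right)
        then show "integrable lborel (\<lambda>y. k y * sdiff (w t) x y)" by (simp add: sw mult_ac)
        show "(LINT y|lborel. k y * sdiff (w t) x y) = \<epsilon> * fdiff hs (\<lambda>x. LINT y|lborel. k y * sdiff (u t) x y) x"
          unfolding *(1) by (simp add: sw mult.left_commute)
      qed
      have swb: "\<bar>sdiff (w t) x y\<bar> \<le> 4 * (2 ^ ?m * U)" if "t \<in> ?I" for t x y
      proof -
        have "\<bar>fdiff hs (u t) z\<bar> \<le> 2 ^ ?m * U" for z by (rule fdiff_bound) (rule ub[OF that])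
        then have "\<bar>w t z\<bar> \<le> 2 ^ ?m * U" for z using \<epsilon> by (simp add: w_def abs_mult)
        from this[of "x + y"] this[of "x - y"] this[of x] show ?thesis unfolding sdiff_def by linarith
      qed
      have tail_i: "integrable lborel (\<lambda>y. (1 - cutoff \<rho> y) * k y * sdiff (w t) x y)" if "t \<in> ?I" for t x
        by (rule integrable_mult_bounded[OF _ swm[OF that] swb[OF that]]) (use C2(2)[OF k pos(2)] in simp)
      have near_i: "integrable lborel (\<lambda>y. cutoff \<rho> y * k y * sdiff (w t) x y)"
        and split: "(LINT y|lborel. cutoff \<rho> y * k y * sdiff (w t) x y)
          = (LINT y|lborel. k y * sdiff (w t) x y) - (LINT y|lborel. (1 - cutoff \<rho> y) * k y * sdiff (w t) x y)"
        if "t \<in> ?I" for t x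
      proof -
        have eq: "(\<lambda>y. cutoff \<rho> y * k y * sdiff (w t) x y)
          = (\<lambda>y. k y * sdiff (w t) x y - (1 - cutoff \<rho> y) * k y * sdiff (w t) x y)"
          by (auto simp: algebra_simps)
        show "integrable lborel (\<lambda>y. cutoff \<rho> y * k y * sdiff (w t) x y)"
          unfolding eq using kw(1)[OF that] tail_i[OF that] by (rule Bochner_Integration.integrable_diff)
        show "(LINT y|lborel. cutoff \<rho> y * k y * sdiff (w t) x y)
          = (LINT y|lborel. k y * sdiff (w t) x y) - (LINT y|lborel. (1 - cutoff \<rho> y) * k y * sdiff (w t) x y)"
          unfolding eq using kw(1)[OF that] tail_i[OF that] by (rule Bochner_Integration.integral_diff)
      qed
      have tail: "(LINT y|lborel. (1 - cutoff \<rho> y) * k y * sdiff (w t) x y)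
          \<le> 2 * C1 * (2 ^ ?m * U * r powr \<alpha> * \<rho> powr (- 2 * s - \<alpha>)) + 2 * W * (C2 * \<rho> powr (- 2 * s))"
        if t: "t \<in> ?I" and x: "x \<in> ball x\<^sub>0 \<rho>" for t x
      proof -
        let ?kf = "\<lambda>y. (1 - cutoff \<rho> y) * k y"
        have kfi: "integrable lborel ?kf" and kfI: "(LINT y|lborel. ?kf y) \<le> C2 * \<rho> powr (- 2 * s)"
          using C2(2)[OF k pos(2)] by auto
        have ub': "\<bar>u t (- z)\<bar> \<le> U" for z by (rule ub[OF t])
        have vb: "\<bar>fdiff hs (u t) z\<bar> \<le> 2 ^ ?m * U" for z by (rule fdiff_bound) (rule ub[OF t])
        have i1: "integrable lborel (\<lambda>y. ?kf y * fdiff hs (u t) (x + y))"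
          by (rule integrable_mult_bounded[OF kfi borel_measurable_translate(1)[OF wm[OF t]] vb])
        have i2: "integrable lborel (\<lambda>y. ?kf y * fdiff hs (u t) (x - y))"
          by (rule integrable_mult_bounded[OF kfi borel_measurable_translate(2)[OF wm[OF t]] vb])
        have I1: "\<bar>LINT y|lborel. ?kf y * fdiff hs (u t) (x + y)\<bar>
            \<le> C1 * (2 ^ ?m * U * r powr \<alpha> * \<rho> powr (- 2 * s - \<alpha>))"
          by (rule C1(2)[OF k pos(2) r(2) hs um[OF t] ub[OF t]])
        have "\<bar>LINT y|lborel. ?kf y * fdiff (map uminus hs) (\<lambda>z. u t (- z)) (- x + y)\<bar>
            \<le> C1 * (2 ^ length (map uminus hs) * U * r powr \<alpha> * \<rho> powr (- 2 * s - \<alpha>))"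
        proof (rule C1(2)[OF k pos(2) r(2) _ _ _ ub'])
          show "(\<lambda>z. u t (- z)) \<in> borel_measurable borel"
            by (rule measurable_compose[OF _ um[OF t]]) simp
        qed (use hs in auto)
        then have I2: "\<bar>LINT y|lborel. ?kf y * fdiff hs (u t) (x - y)\<bar>
            \<le> C1 * (2 ^ ?m * U * r powr \<alpha> * \<rho> powr (- 2 * s - \<alpha>))"
          unfolding fdiff_reflect[of hs "u t" x] length_map .
        have i12: "integrable lborel (\<lambda>y. ?kf y * fdiff hs (u t) (x + y) + ?kf y * fdiff hs (u t) (x - y))"
          using i1 i2 by (rule Bochner_Integration.integrable_add)
        have i3: "integrable lborel (\<lambda>y. 2 * fdiff hs (u t) x * ?kf y)"
          using kfi by (rule integrable_mult_right)
        have "(LINT y|lborel. ?kf y * sdiff (w t) x y)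
          = (LINT y|lborel. \<epsilon> * ((?kf y * fdiff hs (u t) (x + y) + ?kf y * fdiff hs (u t) (x - y)) - 2 * fdiff hs (u t) x * ?kf y))"
          by (intro Bochner_Integration.integral_cong refl) (simp only: sw, simp add: sdiff_def algebra_simps)
        also have "\<dots> = \<epsilon> * ((LINT y|lborel. ?kf y * fdiff hs (u t) (x + y))
            + (LINT y|lborel. ?kf y * fdiff hs (u t) (x - y)) - 2 * fdiff hs (u t) x * (LINT y|lborel. ?kf y))"
          by (simp only: integral_mult_right_zero Bochner_Integration.integral_diff[OF i12 i3] Bochner_Integration.integral_add[OF i1 i2])
        finally have eq: "(LINT y|lborel. ?kf y * sdiff (w t) x y) = \<epsilon> * ((LINT y|lborel. ?kf y * fdiff hs (u t) (x + y))
            + (LINT y|lborel. ?kf y * fdiff hs (u t) (x - y)) - 2 * fdiff hs (u t) x * (LINT y|lborel. ?kf y))" .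
        have kf0: "0 \<le> (LINT y|lborel. ?kf y)"
          using cutoff_range(2)[of \<rho>] kernel_nonneg[OF k]
          by (intro Bochner_Integration.integral_nonneg mult_nonneg_nonneg) (auto simp: le_diff_eq)
        have "\<bar>fdiff hs (u t) x * (LINT y|lborel. ?kf y)\<bar> \<le> W * (C2 * \<rho> powr (- 2 * s))"
          unfolding abs_mult using wb[OF t near[OF x, of x]] kfI kf0 pos by (intro mult_mono) auto
        then show ?thesis
          using I1 I2 \<epsilon> unfolding eq by (auto simp: abs_if split: if_splits)
      qed
      \<comment> \<open>Truncating L at \<rho> turns its tail into a right-hand side:
        \<open>g\<^sub>0\<close> collects the difference of f, the tails of both translates (C1) and
        the tail mass at the centre (C2).\<close>
      have e1: "w' t x - (LINT y|lborel. cutoff \<rho> y * k y * sdiff (w t) x y) \<le> g\<^sub>0"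
        if t: "t \<in> ?I" and x: "x \<in> ball x\<^sub>0 \<rho>" for t x
      proof -
        have "fdiff hs (u' t) x = fdiff hs (\<lambda>x. f t x + (LINT y|lborel. k y * sdiff (u t) x y)) x"
        proof (rule fdiff_cong_local)
          fix y assume "norm (y - x) \<le> sum_list (map norm hs)"
          then have "norm (y - x) \<le> \<rho> / 2" using hsum mr pos by linarith
          from eqn[OF t near[OF x this]] show "u' t y = f t y + (LINT z|lborel. k z * sdiff (u t) y z)" by simp
        qed
        then have "w' t x - (LINT y|lborel. k y * sdiff (w t) x y) = \<epsilon> * fdiff hs (f t) x"
          by (simp add: w'_def kw(2)[OF t] fdiff_add algebra_simps)
        moreover have "\<epsilon> * fdiff hs (f t) x \<le> 2 ^ ?m * U * r powr \<alpha>"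
          using fd[OF t x] \<epsilon> by (auto simp: abs_if split: if_splits)
        ultimately show ?thesis using split[OF t, of x] tail[OF t x] unfolding g\<^sub>0_def by (simp add: algebra_simps)
      qed
      have w0: "0 < w t\<^sub>0 x\<^sub>0" using True by (simp add: w_def)
      have "\<exists>t\<^sub>1\<in>?I. \<exists>x\<^sub>1\<in>ball x\<^sub>0 \<rho>. \<exists>\<theta>. norm \<theta> = 1 \<and> (\<forall>\<sigma>. norm \<sigma> \<le> \<kappa> * l / 2 \<longrightarrow>
          w t\<^sub>0 x\<^sub>0 \<le> (LINT b|lborel. indicator (ball 0 (\<kappa> * l / 2)) b * w t\<^sub>1 (x\<^sub>1 + l *\<^sub>R \<theta> + \<sigma> + b))
              / measure lborel (ball (0::'a) (\<kappa> * l / 2))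
            + C0 * l powr (2 * s) * (g\<^sub>0 + W / \<tau> + W * \<rho> powr (- 2 * s)))"
      proof (rule C0(2)[OF k pos g0])
        show "continuous_on (?I \<times> UNIV) (\<lambda>p. w (fst p) (snd p))" by (rule c1)
        show "0 < w t\<^sub>0 x\<^sub>0" by (rule w0)
        fix t x assume t: "t \<in> ?I"
        show "\<bar>w t x\<bar> \<le> W" if "x \<in> ball x\<^sub>0 (2 * \<rho>)" using t that by (rule b1)
        assume x: "x \<in> ball x\<^sub>0 \<rho>"
        show "((\<lambda>t. w t x) has_real_derivative w' t x) (at t)" using t x by (rule d1)
        show "integrable lborel (\<lambda>y. cutoff \<rho> y * k y * sdiff (w t) x y)" using t by (rule near_i)
        show "w' t x - (LINT y|lborel. cutoff \<rho> y * k y * sdiff (w t) x y) \<le> g\<^sub>0" using t x by (rule e1)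
      qed
      then obtain t\<^sub>1 x\<^sub>1 \<theta> where tx: "t\<^sub>1 \<in> ?I" "x\<^sub>1 \<in> ball x\<^sub>0 \<rho>" and \<theta>: "norm \<theta> = 1"
        and av: "\<And>\<sigma>. norm \<sigma> \<le> \<kappa> * l / 2 \<Longrightarrow>
          w t\<^sub>0 x\<^sub>0 \<le> (LINT b|lborel. indicator (ball 0 (\<kappa> * l / 2)) b * w t\<^sub>1 (x\<^sub>1 + l *\<^sub>R \<theta> + \<sigma> + b))
              / measure lborel (ball (0::'a) (\<kappa> * l / 2)) + E"
        unfolding E_def by blast
      let ?B = "ball (0::'a) (\<kappa> * l / 2)"
      let ?v = "measure lborel ?B"
      have v: "0 < ?v" using \<kappa> pos by (simp add: content_ball_pos)
      \<comment> \<open>Integration over the ball commutes with differences. The difference of G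
        with steps N h is therefore an integral of differences of u with steps N h, which W'
        bounds.\<close>
      define G where "G x = (LINT b|lborel. indicator ?B b * u t\<^sub>1 (x + b))" for x
      have iB: "integrable lborel (indicator ?B :: 'a \<Rightarrow> real)"
        using emeasure_lborel_ball_finite[of "0::'a" "\<kappa> * l / 2"] by simp
      have Gi: "integrable lborel (\<lambda>b. indicator ?B b * u t\<^sub>1 (x + b))" for x
        by (rule integrable_mult_bounded[OF iB borel_measurable_translate(1)[OF um[OF tx(1)]] ub[OF tx(1)]])
      have fG: "fdiff hs' G x = (LINT b|lborel. indicator ?B b * fdiff hs' (u t\<^sub>1) (x + b))"
        "integrable lborel (\<lambda>b. indicator ?B b * fdiff hs' (u t\<^sub>1) (x + b))" for hs' x
        using fdiff_integral[of lborel "\<lambda>b x. indicator ?B b * u t\<^sub>1 (x + b)" hs' x, OF Gi]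
        unfolding G_def by (simp_all add: fdiff_cmult fdiff_translate)
      \<comment> \<open>\<open>av\<close> holds for every shift up to \<kappa> l / 2, and
        telescoping needs shifts of length up to N times the sum of the steps. The hypothesis m N r
        <= \<kappa> l / 2 matches the two.\<close>
      have "real N ^ ?m * ((w t\<^sub>0 x\<^sub>0 - E) * ?v) \<le> \<epsilon> * fdiff (map ((*\<^sub>R) (real N)) hs) G (x\<^sub>1 + l *\<^sub>R \<theta>)"
      proof -
        have "real N ^ ?m * ((w t\<^sub>0 x\<^sub>0 - E) * ?v) \<le> fdiff (map ((*\<^sub>R) (real N)) hs) (\<lambda>x. \<epsilon> * G x) (x\<^sub>1 + l *\<^sub>R \<theta>)"
        proof (rule fdiff_telescope)
          fix \<sigma> :: 'a assume "norm \<sigma> \<le> real N * sum_list (map norm hs)"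
          also have "\<dots> \<le> real N * (real ?m * r)" using hsum by (intro mult_left_mono) auto
          also have "\<dots> \<le> \<kappa> * l / 2" using N(2) by (simp add: mult_ac)
          finally have "w t\<^sub>0 x\<^sub>0 - E \<le> (LINT b|lborel. indicator ?B b * w t\<^sub>1 (x\<^sub>1 + l *\<^sub>R \<theta> + \<sigma> + b)) / ?v"
            using av by fastforce
          then have "(w t\<^sub>0 x\<^sub>0 - E) * ?v \<le> (LINT b|lborel. indicator ?B b * w t\<^sub>1 (x\<^sub>1 + l *\<^sub>R \<theta> + \<sigma> + b))"
            using v by (simp add: pos_le_divide_eq)
          also have "\<dots> = fdiff hs (\<lambda>x. \<epsilon> * G x) (x\<^sub>1 + l *\<^sub>R \<theta> + \<sigma>)"
            unfolding fdiff_cmult fG(1) w_def by (simp add: mult.left_commute)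
          finally show "(w t\<^sub>0 x\<^sub>0 - E) * ?v \<le> fdiff hs (\<lambda>x. \<epsilon> * G x) (x\<^sub>1 + l *\<^sub>R \<theta> + \<sigma>)" .
        qed
        then show ?thesis by (simp add: fdiff_cmult)
      qed
      also have "\<dots> \<le> \<bar>fdiff (map ((*\<^sub>R) (real N)) hs) G (x\<^sub>1 + l *\<^sub>R \<theta>)\<bar>"
        using \<epsilon> by (auto simp: abs_if split: if_splits)
      also have "\<dots> \<le> (LINT b|lborel. W' * indicator ?B b)"
        unfolding fG(1)
      proof (rule integral_dominated_le(2))
        show "integrable lborel (\<lambda>b. W' * indicator ?B b)" using iB by (rule integrable_mult_right)
        show "(\<lambda>b. indicator ?B b * fdiff (map ((*\<^sub>R) (real N)) hs) (u t\<^sub>1) (x\<^sub>1 + l *\<^sub>R \<theta> + b)) \<in> borel_measurable lborel"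
          by (rule borel_measurable_integrable[OF fG(2)])
        show "\<bar>indicator ?B b * fdiff (map ((*\<^sub>R) (real N)) hs) (u t\<^sub>1) (x\<^sub>1 + l *\<^sub>R \<theta> + b)\<bar> \<le> W' * indicator ?B b" for b
        proof (cases "b \<in> ?B")
          case True
          have "norm (l *\<^sub>R \<theta> + b) \<le> l + norm b" using norm_triangle_ineq[of "l *\<^sub>R \<theta>" b] \<theta> pos by simp
          also have "\<dots> \<le> l + (1 / 2) * l / 2"
          proof -
            have "\<kappa> * l \<le> (1 / 2) * l" using \<kappa> pos by (intro mult_right_mono) auto
            then show ?thesis using True by simp
          qed
          also have "\<dots> \<le> \<rho> / 2" using pos by simp
          finally have "x\<^sub>1 + l *\<^sub>R \<theta> + b \<in> ball x\<^sub>0 (2 * \<rho>)"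
            by (intro near[OF tx(2)]) (simp add: algebra_simps)
          then show ?thesis using wb'[OF tx(1)] True by simp
        qed simp
      qed
      also have "\<dots> = W' * ?v" by simp
      finally have "(real N ^ ?m * (w t\<^sub>0 x\<^sub>0 - E)) * ?v \<le> W' * ?v" by (simp add: mult.assoc)
      then have "real N ^ ?m * (w t\<^sub>0 x\<^sub>0 - E) \<le> W'" using v by (simp add: mult_le_cancel_right)
      then have "w t\<^sub>0 x\<^sub>0 - E \<le> W' / real N ^ ?m" using N1 by (simp add: pos_le_divide_eq mult.commute)
      then show ?thesis by (simp add: w_def)
    qed
    have "\<bar>fdiff hs (u t\<^sub>0) x\<^sub>0\<bar> \<le> W' / N ^ ?m + E"
      using key[of 1] key[of "-1"] by linarith
    also have "E \<le> C * 2 ^ ?m * l powr (2 * s)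
            * (U * r powr \<alpha> * (1 + \<rho> powr (- 2 * s - \<alpha>)) + W / \<tau> + W * \<rho> powr (- 2 * s))"
    proof -
      let ?D = "1 + 2 * C1 + 2 * C2" and ?p = "(2::real) ^ ?m"
      let ?a = "U * r powr \<alpha>" and ?b = "\<rho> powr (- 2 * s - \<alpha>)" and ?c = "W / \<tau>" and ?d = "W * \<rho> powr (- 2 * s)"
      have nn: "0 \<le> ?a" "0 \<le> ?b" "0 \<le> ?c" "0 \<le> ?d" "1 \<le> ?p" using U pos by auto
      have "g\<^sub>0 + ?c + ?d = ?p * ?a + ?p * (2 * C1 * (?a * ?b)) + 2 * C2 * ?d + ?c + ?d"
        unfolding g\<^sub>0_def by (simp add: algebra_simps)
      also have "\<dots> \<le> ?p * (?D * ?a) + ?p * (?D * (?a * ?b)) + ?p * (?D * ?c) + ?p * (?D * ?d)"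
      proof -
        have 1: "?p * ?a \<le> ?p * (?D * ?a)"
          using nn C1(1) C2(1) by (intro mult_left_mono) (auto simp: algebra_simps)
        have 2: "?p * (2 * C1 * (?a * ?b)) \<le> ?p * (?D * (?a * ?b))"
          using nn C1(1) C2(1) by (intro mult_left_mono mult_right_mono) auto
        have gen: "B * e \<le> p * (?D * e)" if "0 \<le> e" "1 \<le> p" "0 \<le> B" "B \<le> ?D" for B e p :: real
        proof -
          have "1 * (B * e) \<le> p * (?D * e)" using that by (intro mult_mono) auto
          then show ?thesis by simp
        qed
        have 3: "1 * ?c \<le> ?p * (?D * ?c)" using nn C1(1) C2(1) by (intro gen) auto
        have 4: "(1 + 2 * C2) * ?d \<le> ?p * (?D * ?d)" using nn C1(1) C2(1) by (intro gen) auto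
        have "?p * ?a + ?p * (2 * C1 * (?a * ?b)) + 1 * ?c + (1 + 2 * C2) * ?d
            \<le> ?p * (?D * ?a) + ?p * (?D * (?a * ?b)) + ?p * (?D * ?c) + ?p * (?D * ?d)"
          by (intro add_mono 1 2 3 4)
        moreover have "(1 + 2 * C2) * ?d = ?d + 2 * C2 * ?d" by (simp add: distrib_right)
        ultimately show ?thesis by (simp only: mult_1_left add_ac)
      qed
      also have "\<dots> = ?D * ?p * (?a * (1 + ?b) + ?c + ?d)"
        by (simp add: algebra_simps)
      finally have "E \<le> C0 * l powr (2 * s) * (?D * ?p * (?a * (1 + ?b) + ?c + ?d))"
        unfolding E_def using C0 by (intro mult_left_mono) auto
      then show ?thesis by (simp add: C_def mult_ac)
    qed
    finally show ?case by simp
  qed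
  qed
  qed
  qed
qed

text \<open>Absorption for the weighted supremum S of (d/r)^\<gamma> |fdiff hs u|, where d is the
  parabolic distance to the lateral and initial boundary. The hypothesis with B serves the
  finiteness of S, so that S <= S/2 + C5 U can be solved for S; B does not appear in the
  conclusion.\<close>

lemma spatial_estimate:
  fixes m :: nat and \<gamma> :: real
  assumes m: "1 \<le> m" and \<gamma>: "0 < \<gamma>" "\<gamma> < m" "\<gamma> \<le> 2 * s + \<alpha>"
  obtains C where "0 < C"
    "\<And>(k::'a::euclidean_space \<Rightarrow> real) u u' f T0 T1 R U B t x hs r.
      \<lbrakk>kernel k; R \<le> 1;
       continuous_on ({T0..T1} \<times> UNIV) (\<lambda>p. u (fst p) (snd p));
       \<And>t x. t \<in> {T0..T1} \<Longrightarrow> \<bar>u t x\<bar> \<le> U;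
       \<And>t x. t \<in> {T0..T1} \<Longrightarrow> x \<in> ball 0 R \<Longrightarrow> ((\<lambda>t. u t x) has_real_derivative u' t x) (at t);
       \<And>t x. t \<in> {T0..T1} \<Longrightarrow> integrable lborel (\<lambda>y. k y * sdiff (u t) x y);
       \<And>t x. t \<in> {T0..T1} \<Longrightarrow> x \<in> ball 0 R \<Longrightarrow>
          u' t x - (LINT y|lborel. k y * sdiff (u t) x y) = f t x;
       \<And>t x x'. t \<in> {T0..T1} \<Longrightarrow> x \<in> ball 0 R \<Longrightarrow> x' \<in> ball 0 R \<Longrightarrow>
          \<bar>f t x - f t x'\<bar> \<le> U * norm (x - x') powr \<alpha>;
       \<And>t x hs r. t \<in> {T0..T1} \<Longrightarrow> length hs = m \<Longrightarrow> (\<And>h. h \<in> set hs \<Longrightarrow> norm h \<le> r) \<Longrightarrow> 0 < r \<Longrightarrow> r \<le> 1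
          \<Longrightarrow> \<bar>fdiff hs (u t) x\<bar> \<le> B * r powr \<gamma>;
       T0 < t; t \<le> T1; norm x < R; length hs = m; \<And>h. h \<in> set hs \<Longrightarrow> norm h \<le> r; 0 < r\<rbrakk>
      \<Longrightarrow> \<bar>fdiff hs (u t) x\<bar> \<le> C * U * (r / min (R - norm x) ((t - T0) powr (1 / (2 * s)))) powr \<gamma>"
proof -
  show thesis
  proof (rule fdiff_step[where 'a='a], goal_cases)
  case C1: (1 C1)
  \<comment> \<open>\<open>\<tau> = q * D powr (2 * s)\<close> is the time one can go back before
    the parabolic distance falls from D to D/2, since
    \<open>D powr (2 * s) - \<tau> = (D / 2) powr (2 * s)\<close>.\<close>
  define q :: real where "q = 1 - 2 powr (- 2 * s)"
  have q: "0 < q" using s powr_less_cancel_iff[of 2 "- 2 * s" 0] by (simp add: q_def)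
  \<comment> \<open>At steps of size N r the bound by S gives (N r)^\<gamma>, and telescoping
    divides by N^m; a factor 2^\<gamma> is lost to the smaller distance within the cylinder. As
    \<gamma> < m, a large N brings the product below 1/4.\<close>
  obtain N :: nat where N: "0 < N" "4 * 2 powr \<gamma> \<le> real N powr (m - \<gamma>)"
  proof -
    define z where "z = (4 * 2 powr \<gamma>) powr (1 / (m - \<gamma>))"
    have z: "0 < z" by (simp add: z_def)
    have "4 * 2 powr \<gamma> = z powr (m - \<gamma>)" using \<gamma> by (simp add: z_def powr_powr)
    also have "\<dots> \<le> real (nat \<lceil>z\<rceil>) powr (m - \<gamma>)"
      using \<gamma> z by (intro powr_mono2) (auto simp: real_nat_ceiling_ge)
    finally show thesis using z by (intro that[of "nat \<lceil>z\<rceil>"]) auto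
  qed
  have N1: "1 \<le> real N" using N(1) by simp
  \<comment> \<open>With l = \<Lambda> r the condition m N r <= \<kappa> l / 2 of
    \<open>fdiff_step\<close> becomes an equality.\<close>
  define \<Lambda> where "\<Lambda> = 2 * real m * real N / \<kappa>"
  have \<Lambda>: "0 < \<Lambda>" using m N \<kappa> by (simp add: \<Lambda>_def)
  define C3 where "C3 = C1 * 2 ^ m * \<Lambda> powr (2 * s) * (2 powr \<gamma> * (1 / q + 4 powr (2 * s)))"
  have C3: "0 < C3" unfolding C3_def using C1(1) \<Lambda> q by (intro mult_pos_pos add_pos_pos) auto
  define C4 where "C4 = C1 * 2 ^ m * \<Lambda> powr (2 * s) * (1 + 4 powr (2 * s + \<alpha>))"
  have C4: "0 < C4" unfolding C4_def using C1(1) \<Lambda> by (intro mult_pos_pos add_pos_pos) auto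
  \<comment> \<open>For r <= \<epsilon> D and \<rho> = D/4 the three entries give r <= \<rho>/8, l
    <= \<rho>/4, and a contribution of at most a quarter of S from the localisation terms W / \<tau>
    and W \<rho>^(-2s).\<close>
  define \<epsilon> where "\<epsilon> = min (1 / 32) (min (1 / (16 * \<Lambda>)) ((1 / (4 * C3)) powr (1 / (2 * s))))"
  have \<epsilon>: "0 < \<epsilon>" "\<epsilon> \<le> 1 / 32" "\<Lambda> * \<epsilon> \<le> 1 / 16" "C3 * \<epsilon> powr (2 * s) \<le> 1 / 4"
  proof -
    show "0 < \<epsilon>" using C3 \<Lambda> by (simp add: \<epsilon>_def)
    show "\<epsilon> \<le> 1 / 32" by (simp add: \<epsilon>_def)
    have "\<epsilon> \<le> 1 / (16 * \<Lambda>)" by (simp add: \<epsilon>_def)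
    then show "\<Lambda> * \<epsilon> \<le> 1 / 16" using \<Lambda> by (simp add: field_simps)
    have "\<epsilon> powr (2 * s) \<le> ((1 / (4 * C3)) powr (1 / (2 * s))) powr (2 * s)"
      using \<open>0 < \<epsilon>\<close> s by (intro powr_mono2) (auto simp: \<epsilon>_def)
    also have "\<dots> = 1 / (4 * C3)" using C3 s by (simp add: powr_powr)
    finally show "C3 * \<epsilon> powr (2 * s) \<le> 1 / 4" using C3 by (simp add: field_simps)
  qed
  define C5 where "C5 = C4 + \<epsilon> powr (- \<gamma>) * 2 ^ m"
  have C5: "0 < C5" using C4 by (simp add: C5_def add_pos_nonneg)
  show thesis
  proof (rule that[of "2 * C5"], goal_cases)
    case 1
    show ?case using C5 by simp
  next
    case prems: (2 k u u' f T0 T1 R U B t x hs r)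
    note k = prems(1) and R1 = prems(2) and cont = prems(3) and ub = prems(4) and der = prems(5)
      and int = prems(6) and eqn = prems(7) and fh = prems(8) and fin = prems(9) and pt = prems(10-)
    have U: "0 \<le> U" using ub[of t 0] pt by fastforce
    have B: "0 \<le> B"
    proof -
      have "\<bar>fdiff (replicate m (0::'a)) (u t) 0\<bar> \<le> B * 1 powr \<gamma>"
        by (rule fin) (use pt in auto)
      then show ?thesis by simp
    qed
    define d where "d t x = min (R - norm x) ((t - T0) powr (1 / (2 * s)))" for t and x :: 'a
    define ok where "ok t x hs r \<longleftrightarrow> T0 < t \<and> t \<le> T1 \<and> norm (x::'a) < R \<and> length hs = m
        \<and> (\<forall>h\<in>set hs. norm h \<le> r) \<and> 0 < r" for t x and hs :: "'a list" and r :: real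
    define Q where "Q t x hs r = (d t x / r) powr \<gamma> * \<bar>fdiff hs (u t) x\<bar>" for t x hs r
    define X where "X = {Q t x hs r | t x hs r. ok t x hs r}"
    have d: "0 < d t x" "d t x \<le> 1" if "ok t x hs r" for t x hs r
      using that R1 norm_ge_zero[of x] by (auto simp: d_def ok_def simp del: norm_ge_zero)
    have fb: "\<bar>fdiff hs (u t) x\<bar> \<le> 2 ^ m * U" if "ok t x hs r" for t x hs r
      using fdiff_bound[of "u t" U hs x] ub that by (auto simp: ok_def)
    \<comment> \<open>For r <= 1 this is the hypothesis with B; longer steps are covered by the
      bound of u, because d <= 1.\<close>
    have Qb: "Q t x hs r \<le> B + 2 ^ m * U" if o: "ok t x hs r" for t x hs r
    proof (cases "r \<le> 1")
      case True
      have "Q t x hs r \<le> (1 / r) powr \<gamma> * (B * r powr \<gamma>)"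
        unfolding Q_def
      proof (intro mult_mono)
        show "(d t x / r) powr \<gamma> \<le> (1 / r) powr \<gamma>"
          using d[OF o] o \<gamma> by (intro powr_mono2 divide_right_mono) (auto simp: ok_def)
        show "\<bar>fdiff hs (u t) x\<bar> \<le> B * r powr \<gamma>"
          by (rule fin) (use o True in \<open>auto simp: ok_def\<close>)
      qed auto
      also have "\<dots> = B" using o by (simp add: ok_def powr_divide)
      finally show ?thesis using U by (simp add: add_increasing2)
    next
      case False
      have "Q t x hs r \<le> 1 powr \<gamma> * (2 ^ m * U)"
        unfolding Q_def
        by (intro mult_mono powr_mono2 fb[OF o]) (use d[OF o] False \<gamma> in auto)
      then show ?thesis using B by simp
    qed
    then have bdd: "bdd_above X" unfolding X_def bdd_above_def by blast
    define S where "S = Sup X"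
    have QS: "Q t x hs r \<le> S" if "ok t x hs r" for t x hs r
      unfolding S_def by (rule cSup_upper[OF _ bdd]) (use that in \<open>auto simp: X_def\<close>)
    have okpt: "ok t x hs r" using pt by (auto simp: ok_def)
    have S0: "0 \<le> S" using QS[OF okpt] by (rule order_trans[rotated]) (simp add: Q_def)
    have DS: "\<bar>fdiff hs (u t) x\<bar> \<le> S * (r / d t x) powr \<gamma>" if o: "ok t x hs r" for t x hs r
    proof -
      have "(r / d t x) powr \<gamma> * Q t x hs r \<le> (r / d t x) powr \<gamma> * S"
        by (intro mult_left_mono QS[OF o]) simp
      moreover have "(r / d t x) powr \<gamma> * (d t x / r) powr \<gamma> = 1"
        using d[OF o] o by (simp add: ok_def flip: powr_mult)
      then have "(r / d t x) powr \<gamma> * Q t x hs r = \<bar>fdiff hs (u t) x\<bar>"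
        unfolding Q_def by (simp flip: mult.assoc)
      ultimately show ?thesis by (simp add: mult.commute)
    qed
    \<comment> \<open>Steps comparable to the distance are estimated by 2^m U alone; shorter ones by
      \<open>fdiff_step\<close> on a cylinder in which the distance stays above D/2.\<close>
    have main: "Q t x hs r \<le> S / 2 + C5 * U" if o: "ok t x hs r" for t x hs r
    proof (cases "r \<le> \<epsilon> * d t x")
      case False
      have "Q t x hs r \<le> (1 / \<epsilon>) powr \<gamma> * (2 ^ m * U)"
        unfolding Q_def
      proof (intro mult_mono fb[OF o])
        show "(d t x / r) powr \<gamma> \<le> (1 / \<epsilon>) powr \<gamma>"
          using False d[OF o] o \<gamma> \<epsilon> by (intro powr_mono2) (auto simp: ok_def field_simps)
      qed auto
      also have "\<dots> = \<epsilon> powr (- \<gamma>) * 2 ^ m * U"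
        using \<epsilon> by (simp add: powr_divide powr_minus_divide)
      also have "\<dots> \<le> C5 * U"
        using C4 U by (intro mult_right_mono) (auto simp: C5_def)
      finally show ?thesis using S0 by simp
    next
      case True
      define D where "D = d t x"
      have D: "0 < D" "D \<le> 1" using d[OF o] by (auto simp: D_def)
      have rD: "0 < r" "r \<le> \<epsilon> * D" using o True by (auto simp: ok_def D_def)
      define \<rho> where "\<rho> = D / 4"
      define \<tau> where "\<tau> = q * D powr (2 * s)"
      define l where "l = \<Lambda> * r"
      define W where "W = S * (2 * r / D) powr \<gamma>"
      define W' where "W' = S * (2 * (real N * r) / D) powr \<gamma>"
      have \<rho>: "0 < \<rho>" and \<tau>: "0 < \<tau>" and l: "0 < l" using D q \<Lambda> rD by (auto simp: \<rho>_def \<tau>_def l_def)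
      have "\<Lambda> * r \<le> \<Lambda> * \<epsilon> * D" using rD \<Lambda> by (simp add: mult.assoc)
      also have "\<dots> \<le> 1 / 16 * D" using \<epsilon> D by (intro mult_right_mono) auto
      finally have l4: "l \<le> \<rho> / 4" by (simp add: l_def \<rho>_def)
      have "r \<le> 1 / 32 * D" using rD(2) mult_right_mono[OF \<epsilon>(2), of D] D by linarith
      then have r8: "r \<le> \<rho> / 8" by (simp add: \<rho>_def)
      have W0: "0 \<le> W" using S0 by (simp add: W_def)
      have len: "length hs = m" "hs \<noteq> []" using o m by (auto simp: ok_def)
      have Nl: "real (length hs) * real N * r \<le> \<kappa> * l / 2"
        using \<kappa> by (simp add: len l_def \<Lambda>_def)
      have dD: "D / 2 \<le> d t' x'" "T0 < t'" "t' \<le> T1" "norm x' < R"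
        if "t' \<in> {t - \<tau>..t}" "x' \<in> ball x (2 * \<rho>)" for t' x'
      proof -
        have a: "D \<le> R - norm x" "D \<le> (t - T0) powr (1 / (2 * s))" by (auto simp: D_def d_def)
        have "norm x' \<le> norm x + norm (x' - x)" using norm_triangle_ineq[of x "x' - x"] by simp
        then have b: "D / 2 \<le> R - norm x'"
          using a(1) that(2) by (simp add: \<rho>_def dist_norm norm_minus_commute)
        then show "norm x' < R" using D by linarith
        have "D powr (2 * s) \<le> ((t - T0) powr (1 / (2 * s))) powr (2 * s)"
          using a(2) D s by (intro powr_mono2) auto
        also have "\<dots> = t - T0" using o s by (simp add: powr_powr ok_def)
        finally have "D powr (2 * s) - \<tau> \<le> t' - T0" using that(1) by simp
        moreover have "D powr (2 * s) - \<tau> = (D / 2) powr (2 * s)"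
          using D by (simp add: \<tau>_def q_def powr_divide powr_minus_divide algebra_simps)
        ultimately have e: "(D / 2) powr (2 * s) \<le> t' - T0" by simp
        moreover have "0 < (D / 2) powr (2 * s)" using D by simp
        ultimately show t': "T0 < t'" by linarith
        show "t' \<le> T1" using that(1) o by (simp add: ok_def)
        have "((D / 2) powr (2 * s)) powr (1 / (2 * s)) \<le> (t' - T0) powr (1 / (2 * s))"
          using e s by (intro powr_mono2) auto
        moreover have "((D / 2) powr (2 * s)) powr (1 / (2 * s)) = D / 2"
          using D s by (simp add: powr_powr)
        ultimately show "D / 2 \<le> d t' x'" using b by (simp add: d_def)
      qed
      have Wb: "\<bar>fdiff hs' (u t') x'\<bar> \<le> S * (2 * r' / D) powr \<gamma>"
        if "t' \<in> {t - \<tau>..t}" "x' \<in> ball x (2 * \<rho>)" "length hs' = m" "\<forall>h\<in>set hs'. norm h \<le> r'" "0 < r'"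
        for t' x' hs' r'
      proof -
        have "\<bar>fdiff hs' (u t') x'\<bar> \<le> S * (r' / d t' x') powr \<gamma>"
          by (rule DS) (use that dD[OF that(1,2)] in \<open>auto simp: ok_def\<close>)
        also have "\<dots> \<le> S * (2 * r' / D) powr \<gamma>"
        proof (intro mult_left_mono powr_mono2 S0)
          have "r' / d t' x' \<le> r' / (D / 2)"
            using dD(1)[OF that(1,2)] that(5) D by (intro divide_left_mono) (auto intro!: mult_pos_pos)
          then show "r' / d t' x' \<le> 2 * r' / D" by (simp add: mult.commute)
          show "0 \<le> r' / d t' x'" using dD(1)[OF that(1,2)] that(5) D by auto
        qed (use \<gamma> in auto)
        finally show ?thesis .
      qed
      have step: "\<bar>fdiff hs (u t) x\<bar> \<le> W' / real N ^ length hs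
          + C1 * 2 ^ length hs * l powr (2 * s)
            * (U * r powr \<alpha> * (1 + \<rho> powr (- 2 * s - \<alpha>)) + W / \<tau> + W * \<rho> powr (- 2 * s))"
      proof (rule C1(2)[OF k \<tau> \<rho> l l4 W0 len(2) _ rD(1) r8 N(1) Nl])
        show "norm h \<le> r" if "h \<in> set hs" for h using o that by (simp add: ok_def)
        have sub: "t' \<in> {T0..T1}" if "t' \<in> {t - \<tau>..t}" for t'
          using dD(2,3)[OF that, of x] \<rho> by simp
        then show "continuous_on ({t - \<tau>..t} \<times> UNIV) (\<lambda>p. u (fst p) (snd p))"
          by (intro continuous_on_subset[OF cont]) auto
        fix t' x' assume t': "t' \<in> {t - \<tau>..t}"
        show "\<bar>u t' x'\<bar> \<le> U" by (rule ub[OF sub[OF t']])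
        show "integrable lborel (\<lambda>y. k y * sdiff (u t') x' y)" by (rule int[OF sub[OF t']])
        assume x': "x' \<in> ball x (2 * \<rho>)"
        have xR: "x' \<in> ball 0 R" using dD(4)[OF t' x'] by simp
        show "\<bar>fdiff hs (u t') x'\<bar> \<le> W"
          unfolding W_def by (rule Wb[OF t' x']) (use o in \<open>auto simp: ok_def\<close>)
        show "\<bar>fdiff (map ((*\<^sub>R) (real N)) hs) (u t') x'\<bar> \<le> W'"
          unfolding W'_def by (rule Wb[OF t' x']) (use o N1 in \<open>auto simp: ok_def intro!: mult_left_mono\<close>)
        show "((\<lambda>t. u t x') has_real_derivative u' t' x') (at t')" by (rule der[OF sub[OF t'] xR])
        show "u' t' x' - (LINT y|lborel. k y * sdiff (u t') x' y) = f t' x'" by (rule eqn[OF sub[OF t'] xR])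
        fix x'' assume "x'' \<in> ball x (2 * \<rho>)"
        then have "x'' \<in> ball 0 R" using dD(4)[OF t'] by simp
        then show "\<bar>f t' x' - f t' x''\<bar> \<le> U * norm (x' - x'') powr \<alpha>" by (rule fh[OF sub[OF t'] xR])
      qed
      define Y where "Y = r / D"
      have Y: "0 < Y" "Y \<le> \<epsilon>" "Y \<le> 1" using rD D \<epsilon> by (auto simp: Y_def field_simps intro: order_trans)
      have rY: "r = Y * D" using D by (simp add: Y_def)
      have t1: "W' / real N ^ length hs = S * (2 powr \<gamma> / real N powr (m - \<gamma>)) * Y powr \<gamma>"
      proof -
        have "(2 * (real N * r) / D) powr \<gamma> = 2 powr \<gamma> * (real N powr \<gamma> * Y powr \<gamma>)"
          using N1 Y D by (simp add: rY powr_mult)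
        moreover have "real N ^ m = real N powr m" using N1 by (simp add: powr_realpow)
        ultimately show ?thesis using N1 by (simp add: W'_def len powr_diff field_simps)
      qed
      have t2: "W / \<tau> + W * \<rho> powr (- 2 * s) = S * 2 powr \<gamma> * (1 / q + 4 powr (2 * s)) * Y powr \<gamma> * D powr (- 2 * s)"
      proof -
        have "W = S * 2 powr \<gamma> * Y powr \<gamma>" using Y D by (simp add: W_def rY powr_mult)
        moreover have "\<rho> powr (- 2 * s) = 4 powr (2 * s) * D powr (- 2 * s)"
          using D by (simp add: \<rho>_def powr_divide powr_minus_divide)
        moreover have "1 / \<tau> = 1 / q * D powr (- 2 * s)" using D by (simp add: \<tau>_def powr_minus_divide)
        moreover have "W / \<tau> = W * (1 / \<tau>)" by simp
        ultimately show ?thesis by (simp only: algebra_simps)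
      qed
      have ls: "l powr (2 * s) = \<Lambda> powr (2 * s) * Y powr (2 * s) * D powr (2 * s)"
        using \<Lambda> Y D by (simp add: l_def rY powr_mult)
      \<comment> \<open>The powers of D in l^(2s) = (\<Lambda> Y D)^(2s) cancel those in 1/\<tau>
        and \<rho>^(-2s). What remains is Y^(2s) <= \<epsilon>^(2s), small by the choice of
        \<epsilon>.\<close>
      have DD: "D powr (2 * s) * D powr (- 2 * s) = 1" using D by (simp add: powr_minus_divide)
      have t3: "l powr (2 * s) * (W / \<tau> + W * \<rho> powr (- 2 * s))
          = \<Lambda> powr (2 * s) * (2 powr \<gamma> * (1 / q + 4 powr (2 * s))) * S * Y powr (2 * s) * Y powr \<gamma> * (D powr (2 * s) * D powr (- 2 * s))"
        unfolding t2 ls by (simp only: mult_ac)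
      have t4: "C1 * 2 ^ m * (l powr (2 * s) * (W / \<tau> + W * \<rho> powr (- 2 * s))) \<le> S / 4 * Y powr \<gamma>"
      proof -
        have "C1 * 2 ^ m * (l powr (2 * s) * (W / \<tau> + W * \<rho> powr (- 2 * s))) = S * (C3 * Y powr (2 * s)) * Y powr \<gamma>"
          unfolding t3 DD C3_def by (simp only: mult_ac mult_1_left)
        also have "\<dots> \<le> S * (1 / 4) * Y powr \<gamma>"
        proof (intro mult_right_mono mult_left_mono S0)
          have "C3 * Y powr (2 * s) \<le> C3 * \<epsilon> powr (2 * s)"
            using Y C3 s by (intro mult_left_mono powr_mono2) auto
          then show "C3 * Y powr (2 * s) \<le> 1 / 4" using \<epsilon>(4) by linarith
        qed auto
        finally show ?thesis by simp
      qed
      have t5: "C1 * 2 ^ m * (l powr (2 * s) * (U * r powr \<alpha> * (1 + \<rho> powr (- 2 * s - \<alpha>)))) \<le> C4 * U * Y powr \<gamma>"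
      proof -
        \<comment> \<open>As D <= 1, the constant 1, which stems from f, is absorbed into the
          negative power of D that stems from the tail.\<close>
        have "1 + \<rho> powr (- 2 * s - \<alpha>) \<le> (1 + 4 powr (2 * s + \<alpha>)) * D powr (- (2 * s + \<alpha>))"
        proof -
          have "1 = D powr 0" using D by simp
          also have "\<dots> \<le> D powr (- (2 * s + \<alpha>))" using D s \<alpha> by (intro powr_mono') auto
          finally have "1 \<le> D powr (- (2 * s + \<alpha>))" .
          moreover have "\<rho> powr (- 2 * s - \<alpha>) = 4 powr (2 * s + \<alpha>) * D powr (- (2 * s + \<alpha>))"
          proof -
            have "- 2 * s - \<alpha> = - (2 * s + \<alpha>)" by simp
            moreover have "(D / 4) powr (- p) = 4 powr p * D powr (- p)" for p
              using D by (simp add: powr_divide powr_minus_divide)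
            ultimately show ?thesis by (simp only: \<rho>_def)
          qed
          ultimately show ?thesis by (simp add: distrib_right)
        qed
        then have "l powr (2 * s) * (U * r powr \<alpha> * (1 + \<rho> powr (- 2 * s - \<alpha>)))
            \<le> l powr (2 * s) * (U * r powr \<alpha> * ((1 + 4 powr (2 * s + \<alpha>)) * D powr (- (2 * s + \<alpha>))))"
          using U by (intro mult_left_mono) auto
        also have "\<dots> = \<Lambda> powr (2 * s) * (1 + 4 powr (2 * s + \<alpha>)) * U * (Y powr (2 * s) * Y powr \<alpha>)
            * (D powr (2 * s) * D powr \<alpha> * D powr (- (2 * s + \<alpha>)))"
          unfolding ls rY powr_mult by (simp only: mult_ac)
        also have "D powr (2 * s) * D powr \<alpha> * D powr (- (2 * s + \<alpha>)) = 1"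
          using D by (simp flip: powr_add)
        also have "Y powr (2 * s) * Y powr \<alpha> = Y powr (2 * s + \<alpha>)" by (simp add: powr_add)
        also have "\<Lambda> powr (2 * s) * (1 + 4 powr (2 * s + \<alpha>)) * U * Y powr (2 * s + \<alpha>) * 1
            \<le> \<Lambda> powr (2 * s) * (1 + 4 powr (2 * s + \<alpha>)) * U * Y powr \<gamma> * 1"
          using Y \<gamma> U by (intro mult_right_mono mult_left_mono powr_mono') auto
        finally have "C1 * 2 ^ m * (l powr (2 * s) * (U * r powr \<alpha> * (1 + \<rho> powr (- 2 * s - \<alpha>))))
            \<le> C1 * 2 ^ m * (\<Lambda> powr (2 * s) * (1 + 4 powr (2 * s + \<alpha>)) * U * Y powr \<gamma> * 1)"
          using C1(1) by (intro mult_left_mono) auto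
        then show ?thesis by (simp only: C4_def mult_ac mult_1_left)
      qed
      have t6: "S * (2 powr \<gamma> / real N powr (m - \<gamma>)) * Y powr \<gamma> \<le> S / 4 * Y powr \<gamma>"
      proof -
        have "2 powr \<gamma> / real N powr (m - \<gamma>) \<le> 1 / 4" using N N1 by (simp add: divide_simps)
        then have "S * (2 powr \<gamma> / real N powr (m - \<gamma>)) * Y powr \<gamma> \<le> S * (1 / 4) * Y powr \<gamma>"
          by (intro mult_right_mono mult_left_mono S0) auto
        then show ?thesis by simp
      qed
      have "\<bar>fdiff hs (u t) x\<bar> \<le> (S / 2 + C5 * U) * Y powr \<gamma>"
      proof -
        have "C1 * 2 ^ m * l powr (2 * s)
            * (U * r powr \<alpha> * (1 + \<rho> powr (- 2 * s - \<alpha>)) + W / \<tau> + W * \<rho> powr (- 2 * s))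
          = C1 * 2 ^ m * (l powr (2 * s) * (U * r powr \<alpha> * (1 + \<rho> powr (- 2 * s - \<alpha>))))
          + C1 * 2 ^ m * (l powr (2 * s) * (W / \<tau> + W * \<rho> powr (- 2 * s)))"
          by (simp only: distrib_left mult.assoc add.assoc)
        then have "\<bar>fdiff hs (u t) x\<bar> \<le> S / 4 * Y powr \<gamma> + (C4 * U * Y powr \<gamma> + S / 4 * Y powr \<gamma>)"
          using step t1 t4 t5 t6 unfolding len(1) by linarith
        also have "\<dots> = (S / 2 + C4 * U) * Y powr \<gamma>" by (simp add: algebra_simps)
        also have "\<dots> \<le> (S / 2 + C5 * U) * Y powr \<gamma>"
          using U \<epsilon> by (intro mult_right_mono add_left_mono) (auto simp: C5_def)
        finally show ?thesis .
      qed
      then have "(D / r) powr \<gamma> * \<bar>fdiff hs (u t) x\<bar> \<le> (D / r) powr \<gamma> * ((S / 2 + C5 * U) * Y powr \<gamma>)"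
        by (intro mult_left_mono) auto
      moreover have "(D / r) powr \<gamma> * Y powr \<gamma> = 1"
        using D rD by (simp add: Y_def flip: powr_mult)
      ultimately show ?thesis unfolding Q_def D_def[symmetric]
        by (metis mult.assoc mult.commute mult_1_right)
    qed
    have "S \<le> S / 2 + C5 * U"
      unfolding S_def
    proof (rule cSup_least)
      show "X \<noteq> {}" using okpt by (auto simp: X_def)
      show "z \<le> Sup X / 2 + C5 * U" if "z \<in> X" for z
        using that main unfolding X_def S_def by blast
    qed
    then have S: "S \<le> 2 * C5 * U" by simp
    have "\<bar>fdiff hs (u t) x\<bar> \<le> S * (r / d t x) powr \<gamma>" by (rule DS[OF okpt])
    also have "\<dots> \<le> 2 * C5 * U * (r / d t x) powr \<gamma>" by (intro mult_right_mono S) simp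
    finally show ?case by (simp add: d_def)
  qed
  qed
qed

end

subsection \<open>Doubling arguments\<close>

text \<open>h is doubled until it reaches scale R. Each doubling multiplies a by \<theta>, while
  |h|^e grows by 2^e; for \<theta> 2^e < 1 the value at the top contributes a multiple of |h|^e and
  the errors sum geometrically.\<close>

lemma dyadic_gain:
  fixes a :: "'a::real_normed_vector \<Rightarrow> real"
  assumes \<theta>: "0 \<le> \<theta>" "\<theta> * 2 powr e < 1" and e: "0 \<le> e" and D: "0 \<le> D" and R: "0 < R"
    and step: "\<And>h. 0 < norm h \<Longrightarrow> norm h \<le> R / 2 \<Longrightarrow> a h \<le> \<theta> * a (2 *\<^sub>R h) + D * norm h powr e"
    and top: "\<And>h. R / 2 < norm h \<Longrightarrow> norm h \<le> R \<Longrightarrow> a h \<le> D * R powr e"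
    and h: "0 < norm h" "norm h \<le> R"
  shows "a h \<le> 2 powr e / (1 - \<theta> * 2 powr e) * D * norm h powr e"
proof -
  let ?C = "2 powr e / (1 - \<theta> * 2 powr e)"
  have p1: "1 \<le> 2 powr e" using e by (simp add: ge_one_powr_ge_zero)
  have C1: "2 powr e \<le> ?C" using \<theta> p1 by (simp add: pos_le_divide_eq mult_left_le)
  \<comment> \<open>The constant solves C (1 - \<theta> 2^e) = 2^e. It is at least 2^e, as the top
    scale requires, and satisfies the present inequality, as the doubling step requires.\<close>
  have C2: "\<theta> * 2 powr e * ?C + 1 \<le> ?C"
  proof -
    have gen: "X * C + 1 \<le> C" if "C * (1 - X) = P" "1 \<le> P" for C X P :: real
      using that by (simp add: algebra_simps)
    show ?thesis by (rule gen[OF _ p1]) (use \<theta> in simp)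
  qed
  have base: "a h \<le> ?C * D * norm h powr e" if "R / 2 < norm h" "norm h \<le> R" for h
  proof -
    have "R powr e \<le> (2 * norm h) powr e" using that e R by (intro powr_mono2) auto
    also have "\<dots> = 2 powr e * norm h powr e" by (simp add: powr_mult)
    also have "\<dots> \<le> ?C * norm h powr e" using C1 by (intro mult_right_mono) auto
    finally have "D * R powr e \<le> D * (?C * norm h powr e)" using D by (intro mult_left_mono) auto
    then show ?thesis using top[OF that] by (simp add: mult_ac)
  qed
  have "a h \<le> ?C * D * norm h powr e" if "R / 2 ^ Suc j < norm h" "norm h \<le> R" for h j
    using that
  proof (induction j arbitrary: h)
    case 0
    then show ?case using base by simp
  next
    case (Suc j)
    show ?case
    proof (cases "R / 2 < norm h")
      case True
      then show ?thesis using base Suc.prems by simp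
    next
      case False
      have "R / 2 ^ Suc j < norm (2 *\<^sub>R h)" "norm (2 *\<^sub>R h) \<le> R"
        using Suc.prems False by (auto simp: field_simps)
      then have ih: "a (2 *\<^sub>R h) \<le> ?C * D * norm (2 *\<^sub>R h) powr e" by (rule Suc.IH)
      have pos: "0 < norm h" using Suc.prems(1) R by (metis divide_pos_pos less_trans zero_less_numeral zero_less_power)
      have "a h \<le> \<theta> * a (2 *\<^sub>R h) + D * norm h powr e"
        using False pos by (intro step) auto
      also have "\<dots> \<le> \<theta> * (?C * D * norm (2 *\<^sub>R h) powr e) + D * norm h powr e"
        using ih \<theta> by (intro add_right_mono mult_left_mono) auto
      also have "\<dots> = (\<theta> * 2 powr e * ?C + 1) * (D * norm h powr e)"
        by (simp add: powr_mult algebra_simps)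
      also have "\<dots> \<le> ?C * (D * norm h powr e)"
        using C2 D by (intro mult_right_mono) auto
      finally show ?thesis by (simp add: mult.assoc)
    qed
  qed
  moreover obtain j where "R / 2 ^ Suc j < norm h"
  proof -
    obtain j where "R / norm h < 2 ^ j" using real_arch_pow[of 2] by auto
    then have "R < norm h * 2 ^ j" using h by (simp add: field_simps)
    also have "\<dots> \<le> norm h * 2 ^ Suc j" by simp
    finally show thesis by (intro that[of j]) (simp add: field_simps)
  qed
  ultimately show ?thesis using h by blast
qed

lemma fdiff_append: "fdiff hs (fdiff gs w) x = fdiff (hs @ gs) w x"
  by (induction hs arbitrary: x) auto

text \<open>With D the difference operator of step h, the second difference of step 2h is D^2 (2 +
  D)^2 = 4 D^2 + 4 D^3 + D^4. Halving the step thus costs third differences and gains a factor 1/4,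
  so that \<open>dyadic_gain\<close> reaches every exponent q < 2.\<close>

lemma second_from_third:
  fixes v :: "'a::real_normed_vector \<Rightarrow> real"
  assumes q: "0 \<le> q" "q < 2" "q \<le> \<gamma>" and A: "0 \<le> A" and R: "0 < R"
    and third: "\<And>h z. 0 < norm h \<Longrightarrow> norm h \<le> R \<Longrightarrow> norm (z - x) \<le> R \<Longrightarrow> \<bar>fdiff [h, h, h] v z\<bar> \<le> A * norm h powr \<gamma>"
    and top: "\<And>h. norm h \<le> R \<Longrightarrow> \<bar>fdiff [h, h] v x\<bar> \<le> A * R powr \<gamma>"
    and h: "norm h \<le> R"
  shows "\<bar>fdiff [h, h] v x\<bar> \<le> 2 powr q / (1 - 2 powr q / 4) * A * R powr (\<gamma> - q) * norm h powr q"
proof (cases "h = 0")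
  case False
  have q4: "2 powr q < (4::real)"
    using powr_less_cancel_iff[of 2 q 2] q by simp
  have "\<bar>fdiff [h, h] v x\<bar> \<le> 2 powr q / (1 - 1 / 4 * 2 powr q) * (A * R powr (\<gamma> - q)) * norm h powr q"
  proof (rule dyadic_gain[where R=R])
    fix h :: 'a assume h: "0 < norm h" "norm h \<le> R / 2"
    have eq: "4 * fdiff [h, h] v x = fdiff [2 *\<^sub>R h, 2 *\<^sub>R h] v x - 3 * fdiff [h, h, h] v x - fdiff [h, h, h] v (x + h)"
      by (simp add: algebra_simps scaleR_2)
    have "\<bar>fdiff [h, h, h] v x\<bar> \<le> A * norm h powr \<gamma>" "\<bar>fdiff [h, h, h] v (x + h)\<bar> \<le> A * norm h powr \<gamma>"
      using h R by (auto intro!: third simp del: fdiff.simps)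
    then have "\<bar>fdiff [h, h] v x\<bar> \<le> 1 / 4 * \<bar>fdiff [2 *\<^sub>R h, 2 *\<^sub>R h] v x\<bar> + A * norm h powr \<gamma>"
      using eq by linarith
    also have "norm h powr \<gamma> \<le> R powr (\<gamma> - q) * norm h powr q"
    proof -
      have "norm h powr \<gamma> = norm h powr (\<gamma> - q) * norm h powr q" by (simp flip: powr_add)
      also have "\<dots> \<le> R powr (\<gamma> - q) * norm h powr q"
        using h R q by (intro mult_right_mono powr_mono2) auto
      finally show ?thesis .
    qed
    then have "A * norm h powr \<gamma> \<le> A * (R powr (\<gamma> - q) * norm h powr q)" using A by (rule mult_left_mono)
    finally show "\<bar>fdiff [h, h] v x\<bar> \<le> 1 / 4 * \<bar>fdiff [2 *\<^sub>R h, 2 *\<^sub>R h] v x\<bar> + A * R powr (\<gamma> - q) * norm h powr q"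
      by (simp only: mult.assoc)
  next
    fix h :: 'a assume "norm h \<le> R"
    then have "\<bar>fdiff [h, h] v x\<bar> \<le> A * R powr \<gamma>" by (rule top)
    also have "\<dots> = A * R powr (\<gamma> - q) * R powr q" by (simp add: mult.assoc flip: powr_add)
    finally show "\<bar>fdiff [h, h] v x\<bar> \<le> A * R powr (\<gamma> - q) * R powr q" .
  qed (use q q4 A R False h in auto)
  then show ?thesis by (simp add: mult.assoc)
qed simp

text \<open>The same scheme with step 2h giving 2 D + D^2: the gain per halving is 1/2, which allows
  every exponent p < 1.\<close>

lemma first_from_second:
  fixes v :: "'a::real_normed_vector \<Rightarrow> real"
  assumes p: "0 \<le> p" "p < 1" "p \<le> q" and A: "0 \<le> A" and R: "0 < R"
    and second: "\<And>h. 0 < norm h \<Longrightarrow> norm h \<le> R \<Longrightarrow> \<bar>fdiff [h, h] v x\<bar> \<le> A * R powr (\<gamma> - q) * norm h powr q"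
    and top: "\<And>h. norm h \<le> R \<Longrightarrow> \<bar>fdiff [h] v x\<bar> \<le> A * R powr \<gamma>"
    and h: "norm h \<le> R"
  shows "\<bar>fdiff [h] v x\<bar> \<le> 2 powr p / (1 - 2 powr p / 2) * A * R powr (\<gamma> - p) * norm h powr p"
proof (cases "h = 0")
  case False
  have p2: "2 powr p < (2::real)"
    using powr_less_cancel_iff[of 2 p 1] p by simp
  have "\<bar>fdiff [h] v x\<bar> \<le> 2 powr p / (1 - 1 / 2 * 2 powr p) * (A * R powr (\<gamma> - p)) * norm h powr p"
  proof (rule dyadic_gain[where R=R])
    fix h :: 'a assume h: "0 < norm h" "norm h \<le> R / 2"
    have eq: "2 * fdiff [h] v x = fdiff [2 *\<^sub>R h] v x - fdiff [h, h] v x"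
      by (simp add: algebra_simps scaleR_2)
    have "\<bar>fdiff [h, h] v x\<bar> \<le> A * R powr (\<gamma> - q) * norm h powr q"
      using h R by (intro second) auto
    then have "\<bar>fdiff [h] v x\<bar> \<le> 1 / 2 * \<bar>fdiff [2 *\<^sub>R h] v x\<bar> + A * (R powr (\<gamma> - q) * norm h powr q)"
      using eq by linarith
    also have "R powr (\<gamma> - q) * norm h powr q \<le> R powr (\<gamma> - p) * norm h powr p"
    proof -
      have "R powr (\<gamma> - q) * norm h powr q = R powr (\<gamma> - q) * (norm h powr (q - p) * norm h powr p)" by (simp flip: powr_add)
      also have "\<dots> \<le> R powr (\<gamma> - q) * (R powr (q - p) * norm h powr p)"
        using h R p by (intro mult_left_mono mult_right_mono powr_mono2) auto
      also have "\<dots> = R powr (\<gamma> - p) * norm h powr p" by (simp flip: powr_add mult.assoc)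
      finally show ?thesis .
    qed
    then have "A * (R powr (\<gamma> - q) * norm h powr q) \<le> A * (R powr (\<gamma> - p) * norm h powr p)" using A by (rule mult_left_mono)
    finally show "\<bar>fdiff [h] v x\<bar> \<le> 1 / 2 * \<bar>fdiff [2 *\<^sub>R h] v x\<bar> + A * R powr (\<gamma> - p) * norm h powr p"
      by (simp only: mult.assoc)
  next
    fix h :: 'a assume "norm h \<le> R"
    then have "\<bar>fdiff [h] v x\<bar> \<le> A * R powr \<gamma>" by (rule top)
    also have "\<dots> = A * R powr (\<gamma> - p) * R powr p" by (simp add: mult.assoc flip: powr_add)
    finally show "\<bar>fdiff [h] v x\<bar> \<le> A * R powr (\<gamma> - p) * R powr p" .
  qed (use p p2 A R False h in auto)
  then show ?thesis by (simp add: mult.assoc)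
qed simp

section \<open>Hoelder continuity of Lu and of the time derivative\<close>

context stable_parameters
begin

text \<open>The near part of L, split at a free radius r: inside r an exponent above 2s is
  integrable at 0, between r and \<rho> one below 2s is integrable at infinity. With r = |h| in
  space and r = |t - t'|^(1/(2s)) in time both terms have the same order.\<close>

lemma near_integral_bound:
  fixes q e :: real
  assumes q: "2 * s < q" and e: "e < 2 * s"
  obtains C where "0 < C"
    "\<And>(k::'a::euclidean_space \<Rightarrow> real) v x \<rho> r B1 B2.
      \<lbrakk>kernel k; v \<in> borel_measurable borel; 0 < \<rho>; 0 < r; 0 \<le> B1; 0 \<le> B2;
       \<And>y. norm y < r \<Longrightarrow> \<bar>sdiff v x y\<bar> \<le> B1 * norm y powr q;
       \<And>y. r \<le> norm y \<Longrightarrow> norm y < \<rho> \<Longrightarrow> \<bar>sdiff v x y\<bar> \<le> B2 * norm y powr e\<rbrakk>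
      \<Longrightarrow> integrable lborel (\<lambda>y. cutoff \<rho> y * k y * sdiff v x y)
        \<and> \<bar>LINT y|lborel. cutoff \<rho> y * k y * sdiff v x y\<bar> \<le> C * (B1 * r powr (q - 2 * s) + B2 * r powr (e - 2 * s))"
proof -
  obtain C1 where C1: "0 < C1"
    "\<And>(k::'a \<Rightarrow> real) r. kernel k \<Longrightarrow> 0 < r \<Longrightarrow>
      integrable lborel (\<lambda>y. indicator (ball 0 r) y * (norm y powr q * k y))
      \<and> (LINT y|lborel. indicator (ball 0 r) y * (norm y powr q * k y)) \<le> C1 * r powr (q - 2 * s)"
    by (rule kernel_near[OF q, where 'a='a]) blast
  obtain C2 where C2: "0 < C2"
    "\<And>(k::'a \<Rightarrow> real) r. kernel k \<Longrightarrow> 0 < r \<Longrightarrow>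
      integrable lborel (\<lambda>y. indicator (- ball 0 r) y * (norm y powr e * k y))
      \<and> (LINT y|lborel. indicator (- ball 0 r) y * (norm y powr e * k y)) \<le> C2 * r powr (e - 2 * s)"
    by (rule kernel_far[OF e, where 'a='a]) blast
  show thesis
  proof (rule that[of "C1 + C2"], goal_cases)
    case 1 show ?case using C1 C2 by simp
  next
    case prems: (2 k v x \<rho> r B1 B2)
    note k = prems(1) and B = prems(5,6) and near = prems(7) and far = prems(8)
    note [measurable] = kernel_measurable[OF k]
    let ?f1 = "\<lambda>y. indicator (ball 0 r) y * (norm y powr q * k y)"
    let ?f2 = "\<lambda>y. indicator (- ball 0 r) y * (norm y powr e * k y)"
    have f1: "integrable lborel ?f1" "(LINT y|lborel. ?f1 y) \<le> C1 * r powr (q - 2 * s)"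
      using C1(2)[OF k prems(4)] by auto
    have f2: "integrable lborel ?f2" "(LINT y|lborel. ?f2 y) \<le> C2 * r powr (e - 2 * s)"
      using C2(2)[OF k prems(4)] by auto
    let ?g = "\<lambda>y. B1 * ?f1 y + B2 * ?f2 y"
    have gi: "integrable lborel ?g"
      using f1(1) f2(1) by (intro Bochner_Integration.integrable_add integrable_mult_right)
    have fm: "(\<lambda>y. cutoff \<rho> y * k y * sdiff v x y) \<in> borel_measurable lborel"
      using kernel_measurable[OF k] sdiff_measurable[OF prems(2)] by simp
    have b: "\<bar>cutoff \<rho> y * k y * sdiff v x y\<bar> \<le> ?g y" for y
    proof (cases "norm y < \<rho>")
      case False
      then have "cutoff \<rho> y = 0" using prems(3) by (simp add: cutoff_eq_0)
      then show ?thesis using B kernel_nonneg[OF k, of y] by simp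
    next
      case True
      have "\<bar>cutoff \<rho> y * k y * sdiff v x y\<bar> \<le> k y * \<bar>sdiff v x y\<bar>"
        using cutoff_range[of \<rho> y] kernel_nonneg[OF k, of y]
        by (simp add: abs_mult mult.assoc mult_left_le_one_le)
      also have "\<dots> \<le> ?g y"
      proof (cases "norm y < r")
        case T: True
        have "k y * \<bar>sdiff v x y\<bar> \<le> k y * (B1 * norm y powr q)"
          by (rule mult_left_mono[OF near[OF T] kernel_nonneg[OF k]])
        then show ?thesis using T by (simp add: mult_ac)
      next
        case F: False
        have "k y * \<bar>sdiff v x y\<bar> \<le> k y * (B2 * norm y powr e)"
          using F True by (intro mult_left_mono[OF far kernel_nonneg[OF k]]) auto
        then show ?thesis using F by (simp add: mult_ac)
      qed
      finally show ?thesis .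
    qed
    have "(LINT y|lborel. ?g y) = B1 * (LINT y|lborel. ?f1 y) + B2 * (LINT y|lborel. ?f2 y)"
      using f1(1) f2(1) by (simp add: Bochner_Integration.integral_add)
    also have "\<dots> \<le> B1 * (C1 * r powr (q - 2 * s)) + B2 * (C2 * r powr (e - 2 * s))"
      using f1(2) f2(2) B by (intro add_mono mult_left_mono) auto
    also have "\<dots> \<le> (C1 + C2) * (B1 * r powr (q - 2 * s) + B2 * r powr (e - 2 * s))"
      using C1(1) C2(1) B by (simp add: algebra_simps)
    finally show ?case
      using integral_dominated_le[OF gi fm b] by linarith
  qed
qed

text \<open>In the last bound the increment h is moved onto the kernel for the translates x + y and
  x - y. The central value does not depend on y; it multiplies the mass of the tail and is kept as
  \<open>fdiff [h] w x\<close>.\<close>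

lemma tail_sdiff:
  obtains C where "0 < C"
    "\<And>(k::'a::euclidean_space \<Rightarrow> real) v x \<rho> V.
      \<lbrakk>kernel k; v \<in> borel_measurable borel; 0 < \<rho>; \<And>y. \<bar>v y\<bar> \<le> V\<rbrakk>
      \<Longrightarrow> integrable lborel (\<lambda>y. (1 - cutoff \<rho> y) * k y * sdiff v x y)
        \<and> \<bar>LINT y|lborel. (1 - cutoff \<rho> y) * k y * sdiff v x y\<bar> \<le> C * V * \<rho> powr (- 2 * s)"
    "\<And>(k::'a::euclidean_space \<Rightarrow> real) w h x \<rho> U.
      \<lbrakk>kernel k; w \<in> borel_measurable borel; 0 < \<rho>; norm h \<le> \<rho> / 8; \<And>y. \<bar>w y\<bar> \<le> U\<rbrakk>
      \<Longrightarrow> \<bar>LINT y|lborel. (1 - cutoff \<rho> y) * k y * sdiff (fdiff [h] w) x y\<bar>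
          \<le> C * (U * norm h powr \<alpha> * \<rho> powr (- 2 * s - \<alpha>) + \<bar>fdiff [h] w x\<bar> * \<rho> powr (- 2 * s))"
proof -
  obtain C1 where C1: "0 < C1"
    "\<And>(k::'a \<Rightarrow> real) \<rho> r g hs x U.
      \<lbrakk>kernel k; 0 < \<rho>; r \<le> \<rho> / 8; hs \<noteq> []; \<And>h. h \<in> set hs \<Longrightarrow> norm h \<le> r;
       g \<in> borel_measurable borel; \<And>y. \<bar>g y\<bar> \<le> U\<rbrakk>
      \<Longrightarrow> \<bar>LINT y|lborel. (1 - cutoff \<rho> y) * k y * fdiff hs g (x + y)\<bar>
          \<le> C1 * (2 ^ length hs * U * r powr \<alpha> * \<rho> powr (- 2 * s - \<alpha>))"
    by (rule tail_fdiff[where 'a='a]) blast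
  obtain C2 where C2: "0 < C2"
    "\<And>(k::'a \<Rightarrow> real) \<rho>. kernel k \<Longrightarrow> 0 < \<rho> \<Longrightarrow>
      integrable lborel (\<lambda>y. (1 - cutoff \<rho> y) * k y)
      \<and> (LINT y|lborel. (1 - cutoff \<rho> y) * k y) \<le> C2 * \<rho> powr (- 2 * s)"
    by (rule kernel_tail[where 'a='a]) blast
  show thesis
  proof (rule that[of "4 * C1 + 4 * C2"], goal_cases)
    case 1 show ?case using C1 C2 by simp
  next
    case prems: (2 k v x \<rho> V)
    let ?kf = "\<lambda>y. (1 - cutoff \<rho> y) * k y"
    have kfi: "integrable lborel ?kf" and kfI: "(LINT y|lborel. ?kf y) \<le> C2 * \<rho> powr (- 2 * s)"
      using C2(2)[OF prems(1,3)] by auto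
    have kf0: "0 \<le> ?kf y" for y
      using cutoff_range(2)[of \<rho> y] kernel_nonneg[OF prems(1), of y] by simp
    have V: "0 \<le> V" using prems(4)[of 0] by linarith
    have sb: "\<bar>sdiff v x y\<bar> \<le> 4 * V" for y
      using prems(4)[of "x + y"] prems(4)[of "x - y"] prems(4)[of x] unfolding sdiff_def by linarith
    note sm = sdiff_measurable[OF prems(2)]
    have i: "integrable lborel (\<lambda>y. ?kf y * sdiff v x y)" by (rule integrable_mult_bounded[OF kfi sm sb])
    have gi: "integrable lborel (\<lambda>y. 4 * V * ?kf y)" using kfi by (rule integrable_mult_right)
    have "\<bar>LINT y|lborel. ?kf y * sdiff v x y\<bar> \<le> (LINT y|lborel. 4 * V * ?kf y)"
    proof (rule integral_dominated_le(2)[OF gi borel_measurable_integrable[OF i]])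
      show "\<bar>?kf y * sdiff v x y\<bar> \<le> 4 * V * ?kf y" for y
      proof -
        have "\<bar>?kf y * sdiff v x y\<bar> = ?kf y * \<bar>sdiff v x y\<bar>"
          by (simp only: abs_mult[of "?kf y"] abs_of_nonneg[OF kf0])
        also have "\<dots> \<le> ?kf y * (4 * V)" by (rule mult_left_mono[OF sb kf0])
        finally show ?thesis by (simp only: mult_ac)
      qed
    qed
    also have "\<dots> = 4 * V * (LINT y|lborel. ?kf y)" by (rule integral_mult_right_zero)
    also have "\<dots> \<le> 4 * V * (C2 * \<rho> powr (- 2 * s))" using V kfI by (intro mult_left_mono) auto
    also have "\<dots> \<le> (4 * C1 + 4 * C2) * V * \<rho> powr (- 2 * s)"
      using V C1(1) by (simp add: algebra_simps)
    finally show ?case using i by simp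
  next
    case prems: (3 k w h x \<rho> U)
    let ?kf = "\<lambda>y. (1 - cutoff \<rho> y) * k y"
    let ?v = "fdiff [h] w"
    have kfi: "integrable lborel ?kf" and kfI: "(LINT y|lborel. ?kf y) \<le> C2 * \<rho> powr (- 2 * s)"
      using C2(2)[OF prems(1,3)] by auto
    have kf0: "0 \<le> ?kf y" for y
      using cutoff_range(2)[of \<rho> y] kernel_nonneg[OF prems(1), of y] by simp
    have U: "0 \<le> U" using prems(5)[of 0] by linarith
    have vm: "?v \<in> borel_measurable borel" by (rule borel_measurable_fdiff[OF prems(2)])
    have vb: "\<bar>?v y\<bar> \<le> 2 ^ length [h] * U" for y by (rule fdiff_bound) (rule prems(5))
    have i1: "integrable lborel (\<lambda>y. ?kf y * ?v (x + y))"
      by (rule integrable_mult_bounded[OF kfi borel_measurable_translate(1)[OF vm] vb])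
    have i2: "integrable lborel (\<lambda>y. ?kf y * ?v (x - y))"
      by (rule integrable_mult_bounded[OF kfi borel_measurable_translate(2)[OF vm] vb])
    have I1: "\<bar>LINT y|lborel. ?kf y * ?v (x + y)\<bar>
        \<le> C1 * (2 ^ length [h] * U * norm h powr \<alpha> * \<rho> powr (- 2 * s - \<alpha>))"
      by (rule C1(2)[OF prems(1,3,4) _ _ prems(2,5)]) auto
    have "\<bar>LINT y|lborel. ?kf y * fdiff (map uminus [h]) (\<lambda>z. w (- z)) (- x + y)\<bar>
        \<le> C1 * (2 ^ length (map uminus [h]) * U * norm h powr \<alpha> * \<rho> powr (- 2 * s - \<alpha>))"
    proof (rule C1(2)[OF prems(1,3,4)])
      show "(\<lambda>z. w (- z)) \<in> borel_measurable borel"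
        by (rule measurable_compose[OF _ prems(2)]) simp
      show "\<bar>w (- y)\<bar> \<le> U" for y by (rule prems(5))
    qed auto
    then have I2: "\<bar>LINT y|lborel. ?kf y * ?v (x - y)\<bar>
        \<le> C1 * (2 ^ length [h] * U * norm h powr \<alpha> * \<rho> powr (- 2 * s - \<alpha>))"
      unfolding fdiff_reflect[of "[h]" w x] length_map .
    have i12: "integrable lborel (\<lambda>y. ?kf y * ?v (x + y) + ?kf y * ?v (x - y))"
      using i1 i2 by (rule Bochner_Integration.integrable_add)
    have i3: "integrable lborel (\<lambda>y. 2 * ?v x * ?kf y)"
      using kfi by (rule integrable_mult_right)
    have "(LINT y|lborel. ?kf y * sdiff ?v x y)
      = (LINT y|lborel. (?kf y * ?v (x + y) + ?kf y * ?v (x - y)) - 2 * ?v x * ?kf y)"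
      by (intro Bochner_Integration.integral_cong refl) (simp add: sdiff_def algebra_simps)
    also have "\<dots> = (LINT y|lborel. ?kf y * ?v (x + y)) + (LINT y|lborel. ?kf y * ?v (x - y)) - 2 * ?v x * (LINT y|lborel. ?kf y)"
      by (simp only: integral_mult_right_zero Bochner_Integration.integral_diff[OF i12 i3] Bochner_Integration.integral_add[OF i1 i2])
    finally have eq: "(LINT y|lborel. ?kf y * sdiff ?v x y)
      = (LINT y|lborel. ?kf y * ?v (x + y)) + (LINT y|lborel. ?kf y * ?v (x - y)) - 2 * (?v x * (LINT y|lborel. ?kf y))"
      by simp
    have "0 \<le> (LINT y|lborel. ?kf y)" by (intro Bochner_Integration.integral_nonneg kf0)
    then have "\<bar>?v x * (LINT y|lborel. ?kf y)\<bar> \<le> \<bar>?v x\<bar> * (C2 * \<rho> powr (- 2 * s))"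
      unfolding abs_mult using kfI by (intro mult_mono) auto
    then have "\<bar>LINT y|lborel. ?kf y * sdiff ?v x y\<bar>
        \<le> 4 * C1 * (U * norm h powr \<alpha> * \<rho> powr (- 2 * s - \<alpha>)) + 2 * C2 * (\<bar>?v x\<bar> * \<rho> powr (- 2 * s))"
      using I1 I2 unfolding eq by (simp add: mult_ac)
    also have "\<dots> \<le> (4 * C1 + 4 * C2) * (U * norm h powr \<alpha> * \<rho> powr (- 2 * s - \<alpha>)) + (4 * C1 + 4 * C2) * (\<bar>?v x\<bar> * \<rho> powr (- 2 * s))"
      using U C1(1) C2(1) by (intro add_mono mult_right_mono) auto
    finally show ?case by (simp add: distrib_left)
  qed
qed

text \<open>Three passes over the equation u' = Lu + f: u' is bounded, then \<alpha>-Hoelder in x,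
  then Hoelder in t. The third rests on the second: integrated in time, it controls mixed space-time
  increments of u, which are used for jumps longer than |t - t'|^(1/(2s)).\<close>

lemma temporal_estimate:
  fixes \<gamma> q p \<rho> :: real
  defines "\<gamma> \<equiv> 2 * s + \<alpha>" and "q \<equiv> min \<gamma> (s + 1)" and "p \<equiv> min \<gamma> ((1 + \<alpha>) / 2)" and "\<rho> \<equiv> 1 / 100"
  obtains C where "0 < C"
    "\<And>(k::'a::euclidean_space \<Rightarrow> real) u u' f T0 T1 A t t' x.
      \<lbrakk>kernel k;
       \<And>t. t \<in> {T0..T1} \<Longrightarrow> u t \<in> borel_measurable borel;
       \<And>t x. t \<in> {T0..T1} \<Longrightarrow> \<bar>u t x\<bar> \<le> A;
       \<And>t t' x. t \<in> {T0..T1} \<Longrightarrow> t' \<in> {T0..T1} \<Longrightarrow> \<bar>u t x - u t' x\<bar> \<le> A * \<bar>t - t'\<bar> powr (\<alpha> / (2 * s));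
       \<And>t x. t \<in> {T0..T1} \<Longrightarrow> x \<in> ball 0 (7 / 10) \<Longrightarrow> ((\<lambda>t. u t x) has_real_derivative u' t x) (at t);
       \<And>t x. t \<in> {T0..T1} \<Longrightarrow> integrable lborel (\<lambda>y. k y * sdiff (u t) x y);
       \<And>t x. t \<in> {T0..T1} \<Longrightarrow> x \<in> ball 0 (7 / 10) \<Longrightarrow>
          u' t x - (LINT y|lborel. k y * sdiff (u t) x y) = f t x;
       \<And>t x. t \<in> {T0..T1} \<Longrightarrow> x \<in> ball 0 (7 / 10) \<Longrightarrow> \<bar>f t x\<bar> \<le> A;
       \<And>t x x'. t \<in> {T0..T1} \<Longrightarrow> x \<in> ball 0 (7 / 10) \<Longrightarrow> x' \<in> ball 0 (7 / 10) \<Longrightarrow>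
          \<bar>f t x - f t x'\<bar> \<le> A * norm (x - x') powr \<alpha>;
       \<And>t t' x. t \<in> {T0..T1} \<Longrightarrow> t' \<in> {T0..T1} \<Longrightarrow> x \<in> ball 0 (7 / 10) \<Longrightarrow>
          \<bar>f t x - f t' x\<bar> \<le> A * \<bar>t - t'\<bar> powr (\<alpha> / (2 * s));
       \<And>t x a b c r. t \<in> {T0..T1} \<Longrightarrow> x \<in> ball 0 (7 / 10) \<Longrightarrow> norm a \<le> r \<Longrightarrow> norm b \<le> r \<Longrightarrow> norm c \<le> r \<Longrightarrow> 0 < r \<Longrightarrow>
          \<bar>fdiff [a, b, c] (u t) x\<bar> \<le> A * r powr \<gamma>;
       \<And>t x a b r. t \<in> {T0..T1} \<Longrightarrow> x \<in> ball 0 (7 / 10) \<Longrightarrow> norm a \<le> r \<Longrightarrow> norm b \<le> r \<Longrightarrow> 0 < r \<Longrightarrow>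
          \<bar>fdiff [a, b] (u t) x\<bar> \<le> A * r powr q;
       \<And>t x a r. t \<in> {T0..T1} \<Longrightarrow> x \<in> ball 0 (7 / 10) \<Longrightarrow> norm a \<le> r \<Longrightarrow> 0 < r \<Longrightarrow>
          \<bar>fdiff [a] (u t) x\<bar> \<le> A * r powr p;
       t \<in> {T0..T1}; t' \<in> {T0..T1}; x \<in> ball 0 (3 / 5)\<rbrakk>
      \<Longrightarrow> \<bar>u' t x\<bar> \<le> C * A \<and> \<bar>u' t x - u' t' x\<bar> \<le> C * A * \<bar>t - t'\<bar> powr (\<alpha> / (2 * s))"
proof -
  \<comment> \<open>q > 2s makes second differences integrable against the kernel at 0, and p >
    \<alpha> gives \<gamma> - p < 2s, integrable at infinity; q < 2 and p < 1 are the ranges of the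
    doubling lemmas.\<close>
  have q: "2 * s < q" "q < 2" "q \<le> \<gamma>" "0 \<le> q" using s \<alpha> by (auto simp: q_def \<gamma>_def)
  have p: "\<alpha> < p" "p < 1" "p \<le> q" "0 \<le> p" "p \<le> \<gamma>"
  proof -
    have "p \<le> (1 + \<alpha>) / 2" unfolding p_def by (rule min.cobounded2)
    also have "(1 + \<alpha>) / 2 < 1" using \<alpha> by simp
    finally show "p < 1" .
    show "p \<le> \<gamma>" by (simp add: p_def)
    then show "p \<le> q" using \<open>p < 1\<close> s by (simp add: q_def)
    show "\<alpha> < p" "0 \<le> p" using s \<alpha> by (auto simp: p_def \<gamma>_def)
  qed
  have gp: "\<gamma> - p < 2 * s" using p by (simp add: \<gamma>_def)
  have \<rho>: "0 < \<rho>" by (simp add: \<rho>_def)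
  define c2 :: real where "c2 = 2 powr q / (1 - 2 powr q / 4)"
  define c1 :: real where "c1 = 2 powr p / (1 - 2 powr p / 2)"
  have c2: "0 < c2"
  proof -
    have "2 powr q < (4::real)" using powr_less_cancel_iff[of 2 q 2] q by simp
    then show ?thesis by (simp add: c2_def)
  qed
  have c1: "0 < c1"
  proof -
    have "2 powr p < (2::real)" using powr_less_cancel_iff[of 2 p 1] p by simp
    then show ?thesis by (simp add: c1_def)
  qed
  show thesis
  proof (rule near_integral_bound[OF q(1) gp, where 'a='a], goal_cases)
  case K1: (1 K1)
  show thesis
  proof (rule near_integral_bound[OF q(1) \<alpha>(3), where 'a='a], goal_cases)
  case K2: (1 K2)
  show thesis
  proof (rule tail_sdiff[where 'a='a], goal_cases)
  case K3: (1 K3)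
  define P where "P = \<rho> powr (- 2 * s) + \<rho> powr (- 2 * s - \<alpha>) + \<rho> powr (q - 2 * s)"
  have P: "0 < P" "\<rho> powr (- 2 * s) \<le> P" "\<rho> powr (- 2 * s - \<alpha>) \<le> P" "\<rho> powr (q - 2 * s) \<le> P"
    using \<rho> by (auto simp: P_def add_pos_pos)
  \<comment> \<open>C1 bounds u', C2 its modulus in x, C3 its modulus in t. In each the summand 1 is
    reserved for f, so that Lu is estimated with C - 1. The last terms of C2 and C3 serve increments
    that are not small.\<close>
  define C1 where "C1 = 1 + K1 * P + K3 * P"
  define C2 where "C2 = 1 + K1 * (2 * c2 + 4 * c2 * c1 + c1) + 2 * K3 * P + 2 * C1 * (\<rho> / 8) powr (- \<alpha>)"
  define C3 where "C3 = 1 + K2 * (2 * C2 + 2) * (c2 + 1) + 2 * K3 * P + 2 * C1 * \<rho> powr (- \<alpha>)"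
  have C1: "1 \<le> C1" using K1(1) K3(1) P by (simp add: C1_def add_nonneg_nonneg)
  have C2: "1 \<le> C2" using K1(1) K3(1) P C1 c1 c2 by (simp add: C2_def add_nonneg_nonneg)
  have C3: "0 < C3" using K2(1) K3(1) P C1 C2 c2 by (simp add: C3_def add_pos_nonneg add_nonneg_nonneg)
  show thesis
  proof (rule that[of "C1 + C3"], goal_cases)
    case 1 show ?case using C1 C3 by simp
  next
    case prems: (2 k u u' f T0 T1 A t t' x)
    note k = prems(1) and um = prems(2) and ub = prems(3) and ut = prems(4) and der = prems(5) and int = prems(6)
      and eqn = prems(7) and fb = prems(8) and fx = prems(9) and ft = prems(10)
      and d3 = prems(11) and d2 = prems(12) and d1 = prems(13)
    let ?J = "{T0..T1}"
    have A: "0 \<le> A" using ub[OF prems(14), of 0] by linarith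
    define L where "L v x = (LINT y|lborel. k y * sdiff v x y)" for v x
    \<comment> \<open>Room for the increments, with \<rho> = 1/100: shifts of at most 4 \<rho> lead
      from radius 13/20 into 7/10, and later shifts of at most 3 \<rho> lead from 3/5 into
      16/25.\<close>
    have inb: "z \<in> ball 0 (7 / 10)" if "x \<in> ball 0 (13 / 20)" "norm (z - x) \<le> 4 * \<rho>" for x z :: 'a
    proof -
      have "norm z \<le> norm x + norm (z - x)" using norm_triangle_ineq[of x "z - x"] by simp
      then show ?thesis using that by (simp add: \<rho>_def)
    qed
    have split: "L v x = (LINT y|lborel. cutoff \<rho> y * k y * sdiff v x y) + (LINT y|lborel. (1 - cutoff \<rho> y) * k y * sdiff v x y)"
      if "integrable lborel (\<lambda>y. cutoff \<rho> y * k y * sdiff v x y)"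
        "integrable lborel (\<lambda>y. (1 - cutoff \<rho> y) * k y * sdiff v x y)" for v x
      unfolding Bochner_Integration.integral_add[OF that, symmetric] L_def by (simp add: algebra_simps)
    have Lb: "\<bar>L (u t) x\<bar> \<le> (C1 - 1) * A" if t: "t \<in> ?J" and x: "x \<in> ball 0 (13 / 20)" for t x
    proof -
      have 1: "integrable lborel (\<lambda>y. cutoff \<rho> y * k y * sdiff (u t) x y)
        \<and> \<bar>LINT y|lborel. cutoff \<rho> y * k y * sdiff (u t) x y\<bar> \<le> K1 * (A * \<rho> powr (q - 2 * s) + 0 * \<rho> powr (\<gamma> - p - 2 * s))"
      proof (rule K1(2)[OF k um[OF t] \<rho> \<rho> A order_refl])
        fix y :: 'a assume y: "norm y < \<rho>"
        have z: "x - y \<in> ball 0 (7 / 10)" using y \<rho> by (intro inb[OF x]) auto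
        show "\<bar>sdiff (u t) x y\<bar> \<le> A * norm y powr q"
        proof (cases "y = 0")
          case False
          then show ?thesis unfolding sdiff_conv_fdiff by (intro d2[OF t z]) auto
        qed (simp add: sdiff_def)
      qed auto
      have 2: "integrable lborel (\<lambda>y. (1 - cutoff \<rho> y) * k y * sdiff (u t) x y)
        \<and> \<bar>LINT y|lborel. (1 - cutoff \<rho> y) * k y * sdiff (u t) x y\<bar> \<le> K3 * A * \<rho> powr (- 2 * s)"
        by (rule K3(2)[OF k um[OF t] \<rho> ub[OF t]])
      have "\<bar>L (u t) x\<bar> \<le> K1 * (A * \<rho> powr (q - 2 * s)) + K3 * A * \<rho> powr (- 2 * s)"
        using 1 2 split[of "u t" x] by (simp add: abs_le_iff)
      also have "\<dots> \<le> K1 * (A * P) + K3 * A * P"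
        using K1(1) K3(1) A P by (intro add_mono mult_left_mono) auto
      finally show ?thesis by (simp add: C1_def algebra_simps)
    qed
    have u'b: "\<bar>u' t x\<bar> \<le> C1 * A" if t: "t \<in> ?J" and x: "x \<in> ball 0 (13 / 20)" for t x
    proof -
      have x': "x \<in> ball 0 (7 / 10)" using x by simp
      have "u' t x = L (u t) x + f t x" using eqn[OF t x'] by (simp add: L_def)
      then show ?thesis using Lb[OF t x] fb[OF t x'] unfolding left_diff_distrib by linarith
    qed
    \<comment> \<open>Two small steps h and one step y of size up to r:
      \<open>second_from_third\<close>, applied to the first difference of u along y, trades powers
      of r for powers of |h|. The factor 2 accounts for the base points w and w + y.\<close>
    have two_small: "\<bar>fdiff [h, h, y] (u t) z\<bar> \<le> c2 * (2 * A) * r powr (\<gamma> - q) * norm h powr q"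
      if t: "t \<in> ?J" and z: "norm (z - x) \<le> \<rho>" and x: "x \<in> ball 0 (13 / 20)"
        and r: "0 < r" "r \<le> \<rho>" and h: "norm h \<le> r" and y: "norm y \<le> r" for t z x r h y
    proof -
      have "\<bar>fdiff [h, h] (fdiff [y] (u t)) z\<bar> \<le> 2 powr q / (1 - 2 powr q / 4) * (2 * A) * r powr (\<gamma> - q) * norm h powr q"
      proof (rule second_from_third[OF q(4,2,3) _ r(1) _ _ h])
        show "0 \<le> 2 * A" using A by simp
        fix g :: 'a assume g: "norm g \<le> r"
        show "\<bar>fdiff [g, g] (fdiff [y] (u t)) z\<bar> \<le> 2 * A * r powr \<gamma>"
        proof -
          have "z \<in> ball 0 (7 / 10)" using z \<rho> by (intro inb[OF x]) auto
          then have "\<bar>fdiff [g, g, y] (u t) z\<bar> \<le> A * r powr \<gamma>" using g y r by (intro d3[OF t]) auto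
          moreover have "0 \<le> A * r powr \<gamma>" using A by simp
          ultimately have "\<bar>fdiff [g, g, y] (u t) z\<bar> \<le> 2 * (A * r powr \<gamma>)" by linarith
          then show ?thesis unfolding fdiff_append by (simp only: append.simps mult.assoc)
        qed
        fix w assume g0: "0 < norm g" and w: "norm (w - z) \<le> r"
        have wx: "norm (w - x) \<le> 2 * \<rho>" using norm_triangle_ineq[of "w - z" "z - x"] w z r by simp
        have "norm (w + y - x) \<le> 3 * \<rho>" using norm_triangle_ineq[of "w - x" y] wx y r by (simp add: algebra_simps)
        then have "w + y \<in> ball 0 (7 / 10)" using \<rho> by (intro inb[OF x]) auto
        moreover have "w \<in> ball 0 (7 / 10)" using wx \<rho> by (intro inb[OF x]) auto
        ultimately have "\<bar>fdiff [g, g, g] (u t) w\<bar> \<le> A * norm g powr \<gamma>" "\<bar>fdiff [g, g, g] (u t) (w + y)\<bar> \<le> A * norm g powr \<gamma>"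
          using g0 by (auto intro!: d3[OF t] simp del: fdiff.simps)
        moreover have "fdiff [g, g, g] (fdiff [y] (u t)) w = fdiff [g, g, g] (u t) (w + y) - fdiff [g, g, g] (u t) w"
          by (simp add: algebra_simps)
        ultimately show "\<bar>fdiff [g, g, g] (fdiff [y] (u t)) w\<bar> \<le> 2 * A * norm g powr \<gamma>" by linarith
      qed
      then show ?thesis unfolding fdiff_append by (simp add: c2_def del: fdiff.simps)
    qed
    \<comment> \<open>The opposite regime, one small step h and two steps y: second differences
      along the small direction are two instances of \<open>two_small\<close>, and
      \<open>first_from_second\<close> concludes.\<close>
    have one_small: "\<bar>fdiff [h, y, y] (u t) z\<bar> \<le> c1 * ((4 * c2 + 1) * A) * norm y powr (\<gamma> - p) * norm h powr p"
      if t: "t \<in> ?J" and z: "norm (z - x) \<le> \<rho>" "norm (z + y - x) \<le> \<rho>" and x: "x \<in> ball 0 (13 / 20)"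
        and h: "norm h \<le> norm y" and y: "0 < norm y" "norm y \<le> \<rho>" for t z x h y
    proof -
      let ?B = "(4 * c2 + 1) * A"
      have B: "0 \<le> ?B" using A c2 by simp
      have "\<bar>fdiff [h] (fdiff [y, y] (u t)) z\<bar> \<le> 2 powr p / (1 - 2 powr p / 2) * ?B * norm y powr (\<gamma> - p) * norm h powr p"
      proof (rule first_from_second[OF p(4,2,3) B y(1) _ _ h])
        fix g :: 'a assume g: "norm g \<le> norm y"
        have "z \<in> ball 0 (7 / 10)" using z \<rho> by (intro inb[OF x]) auto
        then have "\<bar>fdiff [g, y, y] (u t) z\<bar> \<le> A * norm y powr \<gamma>" using g y by (intro d3[OF t]) auto
        also have "\<dots> \<le> ?B * norm y powr \<gamma>" using A c2 by (intro mult_right_mono) (auto simp: algebra_simps)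
        finally show "\<bar>fdiff [g] (fdiff [y, y] (u t)) z\<bar> \<le> ?B * norm y powr \<gamma>"
          unfolding fdiff_append by (simp only: append.simps)
        assume "0 < norm g"
        let ?X = "norm y powr (\<gamma> - q) * norm g powr q"
        have "\<bar>fdiff [g, g, y] (u t) z\<bar> \<le> c2 * (2 * A) * norm y powr (\<gamma> - q) * norm g powr q"
          by (rule two_small[OF t z(1) x y g]) simp
        moreover have "\<bar>fdiff [g, g, y] (u t) (z + y)\<bar> \<le> c2 * (2 * A) * norm y powr (\<gamma> - q) * norm g powr q"
          by (rule two_small[OF t z(2) x y g]) simp
        moreover have "fdiff [g, g] (fdiff [y, y] (u t)) z = fdiff [g, g, y] (u t) (z + y) - fdiff [g, g, y] (u t) z"
          by (simp add: algebra_simps)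
        ultimately have "\<bar>fdiff [g, g] (fdiff [y, y] (u t)) z\<bar> \<le> 4 * c2 * A * ?X"
          by (simp only: mult.assoc)
        also have "\<dots> \<le> ?B * ?X" using A by (intro mult_right_mono) (auto simp: algebra_simps)
        finally show "\<bar>fdiff [g, g] (fdiff [y, y] (u t)) z\<bar> \<le> ?B * norm y powr (\<gamma> - q) * norm g powr q"
          by (simp only: mult.assoc)
      qed
      then show ?thesis unfolding fdiff_append by (simp add: c1_def del: fdiff.simps)
    qed
    \<comment> \<open>For small h the integral is split at |y| = |h|. Below, y is the small step and
      \<open>two_small\<close> gives |h|^(\<gamma>-q) |y|^q; above, h is the small step and
      \<open>one_small\<close> gives |h|^p |y|^(\<gamma>-p). Either integrates to
      |h|^\<alpha>.\<close>
    have Lx: "\<bar>L (u t) (x + h) - L (u t) x\<bar> \<le> (C2 - 1) * A * norm h powr \<alpha>"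
      if t: "t \<in> ?J" and x: "x \<in> ball 0 (16 / 25)" "x + h \<in> ball 0 (16 / 25)" for t x h
    proof (cases "norm h \<le> \<rho> / 8")
      case False
      have "\<bar>L (u t) (x + h) - L (u t) x\<bar> \<le> 2 * ((C1 - 1) * A)"
        using Lb[OF t, of x] Lb[OF t, of "x + h"] x by auto
      also have "\<dots> \<le> 2 * (C1 * A)" using A by (simp add: algebra_simps)
      also have "1 \<le> (\<rho> / 8) powr (- \<alpha>) * norm h powr \<alpha>"
      proof -
        have "(\<rho> / 8) powr \<alpha> \<le> norm h powr \<alpha>" using False \<rho> \<alpha> by (intro powr_mono2) auto
        then have "(\<rho> / 8) powr (- \<alpha>) * (\<rho> / 8) powr \<alpha> \<le> (\<rho> / 8) powr (- \<alpha>) * norm h powr \<alpha>"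
          by (intro mult_left_mono) auto
        then show ?thesis using \<rho> by (simp add: powr_minus_divide)
      qed
      then have "2 * (C1 * A) * 1 \<le> 2 * (C1 * A) * ((\<rho> / 8) powr (- \<alpha>) * norm h powr \<alpha>)"
        using C1 A by (intro mult_left_mono) auto
      also have "\<dots> = (2 * C1 * (\<rho> / 8) powr (- \<alpha>)) * (A * norm h powr \<alpha>)" by simp
      also have "\<dots> \<le> (C2 - 1) * (A * norm h powr \<alpha>)"
        using A K1(1) K3(1) c1 c2 P by (intro mult_right_mono) (auto simp: C2_def)
      finally show ?thesis by (simp add: mult.assoc)
    next
      case h8: True
      show ?thesis
      proof (cases "h = 0")
        case False
        define r where "r = norm h"
        have r: "0 < r" "r \<le> \<rho>" using False h8 \<rho> by (auto simp: r_def)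
        let ?v = "fdiff [h] (u t)"
        have x': "x \<in> ball 0 (13 / 20)" using x(1) by simp
        have vm: "?v \<in> borel_measurable borel" by (rule borel_measurable_fdiff[OF um[OF t]])
        have 1: "integrable lborel (\<lambda>y. cutoff \<rho> y * k y * sdiff ?v x y)
          \<and> \<bar>LINT y|lborel. cutoff \<rho> y * k y * sdiff ?v x y\<bar>
            \<le> K1 * ((c2 * (2 * A) * r powr (\<gamma> - q)) * r powr (q - 2 * s)
                + (c1 * ((4 * c2 + 1) * A) * r powr p) * r powr (\<gamma> - p - 2 * s))"
        proof (rule K1(2)[OF k vm \<rho> r(1)])
          show "0 \<le> c2 * (2 * A) * r powr (\<gamma> - q)" "0 \<le> c1 * ((4 * c2 + 1) * A) * r powr p"
            using A c1 c2 by auto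
          fix y :: 'a
          have sd: "sdiff ?v x y = fdiff [y, y, h] (u t) (x - y)" unfolding sdiff_conv_fdiff fdiff_append by simp
          show "\<bar>sdiff ?v x y\<bar> \<le> c2 * (2 * A) * r powr (\<gamma> - q) * norm y powr q" if "norm y < r"
            unfolding sd by (rule two_small[OF t _ x' r]) (use that r in \<open>auto simp: r_def\<close>)
          show "\<bar>sdiff ?v x y\<bar> \<le> c1 * ((4 * c2 + 1) * A) * r powr p * norm y powr (\<gamma> - p)"
            if "r \<le> norm y" "norm y < \<rho>"
          proof -
            have "fdiff [y, y, h] (u t) (x - y) = fdiff [h, y, y] (u t) (x - y)" by (simp add: algebra_simps)
            moreover have "\<bar>fdiff [h, y, y] (u t) (x - y)\<bar> \<le> c1 * ((4 * c2 + 1) * A) * norm y powr (\<gamma> - p) * norm h powr p"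
              by (rule one_small[OF t _ _ x']) (use that r \<rho> in \<open>auto simp: r_def\<close>)
            ultimately show ?thesis unfolding sd by (simp only: r_def mult_ac)
          qed
        qed
        have 2: "\<bar>LINT y|lborel. (1 - cutoff \<rho> y) * k y * sdiff ?v x y\<bar>
            \<le> K3 * (A * norm h powr \<alpha> * \<rho> powr (- 2 * s - \<alpha>) + \<bar>fdiff [h] (u t) x\<bar> * \<rho> powr (- 2 * s))"
          by (rule K3(3)[OF k um[OF t] \<rho> h8 ub[OF t]])
        have vb: "\<bar>?v y\<bar> \<le> 2 ^ length [h] * A" for y by (rule fdiff_bound) (rule ub[OF t])
        have 3: "integrable lborel (\<lambda>y. (1 - cutoff \<rho> y) * k y * sdiff ?v x y)"
          using K3(2)[OF k vm \<rho> vb] by blast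
        have "fdiff [h] (\<lambda>x. L (u t) x) x = L ?v x"
          unfolding L_def using fdiff_integral(1)[of lborel "\<lambda>y x. k y * sdiff (u t) x y" "[h]" x, OF int[OF t]]
          by (simp only: fdiff_sdiff)
        then have Leq: "L (u t) (x + h) - L (u t) x = L ?v x" by simp
        have r1: "r powr (\<gamma> - q) * r powr (q - 2 * s) = r powr \<alpha>" "r powr p * r powr (\<gamma> - p - 2 * s) = r powr \<alpha>"
          by (simp_all add: \<gamma>_def flip: powr_add)
        have d1': "\<bar>fdiff [h] (u t) x\<bar> \<le> A * r powr \<alpha>"
        proof -
          have "\<bar>fdiff [h] (u t) x\<bar> \<le> A * r powr p" using x(1) r by (intro d1[OF t]) (auto simp: r_def)
          also have "\<dots> \<le> A * r powr \<alpha>" using A p r by (intro mult_left_mono powr_mono') (auto simp: \<rho>_def)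
          finally show ?thesis .
        qed
        have "\<bar>L ?v x\<bar> \<le> K1 * ((c2 * (2 * A) * r powr (\<gamma> - q)) * r powr (q - 2 * s)
                + (c1 * ((4 * c2 + 1) * A) * r powr p) * r powr (\<gamma> - p - 2 * s))
            + K3 * (A * norm h powr \<alpha> * \<rho> powr (- 2 * s - \<alpha>) + \<bar>fdiff [h] (u t) x\<bar> * \<rho> powr (- 2 * s))"
          using 1 2 split[OF conjunct1[OF 1] 3] by linarith
        also have "\<dots> = K1 * (c2 * (2 * A) * r powr \<alpha> + c1 * ((4 * c2 + 1) * A) * r powr \<alpha>)
            + K3 * (A * r powr \<alpha> * \<rho> powr (- 2 * s - \<alpha>) + \<bar>fdiff [h] (u t) x\<bar> * \<rho> powr (- 2 * s))"
          using r1 by (simp only: mult.assoc r_def)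
        also have "\<dots> \<le> K1 * (c2 * (2 * A) * r powr \<alpha> + c1 * ((4 * c2 + 1) * A) * r powr \<alpha>)
            + K3 * (A * r powr \<alpha> * P + A * r powr \<alpha> * P)"
        proof (rule add_left_mono, rule mult_left_mono, rule add_mono)
          show "A * r powr \<alpha> * \<rho> powr (- 2 * s - \<alpha>) \<le> A * r powr \<alpha> * P"
            using A P by (intro mult_left_mono) auto
          show "\<bar>fdiff [h] (u t) x\<bar> * \<rho> powr (- 2 * s) \<le> A * r powr \<alpha> * P"
            using A P d1' by (intro mult_mono) auto
        qed (use K3 in auto)
        also have "\<dots> = (K1 * (2 * c2 + 4 * c2 * c1 + c1) + 2 * K3 * P) * (A * r powr \<alpha>)"
          by (simp add: algebra_simps)
        also have "\<dots> \<le> (C2 - 1) * (A * r powr \<alpha>)"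
          using A C1 by (intro mult_right_mono) (auto simp: C2_def)
        finally show ?thesis unfolding Leq by (simp add: r_def mult.assoc)
      qed simp
    qed
    have u'x: "\<bar>u' t (x + h) - u' t x\<bar> \<le> C2 * A * norm h powr \<alpha>"
      if t: "t \<in> ?J" and x: "x \<in> ball 0 (16 / 25)" "x + h \<in> ball 0 (16 / 25)" for t x h
    proof -
      have x': "x \<in> ball 0 (7 / 10)" "x + h \<in> ball 0 (7 / 10)" using x by auto
      have "u' t x = L (u t) x + f t x" "u' t (x + h) = L (u t) (x + h) + f t (x + h)"
        using eqn[OF t x'(1)] eqn[OF t x'(2)] by (simp_all add: L_def)
      moreover have "\<bar>f t (x + h) - f t x\<bar> \<le> A * norm h powr \<alpha>" using fx[OF t x'(2,1)] by simp
      moreover have "(C2 - 1) * A * norm h powr \<alpha> = C2 * A * norm h powr \<alpha> - A * norm h powr \<alpha>"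
        by (simp add: left_diff_distrib)
      ultimately show ?thesis using Lx[OF t x] by linarith
    qed
    \<comment> \<open>Mean value theorem in time for the spatial increment of u, with the bound on
      the spatial increment of u' just found.\<close>
    have u'xt: "\<bar>(u t (x + h) - u t x) - (u t' (x + h) - u t' x)\<bar> \<le> C2 * A * norm h powr \<alpha> * \<bar>t - t'\<bar>"
      if t: "t \<in> ?J" "t' \<in> ?J" and x: "x \<in> ball 0 (16 / 25)" "x + h \<in> ball 0 (16 / 25)" for t t' x h
    proof -
      have "norm ((\<lambda>t. u t (x + h) - u t x) t - (\<lambda>t. u t (x + h) - u t x) t') \<le> C2 * A * norm h powr \<alpha> * norm (t - t')"
      proof (rule field_differentiable_bound[where S = ?J and f' = "\<lambda>t. u' t (x + h) - u' t x"])
        fix \<tau> assume \<tau>: "\<tau> \<in> ?J"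
        have "((\<lambda>t. u t (x + h) - u t x) has_real_derivative u' \<tau> (x + h) - u' \<tau> x) (at \<tau>)"
          using x by (intro DERIV_diff der[OF \<tau>]) auto
        then show "((\<lambda>t. u t (x + h) - u t x) has_field_derivative u' \<tau> (x + h) - u' \<tau> x) (at \<tau> within ?J)"
          by (rule has_field_derivative_at_within)
        show "norm (u' \<tau> (x + h) - u' \<tau> x) \<le> C2 * A * norm h powr \<alpha>" using u'x[OF \<tau> x] by simp
      qed (use t in auto)
      then show ?thesis by simp
    qed
    \<comment> \<open>With r = |t - t'|^(1/(2s)) the increments of v = u(t) - u(t') are of order
      |h|^\<alpha> r^(2s). For |y| >= r this is used directly. For |y| < r it supplies the start of
      the doubling at scale r, where it has size r^\<gamma>, and the third differences of u(t) and
      u(t') do the rest. The tail uses the global bound A r^\<alpha> on v.\<close>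
    have Lt: "\<bar>L (u t) x - L (u t') x\<bar> \<le> (C3 - 1) * A * \<bar>t - t'\<bar> powr (\<alpha> / (2 * s))"
      if t: "t \<in> ?J" "t' \<in> ?J" and x: "x \<in> ball 0 (3 / 5)" for t t' x
    proof (cases "t = t'")
      case False
      define r where "r = \<bar>t - t'\<bar> powr (1 / (2 * s))"
      have r0: "0 < r" using False by (simp add: r_def)
      have r2s: "r powr (2 * s) = \<bar>t - t'\<bar>" using False s by (simp add: r_def powr_powr)
      have r\<alpha>: "\<bar>t - t'\<bar> powr (\<alpha> / (2 * s)) = r powr \<alpha>" by (simp add: r_def powr_powr)
      have x': "x \<in> ball 0 (13 / 20)" using x by simp
      show ?thesis
      proof (cases "r \<le> \<rho>")
        case F: False
        have "\<bar>L (u t) x - L (u t') x\<bar> \<le> 2 * ((C1 - 1) * A)"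
          using Lb[OF t(1) x'] Lb[OF t(2) x'] by auto
        also have "\<dots> \<le> 2 * (C1 * A)" using A by (simp add: algebra_simps)
        also have "1 \<le> \<rho> powr (- \<alpha>) * r powr \<alpha>"
        proof -
          have "\<rho> powr \<alpha> \<le> r powr \<alpha>" using F \<rho> \<alpha> by (intro powr_mono2) auto
          then have "\<rho> powr (- \<alpha>) * \<rho> powr \<alpha> \<le> \<rho> powr (- \<alpha>) * r powr \<alpha>"
            by (intro mult_left_mono) auto
          then show ?thesis using \<rho> by (simp add: powr_minus_divide)
        qed
        then have "2 * (C1 * A) * 1 \<le> 2 * (C1 * A) * (\<rho> powr (- \<alpha>) * r powr \<alpha>)"
          using C1 A by (intro mult_left_mono) auto
        also have "\<dots> = (2 * C1 * \<rho> powr (- \<alpha>)) * (A * r powr \<alpha>)" by simp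
        also have "\<dots> \<le> (C3 - 1) * (A * r powr \<alpha>)"
          using A K2(1) K3(1) C2 c2 P by (intro mult_right_mono) (auto simp: C3_def)
        finally show ?thesis by (simp add: r\<alpha> mult.assoc)
      next
        case r1: True
        define v where "v = (\<lambda>z. u t z - u t' z)"
        have vm: "v \<in> borel_measurable borel" unfolding v_def using um[OF t(1)] um[OF t(2)] by simp
        have vb: "\<bar>v z\<bar> \<le> A * r powr \<alpha>" for z
          unfolding v_def using ut[OF t] r\<alpha> by simp
        have vd: "\<bar>v (z + h) - v z\<bar> \<le> C2 * A * norm h powr \<alpha> * r powr (2 * s)"
          if "norm (z - x) \<le> 3 * \<rho>" "norm (z + h - x) \<le> 3 * \<rho>" for z h
        proof -
          have "norm z \<le> norm x + norm (z - x)" "norm (z + h) \<le> norm x + norm (z + h - x)"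
            using norm_triangle_ineq[of x "z - x"] norm_triangle_ineq[of x "z + h - x"] by auto
          then have "z \<in> ball 0 (16 / 25)" "z + h \<in> ball 0 (16 / 25)" using that x by (auto simp: \<rho>_def)
          from u'xt[OF t this] show ?thesis unfolding r2s v_def by (simp add: algebra_simps)
        qed
        have sd1: "\<bar>sdiff v x y\<bar> \<le> c2 * ((2 * C2 + 2) * A) * r powr (\<gamma> - q) * norm y powr q" if y: "norm y < r" for y
        proof -
          have "\<bar>fdiff [y, y] v (x - y)\<bar> \<le> 2 powr q / (1 - 2 powr q / 4) * ((2 * C2 + 2) * A) * r powr (\<gamma> - q) * norm y powr q"
          proof (rule second_from_third[OF q(4,2,3) _ r0])
            show "0 \<le> (2 * C2 + 2) * A" using C2 A by simp
            show "norm y \<le> r" using y by simp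
            fix g :: 'a assume g: "norm g \<le> r"
            have "\<bar>v (x - y + g + g) - v (x - y + g)\<bar> \<le> C2 * A * norm g powr \<alpha> * r powr (2 * s)"
              "\<bar>v (x - y + g) - v (x - y)\<bar> \<le> C2 * A * norm g powr \<alpha> * r powr (2 * s)"
            proof -
              have "norm (- y + g) \<le> 2 * r" using norm_triangle_ineq[of "- y" g] g y by simp
              moreover have "norm (- y + g + g) \<le> 3 * r"
                using norm_triangle_ineq[of "- y + g" g] g calculation by simp
              moreover have e: "x - y + g - x = - y + g" "x - y + g + g - x = - y + g + g" "x - y - x = - y"
                by (simp_all add: algebra_simps)
              ultimately have n: "norm (x - y - x) \<le> 3 * \<rho>" "norm (x - y + g - x) \<le> 3 * \<rho>"
                "norm (x - y + g + g - x) \<le> 3 * \<rho>"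
                using r1 y \<rho> unfolding e by auto
              show "\<bar>v (x - y + g + g) - v (x - y + g)\<bar> \<le> C2 * A * norm g powr \<alpha> * r powr (2 * s)"
                by (rule vd[OF n(2,3)])
              show "\<bar>v (x - y + g) - v (x - y)\<bar> \<le> C2 * A * norm g powr \<alpha> * r powr (2 * s)"
                by (rule vd[OF n(1,2)])
            qed
            then have "\<bar>fdiff [g, g] v (x - y)\<bar> \<le> 2 * (C2 * A * norm g powr \<alpha> * r powr (2 * s))"
              by simp
            also have "\<dots> \<le> 2 * (C2 * A * r powr \<alpha> * r powr (2 * s))"
              using g \<alpha> C2 A by (intro mult_left_mono mult_right_mono powr_mono2) auto
            also have "\<dots> = 2 * C2 * A * r powr \<gamma>" by (simp add: \<gamma>_def powr_add)
            also have "\<dots> \<le> (2 * C2 + 2) * A * r powr \<gamma>" using A by (intro mult_right_mono) auto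
            finally show "\<bar>fdiff [g, g] v (x - y)\<bar> \<le> (2 * C2 + 2) * A * r powr \<gamma>" .
            fix z assume g0: "0 < norm g" and z: "norm (z - (x - y)) \<le> r"
            have "norm (z - x) \<le> 2 * r" using norm_triangle_ineq[of "z - (x - y)" "- y"] z y by simp
            then have zb: "z \<in> ball 0 (7 / 10)" using r1 \<rho> by (intro inb[OF x']) auto
            have "\<bar>fdiff [g, g, g] (u t) z\<bar> \<le> A * norm g powr \<gamma>" "\<bar>fdiff [g, g, g] (u t') z\<bar> \<le> A * norm g powr \<gamma>"
              using g0 by (auto intro!: d3[OF t(1) zb] d3[OF t(2) zb] simp del: fdiff.simps)
            then have "\<bar>fdiff [g, g, g] v z\<bar> \<le> 2 * (A * norm g powr \<gamma>)"
              unfolding v_def fdiff_diff by linarith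
            also have "\<dots> \<le> (2 * C2 + 2) * A * norm g powr \<gamma>" using A C2 by (simp add: algebra_simps)
            finally show "\<bar>fdiff [g, g, g] v z\<bar> \<le> (2 * C2 + 2) * A * norm g powr \<gamma>" .
          qed
          then show ?thesis unfolding sdiff_conv_fdiff c2_def .
        qed
        have 1: "integrable lborel (\<lambda>y. cutoff \<rho> y * k y * sdiff v x y)
          \<and> \<bar>LINT y|lborel. cutoff \<rho> y * k y * sdiff v x y\<bar>
            \<le> K2 * ((c2 * ((2 * C2 + 2) * A) * r powr (\<gamma> - q)) * r powr (q - 2 * s)
                + (2 * C2 * A * r powr (2 * s)) * r powr (\<alpha> - 2 * s))"
        proof (rule K2(2)[OF k vm \<rho> r0])
          show "0 \<le> c2 * ((2 * C2 + 2) * A) * r powr (\<gamma> - q)" "0 \<le> 2 * C2 * A * r powr (2 * s)"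
            using A C2 c2 by auto
          fix y :: 'a
          show "\<bar>sdiff v x y\<bar> \<le> c2 * ((2 * C2 + 2) * A) * r powr (\<gamma> - q) * norm y powr q" if "norm y < r"
            by (rule sd1[OF that])
          show "\<bar>sdiff v x y\<bar> \<le> 2 * C2 * A * r powr (2 * s) * norm y powr \<alpha>" if "r \<le> norm y" "norm y < \<rho>"
          proof -
            have "\<bar>v (x + y) - v x\<bar> \<le> C2 * A * norm y powr \<alpha> * r powr (2 * s)"
              using that \<rho> by (intro vd) auto
            moreover have "\<bar>v (x + - y) - v x\<bar> \<le> C2 * A * norm (- y) powr \<alpha> * r powr (2 * s)"
              using that \<rho> by (intro vd) auto
            ultimately have "\<bar>sdiff v x y\<bar> \<le> 2 * (C2 * A * norm y powr \<alpha> * r powr (2 * s))"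
              unfolding sdiff_def by (simp add: abs_le_iff)
            then show ?thesis by (simp only: mult_ac)
          qed
        qed
        have 2: "integrable lborel (\<lambda>y. (1 - cutoff \<rho> y) * k y * sdiff v x y)
          \<and> \<bar>LINT y|lborel. (1 - cutoff \<rho> y) * k y * sdiff v x y\<bar> \<le> K3 * (A * r powr \<alpha>) * \<rho> powr (- 2 * s)"
          by (rule K3(2)[OF k vm \<rho> vb])
        have Leq: "L (u t) x - L (u t') x = L v x"
          unfolding L_def Bochner_Integration.integral_diff[OF int[OF t(1)] int[OF t(2)], symmetric]
          by (simp add: sdiff_def v_def algebra_simps)
        have r12: "r powr (\<gamma> - q) * r powr (q - 2 * s) = r powr \<alpha>" "r powr (2 * s) * r powr (\<alpha> - 2 * s) = r powr \<alpha>"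
          by (simp_all add: \<gamma>_def flip: powr_add)
        have "\<bar>L v x\<bar> \<le> K2 * ((c2 * ((2 * C2 + 2) * A) * r powr (\<gamma> - q)) * r powr (q - 2 * s)
                + (2 * C2 * A * r powr (2 * s)) * r powr (\<alpha> - 2 * s)) + K3 * (A * r powr \<alpha>) * \<rho> powr (- 2 * s)"
          using 1 2 split[OF conjunct1[OF 1] conjunct1[OF 2]] by linarith
        also have "\<dots> = K2 * (c2 * ((2 * C2 + 2) * A) * r powr \<alpha> + 2 * C2 * A * r powr \<alpha>) + K3 * (A * r powr \<alpha>) * \<rho> powr (- 2 * s)"
          using r12 by (simp only: mult.assoc)
        also have "\<dots> \<le> K2 * (c2 * ((2 * C2 + 2) * A) * r powr \<alpha> + (2 * C2 + 2) * A * r powr \<alpha>) + K3 * (A * r powr \<alpha>) * (2 * P)"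
        proof (rule add_mono, rule mult_left_mono, rule add_left_mono)
          show "2 * C2 * A * r powr \<alpha> \<le> (2 * C2 + 2) * A * r powr \<alpha>"
            using A by (intro mult_right_mono) auto
          show "K3 * (A * r powr \<alpha>) * \<rho> powr (- 2 * s) \<le> K3 * (A * r powr \<alpha>) * (2 * P)"
            using A K3(1) P by (intro mult_left_mono) auto
        qed (use K2 in auto)
        also have "\<dots> = (K2 * (2 * C2 + 2) * (c2 + 1) + 2 * K3 * P) * (A * r powr \<alpha>)"
          by (simp add: algebra_simps)
        also have "\<dots> \<le> (C3 - 1) * (A * r powr \<alpha>)"
          using A C1 by (intro mult_right_mono) (auto simp: C3_def)
        finally show ?thesis unfolding Leq by (simp add: r\<alpha> mult.assoc)
      qed
    qed simp
    have x: "x \<in> ball 0 (13 / 20)" "x \<in> ball 0 (7 / 10)" using prems(16) by auto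
    have "\<bar>u' t x\<bar> \<le> C1 * A" by (rule u'b[OF prems(14) x(1)])
    then have 1: "\<bar>u' t x\<bar> \<le> (C1 + C3) * A" using C3 A by (simp add: distrib_right add_increasing2)
    let ?B = "A * \<bar>t - t'\<bar> powr (\<alpha> / (2 * s))"
    have "u' t x = L (u t) x + f t x" "u' t' x = L (u t') x + f t' x"
      using eqn[OF prems(14) x(2)] eqn[OF prems(15) x(2)] by (simp_all add: L_def)
    then have "\<bar>u' t x - u' t' x\<bar> \<le> (C3 - 1) * ?B + ?B"
      using Lt[OF prems(14-16)] ft[OF prems(14,15) x(2)] unfolding mult.assoc by linarith
    also have "\<dots> = C3 * ?B" by (simp add: algebra_simps)
    also have "\<dots> \<le> (C1 + C3) * ?B" using C1 A by (intro mult_right_mono) auto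
    finally show ?case using 1 by (simp add: mult.assoc)
  qed
  qed
  qed
  qed
qed

end

subsection \<open>Derivatives from difference bounds\<close>

lemma geometric_increments:
  fixes b :: "nat \<Rightarrow> real"
  assumes \<omega>: "0 \<le> \<omega>" "\<omega> < 1" and inc: "\<And>i. \<bar>b (Suc i) - b i\<bar> \<le> B * \<omega> ^ i"
  obtains l where "b \<longlonglongrightarrow> l" "\<bar>l - b 0\<bar> \<le> B / (1 - \<omega>)"
proof -
  have B: "summable (\<lambda>i. B * \<omega> ^ i)" using \<omega> by (intro summable_mult summable_geometric) simp
  have s: "summable (\<lambda>i. \<bar>b (Suc i) - b i\<bar>)"
    by (rule summable_comparison_test'[OF B, of 0]) (use inc in simp)
  then have s': "summable (\<lambda>i. b (Suc i) - b i)" by (rule summable_rabs_cancel)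
  have "(\<lambda>n. \<Sum>i<n. b (Suc i) - b i) \<longlonglongrightarrow> (\<Sum>i. b (Suc i) - b i)"
    by (rule summable_LIMSEQ[OF s'])
  then have "(\<lambda>n. b n - b 0) \<longlonglongrightarrow> (\<Sum>i. b (Suc i) - b i)" by (simp add: sum_lessThan_telescope)
  then have "(\<lambda>n. (b n - b 0) + b 0) \<longlonglongrightarrow> (\<Sum>i. b (Suc i) - b i) + b 0" by (intro tendsto_add tendsto_const)
  then have l: "b \<longlonglongrightarrow> (\<Sum>i. b (Suc i) - b i) + b 0" by simp
  have "\<bar>\<Sum>i. b (Suc i) - b i\<bar> \<le> (\<Sum>i. \<bar>b (Suc i) - b i\<bar>)" by (rule summable_rabs[OF s])
  also have "\<dots> \<le> (\<Sum>i. B * \<omega> ^ i)" by (rule suminf_le[OF inc s B])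
  also have "\<dots> = B / (1 - \<omega>)"
    using suminf_mult[OF summable_geometric, of \<omega> B] suminf_geometric[of \<omega>] \<omega> by simp
  finally show thesis using l by (intro that) auto
qed

text \<open>Cauchy's functional equation: additivity gives homogeneity for integers, and the bound
  near 0 extends it to the reals.\<close>

lemma additive_bounded_imp_linear:
  fixes f :: "'a::real_normed_vector \<Rightarrow> real"
  assumes add: "\<And>x y. f (x + y) = f x + f y"
    and bnd: "\<And>x. norm x \<le> \<delta> \<Longrightarrow> \<bar>f x\<bar> \<le> M" and \<delta>: "0 < \<delta>"
  shows "linear f" and "\<bar>f x\<bar> \<le> M / \<delta> * norm x"
proof -
  have f0: "f 0 = 0" using add[of 0 0] by simp
  have fnat: "f (real n *\<^sub>R x) = real n * f x" for n x
    by (induction n) (simp_all add: f0 add scaleR_left_distrib distrib_right)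
  have fneg: "f (- x) = - f x" for x using add[of x "- x"] f0 by simp
  have fint: "f (real_of_int z *\<^sub>R x) = real_of_int z * f x" for z x
  proof (cases "0 \<le> z")
    case True then show ?thesis using fnat[of "nat z" x] by simp
  next
    case False then show ?thesis using fnat[of "nat (- z)" x] fneg[of "real (nat (- z)) *\<^sub>R x"] by simp
  qed
  have M: "0 \<le> M" using bnd[of 0] \<delta> f0 by simp
  have scale: "f (c *\<^sub>R x) = c * f x" for c x
  proof -
    obtain j where j: "0 < j" "norm x \<le> real j * \<delta>"
    proof -
      obtain j where "norm x / \<delta> < real j" using reals_Archimedean2 by blast
      then show thesis using \<delta> by (intro that[of "Suc j"]) (auto simp: field_simps intro: less_imp_le order_trans)
    qed
    have b: "\<bar>f (\<theta> *\<^sub>R x)\<bar> \<le> real j * M" if "0 \<le> \<theta>" "\<theta> \<le> 1" for \<theta>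
    proof -
      have "norm ((\<theta> / real j) *\<^sub>R x) \<le> norm x / real j"
        using that j by (simp add: divide_right_mono mult_left_le_one_le)
      also have "\<dots> \<le> \<delta>" using j by (simp add: field_simps)
      finally have "\<bar>f ((\<theta> / real j) *\<^sub>R x)\<bar> \<le> M" by (rule bnd)
      then have "real j * \<bar>f ((\<theta> / real j) *\<^sub>R x)\<bar> \<le> real j * M" by (intro mult_left_mono) auto
      moreover have "f (\<theta> *\<^sub>R x) = real j * f ((\<theta> / real j) *\<^sub>R x)"
        using fnat[of j "(\<theta> / real j) *\<^sub>R x"] j by simp
      ultimately show ?thesis by (simp add: abs_mult)
    qed
    \<comment> \<open>n E depends on the product n c only through its fractional part, so it stays
      bounded as n grows, and E must vanish.\<close>
    define E where "E = f (c *\<^sub>R x) - c * f x"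
    have "real n * \<bar>E\<bar> \<le> \<bar>f x\<bar> + real j * M" for n
    proof -
      let ?z = "\<lfloor>real n * c\<rfloor>" and ?t = "frac (real n * c)"
      have z: "real n * c = real_of_int ?z + ?t" by (simp add: frac_def)
      have "real n * f (c *\<^sub>R x) = f ((real n * c) *\<^sub>R x)" using fnat[of n "c *\<^sub>R x"] by simp
      also have "\<dots> = real_of_int ?z * f x + f (?t *\<^sub>R x)"
        by (subst z) (simp only: scaleR_left_distrib add fint)
      finally have n: "real n * f (c *\<^sub>R x) = real_of_int ?z * f x + f (?t *\<^sub>R x)" .
      have "real n * E = real n * f (c *\<^sub>R x) - (real n * c) * f x"
        by (simp add: E_def right_diff_distrib)
      also have "\<dots> = (real_of_int ?z * f x + f (?t *\<^sub>R x)) - (real_of_int ?z + ?t) * f x"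
        using n z by (simp only:)
      finally have "real n * E = f (?t *\<^sub>R x) - ?t * f x" by (simp add: distrib_right)
      moreover have "\<bar>?t * f x\<bar> \<le> \<bar>f x\<bar>"
        using frac_lt_1[of "real n * c"] by (simp add: abs_mult mult_left_le_one_le)
      moreover have "\<bar>f (?t *\<^sub>R x)\<bar> \<le> real j * M" using frac_lt_1[of "real n * c"] by (intro b) auto
      ultimately have "\<bar>real n * E\<bar> \<le> \<bar>f x\<bar> + real j * M" by linarith
      then show ?thesis by (simp add: abs_mult)
    qed
    moreover obtain n where "(\<bar>f x\<bar> + real j * M) < real n * \<bar>E\<bar>" if "E \<noteq> 0"
      using reals_Archimedean3[of "\<bar>E\<bar>"] by (metis zero_less_abs_iff)
    ultimately have "E = 0" by (metis not_le)
    then show ?thesis by (simp add: E_def)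
  qed
  show "linear f" by (rule linearI) (simp_all add: add scale)
  show "\<bar>f x\<bar> \<le> M / \<delta> * norm x"
  proof (cases "x = 0")
    case False
    have "x = (norm x / \<delta>) *\<^sub>R ((\<delta> / norm x) *\<^sub>R x)" using False \<delta> by simp
    then have "f x = norm x / \<delta> * f ((\<delta> / norm x) *\<^sub>R x)" using scale by metis
    moreover have "\<bar>f ((\<delta> / norm x) *\<^sub>R x)\<bar> \<le> M" using False \<delta> by (intro bnd) simp
    then have "norm x / \<delta> * \<bar>f ((\<delta> / norm x) *\<^sub>R x)\<bar> \<le> norm x / \<delta> * M" using \<delta> by (intro mult_left_mono) auto
    ultimately show ?thesis using \<delta> by (simp add: abs_mult mult.commute)
  qed (simp add: f0)
qed

text \<open>The quotients run along dyadic steps because two consecutive ones differ by 2^i times a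
  second difference with both steps h / 2^(i+1), exactly what the hypotheses bound. The limit is
  taken for each h separately, so linearity in h can be proved before differentiability.\<close>

definition dderiv :: "('a::real_normed_vector \<Rightarrow> real) \<Rightarrow> 'a \<Rightarrow> 'a \<Rightarrow> real" where
  "dderiv g x h = lim (\<lambda>i. 2 ^ i * (g (x + (1 / 2 ^ i) *\<^sub>R h) - g x))"

lemma dderiv_limit:
  fixes g :: "'a::euclidean_space \<Rightarrow> real"
  assumes q: "1 < q"
    and d2: "\<And>x h k r. norm h \<le> r \<Longrightarrow> norm k \<le> r \<Longrightarrow> 0 < r \<Longrightarrow> norm x + norm h + norm k < R
        \<Longrightarrow> \<bar>fdiff [h, k] g x\<bar> \<le> A * r powr q"
    and A: "0 \<le> A" and x: "norm x < R"
  shows "(\<lambda>i. 2 ^ i * (g (x + (1 / 2 ^ i) *\<^sub>R h) - g x)) \<longlonglongrightarrow> dderiv g x h" (is ?lim)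
    and "norm x + norm h < R \<Longrightarrow> \<bar>dderiv g x h - (g (x + h) - g x)\<bar> \<le> A / (1 - 2 powr (1 - q)) * norm h powr q"
proof -
  let ?\<omega> = "2 powr (1 - q) :: real"
  have \<omega>: "0 \<le> ?\<omega>" "?\<omega> < 1" using powr_less_cancel_iff[of 2 "1 - q" 0] q by auto
  let ?a = "\<lambda>h i. 2 ^ i * (g (x + (1 / 2 ^ i) *\<^sub>R h) - g x)"
  have small: "\<exists>l. ?a h \<longlonglongrightarrow> l \<and> \<bar>l - (g (x + h) - g x)\<bar> \<le> A / (1 - ?\<omega>) * norm h powr q"
    if h: "norm x + norm h < R" for h
  proof (cases "h = 0")
    case False
    have "\<bar>?a h (Suc i) - ?a h i\<bar> \<le> (A * norm h powr q) * ?\<omega> ^ i" for i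
    proof -
      let ?k = "(1 / 2 ^ Suc i) *\<^sub>R h"
      have kk: "(1 / 2 ^ i) *\<^sub>R h = ?k + ?k" by (simp flip: scaleR_2)
      have "?a h (Suc i) - ?a h i = - (2 ^ i * fdiff [?k, ?k] g x)"
        unfolding kk by (simp add: algebra_simps)
      moreover have "\<bar>fdiff [?k, ?k] g x\<bar> \<le> A * norm ?k powr q"
      proof (rule d2)
        have "norm ?k + norm ?k = norm h / 2 ^ i" by simp
        also have "\<dots> \<le> norm h / 1" by (rule divide_left_mono) auto
        finally have "norm ?k + norm ?k \<le> norm h" by simp
        then show "norm x + norm ?k + norm ?k < R" using h by linarith
      qed (use False in auto)
      ultimately have "\<bar>?a h (Suc i) - ?a h i\<bar> \<le> 2 ^ i * (A * norm ?k powr q)"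
        by (simp add: abs_mult)
      also have "norm ?k powr q \<le> (norm h / 2 ^ i) powr q"
        using q by (intro powr_mono2) (auto simp: divide_left_mono)
      then have "2 ^ i * (A * norm ?k powr q) \<le> 2 ^ i * (A * (norm h / 2 ^ i) powr q)"
        using A by (intro mult_left_mono) auto
      also have "\<dots> = (A * norm h powr q) * (2 ^ i * (1 / (2 ^ i) powr q))"
        by (simp add: powr_divide)
      also have "2 ^ i * (1 / (2 ^ i) powr q) = ?\<omega> ^ i"
      proof -
        have "(2::real) ^ i = 2 powr real i" by (simp add: powr_realpow)
        then have "(2::real) ^ i * (1 / (2 ^ i) powr q) = 2 powr (real i - real i * q)"
          by (simp add: powr_powr powr_diff)
        also have "real i - real i * q = (1 - q) * real i" by (simp add: algebra_simps)
        also have "2 powr ((1 - q) * real i) = ?\<omega> ^ i"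
          by (simp add: powr_powr[symmetric] powr_realpow)
        finally show ?thesis .
      qed
      finally show ?thesis .
    qed
    then obtain l where "?a h \<longlonglongrightarrow> l" "\<bar>l - ?a h 0\<bar> \<le> (A * norm h powr q) / (1 - ?\<omega>)"
      by (rule geometric_increments[OF \<omega>])
    then show ?thesis by (intro exI[of _ l]) auto
  qed (auto intro!: exI[of _ 0])
  \<comment> \<open>A long h leaves the ball, but h / 2^j does not for large j; its sequence is the
    one for h, shifted by j and divided by 2^j.\<close>
  have conv: "\<exists>l. ?a h \<longlonglongrightarrow> l" for h
  proof -
    obtain j where "norm h / (R - norm x) < 2 ^ j" using real_arch_pow[of 2] by auto
    then have "norm x + norm ((1 / 2 ^ j) *\<^sub>R h) < R" using x by (simp add: field_simps)
    from small[OF this] obtain l where "?a ((1 / 2 ^ j) *\<^sub>R h) \<longlonglongrightarrow> l" by blast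
    then have "(\<lambda>i. 2 ^ j * ?a ((1 / 2 ^ j) *\<^sub>R h) i) \<longlonglongrightarrow> 2 ^ j * l" by (intro tendsto_mult tendsto_const)
    moreover have "(\<lambda>i. 2 ^ j * ?a ((1 / 2 ^ j) *\<^sub>R h) i) = (\<lambda>i. ?a h (i + j))"
      by (rule ext) (simp add: power_add mult_ac)
    ultimately have "(\<lambda>i. ?a h (i + j)) \<longlonglongrightarrow> 2 ^ j * l" by (simp only:)
    then show ?thesis by (auto dest: LIMSEQ_offset)
  qed
  show lim: ?lim using conv[of h] unfolding dderiv_def by (auto dest: limI)
  assume "norm x + norm h < R"
  from small[OF this] obtain l where "?a h \<longlonglongrightarrow> l" "\<bar>l - (g (x + h) - g x)\<bar> \<le> A / (1 - ?\<omega>) * norm h powr q" by blast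
  then show "\<bar>dderiv g x h - (g (x + h) - g x)\<bar> \<le> A / (1 - 2 powr (1 - q)) * norm h powr q"
    using LIMSEQ_unique[OF lim] by auto
qed

text \<open>\<open>dderiv g x\<close> is additive because second differences with steps of order
  2^(-i) are o(2^(-i)) for q > 1, and it is bounded near 0, hence linear. The error bound of
  \<open>dderiv_limit\<close> then is differentiability with remainder |h|^q.\<close>

lemma derivative_from_second_differences:
  fixes q R R' :: real
  assumes q: "1 < q" "q < 2" and R: "0 < R'" "R' < R" "R \<le> 1"
  obtains C where "1 \<le> C"
    "\<And>(g::'a::euclidean_space \<Rightarrow> real) A x x' e.
      \<lbrakk>0 \<le> A; \<And>x. norm x < R \<Longrightarrow> \<bar>g x\<bar> \<le> A;
       \<And>x h k r. norm h \<le> r \<Longrightarrow> norm k \<le> r \<Longrightarrow> 0 < r \<Longrightarrow> norm x + norm h + norm k < R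
        \<Longrightarrow> \<bar>fdiff [h, k] g x\<bar> \<le> A * r powr q; norm x < R'; norm x' < R'\<rbrakk>
      \<Longrightarrow> (g has_derivative dderiv g x) (at x) \<and> \<bar>dderiv g x e\<bar> \<le> C * A * norm e
        \<and> \<bar>dderiv g x e - dderiv g x' e\<bar> \<le> C * A * norm (x - x') powr (q - 1) * norm e"
proof -
  define c where "c = 1 / (1 - 2 powr (1 - q))"
  define \<delta> where "\<delta> = (R - R') / 4"
  have c: "0 < c" using powr_less_cancel_iff[of 2 "1 - q" 0] q by (auto simp: c_def)
  have \<delta>: "0 < \<delta>" "\<delta> \<le> 1" using R by (auto simp: \<delta>_def)
  have \<delta>4: "4 * \<delta> = R - R'" by (simp add: \<delta>_def)
  \<comment> \<open>For |h| <= \<delta> the derivative differs by at most c A from an increment of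
    g, which is at most 2 A; linearity scales this to a bound on all vectors.\<close>
  define C1 where "C1 = (2 + c) / \<delta>"
  define C where "C = 1 + C1 + (1 + 2 * c) + 2 * C1 * \<delta> powr (1 - q)"
  have C1: "0 < C1" using c \<delta> by (simp add: C1_def)
  show thesis
  proof (rule that[of C], goal_cases)
    case 1 show ?case using C1 c by (simp add: C_def)
  next
    case prems: (2 g A x x' e)
    note A = prems(1) and gb = prems(2) and d2 = prems(3)
    have lim: "(\<lambda>i. 2 ^ i * (g (x + (1 / 2 ^ i) *\<^sub>R h) - g x)) \<longlonglongrightarrow> dderiv g x h" if "norm x < R" for x h
      by (rule dderiv_limit(1)[OF q(1) _ A that]) (rule d2)
    have err: "\<bar>dderiv g x h - (g (x + h) - g x)\<bar> \<le> A / (1 - 2 powr (1 - q)) * norm h powr q"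
      if "norm x < R" "norm x + norm h < R" for x h
      by (rule dderiv_limit(2)[OF q(1) _ A that]) (rule d2)
    have err': "\<bar>dderiv g x h - (g (x + h) - g x)\<bar> \<le> c * A * norm h powr q" if "norm x + norm h < R" for x h
    proof -
      have "norm x < R" using that norm_ge_zero[of h] by linarith
      from err[OF this that] show ?thesis by (simp add: c_def)
    qed
    have add: "dderiv g x (h + k) = dderiv g x h + dderiv g x k" if x: "norm x < R" for x h k
    proof (rule LIMSEQ_unique[OF lim[OF x]])
      let ?a = "\<lambda>h i. 2 ^ i * (g (x + (1 / 2 ^ i) *\<^sub>R h) - g x)"
      let ?r = "norm h + norm k + 1"
      have z: "(\<lambda>i. 2 ^ i * fdiff [(1 / 2 ^ i) *\<^sub>R h, (1 / 2 ^ i) *\<^sub>R k] g x) \<longlonglongrightarrow> 0"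
      proof (rule Lim_null_comparison)
        show "(\<lambda>i. A * ?r powr q * (2 powr (1 - q)) ^ i) \<longlonglongrightarrow> 0"
          using powr_less_cancel_iff[of 2 "1 - q" 0] q
          by (intro tendsto_mult_right_zero LIMSEQ_power_zero) auto
        obtain j where j: "2 * ?r / (R - norm x) < 2 ^ j" using real_arch_pow[of 2] by auto
        show "\<forall>\<^sub>F i in sequentially. norm (2 ^ i * fdiff [(1 / 2 ^ i) *\<^sub>R h, (1 / 2 ^ i) *\<^sub>R k] g x)
            \<le> A * ?r powr q * (2 powr (1 - q)) ^ i"
        proof (rule eventually_sequentiallyI[of j])
          fix i assume "j \<le> i"
          then have "(2::real) ^ j \<le> 2 ^ i" by simp
          then have i: "2 * ?r / (R - norm x) < 2 ^ i" using j by linarith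
          have "\<bar>fdiff [(1 / 2 ^ i) *\<^sub>R h, (1 / 2 ^ i) *\<^sub>R k] g x\<bar> \<le> A * (?r / 2 ^ i) powr q"
          proof (rule d2)
            have "2 * ?r / 2 ^ i < R - norm x" using i x by (simp add: field_simps)
            moreover have "2 * ?r / 2 ^ i = ?r / 2 ^ i + ?r / 2 ^ i" by simp
            ultimately have "?r / 2 ^ i + ?r / 2 ^ i < R - norm x" by linarith
            moreover have "norm h / 2 ^ i \<le> ?r / 2 ^ i" "norm k / 2 ^ i \<le> ?r / 2 ^ i"
              by (auto intro!: divide_right_mono)
            moreover have "norm ((1 / 2 ^ i) *\<^sub>R h) = norm h / 2 ^ i" "norm ((1 / 2 ^ i) *\<^sub>R k) = norm k / 2 ^ i"
              by simp_all
            ultimately show "norm x + norm ((1 / 2 ^ i) *\<^sub>R h) + norm ((1 / 2 ^ i) *\<^sub>R k) < R" by linarith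
          qed (auto intro!: divide_right_mono divide_pos_pos add_nonneg_pos)
          then have "norm (2 ^ i * fdiff [(1 / 2 ^ i) *\<^sub>R h, (1 / 2 ^ i) *\<^sub>R k] g x) \<le> 2 ^ i * (A * (?r / 2 ^ i) powr q)"
            by (simp add: abs_mult del: fdiff.simps)
          also have "\<dots> = A * ?r powr q * (2 ^ i * (1 / (2 ^ i) powr q))"
            by (simp add: powr_divide)
          also have "2 ^ i * (1 / (2 ^ i) powr q) = (2 powr (1 - q)) ^ i"
          proof -
            have "(2::real) ^ i = 2 powr real i" by (simp add: powr_realpow)
            then have "(2::real) ^ i * (1 / (2 ^ i) powr q) = 2 powr (real i - real i * q)"
              by (simp add: powr_powr powr_diff)
            also have "real i - real i * q = (1 - q) * real i" by (simp add: algebra_simps)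
            also have "2 powr ((1 - q) * real i) = (2 powr (1 - q)) ^ i"
              by (simp add: powr_powr[symmetric] powr_realpow)
            finally show ?thesis .
          qed
          finally show "norm (2 ^ i * fdiff [(1 / 2 ^ i) *\<^sub>R h, (1 / 2 ^ i) *\<^sub>R k] g x)
            \<le> A * ?r powr q * (2 powr (1 - q)) ^ i" .
        qed
      qed
      have "(\<lambda>i. 2 ^ i * fdiff [(1 / 2 ^ i) *\<^sub>R h, (1 / 2 ^ i) *\<^sub>R k] g x + ?a h i + ?a k i)
          \<longlonglongrightarrow> 0 + dderiv g x h + dderiv g x k"
        by (intro tendsto_add z lim[OF x])
      moreover have "2 ^ i * fdiff [(1 / 2 ^ i) *\<^sub>R h, (1 / 2 ^ i) *\<^sub>R k] g x + ?a h i + ?a k i = ?a (h + k) i" for i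
        by (simp add: algebra_simps)
      ultimately show "?a (h + k) \<longlonglongrightarrow> dderiv g x h + dderiv g x k" by simp
    qed
    have dl: "norm x < R - 2 * \<delta> \<Longrightarrow> linear (dderiv g x)"
      and db: "norm x < R - 2 * \<delta> \<Longrightarrow> \<bar>dderiv g x e\<bar> \<le> C1 * A * norm e" for x e
    proof -
      assume x: "norm x < R - 2 * \<delta>"
      have xR: "norm x < R" using x \<delta> by simp
      have b: "\<bar>dderiv g x h\<bar> \<le> (2 + c) * A" if h: "norm h \<le> \<delta>" for h
      proof -
        have xh: "norm x + norm h < R" using x h \<delta> by linarith
        have "norm (x + h) < R" using norm_triangle_ineq[of x h] xh by linarith
        then have "\<bar>g (x + h)\<bar> \<le> A" "\<bar>g x\<bar> \<le> A" using gb xR by auto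
        moreover have "c * A * norm h powr q \<le> c * A * 1 powr q"
          using c A h \<delta> q by (intro mult_left_mono powr_mono2) auto
        ultimately have "\<bar>dderiv g x h\<bar> \<le> 2 * A + c * A" using err'[OF xh] by simp
        then show ?thesis by (simp add: distrib_right)
      qed
      show "linear (dderiv g x)"
        by (rule additive_bounded_imp_linear(1)[OF add[OF xR] b \<delta>(1)])
      show "\<bar>dderiv g x e\<bar> \<le> C1 * A * norm e"
        using additive_bounded_imp_linear(2)[OF add[OF xR] b \<delta>(1), of e] by (simp add: C1_def)
    qed
    have x: "norm x < R - 4 * \<delta>" "norm x' < R - 4 * \<delta>" using prems(4,5) \<delta>4 by linarith+
    have deriv: "(g has_derivative dderiv g x) (at x)"
    proof (rule has_derivativeI)
      show "bounded_linear (dderiv g x)"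
        using dl[of x] x \<delta> by (simp add: linear_conv_bounded_linear)
      have "((\<lambda>y. c * A * norm (y - x) powr (q - 1)) \<longlongrightarrow> c * A * norm (x - x) powr (q - 1)) (at x)"
        using q by (intro tendsto_intros tendsto_powr') auto
      then have t: "((\<lambda>y. c * A * norm (y - x) powr (q - 1)) \<longlongrightarrow> 0) (at x)" by simp
      show "((\<lambda>y. (g y - g x - dderiv g x (y - x)) /\<^sub>R norm (y - x)) \<longlongrightarrow> 0) (at x)"
      proof (rule Lim_null_comparison[OF _ t])
        have "\<forall>\<^sub>F y in at x. dist y x < \<delta>" using \<delta> by (auto simp: eventually_at)
        then show "\<forall>\<^sub>F y in at x. norm ((g y - g x - dderiv g x (y - x)) /\<^sub>R norm (y - x)) \<le> c * A * norm (y - x) powr (q - 1)"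
        proof (rule eventually_mono)
          fix y assume y: "dist y x < \<delta>"
          show "norm ((g y - g x - dderiv g x (y - x)) /\<^sub>R norm (y - x)) \<le> c * A * norm (y - x) powr (q - 1)"
          proof (cases "y = x")
            case False
            have "\<bar>dderiv g x (y - x) - (g (x + (y - x)) - g x)\<bar> \<le> c * A * norm (y - x) powr q"
              using x y \<delta> by (intro err') (auto simp: dist_norm)
            then have "\<bar>g y - g x - dderiv g x (y - x)\<bar> / norm (y - x) \<le> c * A * norm (y - x) powr q / norm (y - x)"
              by (intro divide_right_mono) auto
            also have "\<dots> = c * A * norm (y - x) powr (q - 1)" using False by (simp add: powr_diff)
            finally show ?thesis by (simp add: divide_inverse mult.commute abs_mult)
          qed simp
        qed
      qed
    qed
    have hold: "\<bar>dderiv g x e - dderiv g x' e\<bar> \<le> C * A * norm (x - x') powr (q - 1) * norm e"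
    proof (cases "norm (x - x') < \<delta>")
      case False
      have "\<bar>dderiv g x e - dderiv g x' e\<bar> \<le> 2 * (C1 * A * norm e)"
        using db[of x e] db[of x' e] x \<delta> by linarith
      also have "1 \<le> \<delta> powr (1 - q) * norm (x - x') powr (q - 1)"
      proof -
        have "\<delta> powr (1 - q) * \<delta> powr (q - 1) \<le> \<delta> powr (1 - q) * norm (x - x') powr (q - 1)"
          using False \<delta> q by (intro mult_left_mono powr_mono2) auto
        then show ?thesis using \<delta> by (simp flip: powr_add)
      qed
      then have "2 * (C1 * A * norm e) * 1 \<le> 2 * (C1 * A * norm e) * (\<delta> powr (1 - q) * norm (x - x') powr (q - 1))"
        using C1 A by (intro mult_left_mono) auto
      also have "\<dots> = (2 * C1 * \<delta> powr (1 - q)) * (A * norm (x - x') powr (q - 1) * norm e)" by simp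
      also have "\<dots> \<le> C * (A * norm (x - x') powr (q - 1) * norm e)"
        using A C1 c by (intro mult_right_mono) (auto simp: C_def)
      finally show ?thesis by (simp add: mult.assoc)
    next
      case True
      show ?thesis
      proof (cases "x = x' \<or> e = 0")
        case True
        have "dderiv g x 0 = 0" "dderiv g x' 0 = 0" using db[of x 0] db[of x' 0] x \<delta> by auto
        then show ?thesis using True by auto
      next
        case F: False
        \<comment> \<open>A step parallel to e with the length of x - x'. The increments of g along
          k at x and at x' differ by a second difference with steps k and x - x', and replacing each
          increment by the derivative costs a multiple of |k|^q.\<close>
        define k where "k = (norm (x - x') / norm e) *\<^sub>R e"
        have nk: "norm k = norm (x - x')" using F by (simp add: k_def)
        have ek: "e = (norm e / norm (x - x')) *\<^sub>R k" using F by (simp add: k_def)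
        have 1: "\<bar>dderiv g x k - (g (x + k) - g x)\<bar> \<le> c * A * norm k powr q"
          using x True \<delta> nk by (intro err') linarith
        have 2: "\<bar>dderiv g x' k - (g (x' + k) - g x')\<bar> \<le> c * A * norm k powr q"
          using x True \<delta> nk by (intro err') linarith
        have "\<bar>fdiff [k, x - x'] g x'\<bar> \<le> A * norm (x - x') powr q"
          using F x True \<delta> nk by (intro d2) auto
        then have 3: "\<bar>(g (x + k) - g x) - (g (x' + k) - g x')\<bar> \<le> A * norm k powr q"
          by (simp add: nk algebra_simps)
        have "\<bar>dderiv g x k - dderiv g x' k\<bar> \<le> A * norm k powr q + 2 * (c * A * norm k powr q)"
          using 1 2 3 by linarith
        also have "\<dots> = (1 + 2 * c) * (A * norm k powr q)" by (simp add: algebra_simps)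
        finally have 4: "\<bar>dderiv g x k - dderiv g x' k\<bar> \<le> (1 + 2 * c) * (A * norm k powr q)" .
        let ?t = "norm e / norm (x - x')"
        have l1: "dderiv g x e = ?t * dderiv g x k" "dderiv g x' e = ?t * dderiv g x' k"
          using linear_cmul[OF dl[of x], of ?t k] linear_cmul[OF dl[of x'], of ?t k] x \<delta> ek by auto
        have "\<bar>dderiv g x e - dderiv g x' e\<bar> = ?t * \<bar>dderiv g x k - dderiv g x' k\<bar>"
          unfolding l1 right_diff_distrib[symmetric] by (simp add: abs_mult)
        also have "\<dots> \<le> ?t * ((1 + 2 * c) * (A * norm k powr q))" by (intro mult_left_mono 4) auto
        also have "\<dots> = (1 + 2 * c) * (A * norm (x - x') powr (q - 1) * norm e)"
          using F by (simp add: nk powr_diff)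
        also have "\<dots> \<le> C * (A * norm (x - x') powr (q - 1) * norm e)"
          using A C1 c by (intro mult_right_mono) (auto simp: C_def)
        finally show ?thesis by (simp add: mult.assoc)
      qed
    qed
    have "\<bar>dderiv g x e\<bar> \<le> C1 * A * norm e" using db[of x e] x \<delta> by simp
    also have "\<dots> \<le> C * A * norm e"
      using A C1 c by (intro mult_right_mono) (auto simp: C_def)
    finally show ?case using deriv hold by blast
  qed
qed

text \<open>The step \<open>h\<close> is cut into \<open>2\<^sup>i\<close> pieces of the size of the other two increments.\<close>

lemma fdiff_subdivide:
  fixes g :: "'a::real_normed_vector \<Rightarrow> real"
  assumes "\<And>j. j < N \<Longrightarrow> \<bar>fdiff [(1 / real N) *\<^sub>R h, a, b] g (x + (real j / real N) *\<^sub>R h)\<bar> \<le> B" and "0 < N"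
  shows "\<bar>fdiff [h, a, b] g x\<bar> \<le> real N * B"
proof -
  let ?F = "\<lambda>j. fdiff [a, b] g (x + (real j / real N) *\<^sub>R h)"
  have "fdiff [h, a, b] g x = ?F N - ?F 0" using assms(2) by simp
  also have "\<dots> = (\<Sum>j<N. ?F (Suc j) - ?F j)" by (rule sum_lessThan_telescope[symmetric])
  also have "\<dots> = (\<Sum>j<N. fdiff [(1 / real N) *\<^sub>R h, a, b] g (x + (real j / real N) *\<^sub>R h))"
  proof (rule sum.cong[OF refl])
    fix j
    have "x + (real (Suc j) / real N) *\<^sub>R h = x + (real j / real N) *\<^sub>R h + (1 / real N) *\<^sub>R h"
      by (simp add: add_divide_distrib scaleR_left_distrib add_ac)
    then show "?F (Suc j) - ?F j = fdiff [(1 / real N) *\<^sub>R h, a, b] g (x + (real j / real N) *\<^sub>R h)"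
      by (simp only: fdiff.simps(2)[of "(1 / real N) *\<^sub>R h" "[a, b]"])
  qed
  also have "\<bar>\<dots>\<bar> \<le> (\<Sum>j<N. \<bar>fdiff [(1 / real N) *\<^sub>R h, a, b] g (x + (real j / real N) *\<^sub>R h)\<bar>)"
    by (rule sum_abs)
  also have "\<dots> \<le> (\<Sum>j<N. B)" by (rule sum_mono) (rule assms(1), simp)
  finally show ?thesis by simp
qed

text \<open>Second differences of the derivative are limits of dyadic difference quotients of G =
  \<open>fdiff [h, k] g\<close>. Passing from one quotient to the next costs third differences with
  steps h, \<tau>, \<tau>, where \<tau> = r / 2^(i+1) shrinks while h does not. Cutting h into
  2^(i+1) pieces makes the steps comparable and bounds them by A 2^(i+1) \<tau>^\<gamma>.\<close>

lemma dderiv_second_differences: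
  fixes q \<gamma> R R' :: real
  assumes q: "1 < q" "q < 2" and \<gamma>: "2 < \<gamma>" "\<gamma> < 3" and R: "0 < R'" "R' < R" "R \<le> 1"
  obtains C where "1 \<le> C"
    "\<And>(g::'a::euclidean_space \<Rightarrow> real) A x h k r e.
      \<lbrakk>0 \<le> A; \<And>x. norm x < R \<Longrightarrow> \<bar>g x\<bar> \<le> A;
       \<And>x h k r. norm h \<le> r \<Longrightarrow> norm k \<le> r \<Longrightarrow> 0 < r \<Longrightarrow> norm x + norm h + norm k < R
        \<Longrightarrow> \<bar>fdiff [h, k] g x\<bar> \<le> A * r powr q;
       \<And>x h k l r. norm h \<le> r \<Longrightarrow> norm k \<le> r \<Longrightarrow> norm l \<le> r \<Longrightarrow> 0 < r \<Longrightarrow> norm x + norm h + norm k + norm l < R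
        \<Longrightarrow> \<bar>fdiff [h, k, l] g x\<bar> \<le> A * r powr \<gamma>;
       norm e = 1; norm h \<le> r; norm k \<le> r; 0 < r; norm x + norm h + norm k < R'\<rbrakk>
      \<Longrightarrow> \<bar>fdiff [h, k] (\<lambda>x. dderiv g x e) x\<bar> \<le> C * A * r powr (\<gamma> - 1)"
proof -
  obtain C0 where C0: "1 \<le> C0"
    "\<And>(g::'a \<Rightarrow> real) A x x' e.
      \<lbrakk>0 \<le> A; \<And>x. norm x < R \<Longrightarrow> \<bar>g x\<bar> \<le> A;
       \<And>x h k r. norm h \<le> r \<Longrightarrow> norm k \<le> r \<Longrightarrow> 0 < r \<Longrightarrow> norm x + norm h + norm k < R
        \<Longrightarrow> \<bar>fdiff [h, k] g x\<bar> \<le> A * r powr q; norm x < R'; norm x' < R'\<rbrakk>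
      \<Longrightarrow> (g has_derivative dderiv g x) (at x) \<and> \<bar>dderiv g x e\<bar> \<le> C0 * A * norm e
        \<and> \<bar>dderiv g x e - dderiv g x' e\<bar> \<le> C0 * A * norm (x - x') powr (q - 1) * norm e"
    by (rule derivative_from_second_differences[OF q R, where 'a='a]) blast
  define \<delta> where "\<delta> = (R - R') / 2"
  have \<delta>: "0 < \<delta>" using R by (simp add: \<delta>_def)
  let ?\<omega> = "2 powr (2 - \<gamma>) :: real"
  have \<omega>: "0 \<le> ?\<omega>" "?\<omega> < 1" using powr_less_cancel_iff[of 2 "2 - \<gamma>" 0] \<gamma> by auto
  define C where "C = 1 + 1 / (1 - ?\<omega>) + 4 * C0 * \<delta> powr (1 - \<gamma>)"
  show thesis
  proof (rule that[of C], goal_cases)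
    case 1 show ?case using \<omega> C0(1) by (simp add: C_def)
  next
    case prems: (2 g A x h k r e)
    note A = prems(1) and gb = prems(2) and d2 = prems(3) and d3 = prems(4) and e = prems(5)
      and h = prems(6) and k = prems(7) and r = prems(8) and x = prems(9)
    let ?D = "\<lambda>x. dderiv g x e"
    have C0': "(g has_derivative dderiv g y) (at y) \<and> \<bar>?D y\<bar> \<le> C0 * A * norm e
        \<and> \<bar>?D y - ?D y\<bar> \<le> C0 * A * norm (y - y) powr (q - 1) * norm e" if "norm y < R'" for y
    proof (rule C0(2)[OF A])
      show "\<bar>g x\<bar> \<le> A" if "norm x < R" for x using that by (rule gb)
      show "\<bar>fdiff [h, k] g x\<bar> \<le> A * r powr q"
        if "norm h \<le> r" "norm k \<le> r" "0 < r" "norm x + norm h + norm k < R" for x h k r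
        using that by (rule d2)
    qed (rule that)+
    show ?case
    proof (cases "r \<le> \<delta>")
      case False
      have b: "\<bar>?D y\<bar> \<le> C0 * A" if "norm y < R'" for y
        using C0'[OF that] e by simp
      have "\<bar>fdiff [h, k] ?D x\<bar> \<le> 2 ^ length [h, k] * (C0 * A)"
      proof (rule fdiff_local_bound)
        fix y assume y: "norm (y - x) \<le> sum_list (map norm [h, k])"
        have "norm y \<le> norm x + norm (y - x)" using norm_triangle_ineq[of x "y - x"] by simp
        then show "\<bar>?D y\<bar> \<le> C0 * A" using x y by (intro b) simp
      qed
      also have "\<dots> = 4 * C0 * A * 1" by simp
      also have "1 \<le> \<delta> powr (1 - \<gamma>) * r powr (\<gamma> - 1)"
      proof -
        have "\<delta> powr (1 - \<gamma>) * \<delta> powr (\<gamma> - 1) \<le> \<delta> powr (1 - \<gamma>) * r powr (\<gamma> - 1)"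
          using False \<delta> \<gamma> by (intro mult_left_mono powr_mono2) auto
        then show ?thesis using \<delta> by (simp flip: powr_add)
      qed
      then have "4 * C0 * A * 1 \<le> 4 * C0 * A * (\<delta> powr (1 - \<gamma>) * r powr (\<gamma> - 1))"
        using C0(1) A by (intro mult_left_mono) auto
      also have "\<dots> = (4 * C0 * \<delta> powr (1 - \<gamma>)) * (A * r powr (\<gamma> - 1))" by simp
      also have "\<dots> \<le> C * (A * r powr (\<gamma> - 1))"
        using A C0(1) \<omega> by (intro mult_right_mono) (auto simp: C_def)
      finally show ?thesis by (simp add: mult.assoc)
    next
      case True
      define G where "G = fdiff [h, k] g"
      define b where "b i = 2 ^ i / r * (G (x + (1 / 2 ^ i) *\<^sub>R (r *\<^sub>R e)) - G x)" for i
      have lim: "b \<longlonglongrightarrow> fdiff [h, k] ?D x"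
      proof -
        let ?a = "\<lambda>y i. 2 ^ i * (g (y + (1 / 2 ^ i) *\<^sub>R (r *\<^sub>R e)) - g y)"
        have l: "?a y \<longlonglongrightarrow> dderiv g y (r *\<^sub>R e)" if "norm y < R" for y
          by (rule dderiv_limit(1)[OF q(1) _ A that]) (rule d2)
        have n: "norm (x + h + k) < R'" "norm (x + h) < R'" "norm (x + k) < R'" "norm x < R'"
          using x norm_triangle_ineq[of "x + h" k] norm_triangle_ineq[of x h] norm_triangle_ineq[of x k]
            norm_ge_zero[of h] norm_ge_zero[of k] by linarith+
        then have n': "norm (x + h + k) < R" "norm (x + h) < R" "norm (x + k) < R" "norm x < R" using R by auto
        have sc: "dderiv g y (r *\<^sub>R e) = r * dderiv g y e" if "norm y < R'" for y
          using linear_cmul[OF has_derivative_linear[OF conjunct1[OF C0'[OF that]]], of r e] by simp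
        have "(\<lambda>i. (1 / r) * ((?a (x + h + k) i - ?a (x + h) i) - (?a (x + k) i - ?a x i)))
          \<longlonglongrightarrow> (1 / r) * ((r * dderiv g (x + h + k) e - r * dderiv g (x + h) e) - (r * dderiv g (x + k) e - r * dderiv g x e))"
          unfolding sc[OF n(1), symmetric] sc[OF n(2), symmetric] sc[OF n(3), symmetric] sc[OF n(4), symmetric]
          by (intro tendsto_intros l n')
        also have "(1 / r) * ((r * dderiv g (x + h + k) e - r * dderiv g (x + h) e) - (r * dderiv g (x + k) e - r * dderiv g x e))
            = fdiff [h, k] ?D x"
          using r by (simp add: field_simps)
        also have "(\<lambda>i. (1 / r) * ((?a (x + h + k) i - ?a (x + h) i) - (?a (x + k) i - ?a x i))) = b"
          by (rule ext) (simp add: b_def G_def algebra_simps)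
        finally show ?thesis .
      qed
      have inc: "\<bar>b (Suc i) - b i\<bar> \<le> (A * r powr (\<gamma> - 1)) * ?\<omega> ^ i" for i
      proof -
        let ?N = "2 ^ Suc i :: nat"
        let ?\<tau> = "r / 2 ^ Suc i"
        let ?k = "?\<tau> *\<^sub>R e"
        have kk: "(1 / 2 ^ i) *\<^sub>R (r *\<^sub>R e) = ?k + ?k" by (simp flip: scaleR_2)
        have k1: "(1 / 2 ^ Suc i) *\<^sub>R (r *\<^sub>R e) = ?k" by simp
        have "b (Suc i) - b i = - (2 ^ i / r * fdiff [?k, ?k] G x)"
        proof -
          have gen: "2 ^ Suc i / r * (a - z) - 2 ^ i / r * (b - z) = - (2 ^ i / r * (b - 2 * a + z))" for a b z :: real
            by (simp add: algebra_simps add_divide_distrib diff_divide_distrib)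
          have eq: "fdiff [?k, ?k] G x = G (x + (?k + ?k)) - 2 * G (x + ?k) + G x" by (simp add: add.assoc)
          show ?thesis unfolding b_def kk k1 eq gen ..
        qed
        \<comment> \<open>Of the fourth difference, the step k is given up: it merely produces two
          base points for a third difference.\<close>
        moreover have "fdiff [?k, ?k] G x = fdiff [h, ?k, ?k] g (x + k) - fdiff [h, ?k, ?k] g x"
          unfolding G_def by (simp add: algebra_simps)
        moreover have B: "\<bar>fdiff [h, ?k, ?k] g y\<bar> \<le> real ?N * (A * ?\<tau> powr \<gamma>)" if y: "norm y + norm h \<le> norm x + norm h + norm k" for y
        proof (rule fdiff_subdivide)
          fix j assume j: "j < ?N"
          have Nr: "real ?N = 2 ^ Suc i" by simp
          have "norm (y + (real j / real ?N) *\<^sub>R h) \<le> norm y + (real j / real ?N) * norm h"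
            using norm_triangle_ineq[of y "(real j / real ?N) *\<^sub>R h"] by simp
          moreover have "(real j / real ?N) * norm h + norm h / real ?N \<le> norm h"
          proof -
            have "(real j + 1) / real ?N \<le> 1" using j by (simp del: power_Suc of_nat_power)
            then have "(real j + 1) / real ?N * norm h \<le> 1 * norm h" by (rule mult_right_mono) simp
            then show ?thesis by (simp add: add_divide_distrib distrib_right del: power_Suc of_nat_power)
          qed
          moreover have "norm ?k + norm ?k \<le> r" using e r by (simp add: field_simps)
          moreover have "norm ((1 / real ?N) *\<^sub>R h) = norm h / real ?N" by simp
          moreover have "R' + r < R" using True \<delta> by (simp add: \<delta>_def)
          ultimately have n: "norm (y + (real j / real ?N) *\<^sub>R h) + norm ((1 / real ?N) *\<^sub>R h) + norm ?k + norm ?k < R"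
            using x y by linarith
          show "\<bar>fdiff [(1 / real ?N) *\<^sub>R h, ?k, ?k] g (y + (real j / real ?N) *\<^sub>R h)\<bar> \<le> A * ?\<tau> powr \<gamma>"
            by (rule d3[OF _ _ _ _ n]) (use h e r in \<open>auto simp: divide_right_mono\<close>)
        qed simp
        ultimately have "\<bar>b (Suc i) - b i\<bar> \<le> 2 ^ i / r * (2 * (real ?N * (A * ?\<tau> powr \<gamma>)))"
        proof -
          have "norm (x + k) + norm h \<le> norm x + norm h + norm k" using norm_triangle_ineq[of x k] by simp
          then have "\<bar>fdiff [h, ?k, ?k] g (x + k) - fdiff [h, ?k, ?k] g x\<bar> \<le> 2 * (real ?N * (A * ?\<tau> powr \<gamma>))"
            using B[of "x + k"] B[of x] norm_ge_zero[of k] by linarith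
          then have "2 ^ i / r * \<bar>fdiff [?k, ?k] G x\<bar> \<le> 2 ^ i / r * (2 * (real ?N * (A * ?\<tau> powr \<gamma>)))"
            using r \<open>fdiff [?k, ?k] G x = _\<close> by (intro mult_left_mono) auto
          then show ?thesis using r \<open>b (Suc i) - b i = _\<close> by (simp add: abs_mult del: fdiff.simps)
        qed
        \<comment> \<open>Two factors 2^(i+1), from the difference quotient and from the
          subdivision, stand against \<tau>^\<gamma>; the increments are summable because \<gamma> >
          2.\<close>
        also have "\<dots> = A * r powr (\<gamma> - 1) * ((2 ^ Suc i * 2 ^ Suc i) * (1 / (2 ^ Suc i) powr \<gamma>))"
          using r by (simp add: powr_divide powr_diff)
        also have "(2 ^ Suc i * 2 ^ Suc i) * (1 / (2 ^ Suc i) powr \<gamma>) = ?\<omega> ^ Suc i"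
        proof -
          have "(2::real) ^ Suc i = 2 powr real (Suc i)" by (simp only: powr_realpow zero_less_numeral)
          then have "((2::real) ^ Suc i * 2 ^ Suc i) * (1 / (2 ^ Suc i) powr \<gamma>) = 2 powr (real (Suc i) + real (Suc i) - real (Suc i) * \<gamma>)"
            by (simp only: powr_powr powr_diff powr_add) simp
          also have "real (Suc i) + real (Suc i) - real (Suc i) * \<gamma> = (2 - \<gamma>) * real (Suc i)" by (simp add: algebra_simps)
          also have "2 powr ((2 - \<gamma>) * real (Suc i)) = ?\<omega> ^ Suc i"
            by (simp only: powr_powr[symmetric]) (simp only: powr_realpow powr_gt_zero zero_less_numeral)
          finally show ?thesis .
        qed
        also have "A * r powr (\<gamma> - 1) * ?\<omega> ^ Suc i \<le> A * r powr (\<gamma> - 1) * ?\<omega> ^ i"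
          using A \<omega> by (intro mult_left_mono) (auto simp: mult_left_le_one_le)
        finally show ?thesis .
      qed
      obtain l where l: "b \<longlonglongrightarrow> l" "\<bar>l - b 0\<bar> \<le> (A * r powr (\<gamma> - 1)) / (1 - ?\<omega>)"
        by (rule geometric_increments[OF \<omega> inc])
      have "l = fdiff [h, k] ?D x" by (rule LIMSEQ_unique[OF l(1) lim])
      moreover have "\<bar>b 0\<bar> \<le> A * r powr (\<gamma> - 1)"
      proof -
        have "\<bar>fdiff [r *\<^sub>R e, h, k] g x\<bar> \<le> A * r powr \<gamma>"
          using h k r e x True \<delta> by (intro d3) (auto simp: \<delta>_def)
        moreover have "b 0 = 1 / r * fdiff [r *\<^sub>R e, h, k] g x" by (simp add: b_def G_def)
        ultimately have "\<bar>b 0\<bar> \<le> 1 / r * (A * r powr \<gamma>)" using r by (simp add: abs_mult divide_right_mono del: fdiff.simps)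
        then show ?thesis using r by (simp add: powr_diff)
      qed
      ultimately have "\<bar>fdiff [h, k] ?D x\<bar> \<le> A * r powr (\<gamma> - 1) + (A * r powr (\<gamma> - 1)) / (1 - ?\<omega>)"
        using l(2) by linarith
      also have "\<dots> = (1 + 1 / (1 - ?\<omega>)) * (A * r powr (\<gamma> - 1))" by (simp add: algebra_simps)
      also have "\<dots> \<le> C * (A * r powr (\<gamma> - 1))"
        using A C0(1) by (intro mult_right_mono) (auto simp: C_def)
      finally show ?thesis by (simp add: mult.assoc)
    qed
  qed
qed

subsection \<open>Bounds for the Hoelder norms\<close>

lemma holder_imp_continuous_on:
  fixes f :: "'a::real_normed_vector \<Rightarrow> real"
  assumes "0 < \<kappa>" "\<And>x y. x \<in> D \<Longrightarrow> y \<in> D \<Longrightarrow> \<bar>f x - f y\<bar> \<le> B * norm (x - y) powr \<kappa>"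
  shows "continuous_on D f"
  unfolding continuous_on_def
proof
  fix x assume x: "x \<in> D"
  have "((\<lambda>y. B * norm (y - x) powr \<kappa>) \<longlongrightarrow> B * norm (x - x) powr \<kappa>) (at x within D)"
    using assms(1) by (intro tendsto_intros tendsto_powr') auto
  then have "((\<lambda>y. B * norm (y - x) powr \<kappa>) \<longlongrightarrow> 0) (at x within D)" using assms(1) by simp
  then have "((\<lambda>y. f y - f x) \<longlongrightarrow> 0) (at x within D)"
  proof (rule Lim_null_comparison[rotated])
    show "\<forall>\<^sub>F y in at x within D. norm (f y - f x) \<le> B * norm (y - x) powr \<kappa>"
      unfolding eventually_at_filter using assms(2) x by (auto intro!: always_eventually)
  qed
  then show "(f \<longlongrightarrow> f x) (at x within D)" by (simp add: LIM_zero_iff)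
qed

text \<open>Each list of directions contributes at most B to the suprema and at most B to the
  seminorms, hence the factor 2. Continuity at top order follows from the Hoelder bound.\<close>

lemma holder_norm_bound:
  fixes w :: "'a::euclidean_space \<Rightarrow> real"
  assumes k: "k = nat \<lfloor>\<gamma>\<rfloor>" and \<kappa>: "0 < frac \<gamma>" and B: "0 \<le> B"
    and diff: "\<And>es x. set es \<subseteq> Basis \<Longrightarrow> length es < k \<Longrightarrow> x \<in> D \<Longrightarrow> iter_deriv es w differentiable (at x)"
    and cont: "\<And>es. set es \<subseteq> Basis \<Longrightarrow> length es < k \<Longrightarrow> continuous_on D (iter_deriv es w)"
    and bnd: "\<And>es x. set es \<subseteq> Basis \<Longrightarrow> length es \<le> k \<Longrightarrow> x \<in> D \<Longrightarrow> \<bar>iter_deriv es w x\<bar> \<le> B"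
    and hold: "\<And>es x y. set es \<subseteq> Basis \<Longrightarrow> length es = k \<Longrightarrow> x \<in> D \<Longrightarrow> y \<in> D
      \<Longrightarrow> \<bar>iter_deriv es w x - iter_deriv es w y\<bar> \<le> B * norm (x - y) powr frac \<gamma>"
  shows "holder_norm \<gamma> w D \<le> ennreal (2 * real (card {es :: 'a list. set es \<subseteq> Basis \<and> length es \<le> k}) * B)"
proof -
  let ?E = "{es :: 'a list. set es \<subseteq> Basis \<and> length es \<le> k}"
  let ?E' = "{es :: 'a list. set es \<subseteq> Basis \<and> length es = k}"
  have fin: "finite ?E" by (rule finite_lists_length_le) simp
  have "?E' \<subseteq> ?E" by auto
  then have cE: "card ?E' \<le> card ?E" using fin by (rule card_mono[rotated])
  have "continuous_on D (iter_deriv es w)" if "set es \<subseteq> Basis" "length es \<le> k" for es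
  proof (cases "length es < k")
    case False
    then have "length es = k" using that by simp
    with that(1) show ?thesis by (intro holder_imp_continuous_on[OF \<kappa>, where B = B] hold)
  qed (use that cont in auto)
  then have Ck: "Ck_on k w D" unfolding Ck_on_def using diff by blast
  have s1: "(\<Sum>es\<in>?E. SUP x\<in>D. ennreal \<bar>iter_deriv es w x\<bar>) \<le> of_nat (card ?E) * ennreal B"
    by (rule sum_bounded_above) (auto intro!: SUP_least ennreal_leI bnd)
  have s2: "(\<Sum>es\<in>?E'. holder_seminorm (frac \<gamma>) (iter_deriv es w) D) \<le> of_nat (card ?E') * ennreal B"
  proof (rule sum_bounded_above)
    fix es assume "es \<in> ?E'"
    then have es: "set es \<subseteq> Basis" "length es = k" by auto
    show "holder_seminorm (frac \<gamma>) (iter_deriv es w) D \<le> ennreal B"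
      unfolding holder_seminorm_def
    proof (intro SUP_least ennreal_leI)
      fix x y assume "x \<in> D" "y \<in> D - {x}"
      then show "\<bar>iter_deriv es w x - iter_deriv es w y\<bar> / norm (x - y) powr frac \<gamma> \<le> B"
        using hold[OF es, of x y] by (subst pos_divide_le_eq) auto
    qed
  qed
  have s3: "of_nat (card ?E') * ennreal B \<le> of_nat (card ?E) * ennreal B"
    using cE by (intro mult_right_mono) (auto simp: of_nat_mono)
  have "holder_norm \<gamma> w D = (\<Sum>es\<in>?E. SUP x\<in>D. ennreal \<bar>iter_deriv es w x\<bar>)
      + (\<Sum>es\<in>?E'. holder_seminorm (frac \<gamma>) (iter_deriv es w) D)"
    unfolding holder_norm_def Let_def k[symmetric] using Ck by (simp only: if_True)
  also have "\<dots> \<le> of_nat (card ?E) * ennreal B + of_nat (card ?E) * ennreal B"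
    by (rule add_mono[OF s1 order_trans[OF s2 s3]])
  also have "\<dots> = ennreal (real (card ?E) * B) + ennreal (real (card ?E) * B)"
    using B by (simp add: ennreal_mult ennreal_of_nat_eq_real_of_nat)
  also have "\<dots> = ennreal (2 * real (card ?E) * B)"
    using B by (simp flip: ennreal_plus)
  finally show ?thesis .
qed

lemma holder_norm_time_bound:
  fixes \<beta> :: real
  assumes \<beta>: "0 < \<beta>" "\<beta> < 1"
  obtains C where "0 < C"
    "\<And>(w::real \<Rightarrow> real) w' D B. \<lbrakk>0 \<le> B; \<And>t. t \<in> D \<Longrightarrow> (w has_real_derivative w' t) (at t);
      \<And>t. t \<in> D \<Longrightarrow> \<bar>w t\<bar> \<le> B; \<And>t. t \<in> D \<Longrightarrow> \<bar>w' t\<bar> \<le> B;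
      \<And>t t'. t \<in> D \<Longrightarrow> t' \<in> D \<Longrightarrow> \<bar>w' t - w' t'\<bar> \<le> B * \<bar>t - t'\<bar> powr \<beta>\<rbrakk>
      \<Longrightarrow> holder_norm (1 + \<beta>) w D \<le> ennreal (C * B)"
proof -
  show thesis
  proof (rule that[of "2 * real (card {es :: real list. set es \<subseteq> Basis \<and> length es \<le> 1}) + 1"], goal_cases)
  case prems: (2 w w' D B)
  have fl: "\<lfloor>1 + \<beta>\<rfloor> = 1" using \<beta> by linarith
  then have k: "(1::nat) = nat \<lfloor>1 + \<beta>\<rfloor>" and fr: "frac (1 + \<beta>) = \<beta>" by (simp_all add: frac_def)
  have es: "es = [] \<or> es = [1]" if "set es \<subseteq> Basis" "length es \<le> 1" for es :: "real list"
    using that by (cases es) auto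
  have fd: "frechet_derivative w (at t) 1 = w' t" if "t \<in> D" for t
  proof -
    have "(w has_derivative (*) (w' t)) (at t)"
      using prems(2)[OF that] by (simp add: has_field_derivative_def)
    then show ?thesis using frechet_derivative_at[of w "(*) (w' t)" t, symmetric] by simp
  qed
  have "holder_norm (1 + \<beta>) w D \<le> ennreal (2 * real (card {es :: real list. set es \<subseteq> Basis \<and> length es \<le> 1}) * B)"
  proof (rule holder_norm_bound[OF k])
    show "0 < frac (1 + \<beta>)" using fr \<beta> by simp
    fix es :: "real list"
    show "iter_deriv es w differentiable (at t)" if "length es < 1" "t \<in> D" for t
      using that prems(2)[OF that(2)] by (auto simp: real_differentiable_def)
    show "continuous_on D (iter_deriv es w)" if "length es < 1"
    proof -
      have "continuous_on D w" by (rule DERIV_continuous_on[of _ _ w']) (auto intro: has_field_derivative_at_within prems(2))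
      then show ?thesis using that by simp
    qed
    show "\<bar>iter_deriv es w t\<bar> \<le> B" if "set es \<subseteq> Basis" "length es \<le> 1" "t \<in> D" for t
      using es[OF that(1,2)] that(3) prems(3,4) fd by auto
    show "\<bar>iter_deriv es w t - iter_deriv es w t'\<bar> \<le> B * norm (t - t') powr frac (1 + \<beta>)"
      if "set es \<subseteq> Basis" "length es = 1" "t \<in> D" "t' \<in> D" for t t'
      using es[OF that(1)] that prems(5)[OF that(3,4)] fd by (auto simp: fr)
  qed (rule prems(1))
  also have "\<dots> \<le> ennreal ((2 * real (card {es :: real list. set es \<subseteq> Basis \<and> length es \<le> 1}) + 1) * B)"
    using prems(1) by (intro ennreal_leI mult_right_mono) auto
  finally show ?case .
qed simp
qed

text \<open>\<open>\<gamma>'\<close> is the exponent available for differences of order m: \<gamma>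
  when m exceeds it, otherwise m - 1/2, which lies in (m - 1, m) and below \<gamma>. The norm
  involves 0, 1 or 2 derivatives. For 2, second differences with exponent 3/2 give the gradient,
  third differences give second differences of the gradient with exponent \<gamma> - 1, and the
  result for one derivative is applied again to the gradient.\<close>

lemma holder_norm_space_bound:
  fixes \<gamma> :: real
  assumes \<gamma>: "0 < \<gamma>" "\<gamma> < 3" "\<gamma> \<notin> \<int>"
  defines "\<gamma>' \<equiv> \<lambda>m::nat. if \<gamma> < m then \<gamma> else real m - 1 / 2"
  obtains C where "0 < C"
    "\<And>(g::'a::euclidean_space \<Rightarrow> real) A.
      \<lbrakk>0 \<le> A; \<And>x. norm x < 3 / 5 \<Longrightarrow> \<bar>g x\<bar> \<le> A;
       \<And>x hs r. 1 \<le> length hs \<Longrightarrow> length hs \<le> 3 \<Longrightarrow> (\<And>h. h \<in> set hs \<Longrightarrow> norm h \<le> r) \<Longrightarrow> 0 < r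
        \<Longrightarrow> norm x + sum_list (map norm hs) < 3 / 5
        \<Longrightarrow> \<bar>fdiff hs g x\<bar> \<le> A * r powr \<gamma>' (length hs)\<rbrakk>
      \<Longrightarrow> holder_norm \<gamma> g (ball 0 (1 / 2)) \<le> ennreal (C * A)"
proof -
  let ?k = "nat \<lfloor>\<gamma>\<rfloor>"
  let ?n = "\<lambda>k. 2 * real (card {es :: 'a list. set es \<subseteq> Basis \<and> length es \<le> k})"
  have n0: "0 \<le> ?n k" for k by simp
  have \<kappa>: "0 < frac \<gamma>" using \<gamma>(3) frac_ge_0[of \<gamma>] by (metis frac_eq_0_iff less_eq_real_def)
  have ne: "\<gamma> \<noteq> 1" "\<gamma> \<noteq> 2" using \<gamma>(3) by (metis Ints_1, metis Ints_numeral)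
  consider "\<gamma> < 1" | "1 < \<gamma>" "\<gamma> < 2" | "2 < \<gamma>" using ne by linarith
  then show thesis
  proof cases
    case 1
    then have fl: "\<lfloor>\<gamma>\<rfloor> = 0" using \<gamma> by linarith
    then have k: "(0::nat) = nat \<lfloor>\<gamma>\<rfloor>" and fr: "frac \<gamma> = \<gamma>" by (simp_all add: frac_def)
    show thesis
    \<comment> \<open>Points closer than 1/10 are joined by a step inside radius 3/5 = 1/2 + 1/10;
      for the others 40 (1/10)^\<gamma> >= 4 exceeds the 2 of the trivial bound. The added 1 makes
      positivity immediate.\<close>
    proof (rule that[of "?n 0 * 40 + 1"], goal_cases)
      case prems: (2 g A)
      have "holder_norm \<gamma> g (ball 0 (1 / 2)) \<le> ennreal (?n 0 * (40 * A))"
      proof (rule holder_norm_bound[OF k \<kappa>])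
        fix es :: "'a list"
        show "\<bar>iter_deriv es g x\<bar> \<le> 40 * A" if "length es \<le> 0" "x \<in> ball 0 (1 / 2)" for x
          using that prems(2)[of x] prems(1) by auto
        show "\<bar>iter_deriv es g x - iter_deriv es g y\<bar> \<le> 40 * A * norm (x - y) powr frac \<gamma>"
          if "length es = 0" "x \<in> ball 0 (1 / 2)" "y \<in> ball 0 (1 / 2)" for x y
        proof (cases "norm (x - y) < 1 / 10")
          case True
          show ?thesis
          proof (cases "x = y")
            case False
            have "\<bar>fdiff [x - y] g y\<bar> \<le> A * norm (x - y) powr \<gamma>' (length [x - y])"
              using that True False by (intro prems(3)) auto
            then have "\<bar>g x - g y\<bar> \<le> 1 * A * norm (x - y) powr \<gamma>" using 1 by (simp add: \<gamma>'_def)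
            also have "\<dots> \<le> 40 * A * norm (x - y) powr \<gamma>" using prems(1) by (intro mult_right_mono) auto
            finally show ?thesis using that by (simp add: fr)
          qed (use that in auto)
        next
          case False
          have "1 / 10 = (1 / 10) powr (1::real)" by simp
          also have "\<dots> \<le> (1 / 10) powr \<gamma>" using 1 \<gamma> by (intro powr_mono') auto
          also have "\<dots> \<le> norm (x - y) powr \<gamma>" using False \<gamma> by (intro powr_mono2) auto
          finally have "40 * A * (1 / 10) \<le> 40 * A * norm (x - y) powr \<gamma>" using prems(1) by (intro mult_left_mono) auto
          moreover have "\<bar>g x - g y\<bar> \<le> 2 * A" using prems(2)[of x] prems(2)[of y] that by auto
          ultimately show ?thesis using that prems(1) by (simp add: fr)
        qed
      qed (use prems in auto)
      also have "\<dots> \<le> ennreal ((?n 0 * 40 + 1) * A)"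
        using prems(1) by (intro ennreal_leI) (simp add: algebra_simps)
      finally show ?case .
    qed (use n0[of 0] in auto)
  next
    case 2
    then have fl: "\<lfloor>\<gamma>\<rfloor> = 1" by linarith
    then have k: "(1::nat) = nat \<lfloor>\<gamma>\<rfloor>" and fr: "frac \<gamma> = \<gamma> - 1" by (simp_all add: frac_def)
    have R: "0 < (1::real) / 2" "(1::real) / 2 < 3 / 5" "(3::real) / 5 \<le> 1" by auto
    show thesis
    proof (rule derivative_from_second_differences[OF 2 R, where 'a='a], goal_cases)
    case C: (1 C)
    show thesis
    proof (rule that[of "?n 1 * C + 1"], goal_cases)
      case prems: (2 g A)
      have D: "(g has_derivative dderiv g x) (at x) \<and> \<bar>dderiv g x e\<bar> \<le> C * A * norm e
        \<and> \<bar>dderiv g x e - dderiv g x' e\<bar> \<le> C * A * norm (x - x') powr (\<gamma> - 1) * norm e"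
        if "norm x < 1 / 2" "norm x' < 1 / 2" for x x' e
      proof (rule C(2)[OF prems(1)])
        show "\<bar>fdiff [h, k] g x\<bar> \<le> A * r powr \<gamma>"
          if "norm h \<le> r" "norm k \<le> r" "0 < r" "norm x + norm h + norm k < 3 / 5" for x h k r
          using prems(3)[of "[h, k]" r x] that 2 by (auto simp: \<gamma>'_def add.assoc simp del: fdiff.simps)
      qed (use prems(2) that in auto)
      have fd: "frechet_derivative g (at x) = dderiv g x" if "norm x < 1 / 2" for x
        using D[OF that that] frechet_derivative_at by metis
      have es: "es = [] \<or> (\<exists>e\<in>Basis. es = [e])" if "set es \<subseteq> Basis" "length es \<le> 1" for es :: "'a list"
        using that by (cases es) auto
      have CA: "A \<le> C * A" "0 \<le> C * A" using C(1) prems(1) by (auto simp: mult_le_cancel_right1 intro: mult_nonneg_nonneg)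
      have "holder_norm \<gamma> g (ball 0 (1 / 2)) \<le> ennreal (?n 1 * (C * A))"
      proof (rule holder_norm_bound[OF k \<kappa> CA(2)])
        fix es :: "'a list"
        show "iter_deriv es g differentiable (at x)" if "length es < 1" "x \<in> ball 0 (1 / 2)" for x
          using that D[of x x] by (auto simp: differentiable_def)
        show "continuous_on (ball 0 (1 / 2)) (iter_deriv es g)" if "length es < 1"
        proof -
          have "g differentiable_on (ball 0 (1 / 2))"
            using D by (intro differentiable_at_imp_differentiable_on) (auto simp: differentiable_def)
          then show ?thesis using that by (simp add: differentiable_imp_continuous_on)
        qed
        show "\<bar>iter_deriv es g x\<bar> \<le> C * A" if es': "set es \<subseteq> Basis" "length es \<le> 1" and x: "x \<in> ball 0 (1 / 2)" for x
          using es[OF es']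
        proof
          assume "es = []" then show ?thesis using prems(2)[of x] x CA(1) by simp
        next
          assume "\<exists>e\<in>Basis. es = [e]"
          then obtain e where "e \<in> Basis" "es = [e]" by auto
          then show ?thesis using D[of x x e] x by (simp add: fd)
        qed
        show "\<bar>iter_deriv es g x - iter_deriv es g y\<bar> \<le> C * A * norm (x - y) powr frac \<gamma>"
          if es': "set es \<subseteq> Basis" "length es = 1" and x: "x \<in> ball 0 (1 / 2)" "y \<in> ball 0 (1 / 2)" for x y
        proof -
          obtain e where "e \<in> Basis" "es = [e]" using es[OF es'(1)] es'(2) by auto
          then show ?thesis using D[of x y e] x by (simp add: fd fr)
        qed
      qed
      also have "\<dots> \<le> ennreal ((?n 1 * C + 1) * A)"
        using prems(1) by (intro ennreal_leI) (simp add: algebra_simps)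
      finally show ?case .
    qed (use C(1) n0[of 1] in \<open>auto intro!: add_nonneg_pos mult_nonneg_nonneg\<close>)
    qed
  next
    case 3
    then have fl: "\<lfloor>\<gamma>\<rfloor> = 2" using \<gamma> by linarith
    then have k: "(2::nat) = nat \<lfloor>\<gamma>\<rfloor>" and fr: "frac \<gamma> = \<gamma> - 2" by (simp_all add: frac_def)
    \<comment> \<open>A shell of width 1/20 is spent on the gradient and another one on its
      derivative.\<close>
    have R1: "0 < (11::real) / 20" "(11::real) / 20 < 3 / 5" "(3::real) / 5 \<le> 1" by auto
    have R2: "0 < (1::real) / 2" "(1::real) / 2 < 11 / 20" "(11::real) / 20 \<le> 1" by auto
    have q: "1 < (3::real) / 2" "(3::real) / 2 < 2" by auto
    have \<gamma>1: "1 < \<gamma> - 1" "\<gamma> - 1 < 2" using 3 \<gamma> by auto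
    show thesis
    proof (rule derivative_from_second_differences[OF q R1, where 'a='a], goal_cases)
    case C1: (1 C1)
    show thesis
    proof (rule dderiv_second_differences[OF q 3 \<gamma>(2) R1, where 'a='a], goal_cases)
    case C2: (1 C2)
    show thesis
    proof (rule derivative_from_second_differences[OF \<gamma>1 R2, where 'a='a], goal_cases)
    case C3: (1 C3)
    define C where "C = C3 * (C1 + C2)"
    have C: "1 \<le> C1 + C2" "C1 + C2 \<le> C"
      using C1(1) C2(1) C3(1) by (auto simp: C_def mult_le_cancel_right1)
    show thesis
    proof (rule that[of "?n 2 * C + 1"], goal_cases)
      case prems: (2 g A)
      have d2: "\<bar>fdiff [h, k] g x\<bar> \<le> A * r powr (3 / 2)"
        if "norm h \<le> r" "norm k \<le> r" "0 < r" "norm x + norm h + norm k < 3 / 5" for x h k r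
        using prems(3)[of "[h, k]" r x] that 3 by (auto simp: \<gamma>'_def add.assoc simp del: fdiff.simps)
      have d3: "\<bar>fdiff [h, k, l] g x\<bar> \<le> A * r powr \<gamma>"
        if "norm h \<le> r" "norm k \<le> r" "norm l \<le> r" "0 < r" "norm x + norm h + norm k + norm l < 3 / 5" for x h k l r
        using prems(3)[of "[h, k, l]" r x] that \<gamma> by (auto simp: \<gamma>'_def add.assoc simp del: fdiff.simps)
      have D: "(g has_derivative dderiv g x) (at x) \<and> \<bar>dderiv g x e\<bar> \<le> C1 * A * norm e
        \<and> \<bar>dderiv g x e - dderiv g x' e\<bar> \<le> C1 * A * norm (x - x') powr (3 / 2 - 1) * norm e"
        if "norm x < 11 / 20" "norm x' < 11 / 20" for x x' e
      proof (rule C1(2)[OF prems(1)])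
        show "\<bar>fdiff [h, k] g x\<bar> \<le> A * r powr (3 / 2)"
          if "norm h \<le> r" "norm k \<le> r" "0 < r" "norm x + norm h + norm k < 3 / 5" for x h k r
          using that by (rule d2)
      qed (use prems(2) that in auto)
      have fd: "frechet_derivative g (at x) = dderiv g x" if "norm x < 11 / 20" for x
        using D[OF that that] frechet_derivative_at by metis
      let ?A = "(C1 + C2) * A"
      have A': "0 \<le> ?A" using C(1) prems(1) by simp
      have D2: "((\<lambda>x. dderiv g x e) has_derivative dderiv (\<lambda>x. dderiv g x e) x) (at x)
        \<and> \<bar>dderiv (\<lambda>x. dderiv g x e) x e'\<bar> \<le> C3 * ?A * norm e'
        \<and> \<bar>dderiv (\<lambda>x. dderiv g x e) x e' - dderiv (\<lambda>x. dderiv g x e) x' e'\<bar> \<le> C3 * ?A * norm (x - x') powr (\<gamma> - 1 - 1) * norm e'"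
        if e: "norm e = 1" and x: "norm x < 1 / 2" "norm x' < 1 / 2" for x x' e e'
      proof (rule C3(2)[OF A'])
        show "\<bar>dderiv g y e\<bar> \<le> ?A" if "norm y < 11 / 20" for y
        proof -
          have "\<bar>dderiv g y e\<bar> \<le> C1 * A" using D[OF that that, of e] e by simp
          also have "\<dots> \<le> ?A" using C2(1) prems(1) by (intro mult_right_mono) auto
          finally show ?thesis .
        qed
        show "\<bar>fdiff [h, k] (\<lambda>x. dderiv g x e) y\<bar> \<le> ?A * r powr (\<gamma> - 1)"
          if "norm h \<le> r" "norm k \<le> r" "0 < r" "norm y + norm h + norm k < 11 / 20" for y h k r
        proof -
          have "\<bar>fdiff [h, k] (\<lambda>x. dderiv g x e) y\<bar> \<le> C2 * A * r powr (\<gamma> - 1)"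
          proof (rule C2(2)[OF prems(1)])
            show "\<bar>fdiff [h, k] g x\<bar> \<le> A * r powr (3 / 2)"
              if "norm h \<le> r" "norm k \<le> r" "0 < r" "norm x + norm h + norm k < 3 / 5" for x h k r
              using that by (rule d2)
            show "\<bar>fdiff [h, k, l] g x\<bar> \<le> A * r powr \<gamma>"
              if "norm h \<le> r" "norm k \<le> r" "norm l \<le> r" "0 < r" "norm x + norm h + norm k + norm l < 3 / 5" for x h k l r
              using that by (rule d3)
          qed (use prems(2) that e in auto)
          also have "\<dots> \<le> ?A * r powr (\<gamma> - 1)" using C1(1) prems(1) by (intro mult_right_mono) auto
          finally show ?thesis .
        qed
      qed (use x in auto)
      have near: "\<forall>\<^sub>F y in nhds x. norm y < 11 / 20" if "norm x < 1 / 2" for x :: 'a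
      proof -
        have "\<forall>\<^sub>F y in nhds x. y \<in> ball 0 (11 / 20)" using that by (intro eventually_nhds_in_open) auto
        then show ?thesis by simp
      qed
      have D3: "((\<lambda>y. frechet_derivative g (at y) e) has_derivative dderiv (\<lambda>x. dderiv g x e) x) (at x)"
        if e: "e \<in> Basis" and x: "norm x < 1 / 2" for x e
      proof (rule has_derivative_transform_within_open[where s = "ball 0 (11 / 20)" and f = "\<lambda>x. dderiv g x e"])
        show "((\<lambda>x. dderiv g x e) has_derivative dderiv (\<lambda>x. dderiv g x e) x) (at x)"
          using D2[of e x x] e x by simp
      qed (use x fd in auto)
      have fd2: "frechet_derivative (\<lambda>y. frechet_derivative g (at y) e) (at x) = dderiv (\<lambda>x. dderiv g x e) x"
        if e: "e \<in> Basis" and x: "norm x < 1 / 2" for x e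
        using D3[OF that] frechet_derivative_at by metis
      have es: "es = [] \<or> (\<exists>e\<in>Basis. es = [e]) \<or> (\<exists>e'\<in>Basis. \<exists>e\<in>Basis. es = [e', e])"
        if "set es \<subseteq> Basis" "length es \<le> 2" for es :: "'a list"
      proof (cases es)
        case (Cons a es')
        then show ?thesis using that by (cases es') auto
      qed simp
      have CA: "A \<le> C * A" "0 \<le> C * A" "C1 * A \<le> C * A" "C3 * ?A = C * A"
        using C C1(1) C2(1) prems(1) by (auto simp: mult_le_cancel_right1 C_def[symmetric] mult.assoc[symmetric] intro: mult_nonneg_nonneg mult_right_mono)
      have "holder_norm \<gamma> g (ball 0 (1 / 2)) \<le> ennreal (?n 2 * (C * A))"
      proof (rule holder_norm_bound[OF k \<kappa> CA(2)])
        fix es :: "'a list"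
        show df: "iter_deriv es g differentiable (at x)" if es': "set es \<subseteq> Basis" "length es < 2" and x: "x \<in> ball 0 (1 / 2)" for x
        proof -
          have x': "norm x < 1 / 2" using x by simp
          have "es = [] \<or> (\<exists>e\<in>Basis. es = [e])" using es[of es] es' by auto
          then show ?thesis
          proof
            assume "es = []"
            then show ?thesis using D[of x x] x' unfolding differentiable_def by auto
          next
            assume "\<exists>e\<in>Basis. es = [e]"
            then obtain e where "e \<in> Basis" "es = [e]" by auto
            then show ?thesis using D3[of e x] x' unfolding differentiable_def by auto
          qed
        qed
        show "continuous_on (ball 0 (1 / 2)) (iter_deriv es g)" if "set es \<subseteq> Basis" "length es < 2"
          by (intro differentiable_imp_continuous_on differentiable_at_imp_differentiable_on df that)
        show "\<bar>iter_deriv es g x\<bar> \<le> C * A" if es': "set es \<subseteq> Basis" "length es \<le> 2" and x: "x \<in> ball 0 (1 / 2)" for x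
        proof -
          have x': "norm x < 1 / 2" "norm x < 11 / 20" using x by auto
          consider "es = []" | e where "e \<in> Basis" "es = [e]" | e' e where "e' \<in> Basis" "e \<in> Basis" "es = [e', e]"
            using es[OF es'] by blast
          then show ?thesis
          proof cases
            case 1 then show ?thesis using prems(2)[of x] x' CA(1) by simp
          next
            case 2 then show ?thesis using D[OF x'(2,2), of e] CA(3) by (simp add: fd[OF x'(2)])
          next
            case 3 then show ?thesis using D2[of e x x e'] x' CA(4) by (simp add: fd2)
          qed
        qed
        show "\<bar>iter_deriv es g x - iter_deriv es g y\<bar> \<le> C * A * norm (x - y) powr frac \<gamma>"
          if es': "set es \<subseteq> Basis" "length es = 2" and x: "x \<in> ball 0 (1 / 2)" "y \<in> ball 0 (1 / 2)" for x y
        proof -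
          obtain e' e where "e' \<in> Basis" "e \<in> Basis" "es = [e', e]" using es[OF es'(1)] es'(2) by auto
          then show ?thesis using D2[of e x y e'] x CA(4) by (simp add: fd2 fr)
        qed
      qed
      also have "\<dots> \<le> ennreal ((?n 2 * C + 1) * A)"
        using prems(1) by (intro ennreal_leI) (simp add: algebra_simps)
      finally show ?case .
    qed (use C n0[of 2] in \<open>auto intro!: add_nonneg_pos mult_nonneg_nonneg\<close>)
    qed
    qed
    qed
  qed
qed

subsection \<open>Mollifiers\<close>

text \<open>\<open>flat 0\<close> is the classical exp(-1/t) extended by 0. The powers of 1/t are
  carried along because differentiation produces them, which closes the family under derivatives up
  to linear combinations.\<close>

definition flat :: "nat \<Rightarrow> real \<Rightarrow> real" where
  "flat k t = (if 0 < t then (1 / t) ^ k * exp (- (1 / t)) else 0)"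

lemma flat_tendsto_0: "(flat k \<longlongrightarrow> 0) (at_right 0)"
proof -
  have "((\<lambda>t::real. (inverse t) ^ k / exp (inverse t)) \<longlongrightarrow> 0) (at_right 0)"
    by (rule filterlim_compose[OF tendsto_power_div_exp_0 filterlim_inverse_at_top_right])
  moreover have "\<forall>\<^sub>F t in at_right 0. (inverse t) ^ k / exp (inverse t) = flat k t"
    unfolding eventually_at_right_field
    by (auto intro!: exI[of _ 1] simp: flat_def exp_minus divide_inverse)
  ultimately show ?thesis by (rule Lim_transform_eventually)
qed

lemma flat_has_derivative:
  "(flat k has_real_derivative flat (k + 2) t - real k * flat (k + 1) t) (at t)"
proof -
  consider "0 < t" | "t < 0" | "t = 0" by linarith
  then show ?thesis
  proof cases
    case 1
    have "((\<lambda>t. (1 / t) ^ k * exp (- (1 / t))) has_real_derivative flat (k + 2) t - real k * flat (k + 1) t) (at t)"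
    proof -
      have 1: "((\<lambda>t. 1 / t) has_real_derivative - ((1 / t) ^ 2)) (at t)"
        using 1 by (auto intro!: derivative_eq_intros simp: power2_eq_square)
      have 2: "((\<lambda>t. (1 / t) ^ k) has_real_derivative - (real k * (1 / t) ^ (k + 1))) (at t)"
        using DERIV_power[OF 1, of k] by (cases k) (simp_all add: power2_eq_square mult_ac)
      have 3: "((\<lambda>t. exp (- (1 / t))) has_real_derivative exp (- (1 / t)) * (1 / t) ^ 2) (at t)"
        using DERIV_chain2[OF DERIV_exp DERIV_minus[OF 1]] by simp
      show ?thesis
        using DERIV_mult[OF 2 3] \<open>0 < t\<close> by (simp add: flat_def power2_eq_square mult_ac)
    qed
    then show ?thesis
      by (rule has_field_derivative_transform_within_open[where S = "{0<..}"]) (use 1 in \<open>auto simp: flat_def\<close>)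
  next
    case 2
    have "((\<lambda>t. 0) has_real_derivative flat (k + 2) t - real k * flat (k + 1) t) (at t)"
      using 2 by (simp add: flat_def)
    then show ?thesis
      by (rule has_field_derivative_transform_within_open[where S = "{..<0}"]) (use 2 in \<open>auto simp: flat_def\<close>)
  next
    case 3
    \<comment> \<open>At 0 the right difference quotient of \<open>flat k\<close> is
      \<open>flat (k + 1) h\<close>, which tends to 0; the left one is 0.\<close>
    have "((\<lambda>h. (flat k (0 + h) - flat k 0) / h) \<longlongrightarrow> 0) (at 0)"
    proof (rule filterlim_split_at)
      have "\<forall>\<^sub>F h in at_left 0. 0 = (flat k (0 + h) - flat k 0) / h"
        unfolding eventually_at_left_field by (auto intro!: exI[of _ "-1"] simp: flat_def)
      then show "((\<lambda>h. (flat k (0 + h) - flat k 0) / h) \<longlongrightarrow> 0) (at_left 0)"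
        by (rule Lim_transform_eventually[OF tendsto_const])
      have "\<forall>\<^sub>F h in at_right 0. flat (k + 1) h = (flat k (0 + h) - flat k 0) / h"
        unfolding eventually_at_right_field by (auto intro!: exI[of _ 1] simp: flat_def)
      then show "((\<lambda>h. (flat k (0 + h) - flat k 0) / h) \<longlongrightarrow> 0) (at_right 0)"
        by (rule Lim_transform_eventually[OF flat_tendsto_0])
    qed
    then show ?thesis using 3 by (simp add: DERIV_def flat_def)
  qed
qed

text \<open>A class generated so that directional derivatives stay inside it: smoothness of all
  orders then reduces to one induction over the generation, with no argument about higher
  derivatives.\<close>

inductive_set smooth :: "('a::euclidean_space \<Rightarrow> real) set" where
  flat: "(\<lambda>z. flat k (c + z \<bullet> v)) \<in> smooth"
| const: "(\<lambda>z. c) \<in> smooth"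
| add: "f \<in> smooth \<Longrightarrow> g \<in> smooth \<Longrightarrow> (\<lambda>z. f z + g z) \<in> smooth"
| mult: "f \<in> smooth \<Longrightarrow> g \<in> smooth \<Longrightarrow> (\<lambda>z. f z * g z) \<in> smooth"

lemma smooth_has_derivative:
  assumes "f \<in> smooth"
  obtains f' where "\<And>z. (f has_derivative f' z) (at z)" "\<And>e. (\<lambda>z. f' z e) \<in> smooth"
proof -
  have "\<exists>f'. (\<forall>z. (f has_derivative f' z) (at z)) \<and> (\<forall>e. (\<lambda>z. f' z e) \<in> smooth)"
    using assms
  proof induction
    case (flat k c v)
    let ?f' = "\<lambda>z e. (flat (k + 2) (c + z \<bullet> v) + (- real k) * flat (k + 1) (c + z \<bullet> v)) * (e \<bullet> v)"
    have "((\<lambda>z. flat k (c + z \<bullet> v)) has_derivative ?f' z) (at z)" for z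
    proof -
      have 1: "(flat k has_derivative (*) (flat (k + 2) (c + z \<bullet> v) - real k * flat (k + 1) (c + z \<bullet> v))) (at (c + z \<bullet> v))"
        using flat_has_derivative by (simp add: has_field_derivative_def)
      have 2: "((\<lambda>z. c + z \<bullet> v) has_derivative (\<lambda>e. e \<bullet> v)) (at z)"
        by (auto intro!: derivative_eq_intros)
      show ?thesis using diff_chain_at[OF 2 1] by (simp add: o_def)
    qed
    moreover have "(\<lambda>z. ?f' z e) \<in> smooth" for e
      by (intro smooth.intros)
    ultimately show ?case by (intro exI[of _ ?f']) auto
  next
    case (const c)
    then show ?case by (intro exI[of _ "\<lambda>z e. 0"]) (auto intro: smooth.const)
  next
    case (add f g)
    then obtain f' g' where "\<And>z. (f has_derivative f' z) (at z)" "\<And>e. (\<lambda>z. f' z e) \<in> smooth"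
      "\<And>z. (g has_derivative g' z) (at z)" "\<And>e. (\<lambda>z. g' z e) \<in> smooth" by blast
    then show ?case
      by (intro exI[of _ "\<lambda>z e. f' z e + g' z e"]) (auto intro: has_derivative_add smooth.add)
  next
    case (mult f g)
    then obtain f' g' where "\<And>z. (f has_derivative f' z) (at z)" "\<And>e. (\<lambda>z. f' z e) \<in> smooth"
      "\<And>z. (g has_derivative g' z) (at z)" "\<And>e. (\<lambda>z. g' z e) \<in> smooth" by blast
    with mult.hyps show ?case
      by (intro exI[of _ "\<lambda>z e. f z * g' z e + f' z e * g z"]) (auto intro!: has_derivative_mult smooth.add smooth.mult)
  qed
  then show thesis using that by blast
qed

lemma smooth_continuous_on: "f \<in> smooth \<Longrightarrow> continuous_on S f"
  by (meson smooth_has_derivative has_derivative_continuous continuous_at_imp_continuous_on)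

lemma smooth_borel[measurable_dest]: "f \<in> smooth \<Longrightarrow> f \<in> borel_measurable borel"
  by (intro borel_measurable_continuous_onI smooth_continuous_on)

lemma smooth_iter_deriv: "f \<in> smooth \<Longrightarrow> iter_deriv es f \<in> smooth"
proof (induction es)
  case (Cons e es)
  then obtain f' where f': "\<And>z. (iter_deriv es f has_derivative f' z) (at z)" "\<And>e. (\<lambda>z. f' z e) \<in> smooth"
    using smooth_has_derivative by blast
  have "frechet_derivative (iter_deriv es f) (at z) = f' z" for z
    using frechet_derivative_at[OF f'(1)] by simp
  then show ?case using f'(2) by simp
qed simp

lemma smooth_Ck_on: "f \<in> smooth \<Longrightarrow> Ck_on k f UNIV"
  unfolding Ck_on_def
  by (meson smooth_iter_deriv smooth_continuous_on smooth_has_derivative differentiableI)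

lemma smooth_reflect: "f \<in> smooth \<Longrightarrow> (\<lambda>z'. f (z - z')) \<in> smooth"
proof (induction rule: smooth.induct)
  case (flat k c v)
  have "(\<lambda>z'. flat k (c + (z - z') \<bullet> v)) = (\<lambda>z'. flat k ((c + z \<bullet> v) + z' \<bullet> (- v)))"
    by (simp add: inner_diff_left algebra_simps)
  then show ?case by (simp only: smooth.flat)
qed (auto intro: smooth.intros)

lemma smooth_prod: "finite B \<Longrightarrow> (\<And>b. b \<in> B \<Longrightarrow> f b \<in> smooth) \<Longrightarrow> (\<lambda>z. \<Prod>b\<in>B. f b z) \<in> smooth"
  by (induction rule: finite_induct) (auto intro: smooth.intros)

definition bump :: "real \<Rightarrow> 'a::euclidean_space \<Rightarrow> real" where
  "bump \<delta> z = (\<Prod>b\<in>Basis. flat 0 (\<delta> + z \<bullet> b) * flat 0 (\<delta> - z \<bullet> b))"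

lemma bump_smooth: "bump \<delta> \<in> smooth"
proof -
  have "(\<lambda>z. flat 0 (\<delta> - z \<bullet> b)) \<in> smooth" for b :: 'a
    using smooth.flat[of 0 \<delta> "- b"] by simp
  then show ?thesis unfolding bump_def[abs_def]
    by (intro smooth_prod smooth.mult smooth.flat) auto
qed

lemma bump_nonneg: "0 \<le> bump \<delta> z"
  unfolding bump_def by (intro prod_nonneg) (auto simp: flat_def)

lemma bump_support: "bump \<delta> z \<noteq> 0 \<longleftrightarrow> (\<forall>b\<in>Basis. \<bar>z \<bullet> b\<bar> < \<delta>)"
  by (auto simp: bump_def flat_def abs_less_iff)

text \<open>K is any compact set off which \<psi> vanishes. Having it as a parameter lets all
  derivatives of \<psi> share the same K.\<close>

definition supported :: "('a::euclidean_space \<Rightarrow> real) \<Rightarrow> 'a set \<Rightarrow> bool" where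
  "supported \<psi> K \<longleftrightarrow> \<psi> \<in> smooth \<and> compact K \<and> (\<forall>z. z \<notin> K \<longrightarrow> \<psi> z = 0)"

lemma supported_bounded:
  assumes "supported \<psi> K" obtains B where "0 \<le> B" "\<And>z. \<bar>\<psi> z\<bar> \<le> B"
proof -
  have "compact (\<psi> ` K)"
    using assms smooth_continuous_on by (intro compact_continuous_image) (auto simp: supported_def)
  then obtain B where B: "\<forall>y\<in>\<psi> ` K. norm y \<le> B" using compact_imp_bounded bounded_iff by metis
  then have "\<bar>\<psi> z\<bar> \<le> max 0 B" for z
    using assms by (cases "z \<in> K") (auto simp: supported_def)
  then show thesis by (intro that[of "max 0 B"]) auto
qed

lemma supported_integrable:
  assumes "supported \<psi> K" shows "integrable lborel \<psi>"
proof -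
  obtain B where B: "0 \<le> B" "\<And>z. \<bar>\<psi> z\<bar> \<le> B" using supported_bounded[OF assms] by blast
  have K: "emeasure lborel K < \<infinity>" "K \<in> sets lborel"
    using assms emeasure_bounded_finite[of K] by (auto simp: supported_def compact_imp_bounded compact_imp_closed borel_closed)
  show ?thesis
  proof (rule integral_dominated_le(1))
    show "integrable lborel (\<lambda>z. B * indicator K z)" using K by simp
    show "\<psi> \<in> borel_measurable lborel" using assms smooth_borel[of \<psi>] by (simp add: supported_def)
    show "\<bar>\<psi> z\<bar> \<le> B * indicator K z" for z
      using B assms by (cases "z \<in> K") (auto simp: supported_def)
  qed
qed

lemma supported_derivative:
  assumes "supported \<psi> K"
  obtains \<psi>' where "\<And>z. (\<psi> has_derivative \<psi>' z) (at z)" "\<And>e. supported (\<lambda>z. \<psi>' z e) K"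
proof -
  obtain \<psi>' where \<psi>': "\<And>z. (\<psi> has_derivative \<psi>' z) (at z)" "\<And>e. (\<lambda>z. \<psi>' z e) \<in> smooth"
    using smooth_has_derivative assms unfolding supported_def by blast
  have "\<psi>' z e = 0" if "z \<notin> K" for z e
  proof -
    have "open (- K)" using assms by (auto simp: supported_def compact_imp_closed)
    then have "(\<psi> has_derivative (\<lambda>_. 0)) (at z)"
      by (rule has_derivative_transform_within_open[OF has_derivative_const[of 0]])
         (use that assms in \<open>auto simp: supported_def\<close>)
    then show ?thesis using has_derivative_unique[OF \<psi>'(1)] by metis
  qed
  then show thesis using \<psi>' assms by (intro that[of \<psi>']) (auto simp: supported_def)
qed

lemma fdiff_sum: "finite B \<Longrightarrow> fdiff hs (\<lambda>x. \<Sum>b\<in>B. f b x) x = (\<Sum>b\<in>B. fdiff hs (f b) x)"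
  by (induction hs arbitrary: x) (auto simp: sum_subtractf)

lemma fdiff_has_derivative:
  fixes \<psi> :: "'a::real_normed_vector \<Rightarrow> real"
  assumes "\<And>z. (\<psi> has_derivative \<psi>' z) (at z)"
  shows "(fdiff hs \<psi> has_derivative (\<lambda>e. fdiff hs (\<lambda>z. \<psi>' z e) z)) (at z)"
proof (induction hs arbitrary: z)
  case Nil
  then show ?case using assms by (simp add: fdiff.simps(1)[abs_def])
next
  case (Cons h hs)
  have "((\<lambda>z. fdiff hs \<psi> (z + h)) has_derivative (\<lambda>e. fdiff hs (\<lambda>z. \<psi>' z e) (z + h))) (at z)"
  proof -
    have "((\<lambda>z. z + h) has_derivative (\<lambda>e. e)) (at z)" by (auto intro!: derivative_eq_intros)
    from diff_chain_at[OF this Cons.IH] show ?thesis by (simp add: o_def)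
  qed
  then show ?case using Cons.IH[of z] by (auto simp: fdiff.simps(2)[abs_def] intro!: has_derivative_diff)
qed

text \<open>Mean value theorem, one derivative per step. The induction hypothesis yields a constant
  for each direction of differentiation; by linearity of the derivative the constants for the basis
  vectors suffice, and their sum is uniform in the step.\<close>

lemma supported_fdiff_bound:
  fixes \<psi> :: "'a::euclidean_space \<Rightarrow> real"
  assumes "supported \<psi> K"
  obtains B where "0 \<le> B" "\<And>hs z. length hs = m \<Longrightarrow> \<bar>fdiff hs \<psi> z\<bar> \<le> B * prod_list (map norm hs)"
proof -
  have "\<exists>B\<ge>0. \<forall>hs z. length hs = m \<longrightarrow> \<bar>fdiff hs \<psi> z\<bar> \<le> B * prod_list (map norm hs)"
    using assms
  proof (induction m arbitrary: \<psi>)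
    case 0
    then show ?case using supported_bounded[of \<psi> K] by (metis fdiff.simps(1) length_0_conv list.map(1) mult_1_right prod_list.Nil)
  next
    case (Suc m)
    obtain \<psi>' where \<psi>': "\<And>z. (\<psi> has_derivative \<psi>' z) (at z)" "\<And>e. supported (\<lambda>z. \<psi>' z e) K"
      using supported_derivative[OF Suc.prems] by blast
    have "\<forall>e. \<exists>B\<ge>0. \<forall>hs z. length hs = m \<longrightarrow> \<bar>fdiff hs (\<lambda>z. \<psi>' z e) z\<bar> \<le> B * prod_list (map norm hs)"
      using Suc.IH[OF \<psi>'(2)] by blast
    then obtain B where B: "\<And>e. 0 \<le> B e"
      "\<And>e hs z. length hs = m \<Longrightarrow> \<bar>fdiff hs (\<lambda>z. \<psi>' z e) z\<bar> \<le> B e * prod_list (map norm hs)"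
      by metis
    show ?case
    proof (intro exI[of _ "\<Sum>b\<in>Basis. B b"] conjI allI impI)
      show "0 \<le> (\<Sum>b\<in>Basis. B b)" using B(1) by (intro sum_nonneg) auto
      fix hs :: "'a list" and z assume len: "length hs = Suc m"
      then obtain h hs' where hs: "hs = h # hs'" and len': "length hs' = m" by (cases hs) auto
      let ?P = "prod_list (map norm hs')"
      have P: "0 \<le> ?P" by (intro prod_list_nonneg) auto
      have lin: "linear (\<psi>' z)" for z using \<psi>'(1) has_derivative_linear by blast
      have d: "\<bar>fdiff hs' (\<lambda>z. \<psi>' z e) z\<bar> \<le> ((\<Sum>b\<in>Basis. B b) * ?P) * norm e" for e z
      proof -
        have "\<psi>' z e = (\<Sum>b\<in>Basis. (e \<bullet> b) * \<psi>' z b)" for z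
        proof -
          have "\<psi>' z e = \<psi>' z (\<Sum>b\<in>Basis. (e \<bullet> b) *\<^sub>R b)" by (simp add: euclidean_representation)
          also have "\<dots> = (\<Sum>b\<in>Basis. (e \<bullet> b) * \<psi>' z b)"
            using lin by (simp add: linear_sum linear_cmul)
          finally show ?thesis .
        qed
        then have "fdiff hs' (\<lambda>z. \<psi>' z e) z = (\<Sum>b\<in>Basis. (e \<bullet> b) * fdiff hs' (\<lambda>z. \<psi>' z b) z)"
          by (simp add: fdiff_sum fdiff_cmult)
        also have "\<bar>\<dots>\<bar> \<le> (\<Sum>b\<in>Basis. norm e * (B b * ?P))"
        proof (rule order_trans[OF sum_abs], rule sum_mono)
          fix b :: 'a assume "b \<in> Basis"
          then show "\<bar>(e \<bullet> b) * fdiff hs' (\<lambda>z. \<psi>' z b) z\<bar> \<le> norm e * (B b * ?P)"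
            unfolding abs_mult using B(2)[OF len', of b z] Basis_le_norm[of b e] by (intro mult_mono) auto
        qed
        also have "\<dots> = ((\<Sum>b\<in>Basis. B b) * ?P) * norm e"
          by (simp add: sum_distrib_left sum_distrib_right mult_ac)
        finally show ?thesis .
      qed
      have "norm (fdiff hs' \<psi> (z + h) - fdiff hs' \<psi> z) \<le> ((\<Sum>b\<in>Basis. B b) * ?P) * norm (z + h - z)"
      proof (rule differentiable_bound[where S = UNIV])
        show "(fdiff hs' \<psi> has_derivative (\<lambda>e. fdiff hs' (\<lambda>z. \<psi>' z e) y)) (at y within UNIV)" for y
          using fdiff_has_derivative[OF \<psi>'(1)] by simp
        show "onorm (\<lambda>e. fdiff hs' (\<lambda>z. \<psi>' z e) y) \<le> (\<Sum>b\<in>Basis. B b) * ?P" for y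
          using d by (intro onorm_le) auto
      qed auto
      then show "\<bar>fdiff hs \<psi> z\<bar> \<le> (\<Sum>b\<in>Basis. B b) * prod_list (map norm hs)"
        by (simp add: hs mult_ac)
    qed
  qed
  then show thesis using that by blast
qed

lemma mollifier_exists:
  fixes \<epsilon> :: real
  assumes "0 < \<epsilon>"
  obtains \<phi> :: "real \<times> 'a::euclidean_space \<Rightarrow> real"
  where "supported \<phi> ({-\<epsilon>..\<epsilon>} \<times> cball 0 \<epsilon>)" "\<And>z. 0 \<le> \<phi> z" "(LINT z|lborel. \<phi> z) = 1"
proof -
  \<comment> \<open>The support of \<open>bump\<close> lies in a cube. For the space component n
    \<delta> = \<epsilon> bounds the 1-norm and hence the Euclidean norm.\<close>
  define \<delta> where "\<delta> = \<epsilon> / real DIM('a)"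
  have \<delta>: "0 < \<delta>" "\<delta> \<le> \<epsilon>" using assms by (auto simp: \<delta>_def field_simps)
  let ?b = "bump \<delta> :: real \<times> 'a \<Rightarrow> real"
  let ?K = "{-\<epsilon>..\<epsilon>} \<times> cball (0::'a) \<epsilon>"
  have b0: "?b z = 0" if "z \<notin> ?K" for z
  proof (rule ccontr)
    assume "?b z \<noteq> 0"
    then have B: "\<And>b. b \<in> Basis \<Longrightarrow> \<bar>z \<bullet> b\<bar> < \<delta>" by (simp add: bump_support)
    have "\<bar>z \<bullet> (1, 0)\<bar> < \<delta>" by (rule B) (simp add: Basis_prod_def)
    then have 1: "\<bar>fst z\<bar> < \<epsilon>" using \<delta> by (simp add: inner_prod_def)
    have "norm (snd z) \<le> (\<Sum>b\<in>Basis. \<bar>snd z \<bullet> b\<bar>)" by (rule norm_le_l1)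
    also have "\<dots> \<le> (\<Sum>b\<in>(Basis::'a set). \<delta>)"
    proof (rule sum_mono)
      fix b :: 'a assume "b \<in> Basis"
      then have "\<bar>z \<bullet> (0, b)\<bar> < \<delta>" by (intro B) (simp add: Basis_prod_def)
      then show "\<bar>snd z \<bullet> b\<bar> \<le> \<delta>" by (simp add: inner_prod_def)
    qed
    also have "\<dots> = \<epsilon>" by (simp add: \<delta>_def)
    finally show False using 1 that by (cases z) auto
  qed
  have sup: "supported ?b ?K"
    unfolding supported_def using bump_smooth b0 by (auto intro!: compact_Times)
  let ?Z = "LINT z|lborel. ?b z"
  \<comment> \<open>The integrand is nonnegative, and it is nonzero on an open set containing 0,
    which cannot be negligible.\<close>
  have "?Z \<noteq> 0"
  proof
    assume "?Z = 0"
    then have "AE z in lborel. ?b z = 0"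
      using integral_nonneg_eq_0_iff_AE[OF supported_integrable[OF sup]] bump_nonneg by auto
    moreover have op: "open {z. ?b z \<noteq> 0}"
      by (rule open_Collect_neq) (auto intro: smooth_continuous_on bump_smooth)
    ultimately have "{z. ?b z \<noteq> 0} \<in> null_sets lborel"
      using AE_iff_null[of lborel "\<lambda>z. ?b z = 0"] by simp
    then have n: "negligible {z. ?b z \<noteq> 0}" by (simp add: null_sets_completionI negligible_iff_null_sets)
    have "0 \<in> {z. ?b z \<noteq> 0}" using \<delta> by (simp add: bump_support)
    then show False using n op open_not_negligible by blast
  qed
  then have Z: "0 < ?Z" using Bochner_Integration.integral_nonneg[of lborel ?b] bump_nonneg by (metis less_eq_real_def)
  show thesis
  proof (rule that[of "\<lambda>z. 1 / ?Z * ?b z"])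
    show "supported (\<lambda>z. 1 / ?Z * ?b z) ?K"
      using sup smooth.mult[OF smooth.const[of "1 / ?Z"] bump_smooth[of \<delta>]] unfolding supported_def by simp
    show "0 \<le> 1 / ?Z * ?b z" for z using Z bump_nonneg[of \<delta> z] by simp
    show "(LINT z|lborel. 1 / ?Z * ?b z) = 1" using Z by simp
  qed
qed

subsection \<open>Convolution\<close>

definition conv :: "('b::euclidean_space \<Rightarrow> real) \<Rightarrow> ('b \<Rightarrow> real) \<Rightarrow> 'b \<Rightarrow> real" where
  "conv u \<psi> z = (LINT z'|lborel. u z' * \<psi> (z - z'))"

lemma supported_reflect:
  assumes "supported \<psi> K" shows "supported (\<lambda>z'. \<psi> (z - z')) ((-) z ` K)"
proof -
  have "compact ((-) z ` K)"
    using assms by (intro compact_continuous_image continuous_intros) (auto simp: supported_def)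
  moreover have "\<psi> (z - z') = 0" if "z' \<notin> (-) z ` K" for z'
  proof -
    have "z - z' \<notin> K" using that image_eqI[of z' "(-) z" "z - z'" K] by auto
    then show ?thesis using assms by (simp add: supported_def)
  qed
  ultimately show ?thesis using assms smooth_reflect by (auto simp: supported_def)
qed

lemma lborel_distr_reflect: "distr lborel borel (\<lambda>x. a - x :: 'a::euclidean_space) = lborel"
proof -
  have "(lborel :: 'a measure) = density (distr lborel borel (\<lambda>x. a + (-1) *\<^sub>R x)) (\<lambda>_. \<bar>-1::real\<bar> ^ DIM('a))"
    by (rule lborel_affine) simp
  also have "\<dots> = distr lborel borel (\<lambda>x. a - x)" by (simp add: density_1)
  finally show ?thesis ..
qed

lemma lborel_integrable_reflect:
  fixes f :: "'a::euclidean_space \<Rightarrow> real"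
  assumes "integrable lborel f"
  shows "integrable lborel (\<lambda>x. f (a - x))"
  by (rule integrable_distr[of "\<lambda>x. a - x" lborel borel f]) (use assms in \<open>simp_all add: lborel_distr_reflect\<close>)

lemma lborel_integral_reflect:
  fixes f :: "'a::euclidean_space \<Rightarrow> real"
  assumes "f \<in> borel_measurable borel"
  shows "(LINT x|lborel. f (a - x)) = (LINT x|lborel. f x)"
proof -
  have "(LINT x|distr lborel borel (\<lambda>x. a - x). f x) = (LINT x|lborel. f (a - x))"
    by (rule integral_distr) (use assms in auto)
  then show ?thesis by (simp add: lborel_distr_reflect)
qed

lemma quadratic_remainder_imp_deriv:
  fixes f :: "real \<Rightarrow> real"
  assumes "\<And>h. \<bar>h\<bar> \<le> 1 \<Longrightarrow> \<bar>f (x + h) - f x - h * D\<bar> \<le> C * h\<^sup>2"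
  shows "(f has_real_derivative D) (at x)"
proof -
  have t: "((\<lambda>h. C * \<bar>h\<bar>) \<longlongrightarrow> C * \<bar>0\<bar>) (at (0::real))" by (intro tendsto_intros)
  have "((\<lambda>h. (f (x + h) - f x) / h - D) \<longlongrightarrow> 0) (at 0)"
  proof (rule Lim_null_comparison)
    show "((\<lambda>h. C * \<bar>h\<bar>) \<longlongrightarrow> 0) (at (0::real))" using t by simp
    have "\<forall>\<^sub>F h in at (0::real). \<bar>h\<bar> < 1 \<and> h \<noteq> 0"
      unfolding eventually_at by (auto intro!: exI[of _ 1])
    then show "\<forall>\<^sub>F h in at 0. norm ((f (x + h) - f x) / h - D) \<le> C * \<bar>h\<bar>"
    proof (rule eventually_mono)
      fix h :: real assume h: "\<bar>h\<bar> < 1 \<and> h \<noteq> 0"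
      have "\<bar>(f (x + h) - f x) / h - D\<bar> = \<bar>f (x + h) - f x - h * D\<bar> / \<bar>h\<bar>"
        using h by (simp add: diff_divide_distrib flip: abs_divide)
      also have "\<dots> \<le> C * h\<^sup>2 / \<bar>h\<bar>" using h by (intro divide_right_mono assms) auto
      also have "\<dots> = C * \<bar>h\<bar>" using h by (simp add: power2_eq_square) (metis abs_mult_self_eq mult.assoc nonzero_mult_div_cancel_right abs_zero zero_less_abs_iff less_irrefl times_divide_eq_right)
      finally show "norm ((f (x + h) - f x) / h - D) \<le> C * \<bar>h\<bar>" by simp
    qed
  qed
  then show ?thesis unfolding DERIV_def by (simp add: LIM_zero_iff)
qed

lemma fdiff_integrable:
  assumes "supported \<psi> K" shows "integrable lborel (fdiff hs \<psi>)"
proof (induction hs)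
  case Nil
  then show ?case using supported_integrable[OF assms] by (simp add: fdiff.simps(1)[abs_def])
next
  case (Cons h hs)
  have "integrable lborel (\<lambda>z. fdiff hs \<psi> (h + z))" by (rule lborel_integrable_translate[OF Cons.IH])
  then have "integrable lborel (\<lambda>z. fdiff hs \<psi> (z + h) - fdiff hs \<psi> z)"
    by (intro Bochner_Integration.integrable_diff Cons.IH) (simp add: add.commute)
  then show ?case by (simp add: fdiff.simps(2)[abs_def])
qed

text \<open>Borel and bounded everywhere, not just almost everywhere: convolutions then exist at
  every point and Fubini applies on \<open>lborel\<close>. \<open>borel_version\<close> supplies
  such representatives.\<close>

locale bounded_borel =
  fixes u :: "'b::euclidean_space \<Rightarrow> real" and U :: real
  assumes u_borel: "u \<in> borel_measurable borel" and u_bound: "\<And>z. \<bar>u z\<bar> \<le> U"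
begin

lemma U_nonneg: "0 \<le> U"
  using u_bound[of 0] by linarith

lemma conv_integrand:
  assumes "integrable lborel \<psi>"
  shows "integrable lborel (\<lambda>z'. u z' * \<psi> (z - z'))"
  using integrable_mult_bounded[OF lborel_integrable_reflect[OF assms] u_borel u_bound, of z]
  by (simp add: mult.commute)

lemma conv_bound_integral:
  assumes "integrable lborel \<psi>" "integrable lborel g" "\<And>z. \<bar>\<psi> z\<bar> \<le> g z"
  shows "\<bar>LINT z'|lborel. u z' * \<psi> (z - z')\<bar> \<le> U * (LINT z|lborel. g z)"
proof -
  have "\<bar>LINT z'|lborel. u z' * \<psi> (z - z')\<bar> \<le> (LINT z'|lborel. U * g (z - z'))"
  proof (rule integral_dominated_le(2))
    show "integrable lborel (\<lambda>z'. U * g (z - z'))"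
      by (intro integrable_mult_right lborel_integrable_reflect assms)
    show "(\<lambda>z'. u z' * \<psi> (z - z')) \<in> borel_measurable lborel"
      by (rule borel_measurable_integrable[OF conv_integrand[OF assms(1)]])
    show "\<bar>u z' * \<psi> (z - z')\<bar> \<le> U * g (z - z')" for z'
      unfolding abs_mult using u_bound assms(3) U_nonneg by (intro mult_mono) auto
  qed
  also have "\<dots> = U * (LINT z'|lborel. g (z - z'))" by simp
  also have "(LINT z'|lborel. g (z - z')) = (LINT z|lborel. g z)"
    using borel_measurable_integrable[OF assms(2)] by (intro lborel_integral_reflect) simp
  finally show ?thesis .
qed

lemma fdiff_conv:
  assumes "supported \<psi> K"
  shows "fdiff hs (conv u \<psi>) z = (LINT z'|lborel. u z' * fdiff hs \<psi> (z - z'))"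
proof -
  have "fdiff hs (\<lambda>z. LINT z'|lborel. u z' * \<psi> (z - z')) z = (LINT z'|lborel. fdiff hs (\<lambda>z. u z' * \<psi> (z - z')) z)"
    by (rule fdiff_integral(1)) (rule conv_integrand[OF supported_integrable[OF assms]])
  also have "\<dots> = (LINT z'|lborel. u z' * fdiff hs \<psi> (z - z'))"
    using fdiff_translate[of hs \<psi> "- z'" z for z'] by (simp add: fdiff_cmult)
  finally show ?thesis unfolding conv_def[abs_def] .
qed

lemma conv_fdiff_bound:
  assumes "supported \<psi> K"
  obtains B where "0 \<le> B"
    "\<And>hs z. length hs = m \<Longrightarrow> (\<And>h. h \<in> set hs \<Longrightarrow> norm h \<le> 1) \<Longrightarrow> \<bar>fdiff hs (conv u \<psi>) z\<bar> \<le> B * prod_list (map norm hs)"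
proof -
  obtain B where B: "0 \<le> B" "\<And>hs z. length hs = m \<Longrightarrow> \<bar>fdiff hs \<psi> z\<bar> \<le> B * prod_list (map norm hs)"
    using supported_fdiff_bound[OF assms] by blast
  have "bounded K" using assms by (auto simp: supported_def compact_imp_bounded)
  then obtain \<rho> where \<rho>: "\<And>z. z \<in> K \<Longrightarrow> norm z \<le> \<rho>" unfolding bounded_iff by blast
  \<comment> \<open>m steps of length at most 1 enlarge the support by at most m, so one set of
    finite measure serves all the differences.\<close>
  define S where "S = cball (0::'b) (\<rho> + real m)"
  have S: "emeasure lborel S < \<infinity>" "S \<in> sets lborel"
    unfolding S_def using emeasure_compact_finite[OF compact_cball] by auto
  show thesis
  proof (rule that[of "U * (B * measure lborel S)"])
    show "0 \<le> U * (B * measure lborel S)" using U_nonneg B(1) by simp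
    fix hs :: "'b list" and z assume len: "length hs = m" and h1: "\<And>h. h \<in> set hs \<Longrightarrow> norm h \<le> 1"
    let ?P = "prod_list (map norm hs)"
    have P: "0 \<le> ?P" by (intro prod_list_nonneg) auto
    have sum: "sum_list (map norm hs) \<le> real m"
      using sum_list_mono[of hs norm "\<lambda>_. 1"] h1 len by (simp add: sum_list_triv)
    have "\<bar>LINT z'|lborel. u z' * fdiff hs \<psi> (z - z')\<bar> \<le> U * (LINT z|lborel. (B * ?P) * indicator S z)"
    proof (rule conv_bound_integral[OF fdiff_integrable[OF assms]])
      show "integrable lborel (\<lambda>z. (B * ?P) * indicator S z)" using S by simp
      show "\<bar>fdiff hs \<psi> z\<bar> \<le> (B * ?P) * indicator S z" for z
      proof (cases "z \<in> S")
        case True then show ?thesis using B(2)[OF len] by simp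
      next
        case False
        have "fdiff hs \<psi> z = fdiff hs (\<lambda>_. 0) z"
        proof (rule fdiff_cong_local)
          fix y assume y: "norm (y - z) \<le> sum_list (map norm hs)"
          have "norm z \<le> norm y + norm (y - z)" using norm_triangle_ineq4[of y "y - z"] by simp
          then have "\<rho> < norm y" using y sum False by (simp add: S_def)
          then have "y \<notin> K" using \<rho> by fastforce
          then show "\<psi> y = 0" using assms by (simp add: supported_def)
        qed
        also have "\<dots> = 0" using fdiff_cmult[of hs 0 "\<lambda>_. 0" z] by simp
        finally show ?thesis using False by simp
      qed
    qed
    then show "\<bar>fdiff hs (conv u \<psi>) z\<bar> \<le> U * (B * measure lborel S) * ?P"
      unfolding fdiff_conv[OF assms] by (simp add: mult_ac)
  qed
qed

lemma conv_bounded: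
  assumes "supported \<psi> K" "\<And>z. 0 \<le> \<psi> z" "(LINT z|lborel. \<psi> z) = 1"
  shows "\<bar>conv u \<psi> z\<bar> \<le> U"
  using conv_bound_integral[OF supported_integrable[OF assms(1)] supported_integrable[OF assms(1)], of z] assms(2,3)
  by (simp add: conv_def)

lemma conv_continuous:
  assumes "supported \<psi> K" shows "continuous_on UNIV (conv u \<psi>)"
proof -
  obtain B where B: "0 \<le> B"
    "\<And>hs z. length hs = 1 \<Longrightarrow> (\<And>h. h \<in> set hs \<Longrightarrow> norm h \<le> 1) \<Longrightarrow> \<bar>fdiff hs (conv u \<psi>) z\<bar> \<le> B * prod_list (map norm hs)"
    using conv_fdiff_bound[OF assms] by blast
  show ?thesis
    unfolding continuous_on_iff
  proof (intro ballI allI impI)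
    fix x :: 'b and e :: real assume e: "0 < e"
    show "\<exists>d>0. \<forall>x'\<in>UNIV. dist x' x < d \<longrightarrow> dist (conv u \<psi> x') (conv u \<psi> x) < e"
    proof (intro exI[of _ "min 1 (e / (B + 1))"] conjI ballI impI)
      show "0 < min 1 (e / (B + 1))" using e B by simp
      fix x' assume d: "dist x' x < min 1 (e / (B + 1))"
      have "\<bar>fdiff [x' - x] (conv u \<psi>) x\<bar> \<le> B * norm (x' - x)"
        using B(2)[of "[x' - x]" x] d by (simp add: dist_norm)
      also have "\<dots> \<le> (B + 1) * norm (x' - x)" by (intro mult_right_mono) auto
      also have "\<dots> < (B + 1) * (e / (B + 1))" using d B by (intro mult_strict_left_mono) (auto simp: dist_norm)
      also have "\<dots> = e" using B by simp
      finally show "dist (conv u \<psi> x') (conv u \<psi> x) < e" by (simp add: dist_norm)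
    qed
  qed
qed

text \<open>The first-order Taylor remainder of \<psi> along e is at most a multiple of h^2 and
  lives on one fixed bounded set; integrating it against u gives the derivative of the convolution
  with a quadratic remainder.\<close>

lemma conv_has_derivative:
  assumes "supported \<psi> K" and \<psi>': "\<And>z. (\<psi> has_derivative \<psi>' z) (at z)" "\<And>e. supported (\<lambda>z. \<psi>' z e) K"
    and e: "norm e = 1"
  shows "((\<lambda>\<tau>. conv u \<psi> (z + \<tau> *\<^sub>R e)) has_real_derivative conv u (\<lambda>z. \<psi>' z e) (z + \<tau> *\<^sub>R e)) (at \<tau>)"
proof -
  obtain B where B: "0 \<le> B" "\<And>hs z. length hs = 1 \<Longrightarrow> \<bar>fdiff hs (\<lambda>z. \<psi>' z e) z\<bar> \<le> B * prod_list (map norm hs)"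
    using supported_fdiff_bound[OF \<psi>'(2)[of e]] by blast
  have "bounded K" using assms(1) by (auto simp: supported_def compact_imp_bounded)
  then obtain \<rho> where \<rho>: "\<And>z. z \<in> K \<Longrightarrow> norm z \<le> \<rho>" unfolding bounded_iff by blast
  define S where "S = cball (0::'b) (\<rho> + 1)"
  have S: "emeasure lborel S < \<infinity>" "S \<in> sets lborel"
    unfolding S_def using emeasure_compact_finite[OF compact_cball] by auto
  have lin: "linear (\<psi>' z)" for z using \<psi>'(1) has_derivative_linear by blast
  let ?R = "\<lambda>h w. \<psi> (w + h *\<^sub>R e) - \<psi> w - h * \<psi>' w e"
  have Rb: "\<bar>?R h w\<bar> \<le> B * h\<^sup>2 * indicator S w" if h: "\<bar>h\<bar> \<le> 1" for h w
  proof (cases "w \<in> S")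
    case True
    let ?g = "\<lambda>\<sigma>. \<psi> (w + \<sigma> *\<^sub>R e) - \<sigma> * \<psi>' w e"
    have "norm (?g h - ?g 0) \<le> (B * \<bar>h\<bar>) * norm (h - 0)"
    proof (rule field_differentiable_bound[where S = "cball 0 \<bar>h\<bar>" and f' = "\<lambda>\<sigma>. \<psi>' (w + \<sigma> *\<^sub>R e) e - \<psi>' w e"])
      fix \<sigma> :: real assume \<sigma>: "\<sigma> \<in> cball 0 \<bar>h\<bar>"
      have "((\<lambda>\<sigma>. \<psi> (w + \<sigma> *\<^sub>R e)) has_derivative (\<lambda>d. \<psi>' (w + \<sigma> *\<^sub>R e) (d *\<^sub>R e))) (at \<sigma>)"
      proof -
        have "((\<lambda>\<sigma>. w + \<sigma> *\<^sub>R e) has_derivative (\<lambda>d. d *\<^sub>R e)) (at \<sigma>)" by (auto intro!: derivative_eq_intros)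
        from diff_chain_at[OF this \<psi>'(1)] show ?thesis by (simp add: o_def)
      qed
      moreover have "(\<lambda>d. \<psi>' (w + \<sigma> *\<^sub>R e) (d *\<^sub>R e)) = (*) (\<psi>' (w + \<sigma> *\<^sub>R e) e)"
        using linear_cmul[OF lin] by (auto simp: fun_eq_iff)
      ultimately have "((\<lambda>\<sigma>. \<psi> (w + \<sigma> *\<^sub>R e)) has_real_derivative \<psi>' (w + \<sigma> *\<^sub>R e) e) (at \<sigma>)"
        by (simp add: has_field_derivative_def)
      then have "(?g has_real_derivative \<psi>' (w + \<sigma> *\<^sub>R e) e - \<psi>' w e) (at \<sigma>)"
        by (auto intro!: derivative_eq_intros)
      then show "(?g has_field_derivative \<psi>' (w + \<sigma> *\<^sub>R e) e - \<psi>' w e) (at \<sigma> within cball 0 \<bar>h\<bar>)"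
        by (rule has_field_derivative_at_within)
      have "\<bar>fdiff [\<sigma> *\<^sub>R e] (\<lambda>z. \<psi>' z e) w\<bar> \<le> B * \<bar>\<sigma>\<bar>"
        using B(2)[of "[\<sigma> *\<^sub>R e]" w] e by simp
      also have "\<dots> \<le> B * \<bar>h\<bar>" using \<sigma> B by (intro mult_left_mono) auto
      finally show "norm (\<psi>' (w + \<sigma> *\<^sub>R e) e - \<psi>' w e) \<le> B * \<bar>h\<bar>" by simp
    qed auto
    then show ?thesis using True by (simp add: power2_eq_square mult.assoc flip: abs_mult)
  next
    case False
    have "\<rho> < norm w" using False by (simp add: S_def)
    moreover have "norm w \<le> norm (w + h *\<^sub>R e) + \<bar>h\<bar>"
      using norm_triangle_ineq4[of "w + h *\<^sub>R e" "h *\<^sub>R e"] e by simp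
    then have "\<rho> < norm (w + h *\<^sub>R e)" using False h by (simp add: S_def)
    ultimately have "w \<notin> K" "w + h *\<^sub>R e \<notin> K" using \<rho> by (meson not_le)+
    then show ?thesis using assms(1) \<psi>'(2)[of e] False by (simp add: supported_def)
  qed
  have "((\<lambda>\<tau>. conv u \<psi> (z + \<tau> *\<^sub>R e)) has_real_derivative conv u (\<lambda>z. \<psi>' z e) (z + \<tau> *\<^sub>R e)) (at \<tau>)"
  proof (rule quadratic_remainder_imp_deriv)
    fix h :: real assume h: "\<bar>h\<bar> \<le> 1"
    let ?z = "z + \<tau> *\<^sub>R e"
    have i1: "integrable lborel (\<lambda>w. \<psi> (w + h *\<^sub>R e))"
      using lborel_integrable_translate[OF supported_integrable[OF assms(1)], of "h *\<^sub>R e"] by (simp add: add.commute)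
    have i3: "integrable lborel (\<lambda>w. h * \<psi>' w e)"
      by (intro integrable_mult_right supported_integrable[OF \<psi>'(2)])
    have Ri: "integrable lborel (?R h)"
      by (intro Bochner_Integration.integrable_diff i1 i3 supported_integrable[OF assms(1)])
    have c: "integrable lborel (\<lambda>z'. u z' * (\<psi> (?z - z' + h *\<^sub>R e)))" "integrable lborel (\<lambda>z'. u z' * \<psi> (?z - z'))"
      "integrable lborel (\<lambda>z'. u z' * (h * \<psi>' (?z - z') e))"
      using conv_integrand[OF i1] conv_integrand[OF supported_integrable[OF assms(1)]] conv_integrand[OF i3] by auto
    have "conv u \<psi> (z + (\<tau> + h) *\<^sub>R e) - conv u \<psi> ?z - h * conv u (\<lambda>z. \<psi>' z e) ?z
        = (LINT z'|lborel. u z' * ?R h (?z - z'))"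
    proof -
      have "(LINT z'|lborel. u z' * ?R h (?z - z'))
        = (LINT z'|lborel. u z' * (\<psi> (?z - z' + h *\<^sub>R e)) - u z' * \<psi> (?z - z') - u z' * (h * \<psi>' (?z - z') e))"
        by (simp add: right_diff_distrib)
      also have "\<dots> = (LINT z'|lborel. u z' * (\<psi> (?z - z' + h *\<^sub>R e))) - (LINT z'|lborel. u z' * \<psi> (?z - z'))
          - (LINT z'|lborel. u z' * (h * \<psi>' (?z - z') e))"
        by (simp only: Bochner_Integration.integral_diff[OF Bochner_Integration.integrable_diff[OF c(1,2)] c(3)]
            Bochner_Integration.integral_diff[OF c(1,2)])
      also have "(LINT z'|lborel. u z' * (h * \<psi>' (?z - z') e)) = h * conv u (\<lambda>z. \<psi>' z e) ?z"
        unfolding conv_def by (simp add: mult.left_commute)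
      finally show ?thesis unfolding conv_def by (simp add: algebra_simps)
    qed
    also have "\<bar>\<dots>\<bar> \<le> U * (LINT w|lborel. B * h\<^sup>2 * indicator S w)"
      by (rule conv_bound_integral[OF Ri _ Rb[OF h]]) (use S in simp)
    finally show "\<bar>conv u \<psi> (z + (\<tau> + h) *\<^sub>R e) - conv u \<psi> ?z - h * conv u (\<lambda>z. \<psi>' z e) ?z\<bar>
        \<le> (U * B * measure lborel S) * h\<^sup>2" by (simp add: mult_ac)
  qed
  then show ?thesis .
qed

end

lemma borel_version:
  fixes u :: "'b::euclidean_space \<Rightarrow> real"
  assumes "u \<in> borel_measurable (lebesgue_on S)" "S \<in> sets borel" "\<And>z. z \<in> S \<Longrightarrow> \<bar>u z\<bar> \<le> U" "0 \<le> U"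
  obtains v where "bounded_borel v U" "AE z in lebesgue. v z = indicator S z * u z"
proof -
  have "(\<lambda>z. indicator S z *\<^sub>R u z) \<in> borel_measurable lebesgue"
    using assms(1,2) borel_measurable_restrict_space_iff[of S lebesgue u] by (simp add: scaleR_conv_of_real)
  then have m: "(\<lambda>z. indicator S z * u z) \<in> borel_measurable (completion lborel)" by simp
  obtain g where g: "g \<in> borel_measurable lborel" "AE z in lborel. indicator S z * u z = g z"
    using completion_ex_borel_measurable_real[OF m] by blast
  \<comment> \<open>Clipping makes the bound hold everywhere, and it leaves g unchanged wherever g
    equals the extension of u by 0.\<close>
  define v where "v z = max (- U) (min U (g z))" for z
  have "bounded_borel v U"
    using g(1) assms(4) by unfold_locales (auto simp: v_def[abs_def] abs_le_iff)
  moreover have "AE z in lebesgue. v z = indicator S z * u z"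
    using AE_completion[OF g(2)]
  proof (rule eventually_mono)
    fix z assume "indicator S z * u z = g z"
    moreover have "\<bar>indicator S z * u z\<bar> \<le> U" using assms(3)[of z] assms(4) by (cases "z \<in> S") auto
    ultimately show "v z = indicator S z * u z" by (simp add: v_def abs_le_iff)
  qed
  ultimately show thesis by (rule that)
qed

section \<open>Convergence of mollifications in L1 and almost everywhere\<close>

context bounded_borel
begin

text \<open>A local form of Young's inequality: \<phi> lives in the unit ball, so the convolution on
  radius \<rho> only sees u on radius \<rho> + 1.\<close>

lemma conv_L1_bound:
  assumes \<phi>: "supported \<phi> K" "K \<subseteq> cball 0 1" "\<And>z. 0 \<le> \<phi> z" "(LINT z|lborel. \<phi> z) = 1"
  shows "(\<integral>\<^sup>+z. indicator (cball 0 \<rho>) z * ennreal \<bar>conv u \<phi> z\<bar> \<partial>lborel)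
    \<le> (\<integral>\<^sup>+z. indicator (cball 0 (\<rho> + 1)) z * ennreal \<bar>u z\<bar> \<partial>lborel)"
proof -
  have \<phi>m: "\<phi> \<in> borel_measurable borel" using \<phi>(1) smooth_borel[of \<phi>] by (simp add: supported_def)
  have um: "u \<in> borel_measurable borel" by (rule u_borel)
  let ?F = "\<lambda>z z'. indicator (cball 0 \<rho>) z * ennreal (\<bar>u z'\<bar> * \<phi> (z - z'))"
  have 1: "indicator (cball 0 \<rho>) z * ennreal \<bar>conv u \<phi> z\<bar> \<le> (\<integral>\<^sup>+z'. ?F z z' \<partial>lborel)" for z
  proof -
    have "ennreal \<bar>conv u \<phi> z\<bar> \<le> (\<integral>\<^sup>+z'. norm (u z' * \<phi> (z - z')) \<partial>lborel)"
      unfolding conv_def using integral_norm_bound_ennreal[OF conv_integrand[OF supported_integrable[OF \<phi>(1)]]] by simp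
    also have "\<dots> = (\<integral>\<^sup>+z'. ennreal (\<bar>u z'\<bar> * \<phi> (z - z')) \<partial>lborel)"
      using \<phi>(3) by (simp add: abs_mult)
    finally have "indicator (cball 0 \<rho>) z * ennreal \<bar>conv u \<phi> z\<bar>
        \<le> indicator (cball 0 \<rho>) z * (\<integral>\<^sup>+z'. ennreal (\<bar>u z'\<bar> * \<phi> (z - z')) \<partial>lborel)"
      by (rule mult_left_mono) simp
    then show ?thesis by (cases "z \<in> cball 0 \<rho>") auto
  qed
  have Fm: "case_prod ?F \<in> borel_measurable (lborel \<Otimes>\<^sub>M lborel)"
  proof -
    have a: "(\<lambda>p::'b \<times> 'b. \<bar>u (snd p)\<bar> * \<phi> (fst p - snd p)) \<in> borel_measurable borel"
    proof (intro borel_measurable_times borel_measurable_abs)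
      show "(\<lambda>p. u (snd p)) \<in> borel_measurable (borel :: ('b \<times> 'b) measure)"
        by (rule measurable_compose[OF _ um]) (intro borel_measurable_continuous_onI continuous_intros)
      show "(\<lambda>p. \<phi> (fst p - snd p)) \<in> borel_measurable (borel :: ('b \<times> 'b) measure)"
        by (rule measurable_compose[OF _ \<phi>m]) (intro borel_measurable_continuous_onI continuous_intros)
    qed
    have b: "(\<lambda>p::'b \<times> 'b. indicator (cball 0 \<rho>) (fst p) :: ennreal) \<in> borel_measurable borel"
      by (rule measurable_compose[where N = borel])
         (auto intro!: borel_measurable_continuous_onI continuous_intros borel_measurable_indicator)
    have "(\<lambda>p. indicator (cball 0 \<rho>) (fst p) * ennreal (\<bar>u (snd p)\<bar> * \<phi> (fst p - snd p)))
        \<in> borel_measurable (borel :: ('b \<times> 'b) measure)"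
      using a b by (intro borel_measurable_times_ennreal measurable_compose[OF _ measurable_ennreal])
    then show ?thesis by (simp add: lborel_prod case_prod_beta')
  qed
  have "(\<integral>\<^sup>+z. indicator (cball 0 \<rho>) z * ennreal \<bar>conv u \<phi> z\<bar> \<partial>lborel) \<le> (\<integral>\<^sup>+z. (\<integral>\<^sup>+z'. ?F z z' \<partial>lborel) \<partial>lborel)"
    by (rule nn_integral_mono) (rule 1)
  also have "\<dots> = (\<integral>\<^sup>+z'. (\<integral>\<^sup>+z. ?F z z' \<partial>lborel) \<partial>lborel)"
    by (rule lborel_pair.Fubini'[symmetric]) (rule Fm)
  also have "\<dots> \<le> (\<integral>\<^sup>+z'. indicator (cball 0 (\<rho> + 1)) z' * ennreal \<bar>u z'\<bar> \<partial>lborel)"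
  proof (rule nn_integral_mono)
    fix z'
    have p: "?F z z' \<le> (indicator (cball 0 (\<rho> + 1)) z' * ennreal \<bar>u z'\<bar>) * ennreal (\<phi> (z - z'))" for z
    proof (cases "z \<in> cball 0 \<rho> \<and> z - z' \<in> K")
      case True
      then have "norm (z - z') \<le> 1" "norm z \<le> \<rho>" using \<phi>(2) by auto
      then have "z' \<in> cball 0 (\<rho> + 1)"
        using norm_triangle_ineq4[of z "z - z'"] by simp
      then show ?thesis using True \<phi>(3) by (simp add: ennreal_mult)
    next
      case False
      then have "indicator (cball 0 \<rho>) z * ennreal (\<bar>u z'\<bar> * \<phi> (z - z')) = 0"
        using \<phi>(1) by (auto simp: supported_def indicator_def)
      then show ?thesis by (simp only: zero_le)
    qed
    have \<phi>r: "(\<lambda>z. \<phi> (z - z')) \<in> borel_measurable borel"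
      by (rule measurable_compose[OF _ \<phi>m]) (intro borel_measurable_continuous_onI continuous_intros)
    have i: "integrable lborel (\<lambda>z. \<phi> (- z' + z))"
      by (rule lborel_integrable_translate[OF supported_integrable[OF \<phi>(1)]])
    have "(LINT z|lborel. \<phi> (- z' + z)) = 1" using lborel_integral_translate[OF \<phi>m, of "- z'"] \<phi>(4) by simp
    then have one: "(\<integral>\<^sup>+z. ennreal (\<phi> (z - z')) \<partial>lborel) = 1"
      using nn_integral_eq_integral[OF i] \<phi>(3) by simp
    have "(\<integral>\<^sup>+z. ?F z z' \<partial>lborel) \<le> (\<integral>\<^sup>+z. (indicator (cball 0 (\<rho> + 1)) z' * ennreal \<bar>u z'\<bar>) * ennreal (\<phi> (z - z')) \<partial>lborel)"
      by (rule nn_integral_mono) (rule p)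
    also have "\<dots> = (indicator (cball 0 (\<rho> + 1)) z' * ennreal \<bar>u z'\<bar>) * (\<integral>\<^sup>+z. ennreal (\<phi> (z - z')) \<partial>lborel)"
      using \<phi>r by (intro nn_integral_cmult) simp
    finally show "(\<integral>\<^sup>+z. ?F z z' \<partial>lborel) \<le> indicator (cball 0 (\<rho> + 1)) z' * ennreal \<bar>u z'\<bar>"
      unfolding one by simp
  qed
  finally show ?thesis .
qed

text \<open>A Lebesgue measurable function is an almost everywhere limit of continuous ones.
  Clipping these at U provides a majorant on the ball, and dominated convergence applies.\<close>

lemma continuous_approximation:
  fixes e :: real
  assumes e: "0 < e"
  obtains g where "continuous_on UNIV g" "\<And>z. \<bar>g z\<bar> \<le> U"
    "(\<integral>\<^sup>+z. indicator (cball 0 \<rho>) z * ennreal \<bar>u z - g z\<bar> \<partial>lborel) < ennreal e"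
proof -
  have "u \<in> borel_measurable lebesgue"
    using u_borel by (intro measurable_completion) simp
  then have "u measurable_on UNIV" by (rule lebesgue_measurable_imp_measurable_on) simp
  then obtain N g where N: "negligible N" and g: "\<And>n. continuous_on UNIV (g n)"
    and lim: "\<And>x. x \<notin> N \<Longrightarrow> (\<lambda>n. g n x) \<longlonglongrightarrow> u x"
    unfolding measurable_on_def by auto
  define h where "h n z = max (- U) (min U (g n z))" for n :: nat and z
  have hc: "continuous_on UNIV (h n)" for n unfolding h_def[abs_def] by (intro continuous_intros g)
  have hb: "\<bar>h n z\<bar> \<le> U" for n z using U_nonneg by (auto simp: h_def abs_le_iff)
  have hm: "h n \<in> borel_measurable borel" for n by (rule borel_measurable_continuous_onI[OF hc])
  have hl: "(\<lambda>n. h n x) \<longlonglongrightarrow> u x" if "x \<notin> N" for x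
  proof -
    have "(\<lambda>n. h n x) \<longlonglongrightarrow> max (- U) (min U (u x))"
      unfolding h_def by (intro tendsto_intros lim[OF that])
    moreover have "max (- U) (min U (u x)) = u x" using u_bound[of x] by (auto simp: abs_le_iff)
    ultimately show ?thesis by simp
  qed
  let ?B = "cball (0::'b) \<rho>"
  have B: "emeasure lborel ?B < \<infinity>" using emeasure_compact_finite[OF compact_cball] by auto
  have um: "u \<in> borel_measurable borel" by (rule u_borel)
  have m: "(\<lambda>z. indicator ?B z * ennreal \<bar>u z - h n z\<bar>) \<in> borel_measurable lborel" for n
    using um hm[of n] by (intro borel_measurable_times_ennreal borel_measurable_indicator measurable_compose[OF _ measurable_ennreal]) auto
  have "(\<lambda>n. \<integral>\<^sup>+z. indicator ?B z * ennreal \<bar>u z - h n z\<bar> \<partial>lborel) \<longlonglongrightarrow> (\<integral>\<^sup>+z. 0 \<partial>(lborel :: 'b measure))"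
  proof (rule nn_integral_dominated_convergence[where w = "\<lambda>z. ennreal (2 * U) * indicator ?B z"])
    show "(\<integral>\<^sup>+z. ennreal (2 * U) * indicator ?B z \<partial>lborel) < \<infinity>"
      using B by (simp add: nn_integral_cmult_indicator ennreal_mult_less_top)
    show "AE z in lborel. indicator ?B z * ennreal \<bar>u z - h n z\<bar> \<le> ennreal (2 * U) * indicator ?B z" for n
    proof (rule AE_I2)
      fix z
      have "\<bar>u z - h n z\<bar> \<le> 2 * U" using u_bound[of z] hb[of n z] by linarith
      then show "indicator ?B z * ennreal \<bar>u z - h n z\<bar> \<le> ennreal (2 * U) * indicator ?B z"
        by (auto simp: indicator_def intro: ennreal_leI)
    qed
    have "AE z in lebesgue. z \<notin> N"
      using N by (intro AE_not_in) (simp add: negligible_iff_null_sets)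
    then have "AE z in lborel. z \<notin> N" by (simp only: AE_completion_iff)
    then show "AE z in lborel. (\<lambda>n. indicator ?B z * ennreal \<bar>u z - h n z\<bar>) \<longlonglongrightarrow> 0"
    proof (rule eventually_mono)
      fix z assume "z \<notin> N"
      then have "(\<lambda>n. \<bar>u z - h n z\<bar>) \<longlonglongrightarrow> \<bar>u z - u z\<bar>" by (intro tendsto_intros hl)
      then have "(\<lambda>n. ennreal \<bar>u z - h n z\<bar>) \<longlonglongrightarrow> ennreal \<bar>u z - u z\<bar>" by (rule tendsto_ennrealI)
      then show "(\<lambda>n. indicator ?B z * ennreal \<bar>u z - h n z\<bar>) \<longlonglongrightarrow> 0"
        by (cases "z \<in> ?B") auto
    qed
    show "(\<lambda>z. ennreal (2 * U) * indicator ?B z) \<in> borel_measurable lborel"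
      by (intro borel_measurable_times_ennreal borel_measurable_indicator) auto
  qed (use m in auto)
  then have "\<forall>\<^sub>F n in sequentially. (\<integral>\<^sup>+z. indicator ?B z * ennreal \<bar>u z - h n z\<bar> \<partial>lborel) < ennreal e"
    using e by (intro order_tendstoD(2)) auto
  then obtain n where "(\<integral>\<^sup>+z. indicator ?B z * ennreal \<bar>u z - h n z\<bar> \<partial>lborel) < ennreal e"
    by (auto simp: eventually_sequentially)
  then show thesis using hc hb by (intro that[of "h n"])
qed

lemma conv_tendsto_L1:
  assumes \<phi>: "\<And>n. supported (\<phi> n) (K n)" "\<And>n. K n \<subseteq> cball 0 (\<epsilon> n)" "\<And>n z. 0 \<le> \<phi> n z" "\<And>n. (LINT z|lborel. \<phi> n z) = 1"
    and \<epsilon>: "\<And>n. \<epsilon> n \<le> 1" "\<epsilon> \<longlonglongrightarrow> 0"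
  shows "(\<lambda>n. \<integral>\<^sup>+z. indicator (cball 0 \<rho>) z * ennreal \<bar>conv u (\<phi> n) z - u z\<bar> \<partial>lborel) \<longlonglongrightarrow> 0"
proof (rule tendsto_zero_ennreal)
  fix r :: real assume r: "0 < r"
  let ?B = "cball (0::'b) \<rho>" and ?B' = "cball (0::'b) (\<rho> + 1)"
  have B: "emeasure lborel ?B < \<infinity>" using emeasure_compact_finite[OF compact_cball] by auto
  define V where "V = measure lborel ?B"
  have V: "emeasure lborel ?B = ennreal V" "0 \<le> V"
    using emeasure_eq_ennreal_measure[of lborel ?B] B by (auto simp: V_def less_top)
  \<comment> \<open>Three errors: u - g itself (e, by the choice of g), its convolution (e, by
    \<open>conv_L1_bound\<close>), and g against its convolution (e V, by uniform continuity). The 3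
    makes e (2 + V) strictly less than r.\<close>
  define e where "e = r / (3 + V)"
  have e: "0 < e" using r V by (simp add: e_def)
  obtain g where g: "continuous_on UNIV g" "\<And>z. \<bar>g z\<bar> \<le> U"
    "(\<integral>\<^sup>+z. indicator ?B' z * ennreal \<bar>u z - g z\<bar> \<partial>lborel) < ennreal e"
    using continuous_approximation[OF e] by blast
  have gm: "g \<in> borel_measurable borel" by (rule borel_measurable_continuous_onI[OF g(1)])
  have um: "u \<in> borel_measurable borel" by (rule u_borel)
  interpret G: bounded_borel g U by unfold_locales (use gm g(2) in auto)
  interpret D: bounded_borel "\<lambda>z. u z - g z" "2 * U"
  proof
    show "(\<lambda>z. u z - g z) \<in> borel_measurable borel" using um gm by simp
    show "\<bar>u z - g z\<bar> \<le> 2 * U" for z using u_bound[of z] g(2)[of z] by linarith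
  qed
  have "uniformly_continuous_on ?B' g"
    by (rule compact_uniformly_continuous) (use continuous_on_subset[OF g(1)] in auto)
  then obtain d where d: "0 < d" "\<And>x x'. x \<in> ?B' \<Longrightarrow> x' \<in> ?B' \<Longrightarrow> dist x' x < d \<Longrightarrow> dist (g x') (g x) < e"
    unfolding uniformly_continuous_on_def using e by metis
  have "\<forall>\<^sub>F n in sequentially. \<epsilon> n < d" using \<epsilon>(2) d(1) by (rule order_tendstoD)
  then show "\<forall>\<^sub>F n in sequentially. (\<integral>\<^sup>+z. indicator ?B z * ennreal \<bar>conv u (\<phi> n) z - u z\<bar> \<partial>lborel) < ennreal r"
  proof (rule eventually_mono)
    fix n assume n: "\<epsilon> n < d"
    note \<phi>i = supported_integrable[OF \<phi>(1)[of n]]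
    have \<phi>m: "\<phi> n \<in> borel_measurable borel" using borel_measurable_integrable[OF \<phi>i] by simp
    have K1: "K n \<subseteq> cball 0 1" using \<phi>(2)[of n] \<epsilon>(1)[of n] by force
    have gd: "\<bar>conv g (\<phi> n) z - g z\<bar> \<le> e" if z: "z \<in> ?B" for z
    proof -
      have r1: "(LINT z'|lborel. \<phi> n (z - z')) = 1" using lborel_integral_reflect[OF \<phi>m] \<phi>(4) by simp
      have ri: "integrable lborel (\<lambda>z'. \<phi> n (z - z'))" by (rule lborel_integrable_reflect[OF \<phi>i])
      have gi: "integrable lborel (\<lambda>z'. g z' * \<phi> n (z - z'))" by (rule G.conv_integrand[OF \<phi>i])
      have ci: "integrable lborel (\<lambda>z'. g z * \<phi> n (z - z'))" using ri by (rule integrable_mult_right)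
      have "conv g (\<phi> n) z - g z = (LINT z'|lborel. g z' * \<phi> n (z - z')) - (LINT z'|lborel. g z * \<phi> n (z - z'))"
        by (simp add: conv_def r1)
      also have "\<dots> = (LINT z'|lborel. g z' * \<phi> n (z - z') - g z * \<phi> n (z - z'))"
        by (rule Bochner_Integration.integral_diff[OF gi ci, symmetric])
      also have "\<bar>\<dots>\<bar> \<le> (LINT z'|lborel. e * \<phi> n (z - z'))"
      proof (rule integral_dominated_le(2))
        show "integrable lborel (\<lambda>z'. e * \<phi> n (z - z'))" using ri by (rule integrable_mult_right)
        show "(\<lambda>z'. g z' * \<phi> n (z - z') - g z * \<phi> n (z - z')) \<in> borel_measurable lborel"
          using borel_measurable_integrable[OF gi] borel_measurable_integrable[OF ci] by simp
        show "\<bar>g z' * \<phi> n (z - z') - g z * \<phi> n (z - z')\<bar> \<le> e * \<phi> n (z - z')" for z'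
        proof (cases "z - z' \<in> K n")
          case True
          then have nz: "norm (z - z') \<le> \<epsilon> n" using \<phi>(2)[of n] by force
          then have "z' \<in> ?B'" using norm_triangle_ineq4[of z "z - z'"] z \<epsilon>(1)[of n] by simp
          moreover have "z \<in> ?B'" using z by auto
          moreover have "dist z' z < d" using nz n by (simp add: dist_norm norm_minus_commute)
          ultimately have "\<bar>g z' - g z\<bar> \<le> e" using d(2)[of z z'] by (simp add: dist_real_def)
          then have "\<bar>g z' - g z\<bar> * \<phi> n (z - z') \<le> e * \<phi> n (z - z')" using \<phi>(3) by (intro mult_right_mono) auto
          then show ?thesis using \<phi>(3)[of n "z - z'"] by (simp add: abs_mult flip: left_diff_distrib)
        next
          case False
          then show ?thesis using \<phi>(1)[of n] by (simp add: supported_def)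
        qed
      qed
      also have "\<dots> = e" by (simp add: r1)
      finally show ?thesis .
    qed
    let ?a = "\<lambda>z. indicator ?B z * ennreal \<bar>conv (\<lambda>z. u z - g z) (\<phi> n) z\<bar>"
    let ?b = "\<lambda>z. ennreal e * indicator ?B z"
    let ?c = "\<lambda>z. indicator ?B' z * ennreal \<bar>u z - g z\<bar>"
    have cd: "conv (\<lambda>z. u z - g z) (\<phi> n) z = conv u (\<phi> n) z - conv g (\<phi> n) z" for z
      unfolding conv_def by (simp add: left_diff_distrib Bochner_Integration.integral_diff[OF conv_integrand[OF \<phi>i] G.conv_integrand[OF \<phi>i]])
    have cm: "conv (\<lambda>z. u z - g z) (\<phi> n) \<in> borel_measurable borel"
      by (rule borel_measurable_continuous_onI[OF D.conv_continuous[OF \<phi>(1)]])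
    have am: "?a \<in> borel_measurable lborel"
      using cm by (intro borel_measurable_times_ennreal borel_measurable_indicator measurable_compose[OF _ measurable_ennreal]) auto
    have bm: "?b \<in> borel_measurable lborel" by (intro borel_measurable_times_ennreal borel_measurable_indicator) auto
    have dm: "(\<lambda>z. u z - g z) \<in> borel_measurable borel" using um gm by simp
    have cm': "?c \<in> borel_measurable lborel"
      using dm by (intro borel_measurable_times_ennreal borel_measurable_indicator measurable_compose[OF _ measurable_ennreal]) auto
    have "indicator ?B z * ennreal \<bar>conv u (\<phi> n) z - u z\<bar> \<le> ?a z + ?b z + ?c z" for z
    proof (cases "z \<in> ?B")
      case True
      then have z': "z \<in> ?B'" by auto
      have "\<bar>conv u (\<phi> n) z - u z\<bar> \<le> \<bar>conv (\<lambda>z. u z - g z) (\<phi> n) z\<bar> + e + \<bar>u z - g z\<bar>"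
        using gd[OF True] cd[of z] by linarith
      then have "ennreal \<bar>conv u (\<phi> n) z - u z\<bar> \<le> ennreal (\<bar>conv (\<lambda>z. u z - g z) (\<phi> n) z\<bar> + e + \<bar>u z - g z\<bar>)"
        by (rule ennreal_leI)
      also have "\<dots> = ennreal \<bar>conv (\<lambda>z. u z - g z) (\<phi> n) z\<bar> + ennreal e + ennreal \<bar>u z - g z\<bar>"
        using e by (simp flip: ennreal_plus)
      finally show ?thesis using True z' by simp
    qed simp
    then have "(\<integral>\<^sup>+z. indicator ?B z * ennreal \<bar>conv u (\<phi> n) z - u z\<bar> \<partial>lborel) \<le> (\<integral>\<^sup>+z. ?a z + ?b z + ?c z \<partial>lborel)"
      by (rule nn_integral_mono)
    also have "\<dots> = (\<integral>\<^sup>+z. ?a z \<partial>lborel) + (\<integral>\<^sup>+z. ?b z \<partial>lborel) + (\<integral>\<^sup>+z. ?c z \<partial>lborel)"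
      using am bm cm' by (simp add: nn_integral_add)
    also have "\<dots> \<le> ennreal e + ennreal (e * V) + ennreal e"
    proof (intro add_mono)
      show c: "(\<integral>\<^sup>+z. ?c z \<partial>lborel) \<le> ennreal e" using g(3) by simp
      have "(\<integral>\<^sup>+z. ?a z \<partial>lborel) \<le> (\<integral>\<^sup>+z. ?c z \<partial>lborel)"
        by (rule D.conv_L1_bound[OF \<phi>(1) K1 \<phi>(3,4)])
      then show "(\<integral>\<^sup>+z. ?a z \<partial>lborel) \<le> ennreal e" using c by (rule order_trans)
      have "(\<integral>\<^sup>+z. ?b z \<partial>lborel) = ennreal e * ennreal V" unfolding V(1)[symmetric] by (rule nn_integral_cmult_indicator) simp
      then show "(\<integral>\<^sup>+z. ?b z \<partial>lborel) \<le> ennreal (e * V)" using e V by (simp add: ennreal_mult)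
    qed
    also have "\<dots> = ennreal (e * (2 + V))" using e V by (simp add: algebra_simps flip: ennreal_plus)
    also have "\<dots> < ennreal r"
    proof (rule ennreal_lessI)
      have "e * (2 + V) < e * (3 + V)" using e by simp
      also have "\<dots> = r" using V by (simp add: e_def)
      finally show "e * (2 + V) < r" .
    qed (rule r)
    finally show "(\<integral>\<^sup>+z. indicator ?B z * ennreal \<bar>conv u (\<phi> n) z - u z\<bar> \<partial>lborel) < ennreal r" .
  qed
qed

lemma conv_subseq_AE:
  assumes \<phi>: "\<And>n. supported (\<phi> n) (K n)" "\<And>n. K n \<subseteq> cball 0 (\<epsilon> n)" "\<And>n z. 0 \<le> \<phi> n z" "\<And>n. (LINT z|lborel. \<phi> n z) = 1"
    and \<epsilon>: "\<And>n. \<epsilon> n \<le> 1" "\<epsilon> \<longlonglongrightarrow> 0"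
  obtains r where "strict_mono r" "AE z in lborel. z \<in> cball 0 \<rho> \<longrightarrow> (\<lambda>n. conv u (\<phi> (r n)) z) \<longlonglongrightarrow> u z"
proof -
  let ?B = "cball (0::'b) \<rho>"
  have B: "emeasure lborel ?B < \<infinity>" using emeasure_compact_finite[OF compact_cball] by auto
  let ?h = "\<lambda>n z. indicator ?B z * (conv u (\<phi> n) z - u z)"
  have i: "integrable lborel (?h n)" for n
  proof (rule integrable_mult_bounded[where U = "2 * U"])
    show "integrable lborel (indicator ?B :: 'b \<Rightarrow> real)" using B by simp
    have "conv u (\<phi> n) \<in> borel_measurable borel" by (rule borel_measurable_continuous_onI[OF conv_continuous[OF \<phi>(1)]])
    then show "(\<lambda>z. conv u (\<phi> n) z - u z) \<in> borel_measurable borel" using u_borel by simp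
    show "\<bar>conv u (\<phi> n) z - u z\<bar> \<le> 2 * U" for z
      using conv_bounded[OF \<phi>(1) \<phi>(3) \<phi>(4), of n z] u_bound[of z] by linarith
  qed
  have eq: "(LINT z|lborel. norm (?h n z)) = enn2real (\<integral>\<^sup>+z. indicator ?B z * ennreal \<bar>conv u (\<phi> n) z - u z\<bar> \<partial>lborel)" for n
  proof -
    have "(LINT z|lborel. norm (?h n z)) = enn2real (\<integral>\<^sup>+z. ennreal (norm (?h n z)) \<partial>lborel)"
      using i[of n] by (intro integral_eq_nn_integral) auto
    also have "(\<integral>\<^sup>+z. ennreal (norm (?h n z)) \<partial>lborel) = (\<integral>\<^sup>+z. indicator ?B z * ennreal \<bar>conv u (\<phi> n) z - u z\<bar> \<partial>lborel)"
      by (rule nn_integral_cong) (simp add: indicator_def abs_mult)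
    finally show ?thesis .
  qed
  have "(\<lambda>n. enn2real (\<integral>\<^sup>+z. indicator ?B z * ennreal \<bar>conv u (\<phi> n) z - u z\<bar> \<partial>lborel)) \<longlonglongrightarrow> 0"
    by (rule tendsto_enn2real) (use conv_tendsto_L1[OF \<phi> \<epsilon>, of \<rho>] in simp_all)
  then have "(\<lambda>n. LINT z|lborel. norm (?h n z)) \<longlonglongrightarrow> 0" unfolding eq by simp
  from tendsto_L1_AE_subseq[OF i this] obtain r where r: "strict_mono r"
    "AE z in lborel. (\<lambda>n. ?h (r n) z) \<longlonglongrightarrow> 0" by blast
  have "AE z in lborel. z \<in> ?B \<longrightarrow> (\<lambda>n. conv u (\<phi> (r n)) z) \<longlonglongrightarrow> u z"
    using r(2)
  proof (rule eventually_mono)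
    fix z assume "(\<lambda>n. ?h (r n) z) \<longlonglongrightarrow> 0"
    then show "z \<in> ?B \<longrightarrow> (\<lambda>n. conv u (\<phi> (r n)) z) \<longlonglongrightarrow> u z" by (auto simp: LIM_zero_iff)
  qed
  with r(1) show thesis by (rule that)
qed

end

subsection \<open>The equation for the mollified solution\<close>

text \<open>The majorant for Fubini in \<open>conv_nonlocal\<close>: quadratic near 0 and constant
  far away, the two regimes in which the kernel is integrable. The constant is written
  \<open>norm y powr 0\<close> to match \<open>kernel_far\<close> with exponent 0.\<close>

lemma supported_sdiff_L1:
  assumes "supported \<phi> K"
  obtains C where "0 \<le> C"
    "\<And>y. (LINT q|lborel. \<bar>sdiff \<phi> q y\<bar>) \<le> C * (indicator (ball 0 1) y * norm y powr 2 + indicator (- ball 0 1) y * norm y powr 0)"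
proof -
  obtain B where B: "0 \<le> B" "\<And>hs z. length hs = 2 \<Longrightarrow> \<bar>fdiff hs \<phi> z\<bar> \<le> B * prod_list (map norm hs)"
    using supported_fdiff_bound[OF assms] by blast
  have "bounded K" using assms(1) by (auto simp: supported_def compact_imp_bounded)
  then obtain \<rho> where \<rho>: "\<And>z. z \<in> K \<Longrightarrow> norm z \<le> \<rho>" unfolding bounded_iff by blast
  define S where "S = cball (0::'a) (\<rho> + 1)"
  have S: "emeasure lborel S < \<infinity>" "S \<in> sets lborel"
    unfolding S_def using emeasure_compact_finite[OF compact_cball] by auto
  have \<phi>i: "integrable lborel \<phi>" by (rule supported_integrable[OF assms])
  have si: "integrable lborel (\<lambda>q. sdiff \<phi> q y)" for y
    unfolding sdiff_conv_fdiff using lborel_integrable_translate[OF fdiff_integrable[OF assms], of "[y,y]" "- y"]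
    by simp
  define D where "D = (LINT q|lborel. \<bar>\<phi> q\<bar>)"
  have D: "0 \<le> D" by (simp add: D_def)
  show thesis
  proof (rule that[of "B * measure lborel S + 4 * D"], goal_cases)
    case 1
    then show ?case using B(1) D by simp
  next
    case (2 y)
    show ?case
    proof (cases "norm y < 1")
      case True
      have "\<bar>sdiff \<phi> q y\<bar> \<le> B * (norm y)\<^sup>2 * indicator S q" for q
      proof (cases "q \<in> S")
        case True
        then show ?thesis using B(2)[of "[y, y]" "q - y"] by (simp add: sdiff_conv_fdiff power2_eq_square)
      next
        case False
        then have q: "\<rho> + 1 < norm q" by (simp add: S_def)
        have nk: "q + h \<notin> K" if "norm h \<le> 1" for h
          using q that \<rho>[of "q + h"] norm_triangle_ineq4[of "q + h" h] by auto
        have "\<phi> (q + y) = 0" "\<phi> (q - y) = 0" "\<phi> q = 0"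
          using nk[of y] nk[of "- y"] nk[of 0] True assms by (auto simp: supported_def)
        then show ?thesis using B(1) by (simp add: sdiff_def)
      qed
      then have "(LINT q|lborel. \<bar>sdiff \<phi> q y\<bar>) \<le> (LINT q|lborel. B * (norm y)\<^sup>2 * indicator S q)"
        using S si by (intro integral_mono) auto
      also have "\<dots> = B * measure lborel S * norm y powr 2" using S by simp
      also have "\<dots> \<le> (B * measure lborel S + 4 * D) * norm y powr 2" using D by (intro mult_right_mono) auto
      finally show ?thesis using True by simp
    next
      case False
      have t1: "integrable lborel (\<lambda>q. \<bar>\<phi> (q + h)\<bar>)" for h
        using lborel_integrable_translate[OF \<phi>i, of h] by (simp add: add.commute)
      have t2: "(LINT q|lborel. \<bar>\<phi> (q + h)\<bar>) = D" for h
        using lborel_integral_translate[of "\<lambda>q. \<bar>\<phi> q\<bar>" h] \<phi>i by (simp add: D_def add.commute)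
      have "(LINT q|lborel. \<bar>sdiff \<phi> q y\<bar>) \<le> (LINT q|lborel. \<bar>\<phi> (q + y)\<bar> + \<bar>\<phi> (q + (- y))\<bar> + 2 * \<bar>\<phi> (q + 0)\<bar>)"
        by (intro integral_mono Bochner_Integration.integrable_add integrable_mult_right integrable_abs t1 si) (auto simp: sdiff_def)
      also have "\<dots> = D + D + 2 * D" using t1[of y] t1[of "- y"] t1[of 0] t2[of y] t2[of "- y"] t2[of 0] by simp
      also have "\<dots> \<le> (B * measure lborel S + 4 * D) * 1" using B(1) by simp
      finally show ?thesis using False by auto
    qed
  qed
qed

context stable_parameters
begin

text \<open>Fubini moves L from the convolution onto the mollifier; v is merely bounded, so L cannot
  act on v itself.\<close>

lemma conv_nonlocal:
  fixes k :: "'a::euclidean_space \<Rightarrow> real" and v \<phi> :: "real \<times> 'a \<Rightarrow> real"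
  assumes k: "kernel k" and v: "bounded_borel v U" and \<phi>: "supported \<phi> K"
  shows "integrable lborel (\<lambda>y. k y * sdiff (\<lambda>x. conv v \<phi> (t, x)) x y)"
    and "integrable lborel (\<lambda>p. v p * (LINT y|lborel. k y * sdiff \<phi> ((t, x) - p) (0, y)))"
    and "(LINT y|lborel. k y * sdiff (\<lambda>x. conv v \<phi> (t, x)) x y)
      = (LINT p|lborel. v p * (LINT y|lborel. k y * sdiff \<phi> ((t, x) - p) (0, y)))"
proof -
  interpret bounded_borel v U by fact
  note vb[measurable] = u_borel and km[measurable] = kernel_measurable[OF k]
  have \<phi>m[measurable]: "\<phi> \<in> borel_measurable borel" using \<phi> smooth_borel[of \<phi>] by (simp add: supported_def)
  let ?z = "(t, x)"
  define F where "F y p = k y * (v p * sdiff \<phi> (?z - p) (0, y))" for y p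
  have Fm: "case_prod F \<in> borel_measurable (lborel \<Otimes>\<^sub>M lborel)"
    unfolding F_def[abs_def] sdiff_def by measurable
  have si: "integrable lborel (\<lambda>q. sdiff \<phi> q y)" for y
    unfolding sdiff_conv_fdiff using lborel_integrable_translate[OF fdiff_integrable[OF \<phi>], of "[y,y]" "- y"]
    by simp
  have vsi: "integrable lborel (\<lambda>p. v p * sdiff \<phi> (?z - p) (0, y))" for y by (rule conv_integrand[OF si])
  have cs: "sdiff (\<lambda>x. conv v \<phi> (t, x)) x y = (LINT p|lborel. v p * sdiff \<phi> (?z - p) (0, y))" for y
  proof -
    have "sdiff (\<lambda>x. conv v \<phi> (t, x)) x y = fdiff [(0, y), (0, y)] (conv v \<phi>) (?z - (0, y))"
      unfolding sdiff_conv_fdiff[symmetric] by (simp add: sdiff_def)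
    also have "\<dots> = (LINT p|lborel. v p * sdiff \<phi> (?z - p) (0, y))"
      by (simp only: fdiff_conv[OF \<phi>] sdiff_conv_fdiff cancel_ab_semigroup_add_class.diff_right_commute[of ?z "(0, y)"])
    finally show ?thesis .
  qed
  obtain C where C: "0 \<le> C"
    "\<And>y. (LINT q|lborel. \<bar>sdiff \<phi> q y\<bar>) \<le> C * (indicator (ball 0 1) y * norm y powr 2 + indicator (- ball 0 1) y * norm y powr 0)"
    using supported_sdiff_L1[OF \<phi>] by blast
  have ki: "integrable lborel (\<lambda>y. indicator (ball 0 1) y * (norm y powr 2 * k y))"
    by (rule kernel_near[where 'a='a and q = 2]) (use s in simp, use k zero_less_one in blast)
  have ki': "integrable lborel (\<lambda>y. indicator (- ball 0 1) y * (norm y powr 0 * k y))"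
    by (rule kernel_far[where 'a='a and p = 0]) (use s in simp, use k zero_less_one in blast)
  have Fi: "integrable (lborel \<Otimes>\<^sub>M lborel) (case_prod F)"
  proof (rule lborel_pair.Fubini_integrable[OF Fm])
    show "AE y in lborel. integrable lborel (\<lambda>p. case_prod F (y, p))"
      unfolding F_def by (intro AE_I2) (simp add: vsi)
    show "integrable lborel (\<lambda>y. LINT p|lborel. norm (case_prod F (y, p)))"
    proof (rule integral_dominated_le(1))
      show "integrable lborel (\<lambda>y. U * C * (indicator (ball 0 1) y * (norm y powr 2 * k y) + indicator (- ball 0 1) y * (norm y powr 0 * k y)))"
        using ki ki' by simp
      have "(\<lambda>(y, p). norm (case_prod F (y, p))) \<in> borel_measurable (lborel \<Otimes>\<^sub>M lborel)" using Fm by measurable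
      then show "(\<lambda>y. LINT p|lborel. norm (case_prod F (y, p))) \<in> borel_measurable lborel"
        by (intro lborel.borel_measurable_lebesgue_integral) simp
      show "\<bar>LINT p|lborel. norm (case_prod F (y, p))\<bar>
        \<le> U * C * (indicator (ball 0 1) y * (norm y powr 2 * k y) + indicator (- ball 0 1) y * (norm y powr 0 * k y))" for y
      proof -
        have ab: "bounded_borel (\<lambda>p. \<bar>v p\<bar>) U" using u_bound by unfold_locales (use vb in auto)
        have i: "integrable lborel (\<lambda>q. \<bar>sdiff \<phi> q (0, y)\<bar>)" using si by simp
        have "(LINT p|lborel. norm (case_prod F (y, p))) = k y * (LINT p|lborel. \<bar>v p\<bar> * \<bar>sdiff \<phi> (?z - p) (0, y)\<bar>)"
          using kernel_nonneg[OF k] by (simp add: F_def abs_mult)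
        moreover have "\<bar>LINT p|lborel. \<bar>v p\<bar> * \<bar>sdiff \<phi> (?z - p) (0, y)\<bar>\<bar> \<le> U * (LINT q|lborel. \<bar>sdiff \<phi> q (0, y)\<bar>)"
          by (rule bounded_borel.conv_bound_integral[OF ab i i]) simp
        moreover have "U * (LINT q|lborel. \<bar>sdiff \<phi> q (0, y)\<bar>) \<le> U * (C * (indicator (ball 0 1) y * norm y powr 2 + indicator (- ball 0 1) y * norm y powr 0))"
          using C(2)[of "(0::real, y)"] U_nonneg by (intro mult_left_mono) (simp_all add: indicator_def norm_Pair)
        ultimately have "\<bar>LINT p|lborel. norm (case_prod F (y, p))\<bar> \<le> k y * (U * (C * (indicator (ball 0 1) y * norm y powr 2 + indicator (- ball 0 1) y * norm y powr 0)))"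
          using mult_left_mono[OF order_trans, OF _ _ kernel_nonneg[OF k, of y]] kernel_nonneg[OF k, of y]
          by (simp only: abs_mult abs_of_nonneg)
        then show ?thesis by (simp add: algebra_simps)
      qed
    qed
  qed
  have eqy: "(LINT p|lborel. F y p) = k y * sdiff (\<lambda>x. conv v \<phi> (t, x)) x y" for y
    unfolding F_def cs by simp
  have eqp: "(LINT y|lborel. F y p) = v p * (LINT y|lborel. k y * sdiff \<phi> (?z - p) (0, y))" for p
    unfolding F_def by (simp add: mult.left_commute[of _ "v p"])
  show "integrable lborel (\<lambda>y. k y * sdiff (\<lambda>x. conv v \<phi> (t, x)) x y)"
    using lborel_pair.integrable_fst[OF Fi] unfolding eqy .
  show "integrable lborel (\<lambda>p. v p * (LINT y|lborel. k y * sdiff \<phi> (?z - p) (0, y)))"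
    using lborel_pair.integrable_snd[OF Fi] unfolding eqp .
  show "(LINT y|lborel. k y * sdiff (\<lambda>x. conv v \<phi> (t, x)) x y)
      = (LINT p|lborel. v p * (LINT y|lborel. k y * sdiff \<phi> (?z - p) (0, y)))"
    using lborel_pair.Fubini_integral[OF Fi] unfolding eqy eqp by simp
qed

text \<open>The weak formulation is tested with p sent to \<phi>(z - p), z = (t, x). Reflection
  reverses the sign of the time derivative and leaves L unchanged, so the signs of the adjoint
  operator turn into the equation for the convolution at z.\<close>

lemma conv_equation:
  fixes a :: "'a::euclidean_space \<Rightarrow> real"
  assumes k: "kernel k" "\<And>y. k y = a (y /\<^sub>R norm y) / norm y powr (real DIM('a) + 2 * s)"
    and ws: "weak_solution s a u f I D" and ID: "I \<in> sets borel" "D \<in> sets borel"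
    and u: "u \<in> borel_measurable (lebesgue_on (I \<times> UNIV))"
    and v: "bounded_borel v U" "AE z in lebesgue. v z = indicator (I \<times> UNIV) z * u z"
    and f: "f \<in> borel_measurable (lebesgue_on (I \<times> D))"
    and g: "bounded_borel g G" "AE z in lebesgue. g z = indicator (I \<times> D) z * f z"
    and \<phi>: "supported \<phi> K" "\<And>z. (\<phi> has_derivative \<phi>' z) (at z)" "supported (\<lambda>z. \<phi>' z (1, 0)) K"
    and K: "(-) (t, x) ` K \<subseteq> I \<times> D"
  shows "conv v (\<lambda>z. \<phi>' z (1, 0)) (t, x) - (LINT y|lborel. k y * sdiff (\<lambda>x. conv v \<phi> (t, x)) x y) = conv g \<phi> (t, x)"
proof -
  interpret V: bounded_borel v U by fact
  interpret G: bounded_borel g G by fact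
  let ?z = "(t, x)" and ?n = "\<lambda>p. LINT y|lborel. k y * sdiff \<phi> ((t, x) - p) (0, y)"
  define \<eta> where "\<eta> p = \<phi> (?z - p)" for p
  have \<phi>m[measurable]: "\<phi> \<in> borel_measurable borel" using \<phi> smooth_borel[of \<phi>] by (simp add: supported_def)
  have \<phi>'m[measurable]: "(\<lambda>z. \<phi>' z (1, 0)) \<in> borel_measurable borel"
    using \<phi>(3) smooth_borel[of "\<lambda>z. \<phi>' z (1, 0)"] by (simp add: supported_def)
  have km[measurable]: "k \<in> borel_measurable borel" by (rule kernel_measurable[OF k(1)])
  have se: "supported \<eta> ((-) ?z ` K)" unfolding \<eta>_def[abs_def] by (rule supported_reflect[OF \<phi>(1)])
  have sub: "closure {p. \<eta> p \<noteq> 0} \<subseteq> (-) ?z ` K"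
    using se by (intro closure_minimal) (auto simp: supported_def compact_imp_closed)
  have "\<eta> \<in> test_functions (I \<times> D)"
    using se sub K compact_Int_closed[of "(-) ?z ` K" "closure {p. \<eta> p \<noteq> 0}"]
    by (auto simp: test_functions_def supported_def smooth_Ck_on Int_absorb1)
  then have eq: "(LINT p:(I \<times> UNIV)|lebesgue. u p * (- time_deriv \<eta> p - stable_op s a \<eta> p)) = (LINT p:(I \<times> D)|lebesgue. f p * \<eta> p)"
    using ws by (simp add: weak_solution_def)
  have td: "time_deriv \<eta> p = - \<phi>' (?z - p) (1, 0)" for p
  proof -
    have "((\<lambda>\<tau>. ?z - (\<tau>, snd p)) has_derivative (\<lambda>h. - (h, 0))) (at (fst p))"
      by (auto intro!: derivative_eq_intros)
    from diff_chain_at[OF this \<phi>(2)] have "((\<lambda>\<tau>. \<eta> (\<tau>, snd p)) has_derivative (\<lambda>h. \<phi>' (?z - p) (- (h, 0)))) (at (fst p))"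
      by (simp add: o_def \<eta>_def)
    moreover have "\<phi>' (?z - p) (- (h, 0)) = (- \<phi>' (?z - p) (1, 0)) * h" for h
    proof -
      have l: "linear (\<phi>' (?z - p))" using \<phi>(2) has_derivative_linear by blast
      have "\<phi>' (?z - p) (- (h, 0)) = \<phi>' (?z - p) ((- h) *\<^sub>R (1, 0))" by simp
      also have "\<dots> = (- h) *\<^sub>R \<phi>' (?z - p) (1, 0)" by (rule linear_cmul[OF l])
      finally show ?thesis by simp
    qed
    moreover have e: "(*) (- d) = (\<lambda>h. - (d * h))" for d :: real by auto
    ultimately have "((\<lambda>\<tau>. \<eta> (\<tau>, snd p)) has_real_derivative - \<phi>' (?z - p) (1, 0)) (at (fst p))"
      by (simp add: has_field_derivative_def e)
    then show ?thesis unfolding time_deriv_def by (simp add: case_prod_beta DERIV_imp_deriv)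
  qed
  \<comment> \<open>The symmetric second difference is even in y, so the reflection in \<eta>
    disappears.\<close>
  have so: "stable_op s a \<eta> p = ?n p" for p
  proof -
    have "stable_op s a \<eta> p = (LINT y|lebesgue. k y * sdiff \<phi> (?z - p) (0, y))"
      unfolding stable_op_def case_prod_beta
      by (rule Bochner_Integration.integral_cong, simp) (cases p, simp add: k(2) \<eta>_def sdiff_def algebra_simps)
    also have "\<dots> = ?n p" unfolding sdiff_def by (rule integral_completion) measurable
    finally show ?thesis .
  qed
  have nm: "?n \<in> borel_measurable borel"
  proof -
    have "?n \<in> borel_measurable lborel"
      unfolding sdiff_def by (rule lborel.borel_measurable_lebesgue_integral) measurable
    then show ?thesis by simp
  qed
  have ind: "(\<lambda>p. indicator S p * w p) \<in> borel_measurable lebesgue"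
    if "w \<in> borel_measurable (lebesgue_on S)" "S \<in> sets borel" for w :: "real \<times> 'a \<Rightarrow> real" and S
    using that borel_measurable_restrict_space_iff[of S lebesgue w] by (simp add: scaleR_conv_of_real)
  have S: "I \<times> (UNIV :: 'a set) \<in> sets borel" "I \<times> D \<in> sets borel"
    by (auto intro!: borel_Times ID)
  have m1: "(\<lambda>p. \<phi>' (?z - p) (1, 0) - ?n p) \<in> borel_measurable borel"
    using nm by measurable
  \<comment> \<open>u is only Lebesgue measurable on the strip. It is replaced by its Borel version
    v before the passage to \<open>lborel\<close>, on which the convolutions are defined.\<close>
  have "(LINT p:(I \<times> UNIV)|lebesgue. u p * (- time_deriv \<eta> p - stable_op s a \<eta> p))
      = (LINT p|lebesgue. v p * (\<phi>' (?z - p) (1, 0) - ?n p))"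
    unfolding set_lebesgue_integral_def td so
  proof (rule integral_cong_AE)
    have "(\<lambda>p. (indicator (I \<times> UNIV) p * u p) * (\<phi>' (?z - p) (1, 0) - ?n p)) \<in> borel_measurable lebesgue"
      by (rule borel_measurable_times[OF ind[OF u] measurable_completion]) (use S m1 in auto)
    then show "(\<lambda>p. indicat_real (I \<times> UNIV) p *\<^sub>R (u p * (- (- \<phi>' (?z - p) (1, 0)) - ?n p))) \<in> borel_measurable lebesgue"
      by (simp add: mult.assoc)
    show "(\<lambda>p. v p * (\<phi>' (?z - p) (1, 0) - ?n p)) \<in> borel_measurable lebesgue"
      by (intro measurable_completion) (use V.u_borel m1 in auto)
    show "AE p in lebesgue. indicat_real (I \<times> UNIV) p *\<^sub>R (u p * (- (- \<phi>' (?z - p) (1, 0)) - ?n p)) = v p * (\<phi>' (?z - p) (1, 0) - ?n p)"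
      using v(2) by (rule eventually_mono) simp
  qed
  also have "\<dots> = (LINT p|lborel. v p * (\<phi>' (?z - p) (1, 0) - ?n p))"
    by (rule integral_completion) (use V.u_borel m1 in auto)
  also have "\<dots> = (LINT p|lborel. v p * \<phi>' (?z - p) (1, 0)) - (LINT p|lborel. v p * ?n p)"
    unfolding right_diff_distrib
    by (rule Bochner_Integration.integral_diff[OF V.conv_integrand[OF supported_integrable[OF \<phi>(3)]] conv_nonlocal(2)[OF k(1) v(1) \<phi>(1)]])
  finally have lhs: "(LINT p:(I \<times> UNIV)|lebesgue. u p * (- time_deriv \<eta> p - stable_op s a \<eta> p))
    = conv v (\<lambda>z. \<phi>' z (1, 0)) ?z - (LINT y|lborel. k y * sdiff (\<lambda>x. conv v \<phi> (t, x)) x y)"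
    using conv_nonlocal(3)[OF k(1) v(1) \<phi>(1), of t x] by (simp add: conv_def)
  have "(LINT p:(I \<times> D)|lebesgue. f p * \<eta> p) = (LINT p|lebesgue. g p * \<phi> (?z - p))"
    unfolding set_lebesgue_integral_def \<eta>_def
  proof (rule integral_cong_AE)
    have "(\<lambda>p. (indicator (I \<times> D) p * f p) * \<phi> (?z - p)) \<in> borel_measurable lebesgue"
      by (rule borel_measurable_times[OF ind[OF f] measurable_completion]) (use S in auto)
    then show "(\<lambda>p. indicat_real (I \<times> D) p *\<^sub>R (f p * \<phi> (?z - p))) \<in> borel_measurable lebesgue"
      by (simp add: mult.assoc)
    show "(\<lambda>p. g p * \<phi> (?z - p)) \<in> borel_measurable lebesgue"
      by (intro measurable_completion) (use G.u_borel in auto)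
    show "AE p in lebesgue. indicat_real (I \<times> D) p *\<^sub>R (f p * \<phi> (?z - p)) = g p * \<phi> (?z - p)"
      using g(2) by (rule eventually_mono) simp
  qed
  also have "\<dots> = conv g \<phi> ?z"
    unfolding conv_def by (rule integral_completion) (use G.u_borel in auto)
  finally show ?thesis using lhs eq by simp
qed

end

subsection \<open>Kernels with Hoelder continuous density\<close>

lemma holder_norm_below_1:
  assumes "0 < \<gamma>" "\<gamma> < 1"
  shows "holder_norm \<gamma> w D = (if continuous_on D w then (SUP x\<in>D. ennreal \<bar>w x\<bar>) + holder_seminorm \<gamma> w D else \<infinity>)"
proof -
  have f: "nat \<lfloor>\<gamma>\<rfloor> = 0" "frac \<gamma> = \<gamma>" using assms by (auto simp: frac_def floor_eq_iff)
  have "{es. set es \<subseteq> Basis \<and> length es \<le> 0} = {[] :: 'a list}" "{es. set es \<subseteq> Basis \<and> length es = 0} = {[] :: 'a list}"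
    by auto
  moreover have "Ck_on 0 w D \<longleftrightarrow> continuous_on D w" by (simp add: Ck_on_def)
  ultimately show ?thesis by (simp add: holder_norm_def f Let_def)
qed

lemma holder_normD:
  assumes "holder_norm \<gamma> w D \<le> ennreal A" "0 < \<gamma>" "\<gamma> < 1" "0 \<le> A"
  shows "continuous_on D w" "\<And>x. x \<in> D \<Longrightarrow> \<bar>w x\<bar> \<le> A"
    "\<And>x y. x \<in> D \<Longrightarrow> y \<in> D \<Longrightarrow> \<bar>w x - w y\<bar> \<le> A * norm (x - y) powr \<gamma>"
proof -
  show c: "continuous_on D w" using assms by (auto simp: holder_norm_below_1 top_unique split: if_splits)
  have le: "(SUP x\<in>D. ennreal \<bar>w x\<bar>) + holder_seminorm \<gamma> w D \<le> ennreal A"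
    using assms c by (simp add: holder_norm_below_1)
  show "\<bar>w x\<bar> \<le> A" if "x \<in> D" for x
  proof -
    have "ennreal \<bar>w x\<bar> \<le> (SUP x\<in>D. ennreal \<bar>w x\<bar>)" using that by (rule SUP_upper)
    also have "\<dots> \<le> (SUP x\<in>D. ennreal \<bar>w x\<bar>) + holder_seminorm \<gamma> w D" by simp
    finally show ?thesis using le assms(4) by (metis ennreal_le_iff order_trans)
  qed
  show "\<bar>w x - w y\<bar> \<le> A * norm (x - y) powr \<gamma>" if "x \<in> D" "y \<in> D" for x y
  proof (cases "x = y")
    case False
    have "ennreal (\<bar>w x - w y\<bar> / norm (x - y) powr \<gamma>) \<le> holder_seminorm \<gamma> w D"
    proof -
      have "ennreal (\<bar>w x - w y\<bar> / norm (x - y) powr \<gamma>) \<le> (SUP y\<in>D - {x}. ennreal (\<bar>w x - w y\<bar> / norm (x - y) powr \<gamma>))"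
        using that False by (intro SUP_upper) auto
      also have "\<dots> \<le> holder_seminorm \<gamma> w D" unfolding holder_seminorm_def using that(1) by (rule SUP_upper)
      finally show ?thesis .
    qed
    also have "\<dots> \<le> (SUP x\<in>D. ennreal \<bar>w x\<bar>) + holder_seminorm \<gamma> w D" by simp
    finally have "\<bar>w x - w y\<bar> / norm (x - y) powr \<gamma> \<le> A" using le assms(4) by (metis ennreal_le_iff order_trans)
    then show ?thesis using False by (simp add: pos_divide_le_eq)
  qed simp
qed

text \<open>Dividing y + h by |y| instead of its own norm costs |h|/|y|, and so does the increment
  itself. If y + h = 0, the inverse of 0 is 0 and the left side is 1, against 2 on the
  right.\<close>

lemma norm_sgn_diff_le:
  fixes y h :: "'a::real_normed_vector"
  assumes "y \<noteq> 0"
  shows "norm ((y + h) /\<^sub>R norm (y + h) - y /\<^sub>R norm y) \<le> 2 * norm h / norm y"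
proof (cases "y + h = 0")
  case True
  then have "norm h = norm y" by (metis add_eq_0_iff norm_minus_cancel)
  then show ?thesis using True assms by simp
next
  case False
  let ?z = "y + h"
  have "?z /\<^sub>R norm ?z - y /\<^sub>R norm y = h /\<^sub>R norm y + (inverse (norm ?z) - inverse (norm y)) *\<^sub>R ?z"
    by (simp add: algebra_simps)
  also have "norm \<dots> \<le> norm (h /\<^sub>R norm y) + norm ((inverse (norm ?z) - inverse (norm y)) *\<^sub>R ?z)"
    by (rule norm_triangle_ineq)
  also have "norm ((inverse (norm ?z) - inverse (norm y)) *\<^sub>R ?z) = \<bar>(inverse (norm ?z) - inverse (norm y)) * norm ?z\<bar>"
    by (simp add: abs_mult)
  also have "(inverse (norm ?z) - inverse (norm y)) * norm ?z = (norm y - norm ?z) / norm y"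
    using False assms by (simp add: field_simps)
  also have "\<bar>\<dots>\<bar> \<le> norm h / norm y"
    using norm_triangle_ineq3[of y ?z] by (simp add: divide_right_mono)
  finally show ?thesis by (simp add: divide_inverse mult_ac)
qed

lemma powr_minus_diff_le:
  fixes r u v m :: real
  assumes "0 < r" "r \<le> u" "r \<le> v" "0 < m"
  shows "\<bar>u powr - m - v powr - m\<bar> \<le> m * r powr (- m - 1) * \<bar>u - v\<bar>"
proof -
  have *: "\<bar>u powr - m - v powr - m\<bar> \<le> m * r powr (- m - 1) * \<bar>u - v\<bar>" if "v < u" "r \<le> v" for u v
  proof -
    have "\<exists>z. v < z \<and> z < u \<and> u powr - m - v powr - m = (u - v) * (- m * z powr (- m - 1))"
    proof (rule MVT2[OF that(1)])
      show "((\<lambda>x. x powr - m) has_real_derivative - m * x powr (- m - 1)) (at x)" if "v \<le> x" "x \<le> u" for x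
        using that \<open>r \<le> v\<close> assms(1) by (intro has_real_derivative_powr) auto
    qed
    then obtain z where z: "v < z" "z < u" "u powr - m - v powr - m = (u - v) * (- m * z powr (- m - 1))" by blast
    have "z powr (- m - 1) \<le> r powr (- m - 1)"
      using z that assms by (intro powr_mono2') auto
    then have "(u - v) * (m * z powr (- m - 1)) \<le> (u - v) * (m * r powr (- m - 1))"
      using that assms by (intro mult_left_mono) auto
    then show ?thesis using z(3) that assms by (simp add: abs_mult mult_ac)
  qed
  show ?thesis using *[of v u] *[of u v] assms by (cases u v rule: linorder_cases) (auto simp: abs_minus_commute)
qed

text \<open>Ellipticity is an integral condition, yet it excludes a < c on the whole sphere: the
  integral for any \<nu> would be at most c times the sphere measure, hence below lam. \<sigma>
  bounds that measure, and 1 + \<sigma> makes the inequality strict.\<close>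

lemma elliptic_density_lower_bound:
  fixes a :: "'a::euclidean_space \<Rightarrow> real"
  assumes "elliptic_density s lam Lam a" "0 < lam" "0 < s"
  shows "\<exists>\<theta>. norm \<theta> = 1 \<and> lam / (1 + real DIM('a) * measure lborel (ball (0::'a) 1)) \<le> a \<theta>"
proof (rule ccontr)
  define \<sigma> where "\<sigma> = real DIM('a) * measure lborel (ball (0::'a) 1)"
  define c where "c = lam / (1 + \<sigma>)"
  have \<sigma>: "0 \<le> \<sigma>" by (simp add: \<sigma>_def)
  have c: "0 < c" using assms \<sigma> by (simp add: c_def add_nonneg_pos)
  assume "\<not> (\<exists>\<theta>. norm \<theta> = 1 \<and> lam / (1 + real DIM('a) * measure lborel (ball (0::'a) 1)) \<le> a \<theta>)"
  then have lt: "a \<theta> < c" if "\<theta> \<in> sphere 0 1" for \<theta>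
    using that by (auto simp: c_def \<sigma>_def)
  have nn: "0 \<le> a \<theta>" if "\<theta> \<in> sphere 0 1" for \<theta> using assms(1) that by (auto simp: elliptic_density_def)
  have fin: "emeasure lborel (ball (0::'a) 1) = ennreal (measure lborel (ball (0::'a) 1))"
    using emeasure_lborel_ball_finite[of "0::'a" 1] by (intro emeasure_eq_ennreal_measure) (simp add: less_top)
  have "emeasure sphere_measure (sphere (0::'a) 1) = of_nat DIM('a) * emeasure lborel {x::'a \<in> ball 0 1 - {0}. x /\<^sub>R norm x \<in> sphere 0 1}"
    by (rule emeasure_sphere_measure) auto
  also have "\<dots> \<le> of_nat DIM('a) * emeasure lborel (ball (0::'a) 1)"
    by (intro mult_left_mono emeasure_mono) auto
  also have "\<dots> = ennreal \<sigma>" by (simp add: fin \<sigma>_def ennreal_mult ennreal_of_nat_eq_real_of_nat)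
  finally have em: "emeasure (sphere_measure :: 'a measure) (space sphere_measure) \<le> ennreal \<sigma>" by (simp add: space_sphere_measure)
  interpret finite_measure "sphere_measure :: 'a measure"
    using em by (intro finite_measureI) (auto simp: top_unique)
  have ms: "measure (sphere_measure :: 'a measure) (space sphere_measure) \<le> \<sigma>"
    using em \<sigma> by (simp add: emeasure_eq_measure)
  obtain \<nu> :: 'a where \<nu>: "\<nu> \<in> Basis" using nonempty_Basis by blast
  have "lam \<le> (INF \<nu>\<in>sphere 0 1. LINT \<theta>|sphere_measure. \<bar>\<nu> \<bullet> \<theta>\<bar> powr (2 * s) * a \<theta>)"
    using assms(1) by (simp add: elliptic_density_def)
  also have "\<dots> \<le> (LINT \<theta>|sphere_measure. \<bar>\<nu> \<bullet> \<theta>\<bar> powr (2 * s) * a \<theta>)"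
  proof (rule cINF_lower)
    show "bdd_below ((\<lambda>\<nu>. LINT \<theta>|sphere_measure. \<bar>\<nu> \<bullet> \<theta>\<bar> powr (2 * s) * a \<theta>) ` sphere 0 1)"
      by (rule bdd_belowI2[of _ 0]) (auto intro!: Bochner_Integration.integral_nonneg_AE AE_I2 mult_nonneg_nonneg nn simp: space_sphere_measure)
  qed (use \<nu> in simp)
  also have "\<dots> \<le> (LINT \<theta>|(sphere_measure :: 'a measure). c)"
  proof (rule integral_mono')
    fix \<theta> :: 'a assume "\<theta> \<in> space sphere_measure"
    then have \<theta>: "\<theta> \<in> sphere 0 1" by (simp add: space_sphere_measure)
    have "\<bar>\<nu> \<bullet> \<theta>\<bar> \<le> 1" using Cauchy_Schwarz_ineq2[of \<nu> \<theta>] \<nu> \<theta> by simp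
    then have "\<bar>\<nu> \<bullet> \<theta>\<bar> powr (2 * s) \<le> 1" using assms(3) by (intro powr_le1) auto
    then have "\<bar>\<nu> \<bullet> \<theta>\<bar> powr (2 * s) * a \<theta> \<le> 1 * a \<theta>" using nn[OF \<theta>] by (intro mult_right_mono) auto
    then show "\<bar>\<nu> \<bullet> \<theta>\<bar> powr (2 * s) * a \<theta> \<le> c" using lt[OF \<theta>] by simp
  qed (use c in auto)
  also have "\<dots> \<le> \<sigma> * c" using ms c by (simp add: mult_right_mono)
  also have "\<dots> < lam" using assms(2) \<sigma> by (simp add: c_def field_simps)
  finally show False by simp
qed

text \<open>The bridge from densities to \<open>kernel\<close>. M, c and \<kappa> are fixed before
  any density is given, from lam, A, s, \<alpha> and the dimension; the final constant inherits its
  dependence from here.\<close>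

lemma stable_kernel_parameters:
  fixes s \<alpha> lam Lam A :: real
  assumes s: "0 < s" "s < 1" and \<alpha>: "0 < \<alpha>" "\<alpha> < 1" "\<alpha> < 2 * s" and lam: "0 < lam" and A: "1 \<le> A"
  obtains M c \<kappa> where "stable_parameters s \<alpha> M c \<kappa>"
    "\<And>a::'a::euclidean_space \<Rightarrow> real. elliptic_density s lam Lam a \<Longrightarrow> holder_norm \<alpha> a (sphere 0 1) \<le> ennreal A \<Longrightarrow>
      stable_parameters.kernel s \<alpha> M c \<kappa> (\<lambda>y. a (y /\<^sub>R norm y) / norm y powr (real DIM('a) + 2 * s))"
proof -
  define m where "m = real DIM('a) + 2 * s"
  define c1 where "c1 = lam / (1 + real DIM('a) * measure lborel (ball (0::'a) 1))"
  \<comment> \<open>A vector within \<kappa> l of l \<theta> has its direction within 2 \<kappa> of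
    \<theta>, so a falls below \<open>a \<theta> \<ge> c1\<close> by at most A (2 \<kappa>)^\<alpha>
    <= c1 / 2. The factor 2^(-m) in c accounts for |y| <= 2 l.\<close>
  define \<kappa> where "\<kappa> = min 1 ((c1 / (2 * A)) powr (1 / \<alpha>)) / 2"
  define c where "c = c1 / 2 * 2 powr - m"
  \<comment> \<open>The 2 comes from the Hoelder bound of a between the two directions, m 2^(m+1)
    from the mean value bound for |y|^(-m) at distance at least |y|/2 from the origin.\<close>
  define M where "M = A * (2 + m * 2 powr (m + 1))"
  have m: "0 < m" "-2 * s - real DIM('a) = - m" "-2 * s - \<alpha> - real DIM('a) = - m - \<alpha>" using s by (auto simp: m_def)
  have c1: "0 < c1" using lam by (simp add: c1_def add_pos_nonneg)
  have \<kappa>: "0 < \<kappa>" "\<kappa> \<le> 1 / 2" using c1 A by (auto simp: \<kappa>_def)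
  have \<kappa>2: "A * (2 * \<kappa>) powr \<alpha> \<le> c1 / 2"
  proof -
    have "(2 * \<kappa>) powr \<alpha> \<le> ((c1 / (2 * A)) powr (1 / \<alpha>)) powr \<alpha>"
      using \<kappa> \<alpha> by (intro powr_mono2) (auto simp: \<kappa>_def)
    also have "\<dots> = c1 / (2 * A)" using c1 A \<alpha> by (simp add: powr_powr)
    finally have "A * (2 * \<kappa>) powr \<alpha> \<le> A * (c1 / (2 * A))" using A by (intro mult_left_mono) auto
    also have "\<dots> = c1 / 2" using A by simp
    finally show ?thesis .
  qed
  have AM: "A \<le> M" "0 < M"
  proof -
    have "A * 1 \<le> M" unfolding M_def using A m by (intro mult_left_mono) auto
    then show "A \<le> M" by simp
    with A show "0 < M" by simp
  qed
  interpret stable_parameters s \<alpha> M c \<kappa>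
    using s \<alpha> AM c1 \<kappa> by unfold_locales (auto simp: c_def)
  show thesis
  proof (rule that[of M c \<kappa>], goal_cases)
    case 1
    show ?case by unfold_locales
  next
    case (2 a)
    let ?k = "\<lambda>y. a (y /\<^sub>R norm y) / norm y powr m"
    have us: "y /\<^sub>R norm y \<in> sphere 0 1" if "y \<noteq> 0" for y :: 'a using that by simp
    note h = holder_normD[OF 2(2) \<alpha>(1,2), OF order_trans[OF zero_le_one A]]
    have nn: "0 \<le> a \<theta>" if "\<theta> \<in> sphere 0 1" for \<theta> using 2(1) that by (auto simp: elliptic_density_def)
    have aA: "a \<theta> \<le> A" if "\<theta> \<in> sphere 0 1" for \<theta> using h(2)[OF that] by simp
    have k1: "?k \<in> borel_measurable borel"
    proof -
      have "continuous_on (- {0}) (\<lambda>y. a (y /\<^sub>R norm y))"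
      proof (rule continuous_on_compose2[OF h(1)])
        show "continuous_on (- {0}) (\<lambda>y::'a. y /\<^sub>R norm y)" by (intro continuous_intros) auto
        show "(\<lambda>y::'a. y /\<^sub>R norm y) ` (- {0}) \<subseteq> sphere 0 1" using us by blast
      qed
      then have "continuous_on (- {0}) ?k" by (intro continuous_intros) auto
      then have "(\<lambda>y. indicator (- {0}) y *\<^sub>R ?k y) \<in> borel_measurable borel"
        by (intro borel_measurable_continuous_on_indicator) auto
      moreover have "(\<lambda>y. indicator (- {0}) y *\<^sub>R ?k y) = ?k" by (auto simp: indicator_def fun_eq_iff)
      ultimately show ?thesis by simp
    qed
    have k2: "0 \<le> ?k y \<and> ?k y \<le> M * norm y powr - m" for y
    proof (cases "y = 0")
      case False
      have "?k y = a (y /\<^sub>R norm y) * norm y powr - m" using False by (simp add: powr_minus divide_inverse)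
      moreover have "a (y /\<^sub>R norm y) * norm y powr - m \<le> M * norm y powr - m"
        using order_trans[OF aA[OF us[OF False]] AM(1)] by (intro mult_right_mono) auto
      ultimately show ?thesis using nn[OF us[OF False]] by simp
    qed simp
    have k3: "\<bar>?k (y + h) - ?k y\<bar> \<le> M * norm h powr \<alpha> * norm y powr (- m - \<alpha>)" if le: "norm h \<le> norm y / 2" for y h
    proof (cases "y = 0")
      case False
      let ?z = "y + h"
      have nz: "norm y / 2 \<le> norm ?z" using norm_diff_ineq[of y h] le by simp
      then have z: "?z \<noteq> 0" using False by auto
      have hy: "norm h \<le> norm y" using le norm_ge_zero[of y] by linarith
      let ?d = "norm h powr \<alpha> * norm y powr (- m - \<alpha>)"
      have "?k ?z - ?k y = a (?z /\<^sub>R norm ?z) * (norm ?z powr - m - norm y powr - m)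
          + (a (?z /\<^sub>R norm ?z) - a (y /\<^sub>R norm y)) * norm y powr - m"
        using False z by (simp add: powr_minus divide_inverse algebra_simps)
      also have "\<bar>\<dots>\<bar> \<le> a (?z /\<^sub>R norm ?z) * \<bar>norm ?z powr - m - norm y powr - m\<bar>
          + \<bar>a (?z /\<^sub>R norm ?z) - a (y /\<^sub>R norm y)\<bar> * norm y powr - m"
        using nn[OF us[OF z]] by (intro order_trans[OF abs_triangle_ineq]) (simp add: abs_mult)
      also have "a (?z /\<^sub>R norm ?z) * \<bar>norm ?z powr - m - norm y powr - m\<bar> \<le> A * (m * 2 powr (m + 1) * ?d)"
      proof (rule mult_mono[OF aA[OF us[OF z]]])
        have "\<bar>norm ?z powr - m - norm y powr - m\<bar> \<le> m * (norm y / 2) powr (- m - 1) * \<bar>norm ?z - norm y\<bar>"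
          using False nz m by (intro powr_minus_diff_le) auto
        also have "\<dots> \<le> m * (norm y / 2) powr (- m - 1) * norm h"
          using norm_triangle_ineq3[of ?z y] m by (intro mult_left_mono) auto
        also have "(norm y / 2) powr (- m - 1) = 2 powr (m + 1) * norm y powr (- m - 1)"
          by (simp add: powr_divide powr_minus powr_diff field_simps powr_add)
        also have "m * (2 powr (m + 1) * norm y powr (- m - 1)) * norm h = m * 2 powr (m + 1) * (norm h * norm y powr (- m - 1))"
          by simp
        also have "\<dots> \<le> m * 2 powr (m + 1) * ?d"
        proof (rule mult_left_mono)
          have "norm h = norm h powr \<alpha> * norm h powr (1 - \<alpha>)" by (cases "h = 0") (simp_all flip: powr_add)
          also have "\<dots> \<le> norm h powr \<alpha> * norm y powr (1 - \<alpha>)" using hy \<alpha> by (intro mult_left_mono powr_mono2) auto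
          finally have "norm h * norm y powr (- m - 1) \<le> (norm h powr \<alpha> * norm y powr (1 - \<alpha>)) * norm y powr (- m - 1)"
            by (rule mult_right_mono) simp
          also have "\<dots> = ?d"
          proof -
            have e: "1 - \<alpha> + (- m - 1) = - m - \<alpha>" by simp
            show ?thesis unfolding mult.assoc powr_add[symmetric] e by (rule refl)
          qed
          finally show "norm h * norm y powr (- m - 1) \<le> ?d" .
        qed (use m in simp)
        finally show "\<bar>norm ?z powr - m - norm y powr - m\<bar> \<le> m * 2 powr (m + 1) * ?d" .
      qed (use A in auto)
      also have "\<bar>a (?z /\<^sub>R norm ?z) - a (y /\<^sub>R norm y)\<bar> * norm y powr - m \<le> (A * (2 * (norm h / norm y) powr \<alpha>)) * norm y powr - m"
      proof (rule mult_right_mono)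
        have "\<bar>a (?z /\<^sub>R norm ?z) - a (y /\<^sub>R norm y)\<bar> \<le> A * norm (?z /\<^sub>R norm ?z - y /\<^sub>R norm y) powr \<alpha>"
          by (rule h(3)[OF us[OF z] us[OF False]])
        also have "norm (?z /\<^sub>R norm ?z - y /\<^sub>R norm y) powr \<alpha> \<le> (2 * (norm h / norm y)) powr \<alpha>"
          using norm_sgn_diff_le[OF False, of h] \<alpha> by (intro powr_mono2) auto
        also have "\<dots> = 2 powr \<alpha> * (norm h / norm y) powr \<alpha>" by (rule powr_mult)
        also have "\<dots> \<le> 2 powr 1 * (norm h / norm y) powr \<alpha>" using \<alpha> by (intro mult_right_mono powr_mono) auto
        finally show "\<bar>a (?z /\<^sub>R norm ?z) - a (y /\<^sub>R norm y)\<bar> \<le> A * (2 * (norm h / norm y) powr \<alpha>)"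
          using A by simp
      qed simp
      also have "(A * (2 * (norm h / norm y) powr \<alpha>)) * norm y powr - m = A * (2 * ?d)"
        unfolding powr_divide powr_diff by simp
      also have "A * (m * 2 powr (m + 1) * ?d) + A * (2 * ?d) = M * ?d" by (simp add: M_def algebra_simps)
      finally show ?thesis by (simp add: mult.assoc)
    qed (use le in simp)
    obtain \<theta> :: 'a where \<theta>: "norm \<theta> = 1" "c1 \<le> a \<theta>"
      using elliptic_density_lower_bound[OF 2(1) lam s(1)] by (auto simp: c1_def)
    have k4: "c * l powr - m \<le> ?k y" if l: "0 < l" and y: "y \<in> ball (l *\<^sub>R \<theta>) (\<kappa> * l)" for l y
    proof -
      define h where "h = y - l *\<^sub>R \<theta>"
      have y': "y = l *\<^sub>R \<theta> + h" by (simp add: h_def)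
      have nh: "norm h < \<kappa> * l" using y by (simp add: h_def dist_norm norm_minus_commute)
      have "\<kappa> * l \<le> 1 / 2 * l" using \<kappa> l by (intro mult_right_mono) auto
      then have nh2: "norm h < l / 2" using nh by simp
      have t0: "l *\<^sub>R \<theta> \<noteq> 0" "norm (l *\<^sub>R \<theta>) = l" "(l *\<^sub>R \<theta>) /\<^sub>R norm (l *\<^sub>R \<theta>) = \<theta>" using \<theta> l by auto
      have ny: "l / 2 < norm y" "norm y \<le> 2 * l"
        using norm_diff_ineq[of "l *\<^sub>R \<theta>" h] norm_triangle_ineq[of "l *\<^sub>R \<theta>" h] nh2 t0(2) l unfolding y'[symmetric] by linarith+
      have y0: "y \<noteq> 0" using ny l by auto
      have "norm (y /\<^sub>R norm y - \<theta>) \<le> 2 * norm h / l"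
        using norm_sgn_diff_le[OF t0(1), of h] unfolding t0(3) unfolding t0(2) y'[symmetric] .
      also have "\<dots> \<le> 2 * \<kappa>" using nh l by (simp add: field_simps)
      finally have "norm (y /\<^sub>R norm y - \<theta>) powr \<alpha> \<le> (2 * \<kappa>) powr \<alpha>" using \<alpha> by (intro powr_mono2) auto
      then have "A * norm (y /\<^sub>R norm y - \<theta>) powr \<alpha> \<le> c1 / 2"
        using \<kappa>2 A mult_left_mono[of _ _ A] by (meson order_trans zero_le_one)
      moreover have "\<bar>a (y /\<^sub>R norm y) - a \<theta>\<bar> \<le> A * norm (y /\<^sub>R norm y - \<theta>) powr \<alpha>"
        using h(3)[OF us[OF y0], of \<theta>] \<theta>(1) by simp
      ultimately have ay: "c1 / 2 \<le> a (y /\<^sub>R norm y)" using \<theta>(2) by linarith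
      have "c * l powr - m = c1 / 2 * (2 * l) powr - m" using l by (simp add: c_def powr_mult)
      also have "\<dots> \<le> a (y /\<^sub>R norm y) * norm y powr - m"
        using ay c1 ny y0 m by (intro mult_mono powr_mono2') auto
      also have "\<dots> = ?k y" by (simp add: powr_minus divide_inverse)
      finally show ?thesis .
    qed
    have "kernel ?k"
      unfolding kernel_def m(2,3) using k1 k2 k3 k4 \<theta>(1) by blast
    then show ?case by (simp add: m_def)
  qed
qed

subsection \<open>Estimates for smooth solutions\<close>

text \<open>What a mollified solution satisfies. One constant N controls all the data. In
  \<open>w_smooth\<close> the bound B is unrelated to N and may blow up with the mollifier; it makes
  suprema finite. Times up to T and radius 9/10 leave room for the mollifier inside the original
  cylinder.\<close>

locale classical_solution = stable_parameters s \<alpha> M c \<kappa> for s \<alpha> M c \<kappa> :: real +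
  fixes k :: "'a::euclidean_space \<Rightarrow> real" and w w' F :: "real \<Rightarrow> 'a \<Rightarrow> real" and N T :: real
  assumes k: "kernel k"
    and w_continuous: "continuous_on ({-9/10..T} \<times> UNIV) (\<lambda>p. w (fst p) (snd p))"
    and w_bound: "\<And>t x. t \<in> {-9/10..T} \<Longrightarrow> \<bar>w t x\<bar> \<le> N"
    and w_time: "\<And>t t' x. t \<in> {-9/10..T} \<Longrightarrow> t' \<in> {-9/10..T} \<Longrightarrow> \<bar>w t x - w t' x\<bar> \<le> N * \<bar>t - t'\<bar> powr (\<alpha> / (2 * s))"
    and w_deriv: "\<And>t x. ((\<lambda>t. w t x) has_real_derivative w' t x) (at t)"
    and w_integrable: "\<And>t x. integrable lborel (\<lambda>y. k y * sdiff (w t) x y)"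
    and w_equation: "\<And>t x. t \<in> {-9/10..T} \<Longrightarrow> x \<in> ball 0 (9/10) \<Longrightarrow> w' t x - (LINT y|lborel. k y * sdiff (w t) x y) = F t x"
    and F_bound: "\<And>t x. t \<in> {-9/10..T} \<Longrightarrow> x \<in> ball 0 (9/10) \<Longrightarrow> \<bar>F t x\<bar> \<le> N"
    and F_space: "\<And>t x x'. t \<in> {-9/10..T} \<Longrightarrow> x \<in> ball 0 (9/10) \<Longrightarrow> x' \<in> ball 0 (9/10) \<Longrightarrow>
      \<bar>F t x - F t x'\<bar> \<le> N * norm (x - x') powr \<alpha>"
    and F_time: "\<And>t t' x. t \<in> {-9/10..T} \<Longrightarrow> t' \<in> {-9/10..T} \<Longrightarrow> x \<in> ball 0 (9/10) \<Longrightarrow>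
      \<bar>F t x - F t' x\<bar> \<le> N * \<bar>t - t'\<bar> powr (\<alpha> / (2 * s))"
    and w_smooth: "\<And>m. \<exists>B\<ge>0. \<forall>t x hs. length hs = m \<longrightarrow> (\<forall>h\<in>set hs. norm h \<le> 1) \<longrightarrow>
      \<bar>fdiff hs (w t) x\<bar> \<le> B * prod_list (map norm hs)"

lemma prod_list_norm_le:
  fixes hs :: "'a::real_normed_vector list"
  assumes "\<And>h. h \<in> set hs \<Longrightarrow> norm h \<le> r" "0 \<le> r"
  shows "0 \<le> prod_list (map norm hs) \<and> prod_list (map norm hs) \<le> r ^ length hs"
  using assms(1)
proof (induction hs)
  case (Cons h hs)
  then show ?case using assms(2) by (auto intro!: mult_mono)
qed simp

context stable_parameters
begin

lemma classical_spatial: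
  fixes m :: nat and \<gamma> :: real
  assumes m: "1 \<le> m" and \<gamma>: "0 < \<gamma>" "\<gamma> < m" "\<gamma> \<le> 2 * s + \<alpha>"
  obtains C where "0 < C"
    "\<And>(k::'a::euclidean_space \<Rightarrow> real) w w' F N T t x hs r.
      \<lbrakk>classical_solution s \<alpha> M c \<kappa> k w w' F N T; t \<in> {-3/5..T}; norm x < 7/10;
       length hs = m; \<And>h. h \<in> set hs \<Longrightarrow> norm h \<le> r; 0 < r\<rbrakk>
      \<Longrightarrow> \<bar>fdiff hs (w t) x\<bar> \<le> C * N * r powr \<gamma>"
proof -
  show thesis
  proof (rule spatial_estimate[where 'a='a, OF m \<gamma>], goal_cases)
    case C: (1 C)
    \<comment> \<open>A lower bound for the parabolic distance on |x| < 7/10, t >= -3/5 in the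
      cylinder of radius 9/10 that starts at -9/10: the margins are 1/5 in space and 3/10 in
      time.\<close>
    define d :: real where "d = min (1/5) ((3/10) powr (1 / (2 * s)))"
    have d: "0 < d" by (simp add: d_def)
    show thesis
    proof (rule that[of "C * d powr - \<gamma>"], goal_cases)
      case 1
      then show ?case using C(1) d by simp
    next
      case prems: (2 k w w' F N T t x hs r)
      interpret classical_solution s \<alpha> M c \<kappa> k w w' F N T by (rule prems(1))
      obtain B where B: "0 \<le> B" "\<And>t x hs. length hs = m \<Longrightarrow> (\<And>h. h\<in>set hs \<Longrightarrow> norm h \<le> 1) \<Longrightarrow>
          \<bar>fdiff hs (w t) x\<bar> \<le> B * prod_list (map norm hs)"
        using w_smooth[of m] by blast
      have N: "0 \<le> N" using w_bound[of t x] prems(2) by fastforce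
      let ?d = "min (9/10 - norm x) ((t - (-9/10)) powr (1 / (2 * s)))"
      have "\<bar>fdiff hs (w t) x\<bar> \<le> C * N * (r / ?d) powr \<gamma>"
      proof (rule C(2)[of k "9/10" "-9/10" T w N w' F B])
        show "\<bar>fdiff hs (w t) x\<bar> \<le> B * r powr \<gamma>"
          if "length hs = m" "\<And>h. h \<in> set hs \<Longrightarrow> norm h \<le> r" "0 < r" "r \<le> 1" for t x hs r
        proof -
          have "\<bar>fdiff hs (w t) x\<bar> \<le> B * prod_list (map norm hs)"
            using that by (intro B(2)) (auto intro: order_trans)
          also have "\<dots> \<le> B * r ^ m"
            using prod_list_norm_le[of hs r] that B(1) by (intro mult_left_mono) auto
          also have "r ^ m \<le> r powr \<gamma>"
            using that \<gamma> powr_mono'[of \<gamma> "real m" r] by (simp add: powr_realpow)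
          finally show ?thesis using B(1) by (simp add: mult_left_mono)
        qed
      qed (use k w_continuous w_bound w_deriv w_integrable w_equation F_space prems in auto)
      also have "\<dots> \<le> C * N * (r / d) powr \<gamma>"
      proof (rule mult_left_mono)
        have "(3/10) powr (1 / (2 * s)) \<le> (t - (-9/10)) powr (1 / (2 * s))"
          using prems s by (intro powr_mono2) auto
        then have "d \<le> ?d" using prems(3) by (auto simp: d_def min_def)
        then have "r / ?d \<le> r / d" using d prems by (intro divide_left_mono mult_pos_pos) auto
        moreover have "0 \<le> r / ?d" using \<open>d \<le> ?d\<close> d prems by (intro divide_nonneg_nonneg) auto
        ultimately show "(r / ?d) powr \<gamma> \<le> (r / d) powr \<gamma>" using \<gamma> by (intro powr_mono2) auto
      qed (use C(1) N in simp)
      also have "\<dots> = C * d powr - \<gamma> * N * r powr \<gamma>"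
        unfolding powr_divide powr_minus by (simp add: divide_inverse)
      finally show ?case .
    qed
  qed
qed

text \<open>The spatial estimate is used at five pairs of order and exponent: orders 1, 2 and 3 with
  \<open>\<gamma>'\<close> for the Hoelder norm in space, and orders 2 and 1 with the exponents q
  and p that the estimate of the time derivative asks for. C0 dominates the five constants.\<close>

lemma classical_estimates:
  fixes \<gamma> :: real and \<gamma>' :: "nat \<Rightarrow> real"
  defines "\<gamma> \<equiv> 2 * s + \<alpha>"
  defines "\<gamma>' \<equiv> \<lambda>m::nat. if \<gamma> < m then \<gamma> else real m - 1 / 2"
  obtains C where "0 < C"
    "\<And>(k::'a::euclidean_space \<Rightarrow> real) w w' F N T t x hs r.
      \<lbrakk>classical_solution s \<alpha> M c \<kappa> k w w' F N T; t \<in> {-3/5..T}; norm x < 7/10;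
       1 \<le> length hs; length hs \<le> 3; \<And>h. h \<in> set hs \<Longrightarrow> norm h \<le> r; 0 < r\<rbrakk>
      \<Longrightarrow> \<bar>fdiff hs (w t) x\<bar> \<le> C * N * r powr \<gamma>' (length hs)"
    "\<And>(k::'a::euclidean_space \<Rightarrow> real) w w' F N T t t' x.
      \<lbrakk>classical_solution s \<alpha> M c \<kappa> k w w' F N T; t \<in> {-3/5..T}; t' \<in> {-3/5..T}; x \<in> ball 0 (3/5)\<rbrakk>
      \<Longrightarrow> \<bar>w' t x\<bar> \<le> C * N \<and> \<bar>w' t x - w' t' x\<bar> \<le> C * N * \<bar>t - t'\<bar> powr (\<alpha> / (2 * s))"
proof -
  define q where "q = min \<gamma> (s + 1)"
  define p where "p = min \<gamma> ((1 + \<alpha>) / 2)"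
  have \<gamma>: "0 < \<gamma>" "\<gamma> < 3" "0 < q" "q < 2" "q \<le> \<gamma>" "0 < p" "p < 1" "p \<le> \<gamma>"
    using s \<alpha> by (auto simp: \<gamma>_def q_def p_def min_less_iff_disj)
  have \<gamma>': "0 < \<gamma>' m" "\<gamma>' m < m" "\<gamma>' m \<le> \<gamma>" if "1 \<le> m" for m
    using that \<gamma> by (auto simp: \<gamma>'_def)
  let ?P = "\<lambda>C \<gamma> m. 0 < C \<and> (\<forall>(k::'a \<Rightarrow> real) w w' F N T t x hs r.
      classical_solution s \<alpha> M c \<kappa> k w w' F N T \<longrightarrow> t \<in> {-3/5..T} \<longrightarrow> norm x < 7/10 \<longrightarrow>
       length hs = m \<longrightarrow> (\<forall>h\<in>set hs. norm h \<le> r) \<longrightarrow> 0 < r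
      \<longrightarrow> \<bar>fdiff hs (w t) x\<bar> \<le> C * N * r powr \<gamma>)"
  have sp: "\<exists>C. ?P C e m" if "1 \<le> m" "0 < e" "e < m" "e \<le> \<gamma>" for e :: real and m :: nat
    by (rule classical_spatial[where 'a='a, OF that(1-3) that(4)[unfolded \<gamma>_def]]) blast
  obtain C1 where C1: "?P C1 (\<gamma>' 1) 1" using sp[OF _ \<gamma>'[of 1]] by auto
  obtain C2 where C2: "?P C2 (\<gamma>' 2) 2" using sp[OF _ \<gamma>'[of 2]] by auto
  obtain C3 where C3: "?P C3 \<gamma> 3" using sp[of 3 \<gamma>] \<gamma> by auto
  obtain Cq where Cq: "?P Cq q 2" using sp[of 2 q] \<gamma> by auto
  obtain Cp where Cp: "?P Cp p 1" using sp[of 1 p] \<gamma> by auto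
  define C0 where "C0 = C1 + C2 + C3 + Cq + Cp + 1"
  have C0: "1 \<le> C0" "C1 \<le> C0" "C2 \<le> C0" "C3 \<le> C0" "Cq \<le> C0" "Cp \<le> C0"
    using C1 C2 C3 Cq Cp by (auto simp: C0_def)
  have N0: "0 \<le> N" if "classical_solution s \<alpha> M c \<kappa> k w w' F N T" "t \<in> {-3/5..T}" for k :: "'a \<Rightarrow> real" and w w' F N T t
    using classical_solution.w_bound[OF that(1), of t 0] that(2) by fastforce
  have up: "\<bar>fdiff hs (w t) x\<bar> \<le> C0 * N * r powr e"
    if P: "?P C e m" and C: "C \<le> C0" and cs: "classical_solution s \<alpha> M c \<kappa> k w w' F N T" and t: "t \<in> {-3/5..T}" and x: "norm x < 7/10"
      and hs: "length hs = m" "\<And>h. h \<in> set hs \<Longrightarrow> norm h \<le> r" and r: "0 < r"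
    for C e :: real and m and k :: "'a \<Rightarrow> real" and w w' F N T t x hs r
  proof -
    have "\<bar>fdiff hs (w t) x\<bar> \<le> C * N * r powr e" using P cs t x hs r by blast
    also have "\<dots> \<le> C0 * N * r powr e" using C N0[OF cs t] by (intro mult_right_mono) auto
    finally show ?thesis .
  qed
  note temporal = temporal_estimate[where 'a='a, folded \<gamma>_def, folded q_def p_def]
  have "\<exists>Ct>0. \<forall>(k::'a \<Rightarrow> real) w w' F N T t t' x.
      classical_solution s \<alpha> M c \<kappa> k w w' F N T \<longrightarrow> t \<in> {-3/5..T} \<longrightarrow> t' \<in> {-3/5..T} \<longrightarrow> x \<in> ball 0 (3/5)
      \<longrightarrow> \<bar>w' t x\<bar> \<le> Ct * (C0 * N) \<and> \<bar>w' t x - w' t' x\<bar> \<le> Ct * (C0 * N) * \<bar>t - t'\<bar> powr (\<alpha> / (2 * s))"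
  proof (rule temporal, goal_cases)
    case C: (1 C)
    show ?case
    proof (intro exI[of _ C] conjI allI impI C(1))
      fix k :: "'a \<Rightarrow> real" and w w' F N T t t' x
      assume cs: "classical_solution s \<alpha> M c \<kappa> k w w' F N T" and t: "t \<in> {-3/5..T}" "t' \<in> {-3/5..T}" and x: "x \<in> ball (0::'a) (3/5)"
      interpret classical_solution s \<alpha> M c \<kappa> k w w' F N T by (rule cs)
      have N: "0 \<le> N" by (rule N0[OF cs t(1)])
      have NN: "N \<le> C0 * N" using C0 N by (simp add: mult_left_le_one_le mult_le_cancel_right1)
      have NN': "N * e \<le> C0 * N * e" if "0 \<le> e" for e using NN that by (rule mult_right_mono)
      have "\<bar>w' t x\<bar> \<le> C * (C0 * N) \<and> \<bar>w' t x - w' t' x\<bar> \<le> C * (C0 * N) * \<bar>t - t'\<bar> powr (\<alpha> / (2 * s))"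
      proof (rule C(2)[of k "-3/5" T w "C0 * N" w' F])
        show "kernel k" by (rule k)
        fix \<tau> assume \<tau>: "\<tau> \<in> {-3/5..T}"
        then have \<tau>': "\<tau> \<in> {-9/10..T}" by auto
        have "continuous_on UNIV (w \<tau>)"
        proof -
          have "continuous_on UNIV (\<lambda>x::'a. (\<tau>, x))" by (intro continuous_intros)
          from continuous_on_compose2[OF w_continuous this] \<tau>' show ?thesis by (simp add: image_subset_iff)
        qed
        then show "w \<tau> \<in> borel_measurable borel" by (rule borel_measurable_continuous_onI)
        show "integrable lborel (\<lambda>y. k y * sdiff (w \<tau>) x y)" for x by (rule w_integrable)
        fix y :: 'a
        show "\<bar>w \<tau> y\<bar> \<le> C0 * N" using w_bound[OF \<tau>', of y] NN by linarith
        show "\<bar>w \<tau> y - w \<tau>' y\<bar> \<le> C0 * N * \<bar>\<tau> - \<tau>'\<bar> powr (\<alpha> / (2 * s))" if "\<tau>' \<in> {-3/5..T}" for \<tau>'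
          using order_trans[OF w_time[OF \<tau>', of \<tau>' y] NN'] that by auto
        assume y: "y \<in> ball 0 (7/10)"
        then have y': "y \<in> ball 0 (9/10)" "norm y < 7/10" by auto
        show "((\<lambda>t. w t y) has_real_derivative w' \<tau> y) (at \<tau>)" by (rule w_deriv)
        show "w' \<tau> y - (LINT z|lborel. k z * sdiff (w \<tau>) y z) = F \<tau> y" by (rule w_equation[OF \<tau>' y'(1)])
        show "\<bar>F \<tau> y\<bar> \<le> C0 * N" using F_bound[OF \<tau>' y'(1)] NN by linarith
        show "\<bar>F \<tau> y - F \<tau> y'\<bar> \<le> C0 * N * norm (y - y') powr \<alpha>" if "y' \<in> ball 0 (7/10)" for y'
          using order_trans[OF F_space[OF \<tau>' y'(1), of y'] NN'] that by auto
        show "\<bar>F \<tau> y - F \<tau>' y\<bar> \<le> C0 * N * \<bar>\<tau> - \<tau>'\<bar> powr (\<alpha> / (2 * s))" if "\<tau>' \<in> {-3/5..T}" for \<tau>'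
          using order_trans[OF F_time[OF \<tau>' _ y'(1), of \<tau>'] NN'] that by auto
        show "\<bar>fdiff [a, b, c] (w \<tau>) y\<bar> \<le> C0 * N * r powr \<gamma>"
          if "norm a \<le> r" "norm b \<le> r" "norm c \<le> r" "0 < r" for a b c r
          by (rule up[OF C3 C0(4) cs \<tau> y'(2)]) (use that in auto)
        show "\<bar>fdiff [a, b] (w \<tau>) y\<bar> \<le> C0 * N * r powr q" if "norm a \<le> r" "norm b \<le> r" "0 < r" for a b r
          by (rule up[OF Cq C0(5) cs \<tau> y'(2)]) (use that in auto)
        show "\<bar>fdiff [a] (w \<tau>) y\<bar> \<le> C0 * N * r powr p" if "norm a \<le> r" "0 < r" for a r
          by (rule up[OF Cp C0(6) cs \<tau> y'(2)]) (use that in auto)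
      qed (use t x in auto)
      then show "\<bar>w' t x\<bar> \<le> C * (C0 * N)" "\<bar>w' t x - w' t' x\<bar> \<le> C * (C0 * N) * \<bar>t - t'\<bar> powr (\<alpha> / (2 * s))" by auto
    qed
  qed
  then obtain Ct where Ct: "0 < Ct" "\<And>(k::'a \<Rightarrow> real) w w' F N T t t' x.
      classical_solution s \<alpha> M c \<kappa> k w w' F N T \<Longrightarrow> t \<in> {-3/5..T} \<Longrightarrow> t' \<in> {-3/5..T} \<Longrightarrow> x \<in> ball 0 (3/5)
      \<Longrightarrow> \<bar>w' t x\<bar> \<le> Ct * (C0 * N) \<and> \<bar>w' t x - w' t' x\<bar> \<le> Ct * (C0 * N) * \<bar>t - t'\<bar> powr (\<alpha> / (2 * s))"
    by blast
  show thesis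
  proof (rule that[of "C0 + Ct * C0"], goal_cases)
    case 1
    then show ?case using C0 Ct(1) by (simp add: add_pos_pos)
  next
    case prems: (2 k w w' F N T t x hs r)
    have N: "0 \<le> N" by (rule N0[OF prems(1,2)])
    have g3: "\<gamma>' 3 = \<gamma>" using \<gamma> by (simp add: \<gamma>'_def)
    have "\<bar>fdiff hs (w t) x\<bar> \<le> C0 * N * r powr \<gamma>' (length hs)"
    proof -
      consider "length hs = 1" | "length hs = 2" | "length hs = 3" using prems(4,5) by linarith
      then show ?thesis
      proof cases
        case 1
        show ?thesis unfolding 1 by (rule up[OF C1 C0(2) prems(1,2,3) 1 prems(6,7)])
      next
        case 2
        show ?thesis unfolding 2 by (rule up[OF C2 C0(3) prems(1,2,3) 2 prems(6,7)])
      next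
        case 3
        show ?thesis unfolding 3 g3 by (rule up[OF C3 C0(4) prems(1,2,3) 3 prems(6,7)])
      qed
    qed
    also have "\<dots> \<le> (C0 + Ct * C0) * N * r powr \<gamma>' (length hs)"
      using N Ct(1) C0(1) by (intro mult_right_mono) auto
    finally show ?case .
  next
    case prems: (3 k w w' F N T t t' x)
    have N: "0 \<le> N" by (rule N0[OF prems(1,2)])
    have le: "Ct * (C0 * N) \<le> (C0 + Ct * C0) * N" using N C0(1) by (simp add: distrib_right)
    have "Ct * (C0 * N) * \<bar>t - t'\<bar> powr (\<alpha> / (2 * s)) \<le> (C0 + Ct * C0) * N * \<bar>t - t'\<bar> powr (\<alpha> / (2 * s))"
      using le by (rule mult_right_mono) simp
    with Ct(2)[OF prems] le show ?case by linarith
  qed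
qed

end

section \<open>Mollified weak solutions are classical solutions\<close>

lemma AE_lborel_reflect:
  fixes z :: "'a::euclidean_space"
  assumes "AE p in lborel. P p"
  shows "AE p in lborel. P (z - p)"
proof -
  obtain N where N0: "\<And>p. p \<in> space lborel - N \<Longrightarrow> P p" and N1: "N \<in> null_sets lborel"
    by (rule AE_E3[OF assms]) blast
  have N: "N \<in> null_sets lborel" "{p. \<not> P p} \<subseteq> N" using N0 N1 by auto
  have Nb: "N \<in> sets borel" using N by auto
  have "emeasure lborel ((\<lambda>p. z - p) -` N) = emeasure (distr lborel borel (\<lambda>p. z - p)) N"
    using Nb by (simp add: emeasure_distr)
  also have "\<dots> = 0" using N(1) by (simp add: lborel_distr_reflect null_sets_def)
  finally have "(\<lambda>p. z - p) -` N \<in> null_sets lborel"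
    using measurable_sets[of "\<lambda>p. z - p" borel borel N] Nb by (simp add: null_sets_def)
  moreover have "{p. \<not> P (z - p)} \<subseteq> (\<lambda>p. z - p) -` N" using N(2) by auto
  ultimately show ?thesis using AE_I'[of "(\<lambda>p. z - p) -` N" lborel "\<lambda>p. P (z - p)"] by simp
qed

context bounded_borel
begin

text \<open>A convolution averages translates, so a modulus of continuity passes to it with the same
  constant. Hence bounds on mollified data do not depend on the mollifier.\<close>

lemma conv_diff_le:
  assumes \<phi>: "supported \<phi> K" "\<And>z. 0 \<le> \<phi> z" "(LINT z|lborel. \<phi> z) = 1"
    and D: "AE p in lborel. p \<in> K \<longrightarrow> \<bar>u (z - p) - u (z' - p)\<bar> \<le> D"
  shows "\<bar>conv u \<phi> z - conv u \<phi> z'\<bar> \<le> D"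
proof -
  note \<phi>i = supported_integrable[OF \<phi>(1)]
  have \<phi>m: "\<phi> \<in> borel_measurable borel" using \<phi>(1) smooth_borel[of \<phi>] by (simp add: supported_def)
  have i: "integrable lborel (\<lambda>p. u (z - p) * \<phi> p)" for z
    using lborel_integrable_reflect[OF conv_integrand[OF \<phi>i, of z], of z] by simp
  have e: "conv u \<phi> z = (LINT p|lborel. u (z - p) * \<phi> p)" for z
    using lborel_integral_reflect[of "\<lambda>p. u p * \<phi> (z - p)" z] u_borel \<phi>m by (simp add: conv_def)
  have "conv u \<phi> z - conv u \<phi> z' = (LINT p|lborel. u (z - p) * \<phi> p - u (z' - p) * \<phi> p)"
    unfolding e by (rule Bochner_Integration.integral_diff[OF i i, symmetric])
  also have "norm \<dots> \<le> (LINT p|lborel. norm (u (z - p) * \<phi> p - u (z' - p) * \<phi> p))"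
    by (rule integral_norm_bound)
  also have "\<dots> \<le> (LINT p|lborel. D * \<phi> p)"
  proof (rule integral_mono_AE)
    show "integrable lborel (\<lambda>p. norm (u (z - p) * \<phi> p - u (z' - p) * \<phi> p))"
      using i i by (intro integrable_norm Bochner_Integration.integrable_diff)
    show "integrable lborel (\<lambda>p. D * \<phi> p)" using \<phi>i by simp
    show "AE p in lborel. norm (u (z - p) * \<phi> p - u (z' - p) * \<phi> p) \<le> D * \<phi> p"
      using D
    proof (rule eventually_mono)
      fix p assume p: "p \<in> K \<longrightarrow> \<bar>u (z - p) - u (z' - p)\<bar> \<le> D"
      show "norm (u (z - p) * \<phi> p - u (z' - p) * \<phi> p) \<le> D * \<phi> p"
      proof (cases "p \<in> K")
        case True
        then have "\<bar>u (z - p) - u (z' - p)\<bar> * \<phi> p \<le> D * \<phi> p" using p \<phi>(2) by (intro mult_right_mono) auto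
        then show ?thesis using \<phi>(2)[of p] by (simp add: abs_mult flip: left_diff_distrib)
      next
        case False
        then show ?thesis using \<phi>(1) by (simp add: supported_def)
      qed
    qed
  qed
  finally show ?thesis using \<phi>(3) by simp
qed

end

lemma fdiff_slice: "fdiff hs (\<lambda>x. w (t, x)) x = fdiff (map (\<lambda>h. (0, h)) hs) w (t, x)"
  for t :: "'b::real_vector" and x :: "'a::real_vector"
  by (induction hs arbitrary: x) (simp_all)

context stable_parameters
begin

text \<open>For t in [-9/10, -2 \<epsilon>] and |x| < 9/10 every z - p with p in the support of
  \<phi> lies in the original cylinder, since \<epsilon> < 1/20. v vanishes almost everywhere
  outside the time interval (-1, 0) and may jump at its ends, which dictates the final time.\<close>

lemma mollified_solution:
  fixes a :: "'a::euclidean_space \<Rightarrow> real"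
  assumes k: "kernel k" "\<And>y. k y = a (y /\<^sub>R norm y) / norm y powr (real DIM('a) + 2 * s)"
    and ws: "weak_solution s a u f {-1<..<0} (ball 0 1)"
    and u: "u \<in> borel_measurable (lebesgue_on ({-1<..<0} \<times> UNIV))"
    and v: "bounded_borel v N" "AE z in lebesgue. v z = indicator ({-1<..<0} \<times> UNIV) z * u z"
    and f: "f \<in> borel_measurable (lebesgue_on ({-1<..<0} \<times> ball 0 1))"
    and g: "bounded_borel g N" "AE z in lebesgue. g z = indicator ({-1<..<0} \<times> ball 0 1) z * f z"
    and u_time: "\<And>t t' x. t \<in> {-1<..<0} \<Longrightarrow> t' \<in> {-1<..<0} \<Longrightarrow> \<bar>u (t, x) - u (t', x)\<bar> \<le> N * \<bar>t - t'\<bar> powr (\<alpha> / (2 * s))"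
    and f_holder: "\<And>t t' x x'. t \<in> {-1<..<0} \<Longrightarrow> t' \<in> {-1<..<0} \<Longrightarrow> x \<in> ball 0 1 \<Longrightarrow> x' \<in> ball 0 1 \<Longrightarrow>
      \<bar>f (t, x) - f (t', x')\<bar> \<le> N * (\<bar>t - t'\<bar> powr (\<alpha> / (2 * s)) + norm (x - x') powr \<alpha>)"
    and \<phi>: "supported \<phi> ({-\<epsilon>..\<epsilon>} \<times> cball 0 \<epsilon>)" "\<And>z. 0 \<le> \<phi> z" "(LINT z|lborel. \<phi> z) = 1"
    and \<phi>': "\<And>z. (\<phi> has_derivative \<phi>' z) (at z)" "\<And>e. supported (\<lambda>z. \<phi>' z e) ({-\<epsilon>..\<epsilon>} \<times> cball 0 \<epsilon>)"
    and \<epsilon>: "0 < \<epsilon>" "\<epsilon> < 1 / 20"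
  shows "classical_solution s \<alpha> M c \<kappa> k (\<lambda>t x. conv v \<phi> (t, x)) (\<lambda>t x. conv v (\<lambda>z. \<phi>' z (1, 0)) (t, x))
    (\<lambda>t x. conv g \<phi> (t, x)) N (- 2 * \<epsilon>)"
proof -
  interpret V: bounded_borel v N by fact
  interpret G: bounded_borel g N by fact
  let ?K = "{-\<epsilon>..\<epsilon>} \<times> cball (0::'a) \<epsilon>"
  let ?I = "{-1<..<0::real}" and ?D = "ball (0::'a) 1"
  have vAE: "AE z in lborel. v z = indicator (?I \<times> UNIV) z * u z"
    using v(2) by (simp add: AE_completion_iff)
  have gAE: "AE z in lborel. g z = indicator (?I \<times> ?D) z * f z"
    using g(2) by (simp add: AE_completion_iff)
  have tI: "t - fst p \<in> ?I" if "t \<in> {-9/10..-2*\<epsilon>}" "p \<in> ?K" for t p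
    using that \<epsilon> by (cases p) auto
  have xD: "x - snd p \<in> ?D" if "x \<in> ball 0 (9/10)" "p \<in> ?K" for x p
    using that \<epsilon> norm_triangle_ineq4[of x "snd p"] by (cases p) auto
  have v_time: "\<bar>conv v \<phi> (t, x) - conv v \<phi> (t', x)\<bar> \<le> N * \<bar>t - t'\<bar> powr (\<alpha> / (2 * s))"
    if "t \<in> {-9/10..-2*\<epsilon>}" "t' \<in> {-9/10..-2*\<epsilon>}" for t t' x
  proof (rule V.conv_diff_le[OF \<phi>])
    show "AE p in lborel. p \<in> ?K \<longrightarrow> \<bar>v ((t, x) - p) - v ((t', x) - p)\<bar> \<le> N * \<bar>t - t'\<bar> powr (\<alpha> / (2 * s))"
      using AE_lborel_reflect[OF vAE, of "(t, x)"] AE_lborel_reflect[OF vAE, of "(t', x)"]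
    proof (eventually_elim, intro impI)
      fix p assume p: "p \<in> ?K" "v ((t, x) - p) = indicator (?I \<times> UNIV) ((t, x) - p) * u ((t, x) - p)"
        "v ((t', x) - p) = indicator (?I \<times> UNIV) ((t', x) - p) * u ((t', x) - p)"
      then show "\<bar>v ((t, x) - p) - v ((t', x) - p)\<bar> \<le> N * \<bar>t - t'\<bar> powr (\<alpha> / (2 * s))"
        using u_time[OF tI[OF that(1) p(1)] tI[OF that(2) p(1)], of "x - snd p"] tI[OF that(1) p(1)] tI[OF that(2) p(1)]
        by (cases p) simp
    qed
  qed
  have g_holder: "\<bar>conv g \<phi> (t, x) - conv g \<phi> (t', x')\<bar> \<le> N * (\<bar>t - t'\<bar> powr (\<alpha> / (2 * s)) + norm (x - x') powr \<alpha>)"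
    if "t \<in> {-9/10..-2*\<epsilon>}" "t' \<in> {-9/10..-2*\<epsilon>}" "x \<in> ball 0 (9/10)" "x' \<in> ball 0 (9/10)" for t t' x x'
  proof (rule G.conv_diff_le[OF \<phi>])
    show "AE p in lborel. p \<in> ?K \<longrightarrow> \<bar>g ((t, x) - p) - g ((t', x') - p)\<bar> \<le> N * (\<bar>t - t'\<bar> powr (\<alpha> / (2 * s)) + norm (x - x') powr \<alpha>)"
      using AE_lborel_reflect[OF gAE, of "(t, x)"] AE_lborel_reflect[OF gAE, of "(t', x')"]
    proof (eventually_elim, intro impI)
      fix p assume p: "p \<in> ?K" "g ((t, x) - p) = indicator (?I \<times> ?D) ((t, x) - p) * f ((t, x) - p)"
        "g ((t', x') - p) = indicator (?I \<times> ?D) ((t', x') - p) * f ((t', x') - p)"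
      note m = tI[OF that(1) p(1)] tI[OF that(2) p(1)] xD[OF that(3) p(1)] xD[OF that(4) p(1)]
      show "\<bar>g ((t, x) - p) - g ((t', x') - p)\<bar> \<le> N * (\<bar>t - t'\<bar> powr (\<alpha> / (2 * s)) + norm (x - x') powr \<alpha>)"
        using f_holder[OF m] m p by (cases p) simp
    qed
  qed
  have \<phi>1: "supported (\<lambda>z. \<phi>' z (1, 0)) ?K" by (rule \<phi>'(2))
  show ?thesis
  proof (unfold_locales, goal_cases)
    case 1
    show ?case by (rule k(1))
  next
    case 2
    have "continuous_on ({-9/10..-2*\<epsilon>} \<times> UNIV) (conv v \<phi>)"
      by (rule continuous_on_subset[OF V.conv_continuous[OF \<phi>(1)]]) simp
    then show ?case by simp
  next
    case (3 t x)
    show ?case by (rule V.conv_bounded[OF \<phi>])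
  next
    case (4 t t' x)
    show ?case by (rule v_time[OF 4])
  next
    case (5 t x)
    have "((\<lambda>\<tau>. conv v \<phi> ((0, x) + \<tau> *\<^sub>R (1, 0))) has_real_derivative conv v (\<lambda>z. \<phi>' z (1, 0)) ((0, x) + t *\<^sub>R (1, 0))) (at t)"
      by (rule V.conv_has_derivative[OF \<phi>(1) \<phi>']) (simp add: norm_Pair)
    then show ?case by simp
  next
    case (6 t x)
    show ?case by (rule conv_nonlocal(1)[OF k(1) v(1) \<phi>(1)])
  next
    case (7 t x)
    have K: "(-) (t, x) ` ?K \<subseteq> ?I \<times> ?D"
    proof
      fix z assume "z \<in> (-) (t, x) ` ?K"
      then obtain p where p: "p \<in> ?K" "z = (t, x) - p" by blast
      show "z \<in> ?I \<times> ?D" using tI[OF 7(1) p(1)] xD[OF 7(2) p(1)] p(2) by (cases p) simp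
    qed
    show ?case
      by (rule conv_equation[OF k ws _ _ u v f g \<phi>(1) \<phi>'(1) \<phi>1 K]) auto
  next
    case (8 t x)
    show ?case by (rule G.conv_bounded[OF \<phi>])
  next
    case (9 t x x')
    show ?case using g_holder[OF 9(1) 9(1) 9(2,3)] by simp
  next
    case (10 t t' x)
    show ?case using g_holder[OF 10(1,2,3,3)] \<alpha> by simp
  next
    case (11 m)
    obtain B where B: "0 \<le> B" "\<And>hs z. length hs = m \<Longrightarrow> (\<And>h. h \<in> set hs \<Longrightarrow> norm h \<le> 1) \<Longrightarrow> \<bar>fdiff hs (conv v \<phi>) z\<bar> \<le> B * prod_list (map norm hs)"
      using V.conv_fdiff_bound[OF \<phi>(1)] by blast
    have e: "map norm (map (\<lambda>h. (0::real, h)) hs) = map norm hs" for hs :: "'a list"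
      by (simp add: norm_Pair)
    show ?case
    proof (intro exI[of _ B] conjI B(1) allI impI)
      fix t x and hs :: "'a list" assume hs: "length hs = m" "\<forall>h\<in>set hs. norm h \<le> 1"
      show "\<bar>fdiff hs (\<lambda>x. conv v \<phi> (t, x)) x\<bar> \<le> B * prod_list (map norm hs)"
      proof -
        have n: "norm (0::real, y) = norm y" for y :: 'a by (simp add: norm_Pair)
        have "norm h \<le> 1" if "h \<in> set (map (\<lambda>h. (0::real, h)) hs)" for h
          using that hs(2) n by (auto simp only: set_map)
        then show ?thesis using B(2)[of "map (\<lambda>h. (0, h)) hs" "(t, x)"] hs(1) unfolding fdiff_slice e by simp
      qed
    qed
  qed
qed

end

subsection \<open>Passage to the limit\<close>

lemma convergent_by_approximation:
  fixes x :: "nat \<Rightarrow> real"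
  assumes "\<And>e. 0 < e \<Longrightarrow> \<exists>y. convergent y \<and> (\<forall>\<^sub>F n in sequentially. \<bar>x n - y n\<bar> \<le> e)"
  shows "convergent x"
proof (rule Cauchy_convergent, rule CauchyI)
  fix e :: real assume "0 < e"
  then obtain y where y: "convergent y" "\<forall>\<^sub>F n in sequentially. \<bar>x n - y n\<bar> \<le> e / 4"
    using assms[of "e / 4"] by auto
  obtain M1 where M1: "\<And>m n. M1 \<le> m \<Longrightarrow> M1 \<le> n \<Longrightarrow> norm (y m - y n) < e / 4"
    using convergent_Cauchy[OF y(1)] \<open>0 < e\<close> CauchyD[of y "e / 4"] by auto
  obtain M2 where M2: "\<And>n. M2 \<le> n \<Longrightarrow> \<bar>x n - y n\<bar> \<le> e / 4"
    using y(2) by (auto simp: eventually_sequentially)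
  show "\<exists>M. \<forall>m\<ge>M. \<forall>n\<ge>M. norm (x m - x n) < e"
  proof (intro exI[of _ "max M1 M2"] allI impI)
    fix m n assume "max M1 M2 \<le> m" "max M1 M2 \<le> n"
    then have "\<bar>y m - y n\<bar> < e / 4" "\<bar>x m - y m\<bar> \<le> e / 4" "\<bar>x n - y n\<bar> \<le> e / 4"
      using M1[of m n] M2[of m] M2[of n] by auto
    then show "norm (x m - x n) < e" using \<open>0 < e\<close> unfolding real_norm_def by linarith
  qed
qed

lemma fdiff_tendsto:
  assumes "\<And>y. norm (y - x) \<le> sum_list (map norm hs) \<Longrightarrow> (\<lambda>n. w n y) \<longlonglongrightarrow> v y"
  shows "(\<lambda>n. fdiff hs (w n) x) \<longlonglongrightarrow> fdiff hs v x"
  using assms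
proof (induction hs arbitrary: x)
  case (Cons h hs)
  have "(\<lambda>n. fdiff hs (w n) (x + h)) \<longlonglongrightarrow> fdiff hs v (x + h)"
  proof (rule Cons.IH)
    fix y assume "norm (y - (x + h)) \<le> sum_list (map norm hs)"
    then have "norm (y - x) \<le> sum_list (map norm (h # hs))"
      using norm_triangle_ineq[of "y - (x + h)" h] by (simp add: algebra_simps)
    then show "(\<lambda>n. w n y) \<longlonglongrightarrow> v y" by (rule Cons.prems)
  qed
  moreover have "(\<lambda>n. fdiff hs (w n) x) \<longlonglongrightarrow> fdiff hs v x"
  proof (rule Cons.IH)
    fix y assume "norm (y - x) \<le> sum_list (map norm hs)"
    then have "norm (y - x) \<le> sum_list (map norm (h # hs))" by (simp add: add_increasing)
    then show "(\<lambda>n. w n y) \<longlonglongrightarrow> v y" by (rule Cons.prems)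
  qed
  ultimately show ?case by (auto intro: tendsto_diff)
qed simp

text \<open>Convergence of the derivatives is a conclusion: they are compared with difference
  quotients of \<open>W n\<close>, which converge, up to the common Hoelder error. The bounds are
  asked for eventually in n at given times, because mollified solutions live on intervals depending
  on n.\<close>

lemma limit_of_derivatives:
  fixes W W' :: "nat \<Rightarrow> real \<Rightarrow> real" and V :: "real \<Rightarrow> real"
  assumes \<beta>: "0 < \<beta>"
    and der: "\<And>n t. (W n has_real_derivative W' n t) (at t)"
    and bnd: "\<And>t. t \<in> {a<..<b} \<Longrightarrow> \<forall>\<^sub>F n in sequentially. \<bar>W' n t\<bar> \<le> A"
    and hold: "\<And>t t'. t \<in> {a<..<b} \<Longrightarrow> t' \<in> {a<..<b} \<Longrightarrow>
      \<forall>\<^sub>F n in sequentially. \<forall>\<tau>\<in>{min t t'..max t t'}. \<bar>W' n \<tau> - W' n t\<bar> \<le> A * \<bar>\<tau> - t\<bar> powr \<beta>"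
    and lim: "\<And>t. t \<in> {a<..<b} \<Longrightarrow> (\<lambda>n. W n t) \<longlonglongrightarrow> V t"
    and A: "0 \<le> A"
  obtains V' where "\<And>t. t \<in> {a<..<b} \<Longrightarrow> (V has_real_derivative V' t) (at t)"
    "\<And>t. t \<in> {a<..<b} \<Longrightarrow> \<bar>V' t\<bar> \<le> A"
    "\<And>t t'. t \<in> {a<..<b} \<Longrightarrow> t' \<in> {a<..<b} \<Longrightarrow> \<bar>V' t - V' t'\<bar> \<le> A * \<bar>t - t'\<bar> powr \<beta>"
proof -
  \<comment> \<open>The quotient is \<open>W' n\<close> at an intermediate time, whose distance to t
    is less than |t' - t|.\<close>
  have quot: "\<forall>\<^sub>F n in sequentially. \<bar>W' n t - (W n t' - W n t) / (t' - t)\<bar> \<le> A * \<bar>t' - t\<bar> powr \<beta>"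
    if t: "t \<in> {a<..<b}" "t' \<in> {a<..<b}" "t \<noteq> t'" for t t'
    using hold[OF t(1,2)]
  proof (rule eventually_mono)
    fix n assume h: "\<forall>\<tau>\<in>{min t t'..max t t'}. \<bar>W' n \<tau> - W' n t\<bar> \<le> A * \<bar>\<tau> - t\<bar> powr \<beta>"
    have "\<exists>z. min t t' < z \<and> z < max t t' \<and> W n (max t t') - W n (min t t') = (max t t' - min t t') * W' n z"
      using t(3) der by (intro MVT2) auto
    then obtain z where z: "min t t' < z" "z < max t t'" "W n (max t t') - W n (min t t') = (max t t' - min t t') * W' n z"
      by blast
    have "(W n t' - W n t) / (t' - t) = W' n z"
      using z t(3) by (cases "t < t'") (auto simp: field_simps min_def max_def)
    moreover have "\<bar>W' n z - W' n t\<bar> \<le> A * \<bar>z - t\<bar> powr \<beta>" using h z by auto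
    moreover have "A * \<bar>z - t\<bar> powr \<beta> \<le> A * \<bar>t' - t\<bar> powr \<beta>"
      using z A \<beta> by (intro mult_left_mono powr_mono2) auto
    ultimately show "\<bar>W' n t - (W n t' - W n t) / (t' - t)\<bar> \<le> A * \<bar>t' - t\<bar> powr \<beta>" by (simp add: abs_minus_commute)
  qed
  have small: "\<forall>\<^sub>F t' in at t. A * \<bar>t' - t\<bar> powr \<beta> < e" if "0 < e" for t e
  proof -
    have "((\<lambda>t'. A * \<bar>t' - t\<bar> powr \<beta>) \<longlongrightarrow> A * \<bar>t - t\<bar> powr \<beta>) (at t)"
      using \<beta> by (intro tendsto_intros tendsto_powr') auto
    then show ?thesis using that \<beta> by (intro order_tendstoD(2)) auto
  qed
  have inside: "\<forall>\<^sub>F t' in at t. t' \<in> {a<..<b} \<and> t' \<noteq> t" if "t \<in> {a<..<b}" for t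
    using eventually_at_in_open[of "{a<..<b}" t] that by (auto elim: eventually_mono)
  have qlim: "(\<lambda>n. (W n t' - W n t) / (t' - t)) \<longlonglongrightarrow> (V t' - V t) / (t' - t)"
    if "t \<in> {a<..<b}" "t' \<in> {a<..<b}" "t \<noteq> t'" for t t'
    using lim that by (intro tendsto_intros) auto
  have conv': "convergent (\<lambda>n. W' n t)" if t: "t \<in> {a<..<b}" for t
  proof (rule convergent_by_approximation)
    fix e :: real assume "0 < e"
    then obtain t' where t': "A * \<bar>t' - t\<bar> powr \<beta> < e" "t' \<in> {a<..<b}" "t \<noteq> t'"
      using eventually_happens'[OF _ eventually_conj[OF small inside[OF t]]] by auto
    show "\<exists>y. convergent y \<and> (\<forall>\<^sub>F n in sequentially. \<bar>W' n t - y n\<bar> \<le> e)"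
    proof (intro exI conjI)
      show "convergent (\<lambda>n. (W n t' - W n t) / (t' - t))" using qlim[OF t t'(2,3)] by (rule convergentI)
      show "\<forall>\<^sub>F n in sequentially. \<bar>W' n t - (W n t' - W n t) / (t' - t)\<bar> \<le> e"
        using quot[OF t t'(2,3)] t'(1) by (auto elim: eventually_mono)
    qed
  qed
  define V' where "V' t = lim (\<lambda>n. W' n t)" for t
  have V': "(\<lambda>n. W' n t) \<longlonglongrightarrow> V' t" if "t \<in> {a<..<b}" for t
    using conv'[OF that] by (simp add: V'_def convergent_LIMSEQ_iff)
  show thesis
  proof (rule that[of V'])
    fix t assume t: "t \<in> {a<..<b}"
    show "\<bar>V' t\<bar> \<le> A"
      using tendsto_rabs[OF V'[OF t]] bnd[OF t] by (intro tendsto_upperbound) auto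
    show "\<bar>V' t - V' t'\<bar> \<le> A * \<bar>t - t'\<bar> powr \<beta>" if t': "t' \<in> {a<..<b}" for t'
    proof (rule tendsto_upperbound)
      show "(\<lambda>n. \<bar>W' n t - W' n t'\<bar>) \<longlonglongrightarrow> \<bar>V' t - V' t'\<bar>" by (intro tendsto_intros V' t t')
      show "\<forall>\<^sub>F n in sequentially. \<bar>W' n t - W' n t'\<bar> \<le> A * \<bar>t - t'\<bar> powr \<beta>"
        using hold[OF t' t] by (auto elim: eventually_mono)
    qed simp
    have "((\<lambda>t'. (V t' - V t) / (t' - t) - V' t) \<longlongrightarrow> 0) (at t)"
    proof (rule Lim_null_comparison)
      show "\<forall>\<^sub>F t' in at t. norm ((V t' - V t) / (t' - t) - V' t) \<le> A * \<bar>t' - t\<bar> powr \<beta>"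
        using inside[OF t]
      proof (rule eventually_mono)
        fix t' assume t': "t' \<in> {a<..<b} \<and> t' \<noteq> t"
        show "norm ((V t' - V t) / (t' - t) - V' t) \<le> A * \<bar>t' - t\<bar> powr \<beta>"
        proof (rule tendsto_upperbound)
          show "(\<lambda>n. norm ((W n t' - W n t) / (t' - t) - W' n t)) \<longlonglongrightarrow> norm ((V t' - V t) / (t' - t) - V' t)"
            using t' t by (intro tendsto_norm tendsto_diff qlim V') auto
          show "\<forall>\<^sub>F n in sequentially. norm ((W n t' - W n t) / (t' - t) - W' n t) \<le> A * \<bar>t' - t\<bar> powr \<beta>"
            using quot[of t t'] t t' by (auto elim!: eventually_mono simp: abs_minus_commute)
        qed simp
      qed
      have "((\<lambda>t'. A * \<bar>t' - t\<bar> powr \<beta>) \<longlongrightarrow> A * \<bar>t - t\<bar> powr \<beta>) (at t)"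
        using \<beta> by (intro tendsto_intros tendsto_powr') auto
      then show "((\<lambda>t'. A * \<bar>t' - t\<bar> powr \<beta>) \<longlongrightarrow> 0) (at t)" using \<beta> by simp
    qed
    then show "(V has_real_derivative V' t) (at t)" by (simp add: has_field_derivative_iff LIM_zero_iff)
  qed
qed

lemma AE_lborel_dense:
  fixes S :: "'a::euclidean_space set"
  assumes "AE z in lborel. P z" "open S" "S \<noteq> {}"
  obtains z where "z \<in> S" "P z"
proof -
  obtain N where N0: "\<And>p. p \<in> space lborel - N \<Longrightarrow> P p" and N1: "N \<in> null_sets lborel"
    by (rule AE_E3[OF assms(1)]) blast
  have N: "N \<in> null_sets lborel" "{p. \<not> P p} \<subseteq> N" using N0 N1 by auto
  have "negligible N" using N(1) by (simp add: negligible_iff_null_sets null_sets_completionI)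
  then have "\<not> S \<subseteq> N" using open_not_negligible[OF assms(2,3)] negligible_subset by blast
  then show thesis using N(2) that by blast
qed

context stable_parameters
begin

text \<open>Mollifications converge almost everywhere, along a subsequence. Estimates common to all
  of them upgrade this to every point of the smaller cylinder: a point of convergence lies
  arbitrarily near, and the common moduli in t and x transfer convergence from it.\<close>

lemma limit_solution:
  fixes a :: "'a::euclidean_space \<Rightarrow> real"
  assumes C: "0 < C"
    and space_est: "\<And>(k::'a \<Rightarrow> real) w w' F N T t x h.
      classical_solution s \<alpha> M c \<kappa> k w w' F N T \<Longrightarrow> t \<in> {-3/5..T} \<Longrightarrow> norm x < 7/10
      \<Longrightarrow> \<bar>w t (x + h) - w t x\<bar> \<le> C * N * norm h powr p" and p: "0 < p"
    and k: "kernel k" "\<And>y. k y = a (y /\<^sub>R norm y) / norm y powr (real DIM('a) + 2 * s)"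
    and ws: "weak_solution s a u f {-1<..<0} (ball 0 1)"
    and u: "u \<in> borel_measurable (lebesgue_on ({-1<..<0} \<times> UNIV))"
    and v: "bounded_borel v N" "AE z in lebesgue. v z = indicator ({-1<..<0} \<times> UNIV) z * u z"
    and f: "f \<in> borel_measurable (lebesgue_on ({-1<..<0} \<times> ball 0 1))"
    and g: "bounded_borel g N" "AE z in lebesgue. g z = indicator ({-1<..<0} \<times> ball 0 1) z * f z"
    and u_time: "\<And>t t' x. t \<in> {-1<..<0} \<Longrightarrow> t' \<in> {-1<..<0} \<Longrightarrow> \<bar>u (t, x) - u (t', x)\<bar> \<le> N * \<bar>t - t'\<bar> powr (\<alpha> / (2 * s))"
    and f_holder: "\<And>t t' x x'. t \<in> {-1<..<0} \<Longrightarrow> t' \<in> {-1<..<0} \<Longrightarrow> x \<in> ball 0 1 \<Longrightarrow> x' \<in> ball 0 1 \<Longrightarrow>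
      \<bar>f (t, x) - f (t', x')\<bar> \<le> N * (\<bar>t - t'\<bar> powr (\<alpha> / (2 * s)) + norm (x - x') powr \<alpha>)"
  shows "\<exists>w w' F T V. (\<forall>n. classical_solution s \<alpha> M c \<kappa> k (w n) (w' n) (F n) N (T n)) \<and> T \<longlonglongrightarrow> 0 \<and>
    (\<forall>t x. t \<in> {-3/5<..<0} \<longrightarrow> norm x < 7/10 \<longrightarrow> (\<lambda>n. w n t x) \<longlonglongrightarrow> V (t, x)) \<and>
    (AE z in lebesgue. z \<in> {-1<..<0} \<times> UNIV \<longrightarrow> V z = u z)"
proof -
  interpret bounded_borel v N by fact
  have N: "0 \<le> N" by (rule U_nonneg)
  define \<epsilon> where "\<epsilon> n = inverse (real (Suc n)) / 21" for n :: nat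
  have \<epsilon>: "0 < \<epsilon> n" "\<epsilon> n < 1 / 20" "\<epsilon> n \<le> 1" for n
    using inverse_le_1_iff[of "real (Suc n)"] by (auto simp: \<epsilon>_def)
  have \<epsilon>0: "\<epsilon> \<longlonglongrightarrow> 0"
    using tendsto_divide[OF LIMSEQ_inverse_real_of_nat tendsto_const, of 21] by (simp add: \<epsilon>_def[abs_def])
  let ?K = "\<lambda>n. {-\<epsilon> n..\<epsilon> n} \<times> cball (0::'a) (\<epsilon> n)"
  have "\<exists>\<phi>. supported \<phi> (?K n) \<and> (\<forall>z. 0 \<le> \<phi> z) \<and> (LINT z|lborel. \<phi> z) = 1" for n
    by (rule mollifier_exists[where 'a='a, OF \<epsilon>(1)[of n]]) blast
  then obtain \<phi> where \<phi>: "\<And>n. supported (\<phi> n) (?K n)" "\<And>n z. 0 \<le> \<phi> n z" "\<And>n. (LINT z|lborel. \<phi> n z) = 1"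
    by metis
  have "\<exists>\<phi>'. (\<forall>z. (\<phi> n has_derivative \<phi>' z) (at z)) \<and> (\<forall>e. supported (\<lambda>z. \<phi>' z e) (?K n))" for n
    by (rule supported_derivative[OF \<phi>(1)[of n]]) blast
  then obtain \<phi>' where \<phi>': "\<And>n z. (\<phi> n has_derivative \<phi>' n z) (at z)" "\<And>n e. supported (\<lambda>z. \<phi>' n z e) (?K n)"
    by metis
  have K: "?K n \<subseteq> cball 0 (2 * \<epsilon> n)" for n
  proof
    fix z assume z: "z \<in> ?K n"
    then have "norm z \<le> \<bar>fst z\<bar> + norm (snd z)" using norm_Pair_le[of "fst z" "snd z"] by simp
    then show "z \<in> cball 0 (2 * \<epsilon> n)" using z by (cases z) auto
  qed
  have \<epsilon>2: "2 * \<epsilon> n \<le> 1" for n using \<epsilon>(2)[of n] by simp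
  have \<epsilon>20: "(\<lambda>n. 2 * \<epsilon> n) \<longlonglongrightarrow> 0" using tendsto_mult_right_zero[OF \<epsilon>0, of 2] by simp
  obtain r where r: "strict_mono r" "AE z in lborel. z \<in> cball 0 2 \<longrightarrow> (\<lambda>n. conv v (\<phi> (r n)) z) \<longlonglongrightarrow> v z"
    by (rule conv_subseq_AE[OF \<phi>(1) K \<phi>(2,3) \<epsilon>2 \<epsilon>20, of 2]) blast
  define w where "w n t x = conv v (\<phi> (r n)) (t, x)" for n t x
  define w' where "w' n t x = conv v (\<lambda>z. \<phi>' (r n) z (1, 0)) (t, x)" for n t x
  define F where "F n t x = conv g (\<phi> (r n)) (t, x)" for n t x
  define T where "T n = - 2 * \<epsilon> (r n)" for n
  have cs: "classical_solution s \<alpha> M c \<kappa> k (w n) (w' n) (F n) N (T n)" for n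
    unfolding w_def[abs_def] w'_def[abs_def] F_def[abs_def] T_def
    by (rule mollified_solution[OF k ws u v f g u_time f_holder \<phi>(1,2,3) \<phi>'(1,2) \<epsilon>(1,2)])
  have "(\<lambda>n. - 2 * \<epsilon> (r n)) \<longlonglongrightarrow> - 2 * 0"
    by (intro tendsto_intros LIMSEQ_subseq_LIMSEQ[OF \<epsilon>0 r(1), unfolded o_def])
  then have T0: "T \<longlonglongrightarrow> 0" by (simp add: T_def[abs_def])
  have conv: "convergent (\<lambda>n. w n t x)" if t: "t \<in> {-3/5<..<0}" and x: "norm x < 7/10" for t x
  proof (rule convergent_by_approximation)
    fix e :: real assume e: "0 < e"
    have "((\<lambda>d. N * d powr (\<alpha> / (2 * s)) + C * N * d powr p) \<longlongrightarrow> N * 0 powr (\<alpha> / (2 * s)) + C * N * 0 powr p) (at_right 0)"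
      using \<alpha> s p by (intro tendsto_intros tendsto_powr') (auto simp: eventually_at_right_less eventually_at_filter)
    then have "\<forall>\<^sub>F d in at_right 0. N * d powr (\<alpha> / (2 * s)) + C * N * d powr p < e"
      using e by (intro order_tendstoD(2)) auto
    moreover have "\<forall>\<^sub>F d in at_right (0::real). 0 < d" by (rule eventually_at_right_less)
    ultimately have "\<forall>\<^sub>F d in at_right 0. N * d powr (\<alpha> / (2 * s)) + C * N * d powr p < e \<and> 0 < d"
      by (rule eventually_conj)
    then obtain d where d: "N * d powr (\<alpha> / (2 * s)) + C * N * d powr p < e" "0 < d"
      using eventually_happens'[OF trivial_limit_at_right_real[of 0]] by auto
    \<comment> \<open>Times below t / 2 < 0 keep S away from t = 0, so that all its points lie
      before \<open>T n\<close> for large n.\<close>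
    define S where "S = ball (t, x) d \<inter> ({-3/5<..<t / 2} \<times> ball 0 (7/10))"
    have "open S" by (auto simp: S_def intro!: open_Int open_Times)
    moreover have "(t, x) \<in> S" using t x d(2) by (auto simp: S_def)
    ultimately obtain z where z: "z \<in> S" "z \<in> cball 0 2 \<longrightarrow> (\<lambda>n. conv v (\<phi> (r n)) z) \<longlonglongrightarrow> v z"
      using AE_lborel_dense[OF r(2), of S] by blast
    obtain t1 x1 where z1: "z = (t1, x1)" by (cases z)
    have t1: "-3/5 < t1" "t1 < t / 2" and x1: "norm x1 < 7/10" and dz: "dist (t, x) (t1, x1) < d"
      using z(1) by (auto simp: S_def z1)
    have "norm (t1, x1) \<le> 2" using norm_Pair_le[of t1 x1] t1 x1 t by simp
    then have lim: "(\<lambda>n. w n t1 x1) \<longlonglongrightarrow> v z" using z(2) by (simp add: z1 w_def)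
    have d1: "\<bar>t - t1\<bar> \<le> d" "norm (x1 - x) \<le> d"
      using dist_fst_le[of "(t, x)" "(t1, x1)"] dist_snd_le[of "(t, x)" "(t1, x1)"] dz
      by (auto simp: dist_real_def dist_norm norm_minus_commute)
    have ev: "\<forall>\<^sub>F n in sequentially. t / 2 < T n" using order_tendstoD(1)[OF T0, of "t / 2"] t by auto
    show "\<exists>y. convergent y \<and> (\<forall>\<^sub>F n in sequentially. \<bar>w n t x - y n\<bar> \<le> e)"
    proof (intro exI conjI)
      show "convergent (\<lambda>n. w n t1 x1)" using lim by (rule convergentI)
      show "\<forall>\<^sub>F n in sequentially. \<bar>w n t x - w n t1 x1\<bar> \<le> e"
        using ev
      proof (rule eventually_mono)
        fix n assume n: "t / 2 < T n"
        have m: "t \<in> {-9/10..T n}" "t1 \<in> {-9/10..T n}" "t1 \<in> {-3/5..T n}" using t t1 n by auto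
        have "\<bar>w n t x - w n t1 x\<bar> \<le> N * \<bar>t - t1\<bar> powr (\<alpha> / (2 * s))"
          by (rule classical_solution.w_time[OF cs m(1,2)])
        also have "\<dots> \<le> N * d powr (\<alpha> / (2 * s))" using d1 N s \<alpha> by (intro mult_left_mono powr_mono2) auto
        finally have 1: "\<bar>w n t x - w n t1 x\<bar> \<le> N * d powr (\<alpha> / (2 * s))" .
        have "\<bar>w n t1 (x + (x1 - x)) - w n t1 x\<bar> \<le> C * N * norm (x1 - x) powr p"
          by (rule space_est[OF cs m(3) x])
        also have "\<dots> \<le> C * N * d powr p" using d1 N C p by (intro mult_left_mono powr_mono2) auto
        finally show "\<bar>w n t x - w n t1 x1\<bar> \<le> e" using 1 d(1) by simp
      qed
    qed
  qed
  \<comment> \<open>The modification of u: the limit, now defined everywhere in the smaller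
    cylinder, and u itself elsewhere.\<close>
  define V where "V z = (if z \<in> {-3/5<..<0} \<times> ball 0 (7/10) then lim (\<lambda>n. w n (fst z) (snd z)) else u z)" for z
  have V: "(\<lambda>n. w n t x) \<longlonglongrightarrow> V (t, x)" if "t \<in> {-3/5<..<0}" "norm x < 7/10" for t x
    using conv[OF that] that by (simp add: V_def convergent_LIMSEQ_iff)
  have r': "AE z in lebesgue. z \<in> cball 0 2 \<longrightarrow> (\<lambda>n. conv v (\<phi> (r n)) z) \<longlonglongrightarrow> v z"
    using r(2) by (simp only: AE_completion_iff)
  have "AE z in lebesgue. z \<in> {-1<..<0} \<times> UNIV \<longrightarrow> V z = u z"
    using r' v(2)
  proof eventually_elim
    case (elim z)
    show ?case
    proof
      assume z: "z \<in> {-1<..<0} \<times> UNIV"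
      show "V z = u z"
      proof (cases "z \<in> {-3/5<..<0} \<times> ball 0 (7/10)")
        case True
        then have zz: "fst z \<in> {-3/5<..<0}" "norm (snd z) < 7/10" by auto
        have "norm z \<le> 2" using norm_Pair_le[of "fst z" "snd z"] zz by simp
        then have "(\<lambda>n. w n (fst z) (snd z)) \<longlonglongrightarrow> v z" using elim(1) by (simp add: w_def)
        then have "V z = v z" using V[OF zz] LIMSEQ_unique by (metis prod.collapse)
        also have "v z = u z" using elim(2) z by (simp add: indicator_def)
        finally show ?thesis .
      qed (simp add: V_def)
    qed
  qed
  with cs T0 V show ?thesis by blast
qed

text \<open>In space the difference bounds pass to the pointwise limit V and only there are
  converted into derivatives, so no spatial derivative has to be followed through the limit. In time
  \<open>limit_of_derivatives\<close> does this.\<close>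

lemma weak_solution_regularity:
  assumes \<gamma>: "2 * s + \<alpha> \<notin> \<int>"
  obtains C where "0 < C"
    "\<And>(a::'a::euclidean_space \<Rightarrow> real) k u v f g N.
      \<lbrakk>kernel k; \<And>y. k y = a (y /\<^sub>R norm y) / norm y powr (real DIM('a) + 2 * s);
       weak_solution s a u f {-1<..<0} (ball 0 1);
       u \<in> borel_measurable (lebesgue_on ({-1<..<0} \<times> UNIV));
       bounded_borel v N; AE z in lebesgue. v z = indicator ({-1<..<0} \<times> UNIV) z * u z;
       f \<in> borel_measurable (lebesgue_on ({-1<..<0} \<times> ball 0 1));
       bounded_borel g N; AE z in lebesgue. g z = indicator ({-1<..<0} \<times> ball 0 1) z * f z;
       \<And>t t' x. t \<in> {-1<..<0} \<Longrightarrow> t' \<in> {-1<..<0} \<Longrightarrow> \<bar>u (t, x) - u (t', x)\<bar> \<le> N * \<bar>t - t'\<bar> powr (\<alpha> / (2 * s));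
       \<And>t t' x x'. t \<in> {-1<..<0} \<Longrightarrow> t' \<in> {-1<..<0} \<Longrightarrow> x \<in> ball 0 1 \<Longrightarrow> x' \<in> ball 0 1 \<Longrightarrow>
         \<bar>f (t, x) - f (t', x')\<bar> \<le> N * (\<bar>t - t'\<bar> powr (\<alpha> / (2 * s)) + norm (x - x') powr \<alpha>)\<rbrakk>
      \<Longrightarrow> \<exists>V. (AE z in lebesgue. z \<in> {-1<..<0} \<times> UNIV \<longrightarrow> V z = u z) \<and>
        holder_norm_t (1 + \<alpha> / (2 * s)) V {-1/2<..<0} (ball 0 (1/2)) + holder_norm_x (2 * s + \<alpha>) V {-1/2<..<0} (ball 0 (1/2))
          \<le> ennreal (C * N)"
proof -
  define \<beta> where "\<beta> = \<alpha> / (2 * s)"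
  define \<gamma>' where "\<gamma>' m = (if 2 * s + \<alpha> < real m then 2 * s + \<alpha> else real m - 1 / 2)" for m :: nat
  have \<beta>: "0 < \<beta>" "\<beta> < 1" using s \<alpha> by (auto simp: \<beta>_def)
  have \<gamma>3: "0 < 2 * s + \<alpha>" "2 * s + \<alpha> < 3" using s \<alpha> by auto
  have \<gamma>1: "0 < \<gamma>' 1" using \<gamma>3 by (simp add: \<gamma>'_def)
  note est = classical_estimates[where 'a='a, folded \<gamma>'_def \<beta>_def]
  show thesis
  proof (rule est, goal_cases)
  case C: (1 C)
  have space1: "\<bar>w t (x + h) - w t x\<bar> \<le> C * N * norm h powr \<gamma>' 1"
    if "classical_solution s \<alpha> M c \<kappa> k w w' F N T" "t \<in> {-3/5..T}" "norm x < 7/10"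
    for k :: "'a \<Rightarrow> real" and w w' F N T t x h
    using C(2)[OF that, of "[h]" "norm h"] by (cases "h = 0") auto
  show thesis
  proof (rule holder_norm_time_bound[OF \<beta>], goal_cases)
  case Ct: (1 Ct)
  show thesis
  proof (rule holder_norm_space_bound[where 'a='a, OF \<gamma>3 \<gamma>, folded \<gamma>'_def], goal_cases)
  case Cx: (1 Cx)
  show thesis
  proof (rule that[of "(Ct + Cx) * (C + 1)"], goal_cases)
    case 1
    then show ?case using Ct(1) Cx(1) C(1) by simp
  next
    case prems: (2 a k u v f g N)
    have N: "0 \<le> N" using bounded_borel.U_nonneg[OF prems(5)] .
    have "\<exists>w w' F T V. (\<forall>n. classical_solution s \<alpha> M c \<kappa> k (w n) (w' n) (F n) N (T n)) \<and> T \<longlonglongrightarrow> 0 \<and>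
    (\<forall>t x. t \<in> {-3/5<..<0} \<longrightarrow> norm x < 7/10 \<longrightarrow> (\<lambda>n. w n t x) \<longlonglongrightarrow> V (t, x)) \<and>
    (AE z in lebesgue. z \<in> {-1<..<0} \<times> UNIV \<longrightarrow> V z = u z)"
      by (rule limit_solution[where C = C and p = "\<gamma>' 1" and a = a and k = k and v = v and f = f and g = g])
        (fact C(1) | fact space1 | fact \<gamma>1 | fact prems)+
    then obtain w w' F T V where cs: "\<And>n. classical_solution s \<alpha> M c \<kappa> k (w n) (w' n) (F n) N (T n)" and T: "T \<longlonglongrightarrow> 0"
      and V: "\<And>t x. t \<in> {-3/5<..<0} \<Longrightarrow> norm x < 7/10 \<Longrightarrow> (\<lambda>n. w n t x) \<longlonglongrightarrow> V (t, x)"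
      and Vu: "AE z in lebesgue. z \<in> {-1<..<0} \<times> UNIV \<longrightarrow> V z = u z"
      by blast
    have ev: "\<forall>\<^sub>F n in sequentially. t \<in> {-3/5..T n} \<and> t' \<in> {-3/5..T n}" if "t \<in> {-3/5<..<0}" "t' \<in> {-3/5<..<0}" for t t'
      using eventually_conj[OF order_tendstoD(1)[OF T, of t] order_tendstoD(1)[OF T, of t']] that by (auto elim!: eventually_mono)
    define A where "A = (C + 1) * N"
    have A: "0 \<le> A" "N \<le> A" "C * N \<le> A" using C(1) N by (auto simp: A_def algebra_simps)
    have Vb: "\<bar>V (t, x)\<bar> \<le> A" if t: "t \<in> {-3/5<..<0}" and x: "norm x < 7/10" for t x
    proof (rule tendsto_upperbound)
      show "(\<lambda>n. \<bar>w n t x\<bar>) \<longlonglongrightarrow> \<bar>V (t, x)\<bar>" by (rule tendsto_rabs[OF V[OF t x]])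
      show "\<forall>\<^sub>F n in sequentially. \<bar>w n t x\<bar> \<le> A"
        using ev[OF t t]
      proof (rule eventually_mono)
        fix n assume "t \<in> {-3/5..T n} \<and> t \<in> {-3/5..T n}"
        then have "\<bar>w n t x\<bar> \<le> N" by (intro classical_solution.w_bound[OF cs]) auto
        then show "\<bar>w n t x\<bar> \<le> A" using A(2) by linarith
      qed
    qed simp
    have hx: "holder_norm (2 * s + \<alpha>) (\<lambda>x. V (t, x)) (ball 0 (1/2)) \<le> ennreal (Cx * A)" if t: "t \<in> {-1/2<..<0}" for t
    proof (rule Cx(2)[OF A(1)])
      have t': "t \<in> {-3/5<..<0}" using t by auto
      show "\<bar>V (t, x)\<bar> \<le> A" if "norm x < 3/5" for x using Vb[OF t', of x] that by simp
      show "\<bar>fdiff hs (\<lambda>x. V (t, x)) x\<bar> \<le> A * r powr \<gamma>' (length hs)"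
        if hs: "1 \<le> length hs" "length hs \<le> 3" "\<And>h. h \<in> set hs \<Longrightarrow> norm h \<le> r" "0 < r" and x: "norm x + sum_list (map norm hs) < 3/5"
        for x hs r
      proof (rule tendsto_upperbound)
        have "0 \<le> sum_list (map norm hs)" by (rule sum_list_nonneg) auto
        then have x': "norm x < 7/10" using x by linarith
        have "(\<lambda>n. fdiff hs (w n t) x) \<longlonglongrightarrow> fdiff hs (\<lambda>x. V (t, x)) x"
        proof (rule fdiff_tendsto)
          fix y assume "norm (y - x) \<le> sum_list (map norm hs)"
          then have "norm y < 7/10" using norm_triangle_ineq[of "y - x" x] x by simp
          then show "(\<lambda>n. w n t y) \<longlonglongrightarrow> V (t, y)" by (rule V[OF t'])
        qed
        then show "(\<lambda>n. \<bar>fdiff hs (w n t) x\<bar>) \<longlonglongrightarrow> \<bar>fdiff hs (\<lambda>x. V (t, x)) x\<bar>" by (rule tendsto_rabs)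
        show "\<forall>\<^sub>F n in sequentially. \<bar>fdiff hs (w n t) x\<bar> \<le> A * r powr \<gamma>' (length hs)"
          using ev[OF t' t']
        proof (rule eventually_mono)
          fix n assume n: "t \<in> {-3/5..T n} \<and> t \<in> {-3/5..T n}"
          have "\<bar>fdiff hs (w n t) x\<bar> \<le> C * N * r powr \<gamma>' (length hs)"
            using n by (intro C(2)[OF cs _ x' hs]) auto
          also have "\<dots> \<le> A * r powr \<gamma>' (length hs)" using A(3) by (rule mult_right_mono) simp
          finally show "\<bar>fdiff hs (w n t) x\<bar> \<le> A * r powr \<gamma>' (length hs)" .
        qed
      qed simp
    qed
    have ht: "holder_norm (1 + \<beta>) (\<lambda>t. V (t, x)) {-1/2<..<0} \<le> ennreal (Ct * A)" if x: "x \<in> ball 0 (1/2)" for x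
    proof -
      have x': "x \<in> ball 0 (3/5)" "norm x < 7/10" using x by auto
      have Ab: "\<bar>w' n t x\<bar> \<le> A \<and> \<bar>w' n t x - w' n t' x\<bar> \<le> A * \<bar>t - t'\<bar> powr \<beta>" if "t \<in> {-3/5..T n}" "t' \<in> {-3/5..T n}" for n t t'
        using C(3)[OF cs that x'(1)] A(3) mult_right_mono[OF A(3), of "\<bar>t - t'\<bar> powr \<beta>"] by fastforce
      obtain V' where V': "\<And>t. t \<in> {-3/5<..<0} \<Longrightarrow> ((\<lambda>t. V (t, x)) has_real_derivative V' t) (at t)"
        "\<And>t. t \<in> {-3/5<..<0} \<Longrightarrow> \<bar>V' t\<bar> \<le> A"
        "\<And>t t'. t \<in> {-3/5<..<0} \<Longrightarrow> t' \<in> {-3/5<..<0} \<Longrightarrow> \<bar>V' t - V' t'\<bar> \<le> A * \<bar>t - t'\<bar> powr \<beta>"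
      proof (rule limit_of_derivatives[OF \<beta>(1), of "\<lambda>n t. w n t x" "\<lambda>n t. w' n t x" "-3/5" 0 A "\<lambda>t. V (t, x)"])
        show "((\<lambda>t. w n t x) has_real_derivative w' n t x) (at t)" for n t by (rule classical_solution.w_deriv[OF cs])
        show "(\<lambda>n. w n t x) \<longlonglongrightarrow> V (t, x)" if "t \<in> {-3/5<..<0}" for t by (rule V[OF that x'(2)])
        show "\<forall>\<^sub>F n in sequentially. \<bar>w' n t x\<bar> \<le> A" if "t \<in> {-3/5<..<0}" for t
          using ev[OF that that] Ab by (auto elim: eventually_mono)
        show "\<forall>\<^sub>F n in sequentially. \<forall>\<tau>\<in>{min t t'..max t t'}. \<bar>w' n \<tau> x - w' n t x\<bar> \<le> A * \<bar>\<tau> - t\<bar> powr \<beta>"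
          if "t \<in> {-3/5<..<0}" "t' \<in> {-3/5<..<0}" for t t'
          using ev[OF that]
        proof (rule eventually_mono, intro ballI)
          fix n \<tau> assume n: "t \<in> {-3/5..T n} \<and> t' \<in> {-3/5..T n}" and \<tau>: "\<tau> \<in> {min t t'..max t t'}"
          then have "\<tau> \<in> {-3/5..T n}" by (auto simp: min_def max_def split: if_splits)
          then show "\<bar>w' n \<tau> x - w' n t x\<bar> \<le> A * \<bar>\<tau> - t\<bar> powr \<beta>" using Ab n by blast
        qed
      qed (use A in auto)
      show ?thesis
        by (rule Ct(2)[OF A(1), of "{-1/2<..<0}" "\<lambda>t. V (t, x)" V']) (use V' Vb[OF _ x'(2)] in auto)
    qed
    have "holder_norm_t (1 + \<beta>) V {-1/2<..<0} (ball 0 (1/2)) \<le> ennreal (Ct * A)"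
      unfolding holder_norm_t_def by (rule SUP_least) (rule ht)
    moreover have "holder_norm_x (2 * s + \<alpha>) V {-1/2<..<0} (ball 0 (1/2)) \<le> ennreal (Cx * A)"
      unfolding holder_norm_x_def by (rule SUP_least) (rule hx)
    ultimately have "holder_norm_t (1 + \<beta>) V {-1/2<..<0} (ball 0 (1/2)) + holder_norm_x (2 * s + \<alpha>) V {-1/2<..<0} (ball 0 (1/2))
        \<le> ennreal (Ct * A) + ennreal (Cx * A)" by (rule add_mono)
    also have "\<dots> = ennreal ((Ct + Cx) * (C + 1) * N)"
      proof -
      have "(Ct + Cx) * (C + 1) * N = Ct * A + Cx * A" by (simp add: A_def algebra_simps)
      then show ?thesis using A(1) Ct(1) Cx(1) by (simp add: ennreal_plus)
    qed
    finally show ?case using Vu by (auto simp: \<beta>_def)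
  qed
  qed
  qed
  qed
qed

end

section \<open>From the norms of the statement to pointwise bounds, and the theorem\<close>

lemma holder_norm_txD:
  assumes "holder_norm_tx \<beta> \<alpha> f I D \<le> ennreal A" "0 \<le> A"
  shows "f \<in> borel_measurable (lebesgue_on (I \<times> D))"
    and "AE p in lebesgue_on (I \<times> D). \<bar>f p\<bar> \<le> A"
    and "\<And>t t' x x'. t \<in> I \<Longrightarrow> t' \<in> I \<Longrightarrow> x \<in> D \<Longrightarrow> x' \<in> D \<Longrightarrow>
      \<bar>f (t, x) - f (t', x')\<bar> \<le> A * (\<bar>t - t'\<bar> powr \<beta> + norm (x - x') powr \<alpha>)"
proof -
  let ?S = "SUP p\<in>I \<times> D. SUP q\<in>I \<times> D - {p}. ennreal (\<bar>f p - f q\<bar> / (\<bar>fst p - fst q\<bar> powr \<beta> + norm (snd p - snd q) powr \<alpha>))"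
  have L: "Linf_norm f (I \<times> D) \<le> ennreal A" and S: "?S \<le> ennreal A"
    using assms(1) unfolding holder_norm_tx_def by (auto intro: order_trans[rotated] simp: add_increasing add_increasing2)
  show m: "f \<in> borel_measurable (lebesgue_on (I \<times> D))"
    using L by (auto simp: Linf_norm_def top_unique split: if_splits)
  have "esssup (lebesgue_on (I \<times> D)) (\<lambda>p. ennreal \<bar>f p\<bar>) \<le> ennreal A" using L m by (simp add: Linf_norm_def)
  with esssup_AE[where M = "lebesgue_on (I \<times> D)" and f = "\<lambda>p. ennreal \<bar>f p\<bar>"] show "AE p in lebesgue_on (I \<times> D). \<bar>f p\<bar> \<le> A"
    using assms(2) by (auto elim!: eventually_mono dest: order_trans simp: ennreal_le_iff)
  fix t t' x x' assume tx: "t \<in> I" "t' \<in> I" "x \<in> D" "x' \<in> D"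
  let ?d = "\<bar>t - t'\<bar> powr \<beta> + norm (x - x') powr \<alpha>"
  show "\<bar>f (t, x) - f (t', x')\<bar> \<le> A * ?d"
  proof (cases "(t, x) = (t', x')")
    case False
    have d: "0 < ?d"
      using False by (cases "t = t'") (auto intro: add_pos_nonneg add_nonneg_pos)
    have "ennreal (\<bar>f (t, x) - f (t', x')\<bar> / ?d) \<le> (SUP q\<in>I \<times> D - {(t, x)}. ennreal (\<bar>f (t, x) - f q\<bar> / (\<bar>fst (t, x) - fst q\<bar> powr \<beta> + norm (snd (t, x) - snd q) powr \<alpha>)))"
      by (rule SUP_upper2[of "(t', x')"]) (use tx False in auto)
    also have "\<dots> \<le> ?S" by (rule SUP_upper) (use tx in auto)
    finally have "ennreal (\<bar>f (t, x) - f (t', x')\<bar> / ?d) \<le> ennreal A" using S by (rule order_trans)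
    then have "\<bar>f (t, x) - f (t', x')\<bar> / ?d \<le> A" unfolding ennreal_le_iff[OF assms(2)] .
    then show ?thesis using d by (simp add: pos_divide_le_eq)
  qed simp
qed

theorem corollary3p7:
  fixes s \<alpha> lam Lam K :: real
  assumes "0 < s" "s < 1"
    and "0 < lam" "lam \<le> Lam"
    and "0 < \<alpha>" "\<alpha> < 1" "\<alpha> < 2 * s"
    and "2 * s + \<alpha> \<notin> \<int>"
  shows "\<exists>C>0. \<forall>(a :: real ^ 'n \<Rightarrow> real) (u :: real \<times> (real ^ 'n) \<Rightarrow> real) (f :: real \<times> (real ^ 'n) \<Rightarrow> real).
     elliptic_density s lam Lam a \<longrightarrow>
     holder_norm \<alpha> a (sphere 0 1) = ennreal K \<longrightarrow>
     Linf_norm u ({-1<..<0} \<times> UNIV) < \<infinity> \<longrightarrow>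
     weak_solution s a u f {-1<..<0} (ball 0 1) \<longrightarrow>
     (\<exists>v. (AE p in lebesgue_on ({-1<..<0} \<times> UNIV). v p = u p) \<and>
          holder_norm_t (1 + \<alpha> / (2 * s)) v {-1/2<..<0} (ball 0 (1/2)) +
          holder_norm_x (2 * s + \<alpha>) v {-1/2<..<0} (ball 0 (1/2))
          \<le> ennreal C *
             (holder_norm_t (\<alpha> / (2 * s)) u {-1<..<0} UNIV +
              holder_norm_tx (\<alpha> / (2 * s)) \<alpha> f {-1<..<0} (ball 0 1)))"
proof -
  \<comment> \<open>The norm of a is given as exactly K, whereas the kernel parameters are chosen
    from an upper bound that is at least 1.\<close>
  have K1: "1 \<le> max 1 K" by simp
  obtain M c \<kappa> where sp: "stable_parameters s \<alpha> M c \<kappa>"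
    and ker: "\<And>a :: real ^ 'n \<Rightarrow> real. elliptic_density s lam Lam a \<Longrightarrow> holder_norm \<alpha> a (sphere 0 1) \<le> ennreal (max 1 K) \<Longrightarrow>
      stable_parameters.kernel s \<alpha> M c \<kappa> (\<lambda>y. a (y /\<^sub>R norm y) / norm y powr (real DIM(real ^ 'n) + 2 * s))"
    by (rule stable_kernel_parameters[where 'a = "real ^ 'n", OF assms(1,2,5,6,7,3) K1]) blast
  interpret stable_parameters s \<alpha> M c \<kappa> by (rule sp)
  have \<beta>: "0 < \<alpha> / (2 * s)" "\<alpha> / (2 * s) < 1" using assms by auto
  show ?thesis
  proof (rule weak_solution_regularity[where 'a = "real ^ 'n", OF assms(8)], goal_cases)
    case C: (1 C)
    show ?case
    proof (intro exI[of _ C] conjI C(1) allI impI)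
      fix a :: "real ^ 'n \<Rightarrow> real" and u f :: "real \<times> (real ^ 'n) \<Rightarrow> real"
      assume a: "elliptic_density s lam Lam a" "holder_norm \<alpha> a (sphere 0 1) = ennreal K"
        and ub: "Linf_norm u ({-1<..<0} \<times> UNIV) < \<infinity>" and ws: "weak_solution s a u f {-1<..<0} (ball 0 1)"
      let ?I = "{-1<..<0::real}" and ?D = "ball (0 :: real ^ 'n) 1"
      let ?h = "holder_norm_t (\<alpha> / (2 * s)) u ?I UNIV" and ?f = "holder_norm_tx (\<alpha> / (2 * s)) \<alpha> f ?I ?D"
      let ?G = "\<lambda>V. holder_norm_t (1 + \<alpha> / (2 * s)) V {-1/2<..<0} (ball 0 (1/2)) + holder_norm_x (2 * s + \<alpha>) V {-1/2<..<0} (ball 0 (1/2))"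
      show "\<exists>v. (AE p in lebesgue_on (?I \<times> UNIV). v p = u p) \<and> ?G v \<le> ennreal C * (?h + ?f)"
      proof (cases "?h + ?f = \<infinity>")
        \<comment> \<open>The right-hand side is infinite because C > 0, so u itself serves as its
          modification.\<close>
        case True
        have top: "ennreal C * (?h + ?f) = \<infinity>" unfolding True using C(1) by (simp add: ennreal_mult_top)
        show ?thesis
        proof (intro exI[of _ u] conjI)
          show "?G u \<le> ennreal C * (?h + ?f)" unfolding top by simp
        qed simp
      next
        case False
        then obtain H F where H: "0 \<le> H" "?h = ennreal H" and F: "0 \<le> F" "?f = ennreal F"
          by (cases ?h; cases ?f) auto
        \<comment> \<open>N is the real value of \<open>C_0\<close>.\<close>
        define N where "N = H + F"
        have N: "0 \<le> N" "H \<le> N" "F \<le> N" using H F by (auto simp: N_def)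
        have kk: "kernel (\<lambda>y. a (y /\<^sub>R norm y) / norm y powr (real DIM(real ^ 'n) + 2 * s))"
          by (rule ker[OF a(1)]) (simp add: a(2) ennreal_leI)
        have um: "u \<in> borel_measurable (lebesgue_on (?I \<times> UNIV))"
          using ub by (auto simp: Linf_norm_def split: if_splits)
        have S: "?I \<times> (UNIV :: (real ^ 'n) set) \<in> sets borel" "?I \<times> ?D \<in> sets borel"
          by (auto intro!: borel_Times)
        have hu: "holder_norm (\<alpha> / (2 * s)) (\<lambda>t. u (t, x)) ?I \<le> ennreal H" for x
          unfolding H(2)[symmetric] holder_norm_t_def by (rule SUP_upper) simp
        \<comment> \<open>The Hoelder norm in time is a supremum over all x, so it bounds u at every
          point of the strip and not just almost everywhere.\<close>
        have u_bound: "\<bar>u (t, x)\<bar> \<le> N" if "t \<in> ?I" for t x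
          using holder_normD(2)[OF hu \<beta> H(1) that] N(2) by (rule order_trans)
        have u_time: "\<bar>u (t, x) - u (t', x)\<bar> \<le> N * \<bar>t - t'\<bar> powr (\<alpha> / (2 * s))" if "t \<in> ?I" "t' \<in> ?I" for t t' x
          using holder_normD(3)[OF hu[of x] \<beta> H(1) that] mult_right_mono[OF N(2), of "\<bar>t - t'\<bar> powr (\<alpha> / (2 * s))"] by simp
        obtain v where v: "bounded_borel v N" "AE z in lebesgue. v z = indicator (?I \<times> UNIV) z * u z"
          by (rule borel_version[OF um S(1), of N]) (use u_bound N in auto)
        note fd = holder_norm_txD[OF eq_refl[OF F(2)] F(1)]
        have f_holder: "\<bar>f (t, x) - f (t', x')\<bar> \<le> N * (\<bar>t - t'\<bar> powr (\<alpha> / (2 * s)) + norm (x - x') powr \<alpha>)"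
          if "t \<in> ?I" "t' \<in> ?I" "x \<in> ?D" "x' \<in> ?D" for t t' x x'
          using fd(3)[OF that] mult_right_mono[OF N(3), of "\<bar>t - t'\<bar> powr (\<alpha> / (2 * s)) + norm (x - x') powr \<alpha>"]
          by (simp add: add_nonneg_nonneg)
        \<comment> \<open>The norm of f bounds it only almost everywhere on the cylinder. Clipping
          at N gives the pointwise bound that \<open>borel_version\<close> asks for and alters f
          there on a null set only.\<close>
        define f' where "f' z = max (- N) (min N (f z))" for z
        have f'm: "f' \<in> borel_measurable (lebesgue_on (?I \<times> ?D))" unfolding f'_def[abs_def] using fd(1) by simp
        obtain g where g: "bounded_borel g N" "AE z in lebesgue. g z = indicator (?I \<times> ?D) z * f' z"
          by (rule borel_version[OF f'm S(2), of N]) (use N in \<open>auto simp: f'_def\<close>)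
        have "AE z in lebesgue. z \<in> ?I \<times> ?D \<longrightarrow> \<bar>f z\<bar> \<le> F"
          using fd(2) S(2) by (simp add: AE_restrict_space_iff)
        with g(2) have g2: "AE z in lebesgue. g z = indicator (?I \<times> ?D) z * f z"
        proof eventually_elim
          case (elim z)
          then show ?case using N(3) by (auto simp: indicator_def f'_def)
        qed
        obtain V where V: "AE z in lebesgue. z \<in> ?I \<times> UNIV \<longrightarrow> V z = u z" "?G V \<le> ennreal (C * N)"
          using C(2)[OF kk refl ws um v fd(1) g(1) g2 u_time f_holder] by blast
        have "AE z in lebesgue_on (?I \<times> UNIV). V z = u z" using V(1) S(1) by (simp add: AE_restrict_space_iff)
        moreover have "ennreal (C * N) = ennreal C * (?h + ?f)"
          using C(1) H F by (simp add: N_def ennreal_mult' ennreal_plus)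
        ultimately show ?thesis using V(2) by auto
      qed
    qed
  qed
qed

end
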